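(* Let $\Pi$ be the upper half plane and $P=(\zeta_1-\zeta_2)^2\frac{\partial^2}{\partial\zeta_1\partial\zeta_2}-(\zeta_1-\zeta_2)\left(\frac{\partial}{\partial\zeta_1}-\frac{\partial}{\partial\zeta_2}\right)$. (1) The differential operator $P$ defines a self-adjoint operator on the Hilbert space $\mathbf{H}(\Pi\times\Pi)$. (2) (Eigenspace decomposition) $\mathbf{H}(\Pi\times\Pi)$ decomposes into the discrete Hilbert sum of the eigenspaces $\mathbf{H}(\Pi\times\Pi)_{\ell}$ of $P$, where $\ell$ runs over $\mathbb{N}$. (3) The generating operator $T$ induces a family of linear bijections (one for each $\ell\in\mathbb{N}$) $$t^{-\ell}T\colon\mathbf{H}(\Pi\times\Pi)_{\ell}\overset{\sim}{\longrightarrow}\mathcal{O}(\Pi)\cap L^2(\Pi,y^{2\ell}\,dx\,dy),$$ which are unitary up to rescaling: $$\|t^{-\ell}Tf\|^2_{L^2(\Pi,\,y^{2\ell}dx\,dy)}=b_{\ell}\,\|f\|^2_{\mathbf{H}(\Pi\times\Pi)}\qquad\text{for any }f\in\mathbf{H}(\Pi\times\Pi)_{\ell},$$ where $$b_{\ell}:=\frac{(2\ell)!}{2^{2\ell+2}\,\pi\,(2\ell+1)\,(\ell!)^2}=\frac{(2\ell-1)!!}{4\pi(2\ell+1)(2\ell)!!}.$$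
   Context: $\mathbb{N}=\{0,1,2,\dots\}$; $\mathcal{O}(\cdot)$ denotes the space of holomorphic functions; $\Pi=\{\zeta\in\mathbb{C}:\operatorname{Im}\zeta>0\}$, with points written $z=x+\sqrt{-1}y$. The Hardy space is $$\mathbf{H}(\Pi)=\Big\{h\in\mathcal{O}(\Pi):\ \|h\|^2_{\mathbf{H}(\Pi)}:=\sup_{y>0}\int_{-\infty}^{\infty}|h(x+\sqrt{-1}y)|^2dx<\infty\Big\},$$ and $\mathbf{H}(\Pi\times\Pi):=\mathbf{H}(\Pi)\widehat\otimes\mathbf{H}(\Pi)$ is the Hilbert completion of the tensor product, regarded as a space of holomorphic functions on $\Pi\times\Pi$. For $\ell\in\mathbb{N}$, $$\mathbf{H}(\Pi\times\Pi)_{\ell}:=\{f\in\mathbf{H}(\Pi\times\Pi):\ Pf=-\ell(\ell+1)f\}.$$ Let $U_\Pi:=\{(z,t)\in\Pi\times\mathbb{C}:2|t|<\operatorname{Im}z\}$. For $f\in\mathcal{O}(\Pi\times\Pi)$ and $(z,t)\in U_\Pi$ the generating operator $T$ is defined by $$(Tf)(z,t):=\frac{1}{(2\pi\sqrt{-1})^2}\oint_{C_1}\oint_{C_2}\frac{f(\zeta_1,\zeta_2)}{(\zeta_1-z)(\zeta_2-z)+t(\zeta_1-\zeta_2)}\,d\zeta_1\,d\zeta_2,$$ where $C_1,C_2$ are contours in $\Pi$ around $z$; one may take $C_1=C_2$ to be the positively oriented circle centred at $z$ of radius $r$ with $2|t|<r<\operatorname{Im}z$. If $f\in\mathcal{O}(\Pi\times\Pi)$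 satisfies $Pf=-\ell(\ell+1)f$, then $(Tf)(z,t)=t^{\ell}\varphi(z)$ for a unique $\varphi\in\mathcal{O}(\Pi)$, and one writes $t^{-\ell}Tf:=\varphi$. Convention: $(-1)!!=0!!=1$. *)

theory Defs
  imports "HOL-Complex_Analysis.Complex_Analysis"
begin

section \<open>Hilbert spaces of complex-valued functions\<close>

text \<open>
  Inner products are linear in the first and conjugate-linear in the second argument.
  A space of functions is a set of total functions; the function spaces below consist of
  functions that vanish off their domain, so that equality in the space is HOL equality.
\<close>

definition fsub :: "('b \<Rightarrow> complex) \<Rightarrow> ('b \<Rightarrow> complex) \<Rightarrow> 'b \<Rightarrow> complex" where
  "fsub f g = (\<lambda>p. f p - g p)"

definition fadd :: "('b \<Rightarrow> complex) \<Rightarrow> ('b \<Rightarrow> complex) \<Rightarrow> 'b \<Rightarrow> complex" where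
  "fadd f g = (\<lambda>p. f p + g p)"

definition fscale :: "complex \<Rightarrow> ('b \<Rightarrow> complex) \<Rightarrow> 'b \<Rightarrow> complex" where
  "fscale c f = (\<lambda>p. c * f p)"

type_synonym 'b inner_prod = "('b \<Rightarrow> complex) \<Rightarrow> ('b \<Rightarrow> complex) \<Rightarrow> complex"

definition ip_norm :: "'b inner_prod \<Rightarrow> ('b \<Rightarrow> complex) \<Rightarrow> real" where
  "ip_norm ip f = sqrt (Re (ip f f))"

definition complex_subspace :: "('b \<Rightarrow> complex) set \<Rightarrow> bool" where
  "complex_subspace V \<longleftrightarrow>
     (\<lambda>_. 0) \<in> V \<and> (\<forall>f\<in>V. \<forall>g\<in>V. fadd f g \<in> V) \<and> (\<forall>c. \<forall>f\<in>V. fscale c f \<in> V)"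

definition complex_linear_on ::
    "('b \<Rightarrow> complex) set \<Rightarrow> (('b \<Rightarrow> complex) \<Rightarrow> 'd \<Rightarrow> complex) \<Rightarrow> bool" where
  "complex_linear_on V A \<longleftrightarrow>
     (\<forall>f\<in>V. \<forall>g\<in>V. A (fadd f g) = fadd (A f) (A g)) \<and>
     (\<forall>c. \<forall>f\<in>V. A (fscale c f) = fscale c (A f))"

definition hilbert_space :: "('b \<Rightarrow> complex) set \<Rightarrow> 'b inner_prod \<Rightarrow> bool" where
  "hilbert_space V ip \<longleftrightarrow>
     complex_subspace V \<and>
     (\<forall>f\<in>V. \<forall>g\<in>V. \<forall>h\<in>V. ip (fadd f g) h = ip f h + ip g h) \<and>
     (\<forall>c. \<forall>f\<in>V. \<forall>g\<in>V. ip (fscale c f) g = c * ip f g) \<and>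
     (\<forall>f\<in>V. \<forall>g\<in>V. ip g f = cnj (ip f g)) \<and>
     (\<forall>f\<in>V. 0 \<le> Re (ip f f) \<and> (ip f f = 0 \<longrightarrow> f = (\<lambda>_. 0))) \<and>
     (\<forall>X. (\<forall>n::nat. X n \<in> V) \<and>
          (\<forall>e>0. \<exists>N. \<forall>m\<ge>N. \<forall>n\<ge>N. ip_norm ip (fsub (X m) (X n)) < e) \<longrightarrow>
          (\<exists>f\<in>V. (\<lambda>n. ip_norm ip (fsub (X n) f)) \<longlonglongrightarrow> 0))"

text \<open>
  Self-adjointness of a possibly unbounded operator \<open>A\<close> with domain \<open>D\<close>: it is densely
  defined, and the graph of the adjoint equals the graph of \<open>A\<close>.
\<close>

definition self_adjoint_operator ::
    "('b \<Rightarrow> complex) set \<Rightarrow> 'b inner_prod \<Rightarrow> ('b \<Rightarrow> complex) set \<Rightarrow>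
     (('b \<Rightarrow> complex) \<Rightarrow> 'b \<Rightarrow> complex) \<Rightarrow> bool" where
  "self_adjoint_operator V ip D A \<longleftrightarrow>
     hilbert_space V ip \<and>
     D \<subseteq> V \<and> complex_subspace D \<and>
     (\<forall>f\<in>V. \<forall>e>0. \<exists>d\<in>D. ip_norm ip (fsub f d) < e) \<and>
     (\<forall>f\<in>D. A f \<in> V) \<and> complex_linear_on D A \<and>
     (\<forall>g\<in>V. \<forall>h\<in>V. (\<forall>f\<in>D. ip (A f) g = ip f h) \<longleftrightarrow> g \<in> D \<and> A g = h)"

definition closed_subspace_of ::
    "('b \<Rightarrow> complex) set \<Rightarrow> 'b inner_prod \<Rightarrow> ('b \<Rightarrow> complex) set \<Rightarrow> bool" where
  "closed_subspace_of V ip W \<longleftrightarrow>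
     W \<subseteq> V \<and> complex_subspace W \<and>
     (\<forall>X f. (\<forall>n::nat. X n \<in> W) \<and> f \<in> V \<and> (\<lambda>n. ip_norm ip (fsub (X n) f)) \<longlonglongrightarrow> 0 \<longrightarrow> f \<in> W)"

definition hilbert_sum ::
    "('b \<Rightarrow> complex) set \<Rightarrow> 'b inner_prod \<Rightarrow> (nat \<Rightarrow> ('b \<Rightarrow> complex) set) \<Rightarrow> bool" where
  "hilbert_sum V ip W \<longleftrightarrow>
     hilbert_space V ip \<and>
     (\<forall>l. closed_subspace_of V ip (W l)) \<and>
     (\<forall>k l. k \<noteq> l \<longrightarrow> (\<forall>f\<in>W k. \<forall>g\<in>W l. ip f g = 0)) \<and>
     (\<forall>f\<in>V. \<exists>g. (\<forall>l. g l \<in> W l) \<and>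
        (\<lambda>n. ip_norm ip (fsub f (\<lambda>p. \<Sum>l<n. g l p))) \<longlonglongrightarrow> 0)"


section \<open>Holomorphic functions on the upper half plane and its square\<close>

definition uhp :: "complex set" where
  "uhp = {z. 0 < Im z}"

definition hol_uhp :: "(complex \<Rightarrow> complex) set" where
  "hol_uhp = {h. h holomorphic_on uhp \<and> (\<forall>z. z \<notin> uhp \<longrightarrow> h z = 0)}"

text \<open>Holomorphy in two variables: the real Frechet derivative exists and is complex linear.\<close>

definition holomorphic2_on :: "(complex \<times> complex \<Rightarrow> complex) \<Rightarrow> (complex \<times> complex) set \<Rightarrow> bool" where
  "holomorphic2_on f S \<longleftrightarrow>
     (\<forall>p\<in>S. \<exists>a b. (f has_derivative (\<lambda>(u, v). a * u + b * v)) (at p within S))"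

definition hol_uhp2 :: "(complex \<times> complex \<Rightarrow> complex) set" where
  "hol_uhp2 = {f. holomorphic2_on f (uhp \<times> uhp) \<and> (\<forall>p. p \<notin> uhp \<times> uhp \<longrightarrow> f p = 0)}"


section \<open>The Hardy space and its Hilbert tensor square\<close>

definition hardy_norm_sq :: "(complex \<Rightarrow> complex) \<Rightarrow> ennreal" where
  "hardy_norm_sq h = (SUP y\<in>{0<..}. \<integral>\<^sup>+x. ennreal ((cmod (h (Complex x y)))\<^sup>2) \<partial>lborel)"

definition hardy :: "(complex \<Rightarrow> complex) set" where
  "hardy = {h \<in> hol_uhp. hardy_norm_sq h < \<infinity>}"

text \<open>The inner product belonging to the norm, by polarization.\<close>

definition hardy_ip :: "complex inner_prod" where
  "hardy_ip g h =
     (\<Sum>k<4. \<i> ^ k * complex_of_real (enn2real (hardy_norm_sq (fadd g (fscale (\<i> ^ k) h))))) / 4"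

text \<open>
  A list of pairs \<open>(g, h)\<close> represents the sum of the elementary tensors of its members.
  As a function on the product, the elementary tensor of \<open>g\<close> and \<open>h\<close> is the one taking \<open>(a, b)\<close> to \<open>g a * h b\<close>.
\<close>

type_synonym tensor = "((complex \<Rightarrow> complex) \<times> (complex \<Rightarrow> complex)) list"

definition tensor_fun :: "tensor \<Rightarrow> complex \<times> complex \<Rightarrow> complex" where
  "tensor_fun u p = (\<Sum>(g, h)\<leftarrow>u. g (fst p) * h (snd p))"

definition tensor_ip :: "tensor \<Rightarrow> tensor \<Rightarrow> complex" where
  "tensor_ip u v = (\<Sum>(g, h)\<leftarrow>u. \<Sum>(g', h')\<leftarrow>v. hardy_ip g g' * hardy_ip h h')"

definition tensor_diff :: "tensor \<Rightarrow> tensor \<Rightarrow> tensor" where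
  "tensor_diff u v = u @ map (\<lambda>(g, h). (fscale (- 1) g, h)) v"

definition tensor_norm :: "tensor \<Rightarrow> real" where
  "tensor_norm u = sqrt (Re (tensor_ip u u))"

text \<open>
  An element of the Hilbert completion of the algebraic tensor product is given by a Cauchy
  sequence of tensors; as a function on the product it is the pointwise limit of that sequence
  (point evaluations on the Hardy space are bounded).
\<close>

definition represents :: "(nat \<Rightarrow> tensor) \<Rightarrow> (complex \<times> complex \<Rightarrow> complex) \<Rightarrow> bool" where
  "represents X f \<longleftrightarrow>
     (\<forall>n. set (X n) \<subseteq> hardy \<times> hardy) \<and>
     (\<forall>e>0. \<exists>N. \<forall>m\<ge>N. \<forall>n\<ge>N. tensor_norm (tensor_diff (X m) (X n)) < e) \<and>
     (\<forall>p\<in>uhp \<times> uhp. (\<lambda>n. tensor_fun (X n) p) \<longlonglongrightarrow> f p)"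

definition hardy2 :: "(complex \<times> complex \<Rightarrow> complex) set" where
  "hardy2 = {f \<in> hol_uhp2. \<exists>X. represents X f}"

definition hardy2_ip :: "(complex \<times> complex) inner_prod" where
  "hardy2_ip f g =
     (THE c. \<exists>X Y. represents X f \<and> represents Y g \<and> (\<lambda>n. tensor_ip (X n) (Y n)) \<longlonglongrightarrow> c)"


section \<open>The operator P and its eigenspaces\<close>

definition d1 :: "(complex \<times> complex \<Rightarrow> complex) \<Rightarrow> complex \<times> complex \<Rightarrow> complex" where
  "d1 f = (\<lambda>(a, b). deriv (\<lambda>w. f (w, b)) a)"

definition d2 :: "(complex \<times> complex \<Rightarrow> complex) \<Rightarrow> complex \<times> complex \<Rightarrow> complex" where
  "d2 f = (\<lambda>(a, b). deriv (\<lambda>w. f (a, w)) b)"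

definition opP :: "(complex \<times> complex \<Rightarrow> complex) \<Rightarrow> complex \<times> complex \<Rightarrow> complex" where
  "opP f = (\<lambda>(a, b). if (a, b) \<in> uhp \<times> uhp
     then (a - b)\<^sup>2 * d1 (d2 f) (a, b) - (a - b) * (d1 f (a, b) - d2 f (a, b))
     else 0)"

text \<open>The maximal domain: \<open>P\<close> is unbounded on the Hilbert space.\<close>

definition domP :: "(complex \<times> complex \<Rightarrow> complex) set" where
  "domP = {f \<in> hardy2. opP f \<in> hardy2}"

definition eigenP :: "nat \<Rightarrow> (complex \<times> complex \<Rightarrow> complex) set" where
  "eigenP l = {f \<in> hardy2. opP f = fscale (- (of_nat l * (of_nat l + 1))) f}"


section \<open>The generating operator\<close>

definition domT :: "(complex \<times> complex) set" where
  "domT = {(z, t). z \<in> uhp \<and> 2 * cmod t < Im z}"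

text \<open>
  Both contours are the circle about \<open>z\<close> whose radius is the midpoint of the admissible
  interval from \<open>2 * cmod t\<close> to \<open>Im z\<close>; the value does not depend on that choice.
\<close>

definition opT :: "(complex \<times> complex \<Rightarrow> complex) \<Rightarrow> complex \<times> complex \<Rightarrow> complex" where
  "opT f = (\<lambda>(z, t). let C = circlepath z ((2 * cmod t + Im z) / 2) in
     1 / (2 * of_real pi * \<i>)\<^sup>2 *
     contour_integral C (\<lambda>a. contour_integral C (\<lambda>b.
       f (a, b) / ((a - z) * (b - z) + t * (a - b)))))"

definition factors_as :: "nat \<Rightarrow> (complex \<times> complex \<Rightarrow> complex) \<Rightarrow> (complex \<Rightarrow> complex) \<Rightarrow> bool" where
  "factors_as l f \<phi> \<longleftrightarrow> \<phi> \<in> hol_uhp \<and> (\<forall>(z, t)\<in>domT. opT f (z, t) = t ^ l * \<phi> z)"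

definition reducedT :: "nat \<Rightarrow> (complex \<times> complex \<Rightarrow> complex) \<Rightarrow> complex \<Rightarrow> complex" where
  "reducedT l f = (THE \<phi>. factors_as l f \<phi>)"


section \<open>Weighted Bergman spaces and the constants\<close>

text \<open>Lebesgue measure on the type of complex numbers is \<open>dx dy\<close>.\<close>

definition bergman_norm_sq :: "nat \<Rightarrow> (complex \<Rightarrow> complex) \<Rightarrow> ennreal" where
  "bergman_norm_sq l \<phi> =
     (\<integral>\<^sup>+z\<in>uhp. ennreal ((cmod (\<phi> z))\<^sup>2 * Im z ^ (2 * l)) \<partial>lborel)"

definition bergman :: "nat \<Rightarrow> (complex \<Rightarrow> complex) set" where
  "bergman l = {\<phi> \<in> hol_uhp. bergman_norm_sq l \<phi> < \<infinity>}"

text \<open>Double factorial; the empty product gives the value 1 at -1 and 0.\<close>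

definition double_fact :: "int \<Rightarrow> int" where
  "double_fact n = (\<Prod>k\<in>{k \<in> {1..n}. even (n - k)}. k)"

definition b_const :: "nat \<Rightarrow> real" where
  "b_const l = fact (2 * l) / (2 ^ (2 * l + 2) * pi * (2 * real l + 1) * (fact l)\<^sup>2)"

end

(*
The Cayley transform identifies the Hardy space of the half plane with the square-summable Taylor
coefficients of holomorphic functions on the unit disc, hence the tensor square with square-summable
arrays (a_ij). On the block i + j = N the operator P becomes L L^* - N (N + 1), where
L = x^2 d/dx + y^2 d/dy + x + y raises the degree; since commuting L past multiplication by x - y only
changes the constant c in x^2 d/dx + y^2 d/dy + c (x + y), the degree-N parts of W_m = (x - y)^m / ((1 - x) (1 - y))^(m + 1), m = 0, ..., N, form an orthogonal eigenbasis with
eigenvalues -m (m + 1). Since the blocks are finite and Hermitian, self-adjointness and the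
decomposition follow.

For T, the inner contour integral is a residue, and on a product of two Szego kernels the outer one is
as well, so T of the generating function sum x^i y^j e_i e_j is an explicit rational function. Its
expansion is a sum over m of t^m times W_m with the variables scaled, so pairing with an element of the
l-th eigenspace leaves only t^l and a power series in the Cayley coordinate. The Bergman norm of that
series is computed termwise in polar coordinates with a Beta integral, and the ratio to the Hardy norm
is independent of the degree.
*)
theory Submission
  imports Defs
begin

section \<open>Coefficient arrays\<close>

text \<open>Up to normalisation \<open>P\<close> is the Casimir operator of the diagonal action of
  SL(2) in which each variable has weight one. This is why a Cayley transform with the factor 1 /
  ((z1 + i) (z2 + i)) restores the same formula in the disc variables; rotations of the disc then
  preserve the total degree, whence the blocks. That the eigenvectors exhaust a block comes from the
  kernel of the lowering operator: in degree N + 1 it is the line of (x - y)^(N + 1).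

  The analytic obstacle is the Hardy norm, a supremum over horizontal lines, which become circles
  tangent at 1 rather than concentric ones. Re-expansion about their centres gives a binomial
  matrix, to which a Schur test applies; this bounds the norm by the coefficients. For the reverse
  bound a damped translate of h is pushed to the unit circle.

  Three sources meet in b_l: |(2 i)^l / pi|^2 from the kernel of \<open>T\<close>, the Beta integral
  of the weight, and the squared norm binom(2 l, l) binom(2 l + k + 1, k) of the degree l + k part
  of the eigenvector.\<close>

type_synonym coeffs = "nat \<times> nat \<Rightarrow> complex"

text \<open>On power series sum a (i, j) x^i y^j, \<open>shift1\<close> and \<open>shift2\<close>
  are multiplication by x and y, and \<open>diffmul\<close> below is multiplication by x -
  y.\<close>

definition shift1 :: "coeffs \<Rightarrow> coeffs" where
  "shift1 a = (\<lambda>(i, j). case i of 0 \<Rightarrow> 0 | Suc i' \<Rightarrow> a (i', j))"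

definition shift2 :: "coeffs \<Rightarrow> coeffs" where
  "shift2 a = (\<lambda>(i, j). case j of 0 \<Rightarrow> 0 | Suc j' \<Rightarrow> a (i, j'))"

lemma shift_simps [simp]:
  "shift1 a (0, j) = 0" "shift1 a (Suc i, j) = a (i, j)"
  "shift2 a (i, 0) = 0" "shift2 a (i, Suc j) = a (i, j)"
  by (simp_all add: shift1_def shift2_def)

definition diffmul :: "coeffs \<Rightarrow> coeffs" where
  "diffmul a = (\<lambda>p. shift1 a p - shift2 a p)"

text \<open>In terms of power series, \<open>raise c\<close> is \<open>x\<^sup>2 \<partial>\<^sub>x + y\<^sup>2 \<partial>\<^sub>y + c (x + y)\<close> and \<open>lower\<close> is \<open>\<partial>\<^sub>x + \<partial>\<^sub>y\<close>;
  \<open>casimir\<close> is the operator \<open>P\<close> after the Cayley transform in both variables.\<close>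

definition raise :: "complex \<Rightarrow> coeffs \<Rightarrow> coeffs" where
  "raise c a = (\<lambda>(i, j). (of_nat i + c - 1) * shift1 a (i, j) + (of_nat j + c - 1) * shift2 a (i, j))"

definition lower :: "coeffs \<Rightarrow> coeffs" where
  "lower a = (\<lambda>(i, j). (of_nat i + 1) * a (Suc i, j) + (of_nat j + 1) * a (i, Suc j))"

definition casimir :: "coeffs \<Rightarrow> coeffs" where
  "casimir a = (\<lambda>(i, j). raise 1 (lower a) (i, j) - of_nat (i + j) * (of_nat (i + j) + 1) * a (i, j))"

text \<open>\<open>eigvec m\<close> lists the Taylor coefficients of \<open>(x - y)\<^sup>m / ((1 - x) (1 - y))\<^sup>m\<^sup>+\<^sup>1\<close>.\<close>

definition base_array :: "nat \<Rightarrow> coeffs" where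
  "base_array m = (\<lambda>(i, j). of_nat ((m + i) choose m) * of_nat ((m + j) choose m))"

definition eigvec :: "nat \<Rightarrow> coeffs" where
  "eigvec m = (diffmul ^^ m) (base_array m)"

lemma diffmul_simps:
  "diffmul a (0, 0) = 0" "diffmul a (Suc i, 0) = a (i, 0)" "diffmul a (0, Suc j) = - a (0, j)"
  "diffmul a (Suc i, Suc j) = a (i, Suc j) - a (Suc i, j)"
  by (simp_all add: diffmul_def)

text \<open>The vector field x^2 d/dx + y^2 d/dy maps x - y to (x - y) (x + y), so moving the factor
  x - y out adds 1 to the coefficient of x + y.\<close>

lemma raise_diffmul: "raise c (diffmul a) = diffmul (raise (c + 1) a)"
proof (rule ext, clarify)
  fix i j
  show "raise c (diffmul a) (i, j) = diffmul (raise (c + 1) a) (i, j)"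
  proof (cases i; cases j)
    fix i' j' assume "i = Suc i'" "j = Suc j'"
    then show ?thesis
      by (cases i'; cases j') (simp_all add: raise_def diffmul_simps algebra_simps)
  next
    fix i' assume "i = Suc i'" "j = 0"
    then show ?thesis by (cases i') (simp_all add: raise_def diffmul_simps algebra_simps)
  next
    fix j' assume "i = 0" "j = Suc j'"
    then show ?thesis by (cases j') (simp_all add: raise_def diffmul_simps algebra_simps)
  qed (simp add: raise_def diffmul_simps)
qed

text \<open>x - y is annihilated by d/dx + d/dy.\<close>

lemma lower_diffmul: "lower (diffmul a) = diffmul (lower a)"
proof (rule ext, clarify)
  fix i j
  show "lower (diffmul a) (i, j) = diffmul (lower a) (i, j)"
    by (cases i; cases j) (simp_all add: lower_def diffmul_simps algebra_simps)
qed

text \<open>Multiplication by x - y adds 1 to the degree, so a factor deg + c turns into deg + c -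
  1.\<close>

lemma diffmul_degree:
  "diffmul (\<lambda>(i, j). (of_nat (i + j) + c) * a (i, j)) (i, j) = (of_nat (i + j) + c - 1) * diffmul a (i, j)"
  by (cases i; cases j) (simp_all add: diffmul_simps algebra_simps)

lemma Suc_times_choose_shift: "Suc i * ((m + Suc i) choose m) = (m + Suc i) * ((m + i) choose m)"
proof -
  have "Suc i * ((m + Suc i) choose Suc i) = (m + Suc i) * ((m + i) choose i)"
    using Suc_times_binomial[of i "m + i"] by simp
  moreover have "(m + Suc i) choose m = (m + Suc i) choose Suc i" "(m + i) choose m = (m + i) choose i"
    using binomial_symmetric[of m "m + Suc i"] binomial_symmetric[of m "m + i"] by simp_all
  ultimately show ?thesis by simp
qed

lemma of_nat_Suc_times_choose_shift:
  "(of_nat i + 1) * (of_nat ((m + Suc i) choose m) :: complex) = (of_nat m + of_nat i + 1) * of_nat ((m + i) choose m)"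
  using arg_cong[OF Suc_times_choose_shift[of i m], of "of_nat :: nat \<Rightarrow> complex"]
  by (simp only: of_nat_mult of_nat_Suc of_nat_add) (simp add: ac_simps)

text \<open>For f = ((1 - x) (1 - y))^(-(m + 1)) one has x^2 f_x + (m + 1) x f = x f_x, and likewise
  in y. At c = m + 1 the operator \<open>raise\<close> therefore acts on f as the Euler operator. On
  coefficients this is the absorption identity for binomials.\<close>

lemma raise_base_array:
  "raise (of_nat m + 1) (base_array m) (i, j) = of_nat (i + j) * base_array m (i, j)"
proof -
  have 1: "(of_nat i + of_nat m) * shift1 (base_array m) (i, j) = of_nat i * base_array m (i, j)"
  proof (cases i)
    case (Suc k)
    have "(of_nat i + of_nat m) * shift1 (base_array m) (i, j) =
       ((of_nat m + of_nat k + 1) * of_nat ((m + k) choose m)) * of_nat ((m + j) choose m)"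
      using Suc by (simp add: base_array_def algebra_simps)
    also have "\<dots> = of_nat i * base_array m (i, j)"
      unfolding of_nat_Suc_times_choose_shift[symmetric] using Suc by (simp add: base_array_def algebra_simps)
    finally show ?thesis .
  qed simp
  have 2: "(of_nat j + of_nat m) * shift2 (base_array m) (i, j) = of_nat j * base_array m (i, j)"
  proof (cases j)
    case (Suc k)
    have "(of_nat j + of_nat m) * shift2 (base_array m) (i, j) =
       of_nat ((m + i) choose m) * ((of_nat m + of_nat k + 1) * of_nat ((m + k) choose m))"
      using Suc by (simp add: base_array_def algebra_simps)
    also have "\<dots> = of_nat j * base_array m (i, j)"
      unfolding of_nat_Suc_times_choose_shift[symmetric] using Suc by (simp add: base_array_def algebra_simps)
    finally show ?thesis .
  qed simp
  have "raise (of_nat m + 1) (base_array m) (i, j) =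
      (of_nat i + of_nat m) * shift1 (base_array m) (i, j) + (of_nat j + of_nat m) * shift2 (base_array m) (i, j)"
    by (simp add: raise_def)
  then show ?thesis unfolding 1 2 by (simp add: algebra_simps)
qed

text \<open>For the same f one has f_x = x f_x + (m + 1) f, so \<open>lower\<close> acts on it as
  the Euler operator plus 2 (m + 1).\<close>

lemma lower_base_array:
  "lower (base_array m) (i, j) = (of_nat (i + j) + 2 * of_nat m + 2) * base_array m (i, j)"
proof -
  have "lower (base_array m) (i, j) =
     ((of_nat i + 1) * of_nat ((m + Suc i) choose m)) * of_nat ((m + j) choose m)
     + of_nat ((m + i) choose m) * ((of_nat j + 1) * of_nat ((m + Suc j) choose m))"
    by (simp add: lower_def base_array_def algebra_simps)
  also have "\<dots> = (of_nat (i + j) + 2 * of_nat m + 2) * base_array m (i, j)"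
    unfolding of_nat_Suc_times_choose_shift by (simp add: base_array_def algebra_simps)
  finally show ?thesis .
qed

text \<open>Each factor x - y taken out raises the parameter by one, so m + 1 - p returns to m + 1
  on \<open>base_array m\<close>. For p = m the parameter is 1, the value used in
  \<open>casimir\<close>.\<close>

lemma raise_diffmul_pow:
  "raise (of_nat m + 1 - of_nat p) ((diffmul ^^ p) (base_array m)) (i, j)
     = (of_nat (i + j) - of_nat p) * (diffmul ^^ p) (base_array m) (i, j)"
proof (induction p arbitrary: i j)
  case 0 then show ?case using raise_base_array[of m i j] by simp
next
  case (Suc p)
  let ?h = "(diffmul ^^ p) (base_array m)"
  have IH: "raise (of_nat m + 1 - of_nat p) ?h = (\<lambda>(i, j). (of_nat (i + j) + (- of_nat p)) * ?h (i, j))"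
    using Suc.IH by (intro ext) auto
  have e: "of_nat m + 1 - of_nat (Suc p) + 1 = (of_nat m + 1 - of_nat p :: complex)" by simp
  show ?case
    unfolding funpow.simps comp_def raise_diffmul e IH diffmul_degree by (simp add: algebra_simps)
qed

lemma raise_eigvec: "raise 1 (eigvec m) (i, j) = (of_nat (i + j) - of_nat m) * eigvec m (i, j)"
  using raise_diffmul_pow[of m m i j] by (simp add: eigvec_def)

lemma lower_diffmul_pow:
  "lower ((diffmul ^^ p) (base_array m)) (i, j)
     = (of_nat (i + j) + 2 * of_nat m + 2 - of_nat p) * (diffmul ^^ p) (base_array m) (i, j)"
proof (induction p arbitrary: i j)
  case 0 then show ?case using lower_base_array[of m i j] by simp
next
  case (Suc p)
  let ?h = "(diffmul ^^ p) (base_array m)"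
  have IH: "lower ?h = (\<lambda>(i, j). (of_nat (i + j) + (2 * of_nat m + 2 - of_nat p)) * ?h (i, j))"
    using Suc.IH by (intro ext) (auto simp: algebra_simps)
  show ?case
    unfolding funpow.simps comp_def lower_diffmul IH diffmul_degree by (simp add: algebra_simps)
qed

lemma lower_eigvec: "lower (eigvec m) (i, j) = (of_nat (i + j) + of_nat m + 2) * eigvec m (i, j)"
  using lower_diffmul_pow[of m m i j] by (simp add: eigvec_def algebra_simps)

text \<open>In degree N the factors are N + m + 1 from \<open>lower\<close>, evaluated one degree
  below, and N - m from \<open>raise\<close>, and (N - m) (N + m + 1) - N (N + 1) = - m (m +
  1).\<close>

lemma casimir_eigvec: "casimir (eigvec m) p = - (of_nat m * (of_nat m + 1)) * eigvec m p"
proof -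
  obtain i j where p: "p = (i, j)" by force
  have l: "lower (eigvec m) = (\<lambda>(i, j). (of_nat (i + j) + of_nat m + 2) * eigvec m (i, j))"
    using lower_eigvec by (intro ext) auto
  have "raise 1 (lower (eigvec m)) (i, j) = (of_nat (i + j) + of_nat m + 1) * raise 1 (eigvec m) (i, j)"
    unfolding l by (cases i; cases j) (simp_all add: raise_def algebra_simps)
  then show ?thesis unfolding p casimir_def by (simp add: raise_eigvec algebra_simps)
qed

text \<open>The lowest-degree part of (x - y)^p a(x, y) is a(0, 0) (x - y)^p.\<close>

lemma diffmul_pow_lowest:
  "i + j = p \<Longrightarrow> (diffmul ^^ p) a (i, j) = (- 1) ^ j * of_nat (p choose j) * a (0, 0)"
  "i + j < p \<Longrightarrow> (diffmul ^^ p) a (i, j) = 0"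
proof (induction p arbitrary: i j)
  case 0
  { case 1 then show ?case by simp }
  { case 2 then show ?case by simp }
next
  case (Suc p)
  { case 1
    then show ?case
    proof (cases i; cases j)
      fix i' j' assume ij: "i = Suc i'" "j = Suc j'"
      then have "i' + Suc j' = p" "Suc i' + j' = p" using 1 by auto
      then show ?thesis using ij Suc.IH(1)
        by (simp add: diffmul_simps algebra_simps)
    next
      fix i' assume ij: "i = Suc i'" "j = 0"
      then show ?thesis using 1 Suc.IH(1)[of i' 0] by (simp add: diffmul_simps)
    next
      fix j' assume ij: "i = 0" "j = Suc j'"
      then show ?thesis using 1 Suc.IH(1)[of 0 j'] by (simp add: diffmul_simps)
    qed simp }
  { case 2
    then show ?case
      by (cases i; cases j) (auto simp add: diffmul_simps Suc.IH(2)) }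
qed

lemma eigvec_lowest: "i + j = m \<Longrightarrow> eigvec m (i, j) = (- 1) ^ j * of_nat (m choose j)"
  by (simp add: eigvec_def diffmul_pow_lowest(1) base_array_def)

lemma cnj_diffmul: "(\<And>p. cnj (a p) = a p) \<Longrightarrow> cnj (diffmul a p) = diffmul a p"
  by (cases p; cases "fst p"; cases "snd p") (auto simp: diffmul_simps)

lemma cnj_eigvec [simp]: "cnj (eigvec m p) = eigvec m p"
proof -
  have "\<forall>p. cnj ((diffmul ^^ k) (base_array m) p) = (diffmul ^^ k) (base_array m) p" for k
  proof (induction k)
    case 0 then show ?case by (auto simp: base_array_def)
  next
    case (Suc k) then show ?case unfolding funpow.simps comp_def using cnj_diffmul by blast
  qed
  then show ?thesis unfolding eigvec_def by blast
qed

section \<open>The Hermitian form on a fixed total degree and the orthogonal eigenbasis\<close>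

definition diag :: "nat \<Rightarrow> (nat \<times> nat) set" where
  "diag N = {(i, j). i + j = N}"

lemma sum_diag: "(\<Sum>p\<in>diag N. f p) = (\<Sum>i\<le>N. f (i, N - i))"
  by (rule sum.reindex_bij_witness[of _ "\<lambda>i. (i, N - i)" fst]) (auto simp: diag_def)

lemma finite_diag [simp]: "finite (diag N)"
  by (rule finite_subset[of _ "{..N} \<times> {..N}"]) (auto simp: diag_def)

definition diag_ip :: "nat \<Rightarrow> coeffs \<Rightarrow> coeffs \<Rightarrow> complex" where
  "diag_ip N a b = (\<Sum>p\<in>diag N. a p * cnj (b p))"

text \<open>At c = 1 the multiplier of \<open>a (i - 1, j)\<close> in \<open>raise\<close> is i, the
  same that \<open>lower\<close> puts on \<open>b (i, j)\<close>; this value of c makes the two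
  operators adjoint between neighbouring degrees.\<close>

lemma diag_ip_raise: "diag_ip (Suc N) (raise 1 a) b = diag_ip N a (lower b)"
proof -
  have "diag_ip (Suc N) (raise 1 a) b =
      (\<Sum>i\<le>Suc N. of_nat i * shift1 a (i, Suc N - i) * cnj (b (i, Suc N - i)))
    + (\<Sum>i\<le>Suc N. of_nat (Suc N - i) * shift2 a (i, Suc N - i) * cnj (b (i, Suc N - i)))"
    unfolding diag_ip_def sum_diag sum.distrib[symmetric]
    by (intro sum.cong) (auto simp: raise_def algebra_simps)
  also have "(\<Sum>i\<le>Suc N. of_nat i * shift1 a (i, Suc N - i) * cnj (b (i, Suc N - i)))
    = (\<Sum>i\<le>N. (of_nat i + 1) * a (i, N - i) * cnj (b (Suc i, N - i)))"
    by (subst sum.atMost_Suc_shift) (simp add: add.commute)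
  also have "(\<Sum>i\<le>Suc N. of_nat (Suc N - i) * shift2 a (i, Suc N - i) * cnj (b (i, Suc N - i)))
    = (\<Sum>i\<le>N. of_nat (Suc N - i) * shift2 a (i, Suc N - i) * cnj (b (i, Suc N - i)))"
    by simp
  also have "\<dots> = (\<Sum>i\<le>N. (of_nat (N - i) + 1) * a (i, N - i) * cnj (b (i, Suc (N - i))))"
    by (intro sum.cong) (auto simp: Suc_diff_le add.commute)
  finally show ?thesis unfolding diag_ip_def sum_diag sum.distrib[symmetric]
    by (simp add: lower_def algebra_simps sum.distrib)
qed

lemma diag_ip_cnj: "cnj (diag_ip N a b) = diag_ip N b a"
  by (simp add: diag_ip_def mult.commute)

lemma diag_ip_casimir: "diag_ip N (casimir a) b = diag_ip N a (casimir b)"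
proof -
  have r: "diag_ip N (casimir a) b = diag_ip N (raise 1 (lower a)) b - of_nat N * (of_nat N + 1) * diag_ip N a b" for a b
    unfolding diag_ip_def sum_distrib_left sum_subtractf[symmetric]
    by (intro sum.cong) (auto simp: casimir_def diag_def algebra_simps)
  have l: "diag_ip N a (casimir b) = diag_ip N a (raise 1 (lower b)) - of_nat N * (of_nat N + 1) * diag_ip N a b"
    using arg_cong[OF r[of b a], of cnj] by (simp add: diag_ip_cnj)
  have "diag_ip N (raise 1 (lower a)) b = diag_ip N a (raise 1 (lower b))"
  \<comment> \<open>Degree 0 has no degree below it, and there \<open>raise 1\<close> vanishes on
    both sides.\<close>
  proof (cases N)
    case 0
    then show ?thesis by (simp add: diag_ip_def sum_diag raise_def)
  next
    case (Suc K)
    then show ?thesis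
      using diag_ip_raise[of K "lower a" b] diag_ip_raise[of K "lower b" a] diag_ip_cnj by metis
  qed
  then show ?thesis using r l by simp
qed

lemma diag_ip_cong: "(\<And>p. p \<in> diag N \<Longrightarrow> a p = a' p) \<Longrightarrow> (\<And>p. p \<in> diag N \<Longrightarrow> b p = b' p) \<Longrightarrow> diag_ip N a b = diag_ip N a' b'"
  by (simp add: diag_ip_def)

lemma diag_ip_scale_left: "diag_ip N (\<lambda>p. c * a p) b = c * diag_ip N a b"
  by (simp add: diag_ip_def sum_distrib_left mult.assoc)

lemma diag_ip_scale_right: "diag_ip N a (\<lambda>p. c * b p) = cnj c * diag_ip N a b"
  by (simp add: diag_ip_def sum_distrib_left ac_simps)

lemma eigenvalue_inject:
  assumes "(of_nat l * (of_nat l + 1) :: complex) = of_nat m * (of_nat m + 1)"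
  shows "l = m"
proof -
  have "(of_nat (l * (l + 1)) :: complex) = of_nat (m * (m + 1))" using assms by (simp only: of_nat_mult of_nat_add of_nat_1)
  then have "l * (l + 1) = m * (m + 1)" by (simp only: of_nat_eq_iff)
  then show ?thesis
  proof -
    have False if "l < m" "l * (l + 1) = m * (m + 1)" for l m :: nat
      using mult_strict_mono[of l m "l + 1" "m + 1"] that by simp
    then show ?thesis using \<open>l * (l + 1) = m * (m + 1)\<close> by (metis linorder_neqE_nat)
  qed
qed

text \<open>\<open>casimir\<close> is symmetric on each degree, and the real numbers - l (l + 1) are
  distinct for distinct l.\<close>

lemma diag_ip_eigvec_eq_0:
  assumes "\<And>p. p \<in> diag N \<Longrightarrow> casimir a p = - (of_nat l * (of_nat l + 1)) * a p" "l \<noteq> m"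
  shows "diag_ip N a (eigvec m) = 0"
proof -
  have "- (of_nat l * (of_nat l + 1)) * diag_ip N a (eigvec m) = diag_ip N (casimir a) (eigvec m)"
    unfolding diag_ip_scale_left[symmetric] by (rule diag_ip_cong) (simp_all add: assms(1))
  also have "\<dots> = diag_ip N a (casimir (eigvec m))" by (rule diag_ip_casimir)
  also have "\<dots> = diag_ip N a (\<lambda>p. - (of_nat m * (of_nat m + 1)) * eigvec m p)"
    by (rule diag_ip_cong) (simp_all only: casimir_eigvec)
  also have "\<dots> = - (of_nat m * (of_nat m + 1)) * diag_ip N a (eigvec m)"
    unfolding diag_ip_scale_right by simp
  finally show ?thesis using eigenvalue_inject[of l m] assms(2) by auto
qed

lemma diag_ip_eigvec_orth: "l \<noteq> m \<Longrightarrow> diag_ip N (eigvec l) (eigvec m) = 0"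
  by (rule diag_ip_eigvec_eq_0) (auto simp: casimir_eigvec)

text \<open>The squared norm of the part of \<open>eigvec m\<close> of degree m + k; the second
  argument counts the degree above the lowest one.\<close>

definition eigvec_norm :: "nat \<Rightarrow> nat \<Rightarrow> nat" where
  "eigvec_norm m k = ((2 * m) choose m) * ((2 * m + k + 1) choose k)"

text \<open>In the lowest degree the sum of squared binomials is the central binomial. Adjointness
  of \<open>raise 1\<close> and \<open>lower\<close>, both scalar on the eigenvector in each degree,
  gives the ratio (2 m + k + 2) / (k + 1) of consecutive squared norms.\<close>

lemma diag_ip_eigvec_self: "diag_ip (m + k) (eigvec m) (eigvec m) = of_nat (eigvec_norm m k)"
proof (induction k)
  case 0
  have "diag_ip m (eigvec m) (eigvec m) = (\<Sum>i\<le>m. of_nat ((m choose (m - i))\<^sup>2))"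
    unfolding diag_ip_def sum_diag
  proof (rule sum.cong)
    fix i assume i: "i \<in> {..m}"
    have "(- 1 :: complex) ^ (m - i) * (- 1) ^ (m - i) = 1"
      by (simp add: power_mult_distrib[symmetric])
    then show "eigvec m (i, m - i) * cnj (eigvec m (i, m - i)) = of_nat ((m choose (m - i))\<^sup>2)"
      using i unfolding cnj_eigvec by (subst (1 2) eigvec_lowest) (auto simp: power2_eq_square mult.left_commute mult.assoc)
  qed simp
  also have "\<dots> = of_nat (\<Sum>i\<le>m. (m choose i)\<^sup>2)"
    by (subst of_nat_sum) (intro sum.cong refl, metis atMost_iff binomial_symmetric)
  also have "\<dots> = of_nat (eigvec_norm m 0)" by (simp add: eigvec_norm_def choose_square_sum)
  finally show ?case by simp
next
  case (Suc k)
  have "(of_nat k + 1) * diag_ip (m + Suc k) (eigvec m) (eigvec m) = diag_ip (Suc (m + k)) (raise 1 (eigvec m)) (eigvec m)"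
    unfolding diag_ip_scale_left[symmetric] add_Suc_right
    by (rule diag_ip_cong) (auto simp: raise_eigvec diag_def simp del: of_nat_add simp flip: of_nat_diff)
  also have "\<dots> = diag_ip (m + k) (eigvec m) (\<lambda>p. (of_nat (2 * m + k + 2)) * eigvec m p)"
    unfolding diag_ip_raise by (rule diag_ip_cong) (auto simp: lower_eigvec diag_def simp flip: of_nat_add)
  also have "\<dots> = of_nat (2 * m + k + 2) * of_nat (eigvec_norm m k)"
    unfolding diag_ip_scale_right Suc.IH by simp
  also have "\<dots> = of_nat ((k + 1) * eigvec_norm m (Suc k))"
  proof -
    have "Suc k * (2 * m + k + 2 choose Suc k) = (2 * m + k + 2) * (2 * m + k + 1 choose k)"
      using Suc_times_binomial[of k "2 * m + k + 1"] by (simp only: Suc_eq_plus1 add.assoc one_add_one)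
    from arg_cong[OF this, of "\<lambda>n. (2 * m choose m) * n"]
    have "(2 * m + k + 2) * eigvec_norm m k = (k + 1) * eigvec_norm m (Suc k)"
      unfolding eigvec_norm_def add_Suc_right add_Suc Suc_eq_plus1
      by (simp only: add.assoc one_add_one) (simp only: ac_simps)
    then show ?thesis by (simp only: of_nat_mult[symmetric])
  qed
  also have "\<dots> = (of_nat k + 1) * of_nat (eigvec_norm m (Suc k))" by (simp add: algebra_simps)
  finally have "(of_nat k + 1) * diag_ip (m + Suc k) (eigvec m) (eigvec m) = (of_nat k + 1) * of_nat (eigvec_norm m (Suc k))" .
  moreover have "(of_nat k + 1 :: complex) \<noteq> 0" using of_nat_eq_0_iff[of "Suc k", where 'a=complex] by (simp add: add.commute)
  ultimately show ?case by (simp only: mult_cancel_left) simp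
qed

lemma eigvec_norm_pos: "0 < eigvec_norm m k"
  by (simp add: eigvec_norm_def)

text \<open>A homogeneous polynomial killed by d/dx + d/dy depends on x - y only. On coefficients
  the equation is a two-term recursion along the diagonal, solved from the corner
  \<open>(Suc N, 0)\<close>.\<close>

lemma lower_0_diag:
  assumes "\<And>p. p \<in> diag N \<Longrightarrow> lower a p = 0" "(i, j) \<in> diag (Suc N)"
  shows "a (i, j) = a (Suc N, 0) * eigvec (Suc N) (i, j)"
  using assms(2)
proof (induction j arbitrary: i)
  case 0
  then show ?case by (simp add: diag_def eigvec_lowest)
next
  case (Suc j)
  have i: "(Suc i, j) \<in> diag (Suc N)" "(i, j) \<in> diag N" using Suc.prems by (auto simp: diag_def)
  have IH: "a (Suc i, j) = a (Suc N, 0) * eigvec (Suc N) (Suc i, j)" using Suc.IH[OF i(1)] .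
  have l: "(of_nat i + 1) * a (Suc i, j) + (of_nat j + 1) * a (i, Suc j) = 0"
    using assms(1)[OF i(2)] by (simp add: lower_def)
  have N: "i + Suc j = Suc N" "Suc i + j = Suc N" using i by (auto simp: diag_def)
  have b: "(of_nat j + 1) * of_nat (Suc N choose Suc j) = (of_nat i + 1) * (of_nat (Suc N choose j) :: complex)"
  proof -
    have "Suc j * (Suc N choose Suc j) = Suc i * (Suc N choose j)"
      using binomial_absorb_comp[of "Suc N" j] Suc_times_binomial[of j N] N(2)[symmetric] by simp
    from arg_cong[OF this, of "of_nat :: nat \<Rightarrow> complex"] show ?thesis
      by (simp only: of_nat_mult of_nat_Suc) (simp add: ac_simps)
  qed
  have "(of_nat j + 1) * a (i, Suc j) = - ((of_nat i + 1) * of_nat (Suc N choose j)) * ((- 1) ^ j * a (Suc N, 0))"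
    using l N IH by (simp add: eigvec_lowest algebra_simps eq_neg_iff_add_eq_0)
  also have "\<dots> = (of_nat j + 1) * (a (Suc N, 0) * eigvec (Suc N) (i, Suc j))"
    unfolding b[symmetric] eigvec_lowest[OF N(1)] by (simp add: algebra_simps)
  finally have "(of_nat j + 1) * a (i, Suc j) = (of_nat j + 1) * (a (Suc N, 0) * eigvec (Suc N) (i, Suc j))" .
  moreover have "(of_nat j + 1 :: complex) \<noteq> 0" using of_nat_eq_0_iff[of "Suc j", where 'a=complex] by (simp add: add.commute)
  ultimately show ?case by (simp only: mult_cancel_left) simp
qed

text \<open>Completeness by induction on the degree. By adjointness, orthogonality to the
  eigenvectors passes from a to \<open>lower a\<close>, which vanishes by induction; then a is a
  multiple of the top vector (x - y)^(N + 1), to which it is orthogonal as well.\<close>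

lemma diag_orth_imp_0:
  assumes "\<And>m. m \<le> N \<Longrightarrow> diag_ip N a (eigvec m) = 0" "p \<in> diag N"
  shows "a p = 0"
  using assms
proof (induction N arbitrary: a p)
  case 0
  then show ?case by (auto simp: diag_def diag_ip_def sum_diag eigvec_lowest)
next
  case (Suc N)
  have "diag_ip N (lower a) (eigvec m) = 0" if "m \<le> N" for m
  proof -
    have "diag_ip N (lower a) (eigvec m) = cnj (diag_ip (Suc N) (raise 1 (eigvec m)) a)"
      by (simp add: diag_ip_raise diag_ip_cnj)
    also have "\<dots> = diag_ip (Suc N) a (\<lambda>p. (of_nat (Suc N) - of_nat m) * eigvec m p)"
      unfolding diag_ip_cnj by (rule diag_ip_cong) (auto simp: raise_eigvec diag_def simp flip: of_nat_add of_nat_Suc)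
    also have "\<dots> = 0" unfolding diag_ip_scale_right using Suc.prems(1)[of m] that by simp
    finally show ?thesis .
  qed
  from Suc.IH[OF this] have "lower a q = 0" if "q \<in> diag N" for q using that by blast
  then have a: "a q = a (Suc N, 0) * eigvec (Suc N) q" if "q \<in> diag (Suc N)" for q
    using lower_0_diag[of N a "fst q" "snd q"] that by simp
  have "0 = diag_ip (Suc N) (\<lambda>q. a (Suc N, 0) * eigvec (Suc N) q) (eigvec (Suc N))"
    using Suc.prems(1)[of "Suc N"] a diag_ip_cong[of "Suc N" a _ "eigvec (Suc N)" "eigvec (Suc N)"] by auto
  also have "\<dots> = a (Suc N, 0) * of_nat (eigvec_norm (Suc N) 0)"
    unfolding diag_ip_scale_left using diag_ip_eigvec_self[of "Suc N" 0] by simp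
  finally have "a (Suc N, 0) = 0" using eigvec_norm_pos[of "Suc N" 0] by auto
  then show ?case using a[OF Suc.prems(2)] by simp
qed

definition eigcoef :: "nat \<Rightarrow> nat \<Rightarrow> coeffs \<Rightarrow> complex" where
  "eigcoef m k a = diag_ip (m + k) a (eigvec m) / of_nat (eigvec_norm m k)"

lemma diag_ip_diff_left: "diag_ip N (\<lambda>p. a p - b p) c = diag_ip N a c - diag_ip N b c"
  by (simp add: diag_ip_def sum_subtractf algebra_simps)

lemma diag_ip_sum_left: "diag_ip N (\<lambda>p. \<Sum>m\<in>S. f m p) c = (\<Sum>m\<in>S. diag_ip N (f m) c)"
  unfolding diag_ip_def sum_distrib_right by (rule sum.swap)

lemma diag_expansion:
  assumes "p \<in> diag N"
  shows "a p = (\<Sum>m\<le>N. eigcoef m (N - m) a * eigvec m p)"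
proof -
  have "(\<lambda>p. a p - (\<Sum>m\<le>N. eigcoef m (N - m) a * eigvec m p)) p = 0"
  proof (rule diag_orth_imp_0[OF _ assms])
    fix l assume l: "l \<le> N"
    have "diag_ip N (\<lambda>p. \<Sum>m\<le>N. eigcoef m (N - m) a * eigvec m p) (eigvec l)
      = (\<Sum>m\<le>N. if m = l then eigcoef l (N - l) a * diag_ip N (eigvec l) (eigvec l) else 0)"
      unfolding diag_ip_sum_left diag_ip_scale_left
      by (intro sum.cong) (auto simp: diag_ip_eigvec_orth)
    also have "\<dots> = diag_ip N a (eigvec l)"
      using l diag_ip_eigvec_self[of l "N - l"] eigvec_norm_pos[of l "N - l"] by (simp add: eigcoef_def)
    finally show "diag_ip N (\<lambda>p. a p - (\<Sum>m\<le>N. eigcoef m (N - m) a * eigvec m p)) (eigvec l) = 0"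
      by (simp add: diag_ip_diff_left)
  qed
  then show ?thesis by simp
qed

text \<open>Eigenvectors with other eigenvalues drop out of the expansion, so each degree N \<ge> l
  carries one line of solutions and the degrees below l carry none.\<close>

lemma casimir_eigen_diag:
  assumes "\<And>p. casimir a p = - (of_nat l * (of_nat l + 1)) * a p" "p \<in> diag N"
  shows "a p = (if l \<le> N then eigcoef l (N - l) a * eigvec l p else 0)"
proof -
  have 0: "eigcoef m (N - m) a = 0" if "m \<noteq> l" "m \<le> N" for m
    using diag_ip_eigvec_eq_0[of N a l m] assms(1) that by (auto simp: eigcoef_def)
  have "a p = (\<Sum>m\<le>N. eigcoef m (N - m) a * eigvec m p)"
    by (rule diag_expansion[OF assms(2)])
  also have "\<dots> = (\<Sum>m\<le>N. if m = l then eigcoef l (N - l) a * eigvec l p else 0)"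
    by (intro sum.cong) (auto simp: 0)
  finally show ?thesis by simp
qed

section \<open>Square-summable families\<close>

text \<open>The index type is left open: \<open>nat\<close> serves for Hardy functions, pairs for
  the tensor square.\<close>

definition l2 :: "('i \<Rightarrow> complex) \<Rightarrow> bool" where
  "l2 a \<longleftrightarrow> (\<lambda>i. (cmod (a i))\<^sup>2) summable_on UNIV"

definition l2norm :: "('i \<Rightarrow> complex) \<Rightarrow> real" where
  "l2norm a = sqrt (\<Sum>\<^sub>\<infinity>i. (cmod (a i))\<^sup>2)"

definition l2ip :: "('i \<Rightarrow> complex) \<Rightarrow> ('i \<Rightarrow> complex) \<Rightarrow> complex" where
  "l2ip a b = (\<Sum>\<^sub>\<infinity>i. a i * cnj (b i))"

lemma l2norm_nonneg [simp]: "0 \<le> l2norm a"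
  by (simp add: l2norm_def infsum_nonneg)

lemma l2norm_sq: "(l2norm a)\<^sup>2 = (\<Sum>\<^sub>\<infinity>i. (cmod (a i))\<^sup>2)"
  by (simp add: l2norm_def infsum_nonneg)

lemma L2_set_le_l2norm: "l2 a \<Longrightarrow> finite F \<Longrightarrow> L2_set (\<lambda>i. cmod (a i)) F \<le> l2norm a"
  unfolding L2_set_def l2norm_def l2_def
  by (intro real_sqrt_le_mono finite_sum_le_infsum) auto

text \<open>Bounds on all finite subfamilies give membership and the norm bound at once; later
  estimates are brought to this finite form.\<close>

lemma l2I:
  assumes "\<And>F. finite F \<Longrightarrow> L2_set (\<lambda>i. cmod (a i)) F \<le> B"
  shows "l2 a" "l2norm a \<le> B"
proof -
  have B: "0 \<le> B" using assms[of "{}"] by simp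
  have le: "(\<Sum>i\<in>F. (cmod (a i))\<^sup>2) \<le> B\<^sup>2" if "finite F" for F
    using assms[OF that] B unfolding L2_set_def
    by (metis real_sqrt_le_iff real_sqrt_unique)
  show l: "l2 a" unfolding l2_def
    by (rule nonneg_bdd_above_summable_on) (auto intro!: bdd_aboveI2[where M = "B\<^sup>2"] le)
  have "(\<Sum>\<^sub>\<infinity>i. (cmod (a i))\<^sup>2) \<le> B\<^sup>2"
    using l unfolding l2_def by (rule infsum_le_finite_sums) (rule le)
  then show "l2norm a \<le> B" unfolding l2norm_def by (rule real_le_lsqrt[OF B])
qed

lemma l2_cong_norm: "(\<And>i. cmod (a i) = cmod (b i)) \<Longrightarrow> l2 a = l2 b \<and> l2norm a = l2norm b"
  by (simp add: l2_def l2norm_def)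

lemma l2_add_norm:
  assumes "l2 a" "l2 b"
  shows "l2 (\<lambda>i. a i + b i)" "l2norm (\<lambda>i. a i + b i) \<le> l2norm a + l2norm b"
proof -
  have "L2_set (\<lambda>i. cmod (a i + b i)) F \<le> l2norm a + l2norm b" if "finite F" for F
  proof -
    have "L2_set (\<lambda>i. cmod (a i + b i)) F \<le> L2_set (\<lambda>i. cmod (a i) + cmod (b i)) F"
      by (rule L2_set_mono) (auto intro: norm_triangle_ineq)
    also have "\<dots> \<le> L2_set (\<lambda>i. cmod (a i)) F + L2_set (\<lambda>i. cmod (b i)) F"
      by (rule L2_set_triangle_ineq)
    finally show ?thesis
      using L2_set_le_l2norm[OF assms(1) that] L2_set_le_l2norm[OF assms(2) that] by linarith
  qed
  then show "l2 (\<lambda>i. a i + b i)" "l2norm (\<lambda>i. a i + b i) \<le> l2norm a + l2norm b"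
    using l2I[of "\<lambda>i. a i + b i"] by blast+
qed

lemmas l2_add = l2_add_norm(1)

lemma l2_scale: assumes "l2 a" shows "l2 (\<lambda>i. c * a i)"
  using summable_on_cmult_right[OF assms[unfolded l2_def], of "(cmod c)\<^sup>2"]
  by (simp add: l2_def norm_mult power_mult_distrib)

lemma l2norm_scale: assumes "l2 a" shows "l2norm (\<lambda>i. c * a i) = cmod c * l2norm a"
  using infsum_cmult_right[of "(cmod c)\<^sup>2" "\<lambda>i. (cmod (a i))\<^sup>2" UNIV] assms
  by (simp add: l2norm_def l2_def norm_mult power_mult_distrib real_sqrt_mult)

lemma l2_diff: assumes "l2 a" "l2 b" shows "l2 (\<lambda>i. a i - b i)"
  using l2_add[OF assms(1) l2_scale[OF assms(2), of "- 1"]] by simp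

lemma l2norm_minus_commute: "l2norm (\<lambda>i. a i - b i) = l2norm (\<lambda>i. b i - a i)"
  using l2_cong_norm[of "\<lambda>i. a i - b i" "\<lambda>i. b i - a i"] by (simp add: norm_minus_commute)

lemma l2norm_diff_triangle:
  assumes "l2 a" "l2 b" "l2 c"
  shows "l2norm (\<lambda>i. a i - c i) \<le> l2norm (\<lambda>i. a i - b i) + l2norm (\<lambda>i. b i - c i)"
  using l2_add_norm(2)[OF l2_diff[OF assms(1,2)] l2_diff[OF assms(2,3)]] by simp

lemma l2_0 [simp]: "l2 (\<lambda>_. 0)" "l2norm (\<lambda>_. 0) = 0"
  by (simp_all add: l2_def l2norm_def)

lemma cmod_le_l2norm: "l2 a \<Longrightarrow> cmod (a i) \<le> l2norm a"
  using L2_set_le_l2norm[of a "{i}"] by simp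

lemma l2norm_eq_0: "l2 a \<Longrightarrow> l2norm a = 0 \<Longrightarrow> a = (\<lambda>_. 0)"
  using cmod_le_l2norm[of a] by (intro ext) (metis norm_le_zero_iff)

lemma l2_finite_support:
  assumes "finite S" "\<And>i. i \<notin> S \<Longrightarrow> a i = 0"
  shows "l2 a"
  unfolding l2_def by (rule finite_nonzero_values_imp_summable_on) (rule finite_subset[OF _ assms(1)], use assms(2) in auto)

text \<open>Stated bilinearly because it bounds inner products as well as point evaluations, which
  pair an array with the powers x^i y^j.\<close>

lemma Cauchy_Schwarz_l2:
  assumes "l2 a" "l2 b"
  shows "(\<lambda>i. cmod (a i * b i)) summable_on UNIV" "cmod (\<Sum>\<^sub>\<infinity>i. a i * b i) \<le> l2norm a * l2norm b"
proof -
  have le: "(\<Sum>i\<in>F. cmod (a i * b i)) \<le> l2norm a * l2norm b" if "finite F" for F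
  proof -
    have "(\<Sum>i\<in>F. cmod (a i * b i)) = (\<Sum>i\<in>F. \<bar>cmod (a i)\<bar> * \<bar>cmod (b i)\<bar>)" by (simp add: norm_mult)
    also have "\<dots> \<le> L2_set (\<lambda>i. cmod (a i)) F * L2_set (\<lambda>i. cmod (b i)) F"
      by (rule L2_set_mult_ineq)
    also have "\<dots> \<le> l2norm a * l2norm b"
      by (intro mult_mono L2_set_le_l2norm assms that) auto
    finally show ?thesis .
  qed
  show s: "(\<lambda>i. cmod (a i * b i)) summable_on UNIV"
    by (rule nonneg_bdd_above_summable_on) (auto intro!: bdd_aboveI2[where M = "l2norm a * l2norm b"] le)
  have "cmod (\<Sum>\<^sub>\<infinity>i. a i * b i) \<le> (\<Sum>\<^sub>\<infinity>i. cmod (a i * b i))" by (rule norm_infsum_bound[OF s])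
  also have "\<dots> \<le> l2norm a * l2norm b" by (rule infsum_le_finite_sums[OF s]) (rule le)
  finally show "cmod (\<Sum>\<^sub>\<infinity>i. a i * b i) \<le> l2norm a * l2norm b" .
qed

lemma l2_cnj: "l2 a \<Longrightarrow> l2 (\<lambda>i. cnj (a i))" "l2norm (\<lambda>i. cnj (a i)) = l2norm a"
  by (simp_all add: l2_def l2norm_def)

lemma l2ip_summable:
  assumes "l2 a" "l2 b"
  shows "(\<lambda>i. a i * cnj (b i)) summable_on UNIV"
  using Cauchy_Schwarz_l2(1)[OF assms(1) l2_cnj(1)[OF assms(2)]] by (rule abs_summable_summable)

lemma cmod_l2ip_le: "l2 a \<Longrightarrow> l2 b \<Longrightarrow> cmod (l2ip a b) \<le> l2norm a * l2norm b"
  using Cauchy_Schwarz_l2(2)[of a "\<lambda>i. cnj (b i)"] by (simp add: l2ip_def l2_cnj)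

lemma l2ip_add_left: "l2 a \<Longrightarrow> l2 b \<Longrightarrow> l2 c \<Longrightarrow> l2ip (\<lambda>i. a i + b i) c = l2ip a c + l2ip b c"
  unfolding l2ip_def distrib_right by (intro infsum_add l2ip_summable)

lemma l2ip_scale_left: "l2ip (\<lambda>i. k * a i) c = k * l2ip a c"
  unfolding l2ip_def mult.assoc by (rule infsum_cmult_right')

lemma l2ip_cnj: "cnj (l2ip a b) = l2ip b a"
  unfolding l2ip_def infsum_cnj[symmetric] by (simp add: mult.commute)

lemma l2ip_diff_left: "l2 a \<Longrightarrow> l2 b \<Longrightarrow> l2 c \<Longrightarrow> l2ip (\<lambda>i. a i - b i) c = l2ip a c - l2ip b c"
  using l2ip_add_left[of a "\<lambda>i. (- 1) * b i" c] l2ip_scale_left[of "-1" b c] l2_scale[of b "-1"] by simp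

lemma l2ip_diff_right: "l2 a \<Longrightarrow> l2 b \<Longrightarrow> l2 c \<Longrightarrow> l2ip c (\<lambda>i. a i - b i) = l2ip c a - l2ip c b"
  using arg_cong[OF l2ip_diff_left[of a b c], of cnj] by (simp add: l2ip_cnj)

lemma l2ip_self: assumes "l2 a" shows "l2ip a a = of_real ((l2norm a)\<^sup>2)"
proof -
  have "((\<lambda>i. complex_of_real ((cmod (a i))\<^sup>2)) has_sum of_real ((l2norm a)\<^sup>2)) UNIV"
    using assms unfolding l2_def l2norm_sq by (intro has_sum_of_real has_sum_infsum)
  then show ?thesis unfolding l2ip_def complex_norm_square by (rule infsumI)
qed

lemma l2ip_tendsto:
  assumes "\<And>n. l2 (a n)" "\<And>n. l2 (b n)" "l2 a'" "l2 b'"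
    and "(\<lambda>n. l2norm (\<lambda>i. a n i - a' i)) \<longlonglongrightarrow> 0" "(\<lambda>n. l2norm (\<lambda>i. b n i - b' i)) \<longlonglongrightarrow> 0"
  shows "(\<lambda>n. l2ip (a n) (b n)) \<longlonglongrightarrow> l2ip a' b'"
proof -
  have "(\<lambda>n. l2ip (a n) (b n) - l2ip a' b') \<longlonglongrightarrow> 0"
  proof (rule Lim_null_comparison)
    show "(\<lambda>n. l2norm (\<lambda>i. a n i - a' i) * (l2norm (\<lambda>i. b n i - b' i) + l2norm b')
        + l2norm a' * l2norm (\<lambda>i. b n i - b' i)) \<longlonglongrightarrow> 0"
      using assms(5,6) by (auto intro!: tendsto_eq_intros)
    show "\<forall>\<^sub>F n in sequentially. norm (l2ip (a n) (b n) - l2ip a' b') \<le>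
      l2norm (\<lambda>i. a n i - a' i) * (l2norm (\<lambda>i. b n i - b' i) + l2norm b')
        + l2norm a' * l2norm (\<lambda>i. b n i - b' i)"
    proof (intro always_eventually allI)
      fix n
      have "l2ip (a n) (b n) - l2ip a' b' = l2ip (\<lambda>i. a n i - a' i) (b n) + l2ip a' (\<lambda>i. b n i - b' i)"
        using assms by (simp add: l2ip_diff_left l2ip_diff_right)
      then have "norm (l2ip (a n) (b n) - l2ip a' b') \<le> cmod (l2ip (\<lambda>i. a n i - a' i) (b n)) + cmod (l2ip a' (\<lambda>i. b n i - b' i))"
        by (metis norm_triangle_ineq)
      also have "\<dots> \<le> l2norm (\<lambda>i. a n i - a' i) * l2norm (b n) + l2norm a' * l2norm (\<lambda>i. b n i - b' i)"
        by (intro add_mono cmod_l2ip_le l2_diff assms)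
      also have "l2norm (b n) \<le> l2norm (\<lambda>i. b n i - b' i) + l2norm b'"
        using l2_add_norm(2)[OF l2_diff[OF assms(2)[of n] assms(4)] assms(4)] by simp
      finally show "norm (l2ip (a n) (b n) - l2ip a' b') \<le>
          l2norm (\<lambda>i. a n i - a' i) * (l2norm (\<lambda>i. b n i - b' i) + l2norm b')
        + l2norm a' * l2norm (\<lambda>i. b n i - b' i)" by (simp add: mult_left_mono)
    qed
  qed
  then show ?thesis by (simp add: LIM_zero_iff)
qed

text \<open>The entrywise limit is the candidate. The Cauchy estimate survives the limit on each
  finite set of indices, hence for the whole norm.\<close>

lemma l2_complete:
  assumes a: "\<And>n. l2 (a n)"
    and C: "\<And>e. 0 < e \<Longrightarrow> \<exists>N. \<forall>m\<ge>N. \<forall>n\<ge>N. l2norm (\<lambda>i. a m i - a n i) < e"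
  obtains b where "l2 b" "(\<lambda>n. l2norm (\<lambda>i. a n i - b i)) \<longlonglongrightarrow> 0"
proof -
  have "Cauchy (\<lambda>n. a n i)" for i
  proof (rule metric_CauchyI)
    fix e :: real assume "0 < e"
    from C[OF this] obtain N where N: "\<And>m n. m \<ge> N \<Longrightarrow> n \<ge> N \<Longrightarrow> l2norm (\<lambda>i. a m i - a n i) < e" by blast
    have "dist (a m i) (a n i) < e" if "m \<ge> N" "n \<ge> N" for m n
      using N[OF that] cmod_le_l2norm[OF l2_diff[OF a[of m] a[of n]], of i] by (simp add: dist_norm)
    then show "\<exists>M. \<forall>m\<ge>M. \<forall>n\<ge>M. dist (a m i) (a n i) < e" by blast
  qed
  then have "\<exists>l. (\<lambda>n. a n i) \<longlonglongrightarrow> l" for i using Cauchy_convergent convergent_def by blast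
  then obtain b where b: "\<And>i. (\<lambda>n. a n i) \<longlonglongrightarrow> b i" by metis
  have key: "L2_set (\<lambda>i. cmod (a m i - b i)) F \<le> e"
    if N: "\<And>m n. m \<ge> N \<Longrightarrow> n \<ge> N \<Longrightarrow> l2norm (\<lambda>i. a m i - a n i) < e" and "m \<ge> N" "finite F" for m N e F
  proof (rule Lim_bounded)
    show "(\<lambda>n. L2_set (\<lambda>i. cmod (a m i - a n i)) F) \<longlonglongrightarrow> L2_set (\<lambda>i. cmod (a m i - b i)) F"
      unfolding L2_set_def by (intro tendsto_intros b)
    show "\<forall>n\<ge>N. L2_set (\<lambda>i. cmod (a m i - a n i)) F \<le> e"
      using L2_set_le_l2norm[OF l2_diff[OF a a] \<open>finite F\<close>] N[OF \<open>m \<ge> N\<close>] by (meson less_imp_le order_trans)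
  qed
  \<comment> \<open>A single index with uniform error 1 already puts the difference, and with it b,
    into the space.\<close>
  from C[of 1] obtain N1 where "\<And>m n. m \<ge> N1 \<Longrightarrow> n \<ge> N1 \<Longrightarrow> l2norm (\<lambda>i. a m i - a n i) < 1" by auto
  from key[OF this] have "l2 (\<lambda>i. a N1 i - b i)" by (intro l2I(1)[where B = 1]) auto
  from l2_diff[OF a[of N1] this] have "l2 b" by simp
  moreover have "(\<lambda>n. l2norm (\<lambda>i. a n i - b i)) \<longlonglongrightarrow> 0"
  proof (rule LIMSEQ_I)
    fix e :: real assume "0 < e"
    then obtain N where N: "\<And>m n. m \<ge> N \<Longrightarrow> n \<ge> N \<Longrightarrow> l2norm (\<lambda>i. a m i - a n i) < e / 2" using C[of "e/2"] by auto
    have "l2norm (\<lambda>i. a m i - b i) \<le> e / 2" if "m \<ge> N" for m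
      by (rule l2I(2)) (rule key[OF N that])
    then show "\<exists>no. \<forall>n\<ge>no. norm (l2norm (\<lambda>i. a n i - b i) - 0) < e"
      using \<open>0 < e\<close> by (intro exI[of _ N]) fastforce
  qed
  ultimately show ?thesis by (rule that)
qed

section \<open>Double power series on the bidisc\<close>

text \<open>Absolute convergence on every smaller bidisc. This class is stable under the derivatives
  in \<open>P\<close>, whereas square-summability is not, so \<open>P\<close> can be computed on
  arrays before membership in its domain is known.\<close>

definition conv_coeffs :: "coeffs \<Rightarrow> bool" where
  "conv_coeffs a \<longleftrightarrow> (\<forall>r. 0 \<le> r \<and> r < 1 \<longrightarrow> (\<lambda>(i, j). cmod (a (i, j)) * r ^ (i + j)) summable_on UNIV)"

definition ps2 :: "coeffs \<Rightarrow> complex \<Rightarrow> complex \<Rightarrow> complex" where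
  "ps2 a x y = (\<Sum>\<^sub>\<infinity>(i, j). a (i, j) * x ^ i * y ^ j)"

lemma conv_coeffs_bound:
  assumes "cmod x \<le> r" "cmod y \<le> r"
  shows "cmod (a (i, j) * x ^ i * y ^ j) \<le> cmod (a (i, j)) * r ^ (i + j)"
proof -
  have "cmod x ^ i * cmod y ^ j \<le> r ^ i * r ^ j"
    by (intro mult_mono power_mono assms) (use order_trans[OF norm_ge_zero assms(1)] in auto)
  then show ?thesis by (simp add: norm_mult norm_power power_add mult_left_mono mult.assoc)
qed

lemma conv_coeffs_abs_summable:
  assumes "conv_coeffs a" "cmod x < 1" "cmod y < 1"
  shows "(\<lambda>(i, j). cmod (a (i, j) * x ^ i * y ^ j)) summable_on UNIV"
proof -
  define r where "r = max (cmod x) (cmod y)"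
  have r: "cmod x \<le> r" "cmod y \<le> r" "0 \<le> r" "r < 1" using assms by (auto simp: r_def le_max_iff_disj)
  have "(\<lambda>(i, j). cmod (a (i, j)) * r ^ (i + j)) summable_on UNIV" using assms(1) r by (auto simp: conv_coeffs_def)
  then show ?thesis
    by (rule summable_on_comparison_test) (use conv_coeffs_bound[OF r(1,2)] in auto)
qed

lemma conv_coeffs_summable:
  assumes "conv_coeffs a" "cmod x < 1" "cmod y < 1"
  shows "(\<lambda>(i, j). a (i, j) * x ^ i * y ^ j) summable_on UNIV"
  by (rule abs_summable_summable) (use conv_coeffs_abs_summable[OF assms] in \<open>simp add: case_prod_unfold\<close>)

lemma ps2_has_sum:
  assumes "conv_coeffs a" "cmod x < 1" "cmod y < 1"
  shows "((\<lambda>(i, j). a (i, j) * x ^ i * y ^ j) has_sum ps2 a x y) UNIV"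
  unfolding ps2_def using conv_coeffs_summable[OF assms] by (rule has_sum_infsum)

text \<open>With a bound at a larger radius q, the terms at radius r are dominated by multiples of
  (r / q)^(i + j), a product of two geometric series. Closure under shifts and derivatives reduces
  to such bounds.\<close>

lemma conv_coeffsI_bounded:
  assumes "\<And>r. 0 < r \<Longrightarrow> r < 1 \<Longrightarrow> \<exists>C. \<forall>i j. cmod (a (i, j)) * r ^ (i + j) \<le> C"
  shows "conv_coeffs a"
  unfolding conv_coeffs_def
proof (intro allI impI)
  fix r :: real assume r: "0 \<le> r \<and> r < 1"
  define q where "q = (r + 1) / 2"
  have q: "0 < q" "q < 1" "r < q" using r by (auto simp: q_def)
  from assms[OF q(1,2)] obtain C where C: "\<And>i j. cmod (a (i, j)) * q ^ (i + j) \<le> C" by blast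
  define s where "s = r / q"
  have s: "0 \<le> s" "s < 1" "r = q * s" using q r by (auto simp: s_def)
  have g: "((\<lambda>i. s ^ i) has_sum 1 / (1 - s)) UNIV"
    using s geometric_sums[of s] by (intro sums_nonneg_imp_has_sum) auto
  have "(\<lambda>(i, j). s ^ i * s ^ j) summable_on UNIV \<times> UNIV"
  proof (rule summable_on_SigmaI[where g = "\<lambda>i. s ^ i * (1 / (1 - s))"])
    show "((\<lambda>j. case (i, j) of (i, j) \<Rightarrow> s ^ i * s ^ j) has_sum s ^ i * (1 / (1 - s))) UNIV" for i
      using has_sum_cmult_right[OF g, of "s ^ i"] by simp
    show "(\<lambda>i. s ^ i * (1 / (1 - s))) summable_on UNIV"
      using has_sum_imp_summable[OF g] by (rule summable_on_cmult_left)
  qed (use s in auto)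
  then have "(\<lambda>(i, j). C * (s ^ i * s ^ j)) summable_on UNIV"
    using summable_on_cmult_right[of "\<lambda>(i, j). s ^ i * s ^ j" UNIV C] by (simp add: case_prod_unfold)
  then show "(\<lambda>(i, j). cmod (a (i, j)) * r ^ (i + j)) summable_on UNIV"
  proof (rule summable_on_comparison_test)
    fix p :: "nat \<times> nat"
    obtain i j where p: "p = (i, j)" by force
    have "cmod (a (i, j)) * r ^ (i + j) = (cmod (a (i, j)) * q ^ (i + j)) * (s ^ i * s ^ j)"
      by (simp add: s(3) power_mult_distrib power_add)
    also have "\<dots> \<le> C * (s ^ i * s ^ j)" using C s by (intro mult_right_mono) auto
    finally show "(case p of (i, j) \<Rightarrow> cmod (a (i, j)) * r ^ (i + j)) \<le> (case p of (i, j) \<Rightarrow> C * (s ^ i * s ^ j))"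
      by (simp add: p)
  qed (use r in auto)
qed

lemma conv_coeffs_boundedD:
  assumes "conv_coeffs a" "0 \<le> r" "r < 1"
  shows "\<exists>C. \<forall>i j. cmod (a (i, j)) * r ^ (i + j) \<le> C"
proof -
  have s: "(\<lambda>(i, j). cmod (a (i, j)) * r ^ (i + j)) summable_on UNIV" using assms by (auto simp: conv_coeffs_def)
  have "cmod (a (i, j)) * r ^ (i + j) \<le> infsum (\<lambda>(i, j). cmod (a (i, j)) * r ^ (i + j)) UNIV" for i j
    using finite_sum_le_infsum[OF s, of "{(i, j)}"] assms by auto
  then show ?thesis by blast
qed

lemma conv_coeffs_bounded_mono:
  assumes "conv_coeffs a" "\<And>i j. cmod (b (i, j)) \<le> K * cmod (a (i, j))"
  shows "conv_coeffs b"
proof (rule conv_coeffsI_bounded)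
  fix r :: real assume r: "0 < r" "r < 1"
  then obtain C where C: "\<And>i j. cmod (a (i, j)) * r ^ (i + j) \<le> C"
    using conv_coeffs_boundedD[OF assms(1), of r] by auto
  show "\<exists>C. \<forall>i j. cmod (b (i, j)) * r ^ (i + j) \<le> C"
  proof (intro exI allI)
    fix i j
    have "cmod (b (i, j)) * r ^ (i + j) \<le> K * cmod (a (i, j)) * r ^ (i + j)"
      using assms(2) r by (intro mult_right_mono) auto
    also have "\<dots> \<le> \<bar>K\<bar> * (cmod (a (i, j)) * r ^ (i + j))"
      using r by (simp add: mult_right_mono mult.assoc)
    also have "\<dots> \<le> \<bar>K\<bar> * C" using C by (intro mult_left_mono) auto
    finally show "cmod (b (i, j)) * r ^ (i + j) \<le> \<bar>K\<bar> * C" .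
  qed
qed

lemma conv_coeffs_l2: assumes "l2 a" shows "conv_coeffs a"
proof (rule conv_coeffsI_bounded)
  fix r :: real assume r: "0 < r" "r < 1"
  have "cmod (a (i, j)) * r ^ (i + j) \<le> l2norm a * 1" for i j
    using r cmod_le_l2norm[OF assms] by (intro mult_mono power_le_one) auto
  then show "\<exists>C. \<forall>i j. cmod (a (i, j)) * r ^ (i + j) \<le> C" by blast
qed

lemma conv_coeffs_add:
  assumes "conv_coeffs a" "conv_coeffs b"
  shows "conv_coeffs (\<lambda>p. a p + b p)"
  unfolding conv_coeffs_def
proof (intro allI impI)
  fix r :: real assume r: "0 \<le> r \<and> r < 1"
  have "(\<lambda>p. (case p of (i, j) \<Rightarrow> cmod (a (i, j)) * r ^ (i + j)) + (case p of (i, j) \<Rightarrow> cmod (b (i, j)) * r ^ (i + j))) summable_on UNIV"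
    using assms r by (intro summable_on_add) (auto simp: conv_coeffs_def)
  then show "(\<lambda>(i, j). cmod (a (i, j) + b (i, j)) * r ^ (i + j)) summable_on UNIV"
    by (rule summable_on_comparison_test)
       (use r in \<open>auto simp flip: distrib_right intro!: mult_right_mono norm_triangle_ineq\<close>)
qed

lemma conv_coeffs_scale: "conv_coeffs a \<Longrightarrow> conv_coeffs (\<lambda>p. c * a p)"
  by (rule conv_coeffs_bounded_mono[where K = "cmod c" and a = a]) (simp_all add: norm_mult)

lemma conv_coeffs_diff:
  assumes "conv_coeffs a" "conv_coeffs b"
  shows "conv_coeffs (\<lambda>p. a p - b p)"
  using conv_coeffs_add[OF assms(1) conv_coeffs_scale[OF assms(2), of "- 1"]] by simp

lemma ps2_add:
  assumes "conv_coeffs a" "conv_coeffs b" "cmod x < 1" "cmod y < 1"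
  shows "ps2 (\<lambda>p. a p + b p) x y = ps2 a x y + ps2 b x y"
  unfolding ps2_def using infsum_add[OF conv_coeffs_summable[OF assms(1,3,4)] conv_coeffs_summable[OF assms(2-4)]]
  by (simp add: case_prod_unfold distrib_right)

lemma ps2_scale: "ps2 (\<lambda>p. c * a p) x y = c * ps2 a x y"
  unfolding ps2_def infsum_cmult_right'[symmetric] by (simp add: case_prod_unfold mult.assoc)

lemma ps2_diff:
  assumes "conv_coeffs a" "conv_coeffs b" "cmod x < 1" "cmod y < 1"
  shows "ps2 (\<lambda>p. a p - b p) x y = ps2 a x y - ps2 b x y"
  using ps2_add[OF assms(1) conv_coeffs_scale[OF assms(2), of "- 1"] assms(3,4)] ps2_scale[of "- 1" b x y] by simp

text \<open>Exchanging the variables carries each fact about x over to y.\<close>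

definition transp :: "coeffs \<Rightarrow> coeffs" where "transp a = (\<lambda>(i, j). a (j, i))"

lemma conv_coeffs_transp: "conv_coeffs a \<Longrightarrow> conv_coeffs (transp a)"
proof (rule conv_coeffsI_bounded)
  fix r :: real assume "conv_coeffs a" "0 < r" "r < 1"
  then show "\<exists>C. \<forall>i j. cmod (transp a (i, j)) * r ^ (i + j) \<le> C"
    using conv_coeffs_boundedD[of a r] unfolding transp_def by (metis (no_types, lifting) add.commute case_prod_conv less_imp_le)
qed

lemma ps2_transp: "ps2 (transp a) x y = ps2 a y x"
  unfolding ps2_def
  by (rule infsum_reindex_bij_witness[of _ prod.swap prod.swap]) (auto simp: transp_def)

lemma shift1_has_sum:
  assumes "conv_coeffs a" "cmod x < 1" "cmod y < 1"
  shows "((\<lambda>(i, j). shift1 a (i, j) * x ^ i * y ^ j) has_sum x * ps2 a x y) UNIV"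
proof -
  have "((\<lambda>p. x * (case p of (i, j) \<Rightarrow> a (i, j) * x ^ i * y ^ j)) has_sum x * ps2 a x y) UNIV"
    using ps2_has_sum[OF assms] by (rule has_sum_cmult_right)
  also have "?this \<longleftrightarrow> ((\<lambda>(i, j). shift1 a (i, j) * x ^ i * y ^ j) has_sum x * ps2 a x y) {p. fst p \<noteq> 0}"
    by (rule has_sum_reindex_bij_witness[of _ "\<lambda>(i, j). (i - 1, j)" "\<lambda>(i, j). (Suc i, j)"]) auto
  also have "\<dots> \<longleftrightarrow> ?thesis"
    by (rule has_sum_cong_neutral) auto
  finally show ?thesis .
qed

lemma conv_coeffs_shift1: assumes "conv_coeffs a" shows "conv_coeffs (shift1 a)"
proof (rule conv_coeffsI_bounded)
  fix r :: real assume r: "0 < r" "r < 1"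
  then obtain C where C: "\<And>i j. cmod (a (i, j)) * r ^ (i + j) \<le> C"
    using conv_coeffs_boundedD[OF assms, of r] by auto
  have C0: "0 \<le> C" using C[of 0 0] order_trans[OF norm_ge_zero] by fastforce
  have "cmod (shift1 a (i, j)) * r ^ (i + j) \<le> C" for i j
  proof (cases i)
    case (Suc k)
    have "cmod (a (k, j)) * r ^ (k + j) * r \<le> C * 1"
      using C C0 r by (intro mult_mono) auto
    then show ?thesis by (simp add: Suc ac_simps)
  qed (simp add: C0)
  then show "\<exists>C. \<forall>i j. cmod (shift1 a (i, j)) * r ^ (i + j) \<le> C" by blast
qed

lemma ps2_shift1:
  assumes "conv_coeffs a" "cmod x < 1" "cmod y < 1"
  shows "ps2 (shift1 a) x y = x * ps2 a x y"
  using shift1_has_sum[OF assms] unfolding ps2_def[of "shift1 a"] by (rule infsumI)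

lemma shift2_transp: "shift2 a = transp (shift1 (transp a))"
proof (rule ext, clarify)
  fix i j show "shift2 a (i, j) = transp (shift1 (transp a)) (i, j)" by (cases j) (auto simp: transp_def)
qed

lemma conv_coeffs_shift2: "conv_coeffs a \<Longrightarrow> conv_coeffs (shift2 a)"
  unfolding shift2_transp by (intro conv_coeffs_transp conv_coeffs_shift1)

lemma ps2_shift2:
  "conv_coeffs a \<Longrightarrow> cmod x < 1 \<Longrightarrow> cmod y < 1 \<Longrightarrow> ps2 (shift2 a) x y = y * ps2 a x y"
  unfolding shift2_transp by (simp add: ps2_transp ps2_shift1 conv_coeffs_transp)

lemma conv_coeffs_diffmul: "conv_coeffs a \<Longrightarrow> conv_coeffs (diffmul a)"
  unfolding diffmul_def by (intro conv_coeffs_diff conv_coeffs_shift1 conv_coeffs_shift2)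

lemma ps2_diffmul:
  "conv_coeffs a \<Longrightarrow> cmod x < 1 \<Longrightarrow> cmod y < 1 \<Longrightarrow> ps2 (diffmul a) x y = (x - y) * ps2 a x y"
  unfolding diffmul_def
  by (simp add: ps2_diff conv_coeffs_shift1 conv_coeffs_shift2 ps2_shift1 ps2_shift2 algebra_simps)

definition dcoef1 :: "coeffs \<Rightarrow> coeffs" where
  "dcoef1 a = (\<lambda>(i, j). (of_nat i + 1) * a (Suc i, j))"

definition dcoef2 :: "coeffs \<Rightarrow> coeffs" where
  "dcoef2 a = (\<lambda>(i, j). (of_nat j + 1) * a (i, Suc j))"

lemma dcoef2_transp: "dcoef2 a = transp (dcoef1 (transp a))"
  by (auto simp: dcoef1_def dcoef2_def transp_def)

text \<open>The factor i + 1 from differentiation is absorbed by passing from radius q to r < q,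
  since n (r / q)^n is bounded.\<close>

lemma conv_coeffs_dcoef1: assumes "conv_coeffs a" shows "conv_coeffs (dcoef1 a)"
proof (rule conv_coeffsI_bounded)
  fix r :: real assume r: "0 < r" "r < 1"
  define q where "q = (r + 1) / 2"
  have q: "0 < q" "q < 1" "r < q" using r by (auto simp: q_def)
  from conv_coeffs_boundedD[OF assms, of q] q obtain C where C: "\<And>i j. cmod (a (i, j)) * q ^ (i + j) \<le> C" by auto
  have C0: "0 \<le> C" using C[of 0 0] order_trans[OF norm_ge_zero] by fastforce
  define s where "s = r / q"
  have s: "0 < s" "s < 1" "r = q * s" using q r by (auto simp: s_def)
  have "(\<lambda>n. real n * s ^ n) \<longlonglongrightarrow> 0" using s lim_n_over_pown[of "1 / s"] by (simp add: power_one_over field_simps)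
  then have "Bseq (\<lambda>n. real n * s ^ n)" by (intro convergent_imp_Bseq convergentI)
  then obtain K where K: "\<And>n. norm (real n * s ^ n) \<le> K" by (auto simp: Bseq_def)
  have "cmod (dcoef1 a (i, j)) * r ^ (i + j) \<le> C * K / r" for i j
  proof -
    have r': "r ^ (i + j) = q ^ (Suc i + j) * s ^ (Suc i) * s ^ j / r"
      using q s(1) by (simp add: s(3) power_mult_distrib power_add)
    have "cmod (dcoef1 a (i, j)) = real (Suc i) * cmod (a (Suc i, j))"
      unfolding dcoef1_def by (simp add: norm_mult) (metis add.commute norm_of_nat of_nat_Suc)
    then have "cmod (dcoef1 a (i, j)) * r ^ (i + j) =
       (cmod (a (Suc i, j)) * q ^ (Suc i + j)) * (real (Suc i) * s ^ Suc i) * s ^ j / r"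
      unfolding r' by (simp add: mult_ac)
    also have "\<dots> \<le> C * K * 1 / r"
      using C[of "Suc i" j] C0 K[of "Suc i"] K[of 0] s r
      by (intro divide_right_mono mult_mono power_le_one mult_nonneg_nonneg) (auto simp del: power_Suc of_nat_Suc)
    finally show ?thesis by simp
  qed
  then show "\<exists>C. \<forall>i j. cmod (dcoef1 a (i, j)) * r ^ (i + j) \<le> C" by blast
qed

lemma conv_coeffs_dcoef2: "conv_coeffs a \<Longrightarrow> conv_coeffs (dcoef2 a)"
  unfolding dcoef2_transp by (intro conv_coeffs_transp conv_coeffs_dcoef1)

text \<open>Summing over j first gives an ordinary power series in x, to which termwise
  differentiation in one variable applies.\<close>

lemma ps2_sums_rows:
  assumes "conv_coeffs a" "cmod x < 1" "cmod y < 1"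
  shows "(\<lambda>i. (\<Sum>\<^sub>\<infinity>j. a (i, j) * y ^ j) * x ^ i) sums ps2 a x y"
    and "\<And>i. (\<lambda>j. a (i, j) * y ^ j) summable_on UNIV"
proof -
  show row: "(\<lambda>j. a (i, j) * y ^ j) summable_on UNIV" for i
  proof -
    have s: "(\<lambda>(i, j). cmod (a (i, j)) * cmod y ^ (i + j)) summable_on UNIV \<times> UNIV"
      using assms by (auto simp: conv_coeffs_def)
    show ?thesis
    \<comment> \<open>A row is recovered from the weights |y|^(i + j) by dividing by |y|^i, so y = 0
      is treated apart.\<close>
    proof (cases "y = 0")
      case True
      then have "{j \<in> UNIV. a (i, j) * y ^ j \<noteq> 0} \<subseteq> {0}" by (auto simp: power_0_left)
      then show ?thesis by (intro finite_nonzero_values_imp_summable_on) (rule finite_subset, auto)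
    next
      case False
      have "(\<lambda>j. cmod (a (i, j)) * cmod y ^ (i + j)) summable_on UNIV"
        by (rule summable_on_SigmaD1[OF s]) simp
      then have "(\<lambda>j. (1 / cmod y ^ i) * (cmod (a (i, j)) * cmod y ^ (i + j))) summable_on UNIV"
        by (rule summable_on_cmult_right)
      then have "(\<lambda>j. cmod (a (i, j) * y ^ j)) summable_on UNIV"
        using False by (simp add: norm_mult norm_power power_add)
      then show ?thesis by (rule abs_summable_summable)
    qed
  qed
  have "((\<lambda>(i, j). a (i, j) * x ^ i * y ^ j) has_sum ps2 a x y) (UNIV \<times> UNIV)"
    using ps2_has_sum[OF assms] by simp
  moreover have "((\<lambda>j. case (i, j) of (i, j) \<Rightarrow> a (i, j) * x ^ i * y ^ j) has_sum (\<Sum>\<^sub>\<infinity>j. a (i, j) * y ^ j) * x ^ i) UNIV" for i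
    using has_sum_cmult_left[OF has_sum_infsum[OF row[of i]], of "x ^ i"] by (simp add: ac_simps)
  ultimately have "((\<lambda>i. (\<Sum>\<^sub>\<infinity>j. a (i, j) * y ^ j) * x ^ i) has_sum ps2 a x y) UNIV"
    by (rule has_sum_SigmaD)
  then show "(\<lambda>i. (\<Sum>\<^sub>\<infinity>j. a (i, j) * y ^ j) * x ^ i) sums ps2 a x y" by (rule has_sum_imp_sums)
qed

lemma ps2_DERIV1:
  assumes "conv_coeffs a" "cmod x < 1" "cmod y < 1"
  shows "((\<lambda>x. ps2 a x y) has_field_derivative ps2 (dcoef1 a) x y) (at x)"
proof -
  define A where "A = (\<lambda>i. \<Sum>\<^sub>\<infinity>j. a (i, j) * y ^ j)"
  obtain K where K: "cmod x < K" "K < 1" using assms(2) dense by blast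
  then have K0: "0 < K" using norm_ge_zero[of x] by linarith
  have "summable (\<lambda>n. A n * of_real K ^ n)"
    using ps2_sums_rows(1)[OF assms(1) _ assms(3), of "of_real K"] K K0 by (auto simp: A_def sums_iff)
  from termdiffs_strong[OF this, of x] K K0
  have "((\<lambda>x. \<Sum>n. A n * x ^ n) has_field_derivative (\<Sum>n. diffs A n * x ^ n)) (at x)" by simp
  moreover have "(\<Sum>n. diffs A n * x ^ n) = ps2 (dcoef1 a) x y"
  proof -
    have "(\<Sum>\<^sub>\<infinity>j. dcoef1 a (i, j) * y ^ j) = diffs A i" for i
      unfolding diffs_def A_def dcoef1_def infsum_cmult_right'[symmetric] by (simp add: add.commute mult.assoc)
    then show ?thesis using ps2_sums_rows(1)[OF conv_coeffs_dcoef1[OF assms(1)] assms(2,3)] by (simp add: sums_iff)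
  qed
  ultimately have "((\<lambda>x. \<Sum>n. A n * x ^ n) has_field_derivative ps2 (dcoef1 a) x y) (at x)" by simp
  then show ?thesis
  proof (rule has_field_derivative_transform_within_open)
    show "open (ball 0 1 :: complex set)" "x \<in> ball 0 1" using assms by auto
    show "(\<Sum>n. A n * u ^ n) = ps2 a u y" if "u \<in> ball 0 1" for u
      using ps2_sums_rows(1)[OF assms(1) _ assms(3), of u] that by (auto simp: A_def sums_iff)
  qed
qed

lemma ps2_DERIV2:
  assumes "conv_coeffs a" "cmod x < 1" "cmod y < 1"
  shows "((\<lambda>y. ps2 a x y) has_field_derivative ps2 (dcoef2 a) x y) (at y)"
  using ps2_DERIV1[OF conv_coeffs_transp[OF assms(1)] assms(3,2)] by (simp add: ps2_transp dcoef2_transp)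

lemma ps2_at_0: "ps2 a 0 0 = a (0, 0)"
proof -
  have "((\<lambda>(i, j). a (i, j) * 0 ^ i * 0 ^ j) has_sum a (0, 0)) UNIV"
    by (rule has_sum_finite_neutralI[of "{(0, 0)}"]) (auto simp: power_0_left split: if_splits)
  then show ?thesis unfolding ps2_def by (rule infsumI)
qed

text \<open>Differentiation in x or y lowers the total degree of the coefficient in question, down
  to the constant term, which is the value at the origin.\<close>

lemma ps2_eq_0_imp:
  assumes "conv_coeffs a" "\<And>x y. cmod x < 1 \<Longrightarrow> cmod y < 1 \<Longrightarrow> ps2 a x y = 0"
  shows "a = (\<lambda>_. 0)"
proof -
  have "a (i, j) = 0" for i j
    using assms
  proof (induction "i + j" arbitrary: i j a)
    case 0
    then show ?case using ps2_at_0[of a] by simp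
  next
    case (Suc n)
    show ?case
    proof (cases i)
      case (Suc k)
      have z: "ps2 (dcoef1 a) x y = 0" if "cmod x < 1" "cmod y < 1" for x y
      proof (rule DERIV_unique)
        show "((\<lambda>x. ps2 a x y) has_field_derivative ps2 (dcoef1 a) x y) (at x)" by (rule ps2_DERIV1[OF Suc.prems(1) that])
        show "((\<lambda>x. ps2 a x y) has_field_derivative 0) (at x)"
          by (rule has_field_derivative_transform_within_open[of "\<lambda>_. 0" _ _ "ball 0 1"])
             (use that Suc.prems(2) in auto)
      qed
      have "dcoef1 a (k, j) = 0"
        using Suc.hyps Suc by (intro Suc.hyps(1)[OF _ conv_coeffs_dcoef1[OF Suc.prems(1)]] z) auto
      moreover have "(of_nat k + 1 :: complex) \<noteq> 0" by (metis Suc_neq_Zero add.commute of_nat_Suc of_nat_eq_0_iff)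
      ultimately show ?thesis by (simp add: dcoef1_def Suc)
    next
      case 0
      then obtain k where k: "j = Suc k" using Suc.hyps by (cases j) auto
      have z: "ps2 (dcoef2 a) x y = 0" if "cmod x < 1" "cmod y < 1" for x y
      proof (rule DERIV_unique)
        show "((\<lambda>y. ps2 a x y) has_field_derivative ps2 (dcoef2 a) x y) (at y)" by (rule ps2_DERIV2[OF Suc.prems(1) that])
        show "((\<lambda>y. ps2 a x y) has_field_derivative 0) (at y)"
          by (rule has_field_derivative_transform_within_open[of "\<lambda>_. 0" _ _ "ball 0 1"])
             (use that Suc.prems(2) in auto)
      qed
      have "dcoef2 a (i, k) = 0"
        using Suc.hyps k by (intro Suc.hyps(1)[OF _ conv_coeffs_dcoef2[OF Suc.prems(1)]] z) auto
      moreover have "(of_nat k + 1 :: complex) \<noteq> 0" by (metis Suc_neq_Zero add.commute of_nat_Suc of_nat_eq_0_iff)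
      ultimately show ?thesis by (simp add: dcoef2_def k)
    qed
  qed
  then show ?thesis by auto
qed

lemma ps2_inject:
  assumes "conv_coeffs a" "conv_coeffs b" "\<And>x y. cmod x < 1 \<Longrightarrow> cmod y < 1 \<Longrightarrow> ps2 a x y = ps2 b x y"
  shows "a = b"
proof -
  have "(\<lambda>p. a p - b p) = (\<lambda>_. 0)"
    by (rule ps2_eq_0_imp) (auto intro: conv_coeffs_diff assms simp: ps2_diff assms)
  then show ?thesis by (metis eq_iff_diff_eq_0 ext)
qed

lemma ps2_uniform_limit:
  assumes "conv_coeffs a" "0 \<le> r" "r < 1"
  shows "uniform_limit (cball 0 r \<times> cball 0 r) (\<lambda>X p. \<Sum>(i, j)\<in>X. a (i, j) * fst p ^ i * snd p ^ j)
     (\<lambda>p. ps2 a (fst p) (snd p)) (finite_subsets_at_top UNIV)"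
  unfolding ps2_def case_prod_unfold
  by (rule Weierstrass_m_test_general[where M = "\<lambda>(i, j). cmod (a (i, j)) * r ^ (i + j)"])
     (use assms conv_coeffs_bound[of _ r _ a] in \<open>auto simp: conv_coeffs_def\<close>)

lemma continuous_on_ps2:
  assumes "conv_coeffs a"
  shows "continuous_on (ball 0 1 \<times> ball 0 1) (\<lambda>p. ps2 a (fst p) (snd p))"
proof (rule continuous_at_imp_continuous_on, clarify)
  fix x y :: complex assume "x \<in> ball 0 1" "y \<in> ball 0 1"
  then obtain r where r: "cmod x < r" "cmod y < r" "r < 1" using dense[of "max (cmod x) (cmod y)" 1] by auto
  then have r0: "0 \<le> r" using norm_ge_zero[of x] by linarith
  have "continuous_on (cball 0 r \<times> cball 0 r) (\<lambda>p. ps2 a (fst p) (snd p))"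
    by (rule uniform_limit_theorem[OF _ ps2_uniform_limit[OF assms r0 r(3)]])
       (auto intro!: always_eventually continuous_intros simp: case_prod_unfold)
  then have "continuous_on (ball 0 r \<times> ball 0 r) (\<lambda>p. ps2 a (fst p) (snd p))"
    by (rule continuous_on_subset) auto
  then show "isCont (\<lambda>p. ps2 a (fst p) (snd p)) (x, y)"
    by (rule continuous_on_interior) (use r in \<open>auto simp: interior_open open_Times\<close>)
qed

text \<open>The partial derivatives combine to a total derivative because the one in y is jointly
  continuous.\<close>

lemma ps2_has_derivative:
  assumes "conv_coeffs a" "cmod x < 1" "cmod y < 1"
  shows "((\<lambda>(x, y). ps2 a x y) has_derivative (\<lambda>(u, v). ps2 (dcoef1 a) x y * u + ps2 (dcoef2 a) x y * v)) (at (x, y))"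
proof -
  have "((\<lambda>(x, y). ps2 a x y) has_derivative
      (\<lambda>(tx, ty). ps2 (dcoef1 a) x y * tx + blinfun_apply (blinfun_mult_right (ps2 (dcoef2 a) x y)) ty))
      (at (x, y) within ball 0 1 \<times> ball 0 1)"
  proof (rule has_derivative_partialsI[where fx = "\<lambda>tx. ps2 (dcoef1 a) x y * tx" and fy = "\<lambda>x y. blinfun_mult_right (ps2 (dcoef2 a) x y)"])
    show "((\<lambda>x. ps2 a x y) has_derivative (*) (ps2 (dcoef1 a) x y)) (at x within ball 0 1)"
      using ps2_DERIV1[OF assms] by (auto simp: has_field_derivative_def intro: has_derivative_at_withinI)
    show "((\<lambda>y. ps2 a x y) has_derivative blinfun_apply (blinfun_mult_right (ps2 (dcoef2 a) x y))) (at y within ball 0 1)"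
      if "x \<in> ball 0 1" "y \<in> ball 0 1" for x y
      using ps2_DERIV2[OF assms(1), of x y] that by (auto simp: has_field_derivative_def intro: has_derivative_at_withinI)
    have "continuous_on (ball 0 1 \<times> ball 0 1) (\<lambda>p. blinfun_mult_right (ps2 (dcoef2 a) (fst p) (snd p)))"
      using continuous_on_ps2[OF conv_coeffs_dcoef2[OF assms(1)]]
      by (rule bounded_linear.continuous_on[OF bounded_linear_blinfun_mult_right])
    then show "continuous (at (x, y) within ball 0 1 \<times> ball 0 1) (\<lambda>(x, y). blinfun_mult_right (ps2 (dcoef2 a) x y))"
      using assms by (simp add: continuous_on_eq_continuous_within case_prod_unfold)
  qed (use assms in auto)
  moreover have "at (x, y) within ball 0 1 \<times> ball 0 1 = at (x, y)"
    using assms by (intro at_within_open) (auto intro: open_Times)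
  ultimately show ?thesis by simp
qed

text \<open>With the Euler operator E, expanding (x^2 d/dx + y^2 d/dy + x + y) (d/dx + d/dy) - E (E
  + 1) cancels the pure second derivatives and leaves (x - y)^2 d/dx d/dy - (x - y) (d/dx - d/dy):
  the formula of \<open>P\<close>, now in the disc variables.\<close>

lemma casimir_eq_diff_operator:
  "casimir a = (\<lambda>p. diffmul (diffmul (dcoef1 (dcoef2 a))) p - diffmul (\<lambda>p. dcoef1 a p - dcoef2 a p) p)"
proof (rule ext, clarify)
  fix i j
  show "casimir a (i, j) = diffmul (diffmul (dcoef1 (dcoef2 a))) (i, j) - diffmul (\<lambda>p. dcoef1 a p - dcoef2 a p) (i, j)"
  proof (cases i; cases j)
    fix i' j' assume "i = Suc i'" "j = Suc j'"
    then show ?thesis by (cases i'; cases j')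
      (simp_all add: casimir_def raise_def lower_def diffmul_simps dcoef1_def dcoef2_def algebra_simps)
  next
    fix i' assume "i = Suc i'" "j = 0"
    then show ?thesis by (cases i')
      (simp_all add: casimir_def raise_def lower_def diffmul_simps dcoef1_def dcoef2_def algebra_simps)
  next
    fix j' assume "i = 0" "j = Suc j'"
    then show ?thesis by (cases j')
      (simp_all add: casimir_def raise_def lower_def diffmul_simps dcoef1_def dcoef2_def algebra_simps)
  qed (simp add: casimir_def raise_def lower_def diffmul_simps dcoef1_def dcoef2_def algebra_simps)
qed

lemma conv_coeffs_casimir: "conv_coeffs a \<Longrightarrow> conv_coeffs (casimir a)"
  unfolding casimir_eq_diff_operator
  by (intro conv_coeffs_diff conv_coeffs_diffmul conv_coeffs_dcoef1 conv_coeffs_dcoef2)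

lemma ps2_casimir:
  assumes "conv_coeffs a" "cmod x < 1" "cmod y < 1"
  shows "ps2 (casimir a) x y =
    (x - y)\<^sup>2 * ps2 (dcoef1 (dcoef2 a)) x y - (x - y) * (ps2 (dcoef1 a) x y - ps2 (dcoef2 a) x y)"
  using assms unfolding casimir_eq_diff_operator
  by (simp add: ps2_diff ps2_diffmul conv_coeffs_diff conv_coeffs_diffmul conv_coeffs_dcoef1 conv_coeffs_dcoef2 power2_eq_square)

section \<open>Integration\<close>

text \<open>This lets a change of variables for absolutely integrable functions, which transports
  integrability in both directions, be used for nonnegative integrals that may be
  \<open>\<infinity>\<close>.\<close>

lemma nn_integral_eq_absolute_integral:
  fixes f :: "'a::euclidean_space \<Rightarrow> real"
  assumes "(\<lambda>x. indicator A x * f x) \<in> borel_measurable borel" "\<And>x. x \<in> A \<Longrightarrow> 0 \<le> f x"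
  shows "(\<integral>\<^sup>+x\<in>A. ennreal (f x) \<partial>lborel)
    = (if f absolutely_integrable_on A then ennreal (integral A f) else \<infinity>)"
proof -
  have m: "(\<lambda>x. indicator A x *\<^sub>R f x) \<in> borel_measurable lebesgue"
    using assms(1) by (auto intro: measurable_completion)
  have e: "(\<integral>\<^sup>+x\<in>A. ennreal (f x) \<partial>lborel) = (\<integral>\<^sup>+x. ennreal (indicator A x *\<^sub>R f x) \<partial>lebesgue)"
    unfolding nn_integral_completion by (intro nn_integral_cong) (auto simp: indicator_def)
  show ?thesis
  proof (cases "f absolutely_integrable_on A")
    case True
    then have "integrable lebesgue (\<lambda>x. indicator A x *\<^sub>R f x)" by (simp add: set_integrable_def)
    then have "(\<integral>\<^sup>+x. ennreal (indicator A x *\<^sub>R f x) \<partial>lebesgue) = ennreal (\<integral>x. indicator A x *\<^sub>R f x \<partial>lebesgue)"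
      by (rule nn_integral_eq_integral) (use assms(2) in \<open>auto simp: indicator_def\<close>)
    also have "(\<integral>x. indicator A x *\<^sub>R f x \<partial>lebesgue) = integral A f"
      using set_lebesgue_integral_eq_integral(2)[OF True] by (simp add: set_lebesgue_integral_def)
    finally show ?thesis using True e by simp
  next
    case False
    then have "\<not> integrable lebesgue (\<lambda>x. indicator A x *\<^sub>R f x)" by (simp add: set_integrable_def)
    moreover have "AE x in lebesgue. 0 \<le> indicat_real A x *\<^sub>R f x"
      using assms(2) by (auto simp: indicator_def)
    ultimately have "(\<integral>\<^sup>+x. ennreal (indicator A x *\<^sub>R f x) \<partial>lebesgue) = \<infinity>"
      using integrableI_nonneg[OF m] by (metis infinity_ennreal_def less_top)
    then show ?thesis using False e by simp
  qed
qed

section \<open>Changes of variables on the line and in the plane\<close>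

lemma nn_integral_change_of_variables_real:
  fixes f :: "real \<Rightarrow> real"
  assumes "S \<in> sets borel" "g ` S \<in> sets borel" "f \<in> borel_measurable borel" "\<And>x. 0 \<le> f x"
    and der: "\<And>x. x \<in> S \<Longrightarrow> (g has_real_derivative g' x) (at x)" and inj: "inj_on g S"
    and m: "continuous_on S g'"
  shows "(\<integral>\<^sup>+x\<in>g ` S. ennreal (f x) \<partial>lborel) = (\<integral>\<^sup>+x\<in>S. ennreal (\<bar>g' x\<bar> * f (g x)) \<partial>lborel)"
proof -
  have "continuous_on S g"
    using der by (meson DERIV_continuous continuous_at_imp_continuous_on)
  then have g: "g \<in> borel_measurable (restrict_space borel S)" by (rule borel_measurable_continuous_on_restrict)
  have "(\<lambda>x. \<bar>g' x\<bar> * f (g x)) \<in> borel_measurable (restrict_space borel S)"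
    by (intro borel_measurable_times borel_measurable_abs borel_measurable_continuous_on_restrict m measurable_compose[OF g assms(3)])
  then have 2: "(\<lambda>x. indicator S x * (\<bar>g' x\<bar> * f (g x))) \<in> borel_measurable borel"
    using assms(1) by (subst (asm) borel_measurable_restrict_space_iff) (auto simp: ac_simps)
  have 1: "(\<lambda>x. indicator (g ` S) x * f x) \<in> borel_measurable borel" using assms(2,3) by measurable
  have "S \<in> sets lebesgue" using assms(1) by auto
  \<comment> \<open>An equivalence for a prescribed value of the integral: instantiated at the value
    of each side, it carries integrability over in both directions.\<close>
  note cov = has_absolute_integral_change_of_variables_1'[OF this DERIV_subset[OF der subset_UNIV] inj, of f]
  show ?thesis
    unfolding nn_integral_eq_absolute_integral[OF 1 assms(4)]
    by (subst nn_integral_eq_absolute_integral[OF 2])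
       (use cov[of "integral (g ` S) f"] cov[of "integral S (\<lambda>x. \<bar>g' x\<bar> * f (g x))"] assms(4) in \<open>auto simp del: integral_unique\<close>)
qed

text \<open>Complex numbers as vectors of \<open>real^2\<close>, where the Jacobian is the
  determinant of a matrix.\<close>

definition plane :: "complex \<Rightarrow> real^2" where "plane z = (\<chi> i. if i = 1 then Re z else Im z)"
definition unplane :: "real^2 \<Rightarrow> complex" where "unplane v = Complex (v $ 1) (v $ 2)"

lemma plane_unplane [simp]: "plane (unplane v) = v" "unplane (plane z) = z"
  by (auto simp: plane_def unplane_def vec_eq_iff complex_eq_iff) (metis exhaust_2)

lemma bounded_linear_plane: "bounded_linear plane"
proof -
  have "linear plane" by (rule linearI) (auto simp: plane_def vec_eq_iff)
  then show ?thesis by (simp add: linear_conv_bounded_linear)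
qed

lemma bounded_linear_unplane: "bounded_linear unplane"
proof -
  have "linear unplane" by (rule linearI) (auto simp: unplane_def complex_eq_iff)
  then show ?thesis by (simp add: linear_conv_bounded_linear)
qed

lemma measurable_plane [measurable]: "plane \<in> borel \<rightarrow>\<^sub>M borel" "unplane \<in> borel \<rightarrow>\<^sub>M borel"
  by (auto intro!: borel_measurable_continuous_onI linear_continuous_on bounded_linear_plane bounded_linear_unplane)

lemma complex_box: "z \<in> box l u \<longleftrightarrow> Re l < Re z \<and> Re z < Re u \<and> Im l < Im z \<and> Im z < Im u"
  by (auto simp: mem_box Basis_complex_def)

lemma lborel_complex_eq_plane: "lborel = distr lborel borel unplane"
proof (rule lborel_eqI)
  fix l u :: complex assume le: "\<And>b. b \<in> Basis \<Longrightarrow> l \<bullet> b \<le> u \<bullet> b"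
  then have le': "Re l \<le> Re u" "Im l \<le> Im u" using le[of 1] le[of \<i>] by (simp_all add: Basis_complex_def)
  have "unplane -` box l u = box (plane l) (plane u)"
    by (auto simp: complex_box mem_box_cart unplane_def plane_def forall_2)
  then have "emeasure (distr lborel borel unplane) (box l u) = emeasure lborel (box (plane l) (plane u))"
    by (subst emeasure_distr) auto
  also have "\<dots> = ennreal (\<Prod>b\<in>Basis. (plane u - plane l) \<bullet> b)"
    using le' by (intro emeasure_lborel_box) (auto simp: Basis_vec_def inner_axis plane_def)
  also have "(\<Prod>b\<in>Basis. (plane u - plane l) \<bullet> b) = (\<Prod>b\<in>range (\<lambda>i::2. axis i (1::real)). (plane u - plane l) \<bullet> b)"
    by (rule arg_cong[where f = "prod _"]) (auto simp: Basis_vec_def)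
  also have "\<dots> = (\<Prod>i\<in>UNIV. (plane u - plane l) $ i)"
    by (subst prod.reindex) (auto simp: inj_on_def axis_eq_axis inner_axis)
  also have "\<dots> = (\<Prod>b\<in>Basis. (u - l) \<bullet> b)"
    by (simp add: Basis_complex_def UNIV_2 plane_def)
  finally show "emeasure (distr lborel borel unplane) (box l u) = ennreal (\<Prod>b\<in>Basis. (u - l) \<bullet> b)" .
qed simp

lemma lborel_complex_eq_pair: "lborel = distr (lborel \<Otimes>\<^sub>M lborel) borel (\<lambda>(x, y). Complex x y)"
proof (rule lborel_eqI)
  have c: "(\<lambda>(x, y). Complex x y) \<in> borel_measurable (lborel \<Otimes>\<^sub>M lborel)"
    unfolding lborel_prod case_prod_unfold
    by (simp add: Complex_eq) (intro borel_measurable_continuous_onI continuous_intros)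
  fix l u :: complex assume le: "\<And>b. b \<in> Basis \<Longrightarrow> l \<bullet> b \<le> u \<bullet> b"
  then have le': "Re l \<le> Re u" "Im l \<le> Im u" using le[of 1] le[of \<i>] by (simp_all add: Basis_complex_def)
  have v: "(\<lambda>(x, y). Complex x y) -` box l u = {Re l<..<Re u} \<times> {Im l<..<Im u}"
    by (auto simp: complex_box)
  have "emeasure (distr (lborel \<Otimes>\<^sub>M lborel) borel (\<lambda>(x, y). Complex x y)) (box l u)
     = emeasure (lborel \<Otimes>\<^sub>M lborel) ({Re l<..<Re u} \<times> {Im l<..<Im u})"
    using c by (subst emeasure_distr) (auto simp: v space_pair_measure)
  also have "\<dots> = ennreal (Re u - Re l) * ennreal (Im u - Im l)"
    using le' by (subst lborel.emeasure_pair_measure_Times) auto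
  also have "\<dots> = ennreal (\<Prod>b\<in>Basis. (u - l) \<bullet> b)"
    using le' by (simp add: Basis_complex_def ennreal_mult)
  finally show "emeasure (distr (lborel \<Otimes>\<^sub>M lborel) borel (\<lambda>(x, y). Complex x y)) (box l u) = ennreal (\<Prod>b\<in>Basis. (u - l) \<bullet> b)" .
qed simp

lemma nn_integral_complex_plane:
  assumes "f \<in> borel_measurable borel"
  shows "(\<integral>\<^sup>+z. f z \<partial>lborel) = (\<integral>\<^sup>+v. f (unplane v) \<partial>lborel)"
  by (subst lborel_complex_eq_plane, subst nn_integral_distr) (use assms in auto)

lemma nn_integral_complex_Fubini:
  assumes [measurable]: "f \<in> borel_measurable borel"
  shows "(\<integral>\<^sup>+z. f z \<partial>lborel) = (\<integral>\<^sup>+x. \<integral>\<^sup>+y. f (Complex x y) \<partial>lborel \<partial>lborel)"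
    and "(\<integral>\<^sup>+z. f z \<partial>lborel) = (\<integral>\<^sup>+y. \<integral>\<^sup>+x. f (Complex x y) \<partial>lborel \<partial>lborel)"
proof -
  have c: "(\<lambda>(x, y). Complex x y) \<in> borel_measurable (lborel \<Otimes>\<^sub>M lborel)"
    unfolding lborel_prod case_prod_unfold
    by (simp add: Complex_eq) (intro borel_measurable_continuous_onI continuous_intros)
  then have m: "(\<lambda>(x, y). f (Complex x y)) \<in> borel_measurable (lborel \<Otimes>\<^sub>M lborel)"
    using measurable_compose[OF c assms] by (simp add: case_prod_unfold)
  have "(\<integral>\<^sup>+z. f z \<partial>lborel) = (\<integral>\<^sup>+p. (case p of (x, y) \<Rightarrow> f (Complex x y)) \<partial>(lborel \<Otimes>\<^sub>M lborel))"
    by (subst lborel_complex_eq_pair, subst nn_integral_distr[OF c]) (auto simp: case_prod_unfold)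
  then show "(\<integral>\<^sup>+z. f z \<partial>lborel) = (\<integral>\<^sup>+x. \<integral>\<^sup>+y. f (Complex x y) \<partial>lborel \<partial>lborel)"
    "(\<integral>\<^sup>+z. f z \<partial>lborel) = (\<integral>\<^sup>+y. \<integral>\<^sup>+x. f (Complex x y) \<partial>lborel \<partial>lborel)"
    using lborel.nn_integral_fst[OF m] lborel_pair.nn_integral_snd[OF m] by auto
qed

text \<open>By the Cauchy-Riemann equations the real derivative of g is the matrix of multiplication
  by g', with determinant |g'|^2.\<close>

lemma nn_integral_change_of_variables_holomorphic:
  fixes f :: "complex \<Rightarrow> real"
  assumes "open S" and f: "f \<in> borel_measurable borel" "\<And>x. 0 \<le> f x"
    and hol: "g holomorphic_on S" and inj: "inj_on g S"
  shows "(\<integral>\<^sup>+z\<in>g ` S. ennreal (f z) \<partial>lborel) = (\<integral>\<^sup>+z\<in>S. ennreal ((cmod (deriv g z))\<^sup>2 * f (g z)) \<partial>lborel)"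
proof -
  define T where "T = plane ` S"
  define h where "h = (\<lambda>v. plane (g (unplane v)))"
  define h' where "h' = (\<lambda>v u. plane (deriv g (unplane v) * unplane u))"
  have T: "v \<in> T \<longleftrightarrow> unplane v \<in> S" for v by (auto simp: T_def image_iff) (metis plane_unplane(1))
  have Tb: "T \<in> sets borel"
  proof -
    have "T = unplane -` S" using T by auto
    then show ?thesis using measurable_sets_borel[OF measurable_plane(2), of S] assms(1) by simp
  qed
  have gS: "open (g ` S)" using open_mapping_thm3 assms(1) hol inj by blast
  have hT: "h ` T = plane ` g ` S" by (auto simp: T_def h_def image_image)
  have hTmem: "v \<in> h ` T \<longleftrightarrow> unplane v \<in> g ` S" for v
    unfolding hT by (auto simp: image_iff) (metis plane_unplane(1))
  have hTb: "h ` T \<in> sets borel"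
  proof -
    have "h ` T = unplane -` g ` S" using hTmem by (simp only: set_eq_iff vimage_eq simp_thms)
    then show ?thesis using measurable_sets_borel[OF measurable_plane(2), of "g ` S"] gS by simp
  qed
  have der: "(h has_derivative h' v) (at v within T)" if "v \<in> T" for v
  proof -
    have "(g has_derivative (*) (deriv g (unplane v))) (at (unplane v))"
      using holomorphic_derivI[OF hol assms(1)] that T by (simp add: has_field_derivative_def)
    then have "(g \<circ> unplane has_derivative (*) (deriv g (unplane v)) \<circ> unplane) (at v)"
      by (intro diff_chain_at bounded_linear_imp_has_derivative bounded_linear_unplane)
    then have "(h has_derivative h' v) (at v)"
      unfolding h_def h'_def using bounded_linear.has_derivative[OF bounded_linear_plane] by (simp add: o_def)
    then show ?thesis by (rule has_derivative_at_withinI)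
  qed
  have det: "\<bar>det (matrix (h' v))\<bar> = (cmod (deriv g (unplane v)))\<^sup>2" for v
  proof -
    have "unplane (axis 1 1) = 1" "unplane (axis 2 1) = \<i>"
      by (auto simp: unplane_def axis_def complex_eq_iff)
    then have "det (matrix (h' v)) = (Re (deriv g (unplane v)))\<^sup>2 + (Im (deriv g (unplane v)))\<^sup>2"
      by (simp add: det_2 matrix_def h'_def plane_def power2_eq_square)
    then show ?thesis by (simp add: cmod_power2)
  qed
  have injh: "inj_on h T" using inj by (auto simp: inj_on_def h_def T_def) (metis plane_unplane(2))
  \<comment> \<open>The change of variables concerns functions with values in a Cartesian space, so
    real values become vectors of \<open>real^1\<close>.\<close>
  let ?F = "\<lambda>v. vec (f (unplane v)) :: real^1"
  have "T \<in> sets lebesgue" using Tb by auto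
  from has_absolute_integral_change_of_variables[OF this der injh, of ?F "vec b" for b]
  have cov: "((\<lambda>v. (cmod (deriv g (unplane v)))\<^sup>2 * f (unplane (h v))) absolutely_integrable_on T \<and>
     integral T (\<lambda>v. (cmod (deriv g (unplane v)))\<^sup>2 * f (unplane (h v))) = b) \<longleftrightarrow>
     (\<lambda>v. f (unplane v)) absolutely_integrable_on h ` T \<and> integral (h ` T) (\<lambda>v. f (unplane v)) = b" for b
    unfolding det by (simp add: absolutely_integrable_on_1_iff integral_on_1_eq)
  have fp: "(\<lambda>v. f (unplane v)) \<in> borel_measurable borel" using f(1) by measurable
  have 1: "(\<lambda>v. indicator (h ` T) v * f (unplane v)) \<in> borel_measurable borel"
    using hTb fp by measurable
  have dc: "continuous_on S (\<lambda>z. (cmod (deriv g z))\<^sup>2)"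
    by (intro continuous_intros holomorphic_on_imp_continuous_on holomorphic_deriv hol assms(1))
  have gm: "g \<in> borel_measurable (restrict_space borel S)"
    by (intro borel_measurable_continuous_on_restrict holomorphic_on_imp_continuous_on hol)
  have "(\<lambda>z. (cmod (deriv g z))\<^sup>2 * f (g z)) \<in> borel_measurable (restrict_space borel S)"
    by (intro borel_measurable_times borel_measurable_continuous_on_restrict dc measurable_compose[OF gm f(1)])
  then have 3: "(\<lambda>z. indicator S z * ((cmod (deriv g z))\<^sup>2 * f (g z))) \<in> borel_measurable borel"
    using assms(1) by (subst (asm) borel_measurable_restrict_space_iff) (auto simp: ac_simps)
  have iT: "indicator T v = (indicator S (unplane v) :: real)" for v using T by (auto simp: indicator_def)
  have 2: "(\<lambda>v. indicator T v * ((cmod (deriv g (unplane v)))\<^sup>2 * f (unplane (h v)))) \<in> borel_measurable borel"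
    using measurable_compose[OF measurable_plane(2) 3] by (simp add: h_def iT)
  have "(\<integral>\<^sup>+z\<in>g ` S. ennreal (f z) \<partial>lborel) = (\<integral>\<^sup>+v. ennreal (f (unplane v)) * indicator (g ` S) (unplane v) \<partial>lborel)"
    by (rule nn_integral_complex_plane)
      (intro borel_measurable_times_ennreal borel_measurable_indicator measurable_compose[OF f(1) measurable_ennreal], use gS in simp)
  also have "\<dots> = (\<integral>\<^sup>+v\<in>h ` T. ennreal (f (unplane v)) \<partial>lborel)"
    using hTmem by (intro nn_integral_cong) (auto simp: indicator_def)
  also have "\<dots> = (\<integral>\<^sup>+v\<in>T. ennreal ((cmod (deriv g (unplane v)))\<^sup>2 * f (unplane (h v))) \<partial>lborel)"
    unfolding nn_integral_eq_absolute_integral[OF 1 f(2)]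
    by (subst nn_integral_eq_absolute_integral[OF 2])
      (use cov[of "integral (h ` T) (\<lambda>v. f (unplane v))"]
         cov[of "integral T (\<lambda>v. (cmod (deriv g (unplane v)))\<^sup>2 * f (unplane (h v)))"] f(2) in \<open>auto\<close>)
  also have "\<dots> = (\<integral>\<^sup>+v. ennreal (indicator S (unplane v) * ((cmod (deriv g (unplane v)))\<^sup>2 * f (g (unplane v)))) \<partial>lborel)"
    using T by (intro nn_integral_cong) (auto simp: indicator_def h_def)
  also have "\<dots> = (\<integral>\<^sup>+z. ennreal (indicator S z * ((cmod (deriv g z))\<^sup>2 * f (g z))) \<partial>lborel)"
    by (subst nn_integral_complex_plane) (use 3 in measurable)
  also have "\<dots> = (\<integral>\<^sup>+z\<in>S. ennreal ((cmod (deriv g z))\<^sup>2 * f (g z)) \<partial>lborel)"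
    by (intro nn_integral_cong) (auto simp: indicator_def)
  finally show ?thesis .
qed

text \<open>The open interval omits the angles at which tan (t / 2) is infinite; they correspond to
  the point 1 of the circle, the image of infinity under the Cayley transform.\<close>

abbreviation angles :: "real set" where "angles \<equiv> {- pi<..<pi}"

section \<open>The half-angle substitution and Parseval's identity\<close>

lemma tan_half_image: assumes "0 < k" shows "(\<lambda>t. k * tan (t / 2)) ` angles = UNIV"
proof -
  have "x \<in> (\<lambda>t. k * tan (t / 2)) ` angles" for x
    using arctan_bounded[of "x / k"] assms
    by (intro image_eqI[of _ _ "2 * arctan (x / k)"]) (auto simp: tan_arctan)
  then show ?thesis by auto
qed

lemma nn_integral_tan_half:
  fixes f :: "real \<Rightarrow> real"
  assumes "0 < k" "f \<in> borel_measurable borel" "\<And>x. 0 \<le> f x"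
  shows "(\<integral>\<^sup>+x. ennreal (f x) \<partial>lborel) = (\<integral>\<^sup>+t\<in>angles. ennreal (k / 2 * (1 + (tan (t / 2))\<^sup>2) * f (k * tan (t / 2))) \<partial>lborel)"
proof -
  have c: "cos (t / 2) \<noteq> 0" if "t \<in> angles" for t :: real
    using that cos_gt_zero_pi[of "t / 2"] by auto
  have "(\<integral>\<^sup>+x. ennreal (f x) \<partial>lborel) = (\<integral>\<^sup>+x\<in>(\<lambda>t. k * tan (t / 2)) ` angles. ennreal (f x) \<partial>lborel)"
    unfolding tan_half_image[OF assms(1)] by simp
  also have "\<dots> = (\<integral>\<^sup>+t\<in>angles. ennreal (\<bar>k / 2 * (1 + (tan (t / 2))\<^sup>2)\<bar> * f (k * tan (t / 2))) \<partial>lborel)"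
  proof (rule nn_integral_change_of_variables_real)
    show "(\<lambda>t. k * tan (t / 2)) ` angles \<in> sets borel" unfolding tan_half_image[OF assms(1)] by simp
    show "((\<lambda>t. k * tan (t / 2)) has_real_derivative k / 2 * (1 + (tan (t / 2))\<^sup>2)) (at t)" if "t \<in> angles" for t
      using c[OF that] by (auto intro!: derivative_eq_intros simp: tan_sec field_simps)
    show "inj_on (\<lambda>t. k * tan (t / 2)) angles"
    proof (rule inj_onI)
      fix s t :: real assume st: "s \<in> angles" "t \<in> angles" "k * tan (s / 2) = k * tan (t / 2)"
      then have "arctan (tan (s / 2)) = arctan (tan (t / 2))" using assms(1) by simp
      then show "s = t" using st by (simp add: arctan_tan)
    qed
    show "continuous_on angles (\<lambda>t. k / 2 * (1 + (tan (t / 2))\<^sup>2))"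
      using c by (auto intro!: continuous_intros)
  qed (use assms in auto)
  also have "\<dots> = (\<integral>\<^sup>+t\<in>angles. ennreal (k / 2 * (1 + (tan (t / 2))\<^sup>2) * f (k * tan (t / 2))) \<partial>lborel)"
    using assms(1) by (simp add: abs_mult)
  finally show ?thesis .
qed

lemma has_integral_cis:
  "((\<lambda>t. cis (of_int k * t)) has_integral (if k = 0 then 2 * of_real pi else 0)) {- pi..pi}"
proof (cases "k = 0")
  case True
  then show ?thesis using has_integral_const_real[of "1::complex" "- pi" pi] by (simp add: scaleR_conv_of_real)
next
  case False
  have "((\<lambda>t. cis (of_int k * t)) has_integral
     (cis (of_int k * pi) / (\<i> * of_int k) - cis (of_int k * (- pi)) / (\<i> * of_int k))) {- pi..pi}"
  proof (rule fundamental_theorem_of_calculus)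
    fix t :: real
    define c where "c = \<i> * of_int k"
    have "c \<noteq> 0" using False by (simp add: c_def)
    then have "((\<lambda>t. exp (c * of_real t) / c) has_vector_derivative exp (c * of_real t)) (at t within {- pi..pi})"
      by (auto intro!: derivative_eq_intros has_vector_derivative_real_field)
    then show "((\<lambda>t. cis (of_int k * t) / (\<i> * of_int k)) has_vector_derivative cis (of_int k * t)) (at t within {- pi..pi})"
      by (simp add: cis_conv_exp c_def mult.assoc)
  qed simp
  moreover have "cis (of_int k * pi) = cis (of_int k * (- pi))"
    by (simp add: complex_eq_iff sin_times_pi_eq_0)
  ultimately show ?thesis using False by simp
qed

lemma Parseval_finite:
  "((\<lambda>t. (cmod (\<Sum>n<N. d n * cis (real n * t)))\<^sup>2) has_integral 2 * pi * (\<Sum>n<N. (cmod (d n))\<^sup>2)) {- pi..pi}"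
proof -
  have e: "(\<Sum>n<N. d n * cis (real n * t)) * cnj (\<Sum>n<N. d n * cis (real n * t))
     = (\<Sum>m<N. \<Sum>n<N. (d m * cnj (d n)) * cis (of_int (int m - int n) * t))" for t
    unfolding cnj_sum sum_product
    by (intro sum.cong refl) (simp add: cis_cnj cis_mult algebra_simps flip: cis_divide)
  have "((\<lambda>t. \<Sum>m<N. \<Sum>n<N. (d m * cnj (d n)) * cis (of_int (int m - int n) * t))
      has_integral (\<Sum>m<N. \<Sum>n<N. (d m * cnj (d n)) * (if int m - int n = 0 then 2 * of_real pi else 0))) {- pi..pi}"
    by (intro has_integral_sum has_integral_mult_right has_integral_cis) auto
  also have "(\<Sum>m<N. \<Sum>n<N. (d m * cnj (d n)) * (if int m - int n = 0 then 2 * of_real pi else 0))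
      = (\<Sum>m<N. \<Sum>n<N. if n = m then 2 * of_real pi * (d m * cnj (d m)) else 0)"
    by (intro sum.cong refl) auto
  also have "\<dots> = of_real (2 * pi * (\<Sum>n<N. (cmod (d n))\<^sup>2))"
    unfolding complex_norm_square[symmetric] by (simp add: sum_distrib_left)
  finally have "((\<lambda>t. (\<Sum>n<N. d n * cis (real n * t)) * cnj (\<Sum>n<N. d n * cis (real n * t)))
     has_integral of_real (2 * pi * (\<Sum>n<N. (cmod (d n))\<^sup>2))) {- pi..pi}"
    by (simp only: e)
  from has_integral_linear[OF this bounded_linear_Re] show ?thesis
    unfolding complex_norm_square[symmetric] by (simp add: o_def)
qed

lemma nn_integral_angles:
  assumes "(f has_integral I) {- pi..pi}" "\<And>t. 0 \<le> f t"
  shows "(\<integral>\<^sup>+t\<in>angles. ennreal (f t) \<partial>lborel) = ennreal I"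
proof -
  have "(\<integral>\<^sup>+t. ennreal (f t) * indicator {- pi..pi} t \<partial>lborel) = ennreal I"
    using nn_integral_has_integral_lebesgue[of "{- pi..pi}" f I] assms(1,2)
    by (simp add: nn_integral_set_ennreal mult.commute)
  moreover have "(\<integral>\<^sup>+t. ennreal (f t) * indicator {- pi..pi} t \<partial>lborel) = (\<integral>\<^sup>+t\<in>angles. ennreal (f t) \<partial>lborel)"
    by (rule nn_integral_cong_AE, rule AE_I[of _ _ "{- pi, pi}"]) (auto simp: indicator_def emeasure_lborel_countable split: if_splits)
  ultimately show ?thesis by simp
qed

text \<open>Absolute summability makes the partial sums converge uniformly, so their square
  integrals, known from orthogonality, converge to that of the limit.\<close>

lemma Parseval_circle:
  assumes "summable (\<lambda>n. cmod (d n))"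
  shows "(\<integral>\<^sup>+t\<in>angles. ennreal ((cmod (\<Sum>n. d n * cis (real n * t)))\<^sup>2) \<partial>lborel) = ennreal (2 * pi * (\<Sum>n. (cmod (d n))\<^sup>2))"
    and "summable (\<lambda>n. (cmod (d n))\<^sup>2)"
proof -
  show s2: "summable (\<lambda>n. (cmod (d n))\<^sup>2)"
  proof (rule summable_comparison_test_ev[OF _ assms])
    have "(\<lambda>n. cmod (d n)) \<longlonglongrightarrow> 0" by (rule summable_LIMSEQ_zero[OF assms])
    then have "\<forall>\<^sub>F n in sequentially. cmod (d n) < 1" by (rule order_tendstoD) simp
    then show "\<forall>\<^sub>F n in sequentially. norm ((cmod (d n))\<^sup>2) \<le> cmod (d n)"
    proof eventually_elim
      case (elim n)
      then show ?case using mult_left_le[of "cmod (d n)" "cmod (d n)"] by (simp add: power2_eq_square)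
    qed
  qed
  let ?S = "\<lambda>N t. \<Sum>n<N. d n * cis (real n * t)"
  let ?f = "\<lambda>t. \<Sum>n. d n * cis (real n * t)"
  have u: "uniform_limit UNIV ?S ?f sequentially"
    by (rule Weierstrass_m_test[OF _ assms]) (simp add: norm_mult)
  have u2: "uniform_limit UNIV (\<lambda>N t. (cmod (?S N t))\<^sup>2) (\<lambda>t. (cmod (?f t))\<^sup>2) sequentially"
  proof -
    have b: "cmod (?f t) \<le> (\<Sum>n. cmod (d n))" for t
      using assms by (intro order_trans[OF summable_norm]) (auto simp: norm_mult)
    then have bb: "bounded ((\<lambda>t. cmod (?f t)) ` UNIV)" by (intro boundedI[of _ "\<Sum>n. cmod (d n)"]) auto
    show ?thesis
      unfolding power2_eq_square
      by (rule uniform_lim_mult[OF uniform_limit_norm[OF u] uniform_limit_norm[OF u] bb bb])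
  qed
  have cS: "continuous_on A (?S N)" for A N by (intro continuous_intros)
  have cf: "continuous_on A ?f" for A
    by (rule continuous_on_subset[OF uniform_limit_theorem[OF _ u]]) (auto intro!: always_eventually cS)
  have cS2: "\<And>N. continuous_on {- pi..pi} (\<lambda>t. (cmod (?S N t))\<^sup>2)" by (intro continuous_intros)
  obtain I J where IJ: "\<And>N. ((\<lambda>t. (cmod (?S N t))\<^sup>2) has_integral I N) {- pi..pi}"
     "((\<lambda>t. (cmod (?f t))\<^sup>2) has_integral J) {- pi..pi}" "I \<longlonglongrightarrow> J"
    by (rule uniform_limit_integral[OF uniform_limit_on_subset[OF u2 subset_UNIV] cS2 sequentially_bot]) blast
  have "I = (\<lambda>N. 2 * pi * (\<Sum>n<N. (cmod (d n))\<^sup>2))"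
    using has_integral_unique[OF IJ(1) Parseval_finite] by (rule ext)
  then have "I \<longlonglongrightarrow> 2 * pi * (\<Sum>n. (cmod (d n))\<^sup>2)"
    using tendsto_mult_left[OF summable_LIMSEQ[OF s2], of "2 * pi"] by simp
  then have J: "J = 2 * pi * (\<Sum>n. (cmod (d n))\<^sup>2)" using IJ(3) LIMSEQ_unique by blast
  show "(\<integral>\<^sup>+t\<in>angles. ennreal ((cmod (?f t))\<^sup>2) \<partial>lborel) = ennreal (2 * pi * (\<Sum>n. (cmod (d n))\<^sup>2))"
    unfolding J[symmetric]
    by (rule nn_integral_angles[OF IJ(2)]) simp
qed

text \<open>Polar coordinates appear as the holomorphic substitution w = exp (x + i t) with Jacobian
  exp (2 x). The half strip |t| < pi, x < ln R covers the disc up to a part of the real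
  axis.\<close>

lemma nn_integral_polar:
  fixes f :: "complex \<Rightarrow> real"
  assumes [measurable]: "f \<in> borel_measurable borel" and f0: "\<And>z. 0 \<le> f z" and R: "0 < R"
  shows "(\<integral>\<^sup>+z\<in>ball 0 R. ennreal (f z) \<partial>lborel)
    = (\<integral>\<^sup>+x\<in>{..<ln R}. (\<integral>\<^sup>+t\<in>angles. ennreal (exp (2 * x) * f (of_real (exp x) * cis t)) \<partial>lborel) \<partial>lborel)"
proof -
  define S where "S = {z. Re z < ln R \<and> - pi < Im z \<and> Im z < pi}"
  have S: "open S"
  proof -
    have "S = {z. Re z < ln R} \<inter> {z. - pi < Im z} \<inter> {z. Im z < pi}" by (auto simp: S_def)
    then show ?thesis by (simp add: open_Int open_halfspace_Re_lt open_halfspace_Im_gt open_halfspace_Im_lt)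
  qed
  have de: "deriv exp z = exp z" for z :: complex by (rule DERIV_imp_deriv) (rule DERIV_exp)
  have inj: "inj_on exp S"
  proof (rule inj_onI)
    fix a b assume ab: "a \<in> S" "b \<in> S" "exp a = exp b"
    have "Ln (exp a) = a" "Ln (exp b) = b" using ab(1,2) by (auto simp: S_def intro: Ln_exp)
    then show "a = b" using ab(3) by metis
  qed
  \<comment> \<open>The whole real axis is discarded: it is a null set that contains the slit and
    the origin.\<close>
  define N where "N = {z::complex. Im z = 0}"
  have N: "negligible N"
    using negligible_hyperplane[of \<i> 0] by (simp add: N_def inner_complex_def)
  have sub: "exp ` S \<subseteq> ball 0 R"
  proof safe
    fix z assume "z \<in> S"
    then have "exp (Re z) < exp (ln R)" by (simp add: S_def)
    then have "exp (Re z) < R" using R by simp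
    then show "exp z \<in> ball 0 R" by simp
  qed
  have sup: "z \<in> exp ` S" if "z \<in> ball 0 R" "z \<notin> N" for z
  proof (rule image_eqI)
    have "z \<noteq> 0" using that by (auto simp: N_def)
    then show "z = exp (Ln z)" by simp
    have "Im (Ln z) \<noteq> pi" using that Im_Ln_eq_pi[OF \<open>z \<noteq> 0\<close>] by (auto simp: N_def)
    then show "Ln z \<in> S" using mpi_less_Im_Ln[OF \<open>z \<noteq> 0\<close>] Im_Ln_le_pi[OF \<open>z \<noteq> 0\<close>] that(1) \<open>z \<noteq> 0\<close> R
      by (auto simp: S_def ln_less_cancel_iff[of "cmod z" R])
  qed
  have "(\<integral>\<^sup>+z\<in>ball 0 R. ennreal (f z) \<partial>lborel) = (\<integral>\<^sup>+z\<in>exp ` S. ennreal (f z) \<partial>lborel)"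
  proof (rule nn_integral_cong_AE)
    have "closed N" unfolding N_def by (intro closed_Collect_eq continuous_intros)
    then have "N \<in> null_sets lborel"
      using N null_sets_completion_iff[of N lborel] by (simp add: negligible_iff_null_sets borel_closed)
    then have "AE z in lborel. z \<notin> N" by (rule AE_not_in)
    then show "AE z in lborel. ennreal (f z) * indicator (ball 0 R) z = ennreal (f z) * indicator (exp ` S) z"
    proof eventually_elim
      case (elim z)
      then have "z \<in> ball 0 R \<longleftrightarrow> z \<in> exp ` S" using sub sup by blast
      then show ?case by (simp add: indicator_def)
    qed
  qed
  also have "\<dots> = (\<integral>\<^sup>+z\<in>S. ennreal ((cmod (deriv exp z))\<^sup>2 * f (exp z)) \<partial>lborel)"
    by (rule nn_integral_change_of_variables_holomorphic[OF S _ f0 _ inj]) (auto intro: holomorphic_intros)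
  also have "\<dots> = (\<integral>\<^sup>+x. \<integral>\<^sup>+t. ennreal ((cmod (deriv exp (Complex x t)))\<^sup>2 * f (exp (Complex x t))) * indicator S (Complex x t) \<partial>lborel \<partial>lborel)"
  proof (rule nn_integral_complex_Fubini(1))
    have "(\<lambda>z. ennreal ((cmod (exp z))\<^sup>2 * f (exp z)) * indicator S z) \<in> borel_measurable borel"
      using S by (intro borel_measurable_times_ennreal measurable_compose[OF _ measurable_ennreal] borel_measurable_times
         borel_measurable_indicator measurable_compose[OF _ assms(1)] borel_measurable_continuous_onI continuous_intros) auto
    then show "(\<lambda>z. ennreal ((cmod (deriv exp z))\<^sup>2 * f (exp z)) * indicator S z) \<in> borel_measurable borel" by (simp only: de)
  qed
  also have "\<dots> = (\<integral>\<^sup>+x\<in>{..<ln R}. (\<integral>\<^sup>+t\<in>angles. ennreal (exp (2 * x) * f (of_real (exp x) * cis t)) \<partial>lborel) \<partial>lborel)"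
  proof (rule nn_integral_cong)
    fix x :: real
    have e: "exp (Complex x t) = of_real (exp x) * cis t" for t by (simp add: exp_eq_polar)
    have "(\<integral>\<^sup>+t. ennreal ((cmod (deriv exp (Complex x t)))\<^sup>2 * f (exp (Complex x t))) * indicator S (Complex x t) \<partial>lborel)
      = (\<integral>\<^sup>+t. (ennreal (exp (2 * x) * f (of_real (exp x) * cis t)) * indicator angles t) * indicator {..<ln R} x \<partial>lborel)"
      by (intro nn_integral_cong) (auto simp: S_def indicator_def e de norm_mult exp_double)
    also have "\<dots> = (\<integral>\<^sup>+t. ennreal (exp (2 * x) * f (of_real (exp x) * cis t)) * indicator angles t \<partial>lborel) * indicator {..<ln R} x"
    proof (rule nn_integral_multc)
      have "(\<lambda>t. exp (2 * x) * f (of_real (exp x) * cis t)) \<in> borel_measurable borel"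
        by (intro borel_measurable_times measurable_compose[OF _ assms(1)] borel_measurable_continuous_onI continuous_intros)
      then show "(\<lambda>t. ennreal (exp (2 * x) * f (of_real (exp x) * cis t)) * indicator angles t) \<in> borel_measurable lborel"
        by measurable
    qed
    finally show "(\<integral>\<^sup>+t. ennreal ((cmod (deriv exp (Complex x t)))\<^sup>2 * f (exp (Complex x t))) * indicator S (Complex x t) \<partial>lborel)
      = (\<integral>\<^sup>+t\<in>angles. ennreal (exp (2 * x) * f (of_real (exp x) * cis t)) \<partial>lborel) * indicator {..<ln R} x" .
  qed
  finally show ?thesis .
qed

text \<open>The substitution s = |w|^2 = exp (2 x), which makes a radial integral into one over (0,
  R^2).\<close>

lemma nn_integral_exp_double:
  fixes f :: "real \<Rightarrow> real"
  assumes "f \<in> borel_measurable borel" "\<And>x. 0 \<le> f x" "0 < R"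
  shows "(\<integral>\<^sup>+s\<in>{0<..<R\<^sup>2}. ennreal (f s) \<partial>lborel) = (\<integral>\<^sup>+x\<in>{..<ln R}. ennreal (2 * exp (2 * x) * f (exp (2 * x))) \<partial>lborel)"
proof -
  have i: "(\<lambda>x. exp (2 * x)) ` {..<ln R} = {0<..<R\<^sup>2}"
  proof safe
    fix x :: real assume "x < ln R"
    then have "exp x < R" using assms(3) by (metis exp_less_cancel_iff exp_ln)
    then show "exp (2 * x) \<in> {0<..<R\<^sup>2}"
      by (simp add: exp_double power_strict_mono)
  next
    fix s :: real assume s: "s \<in> {0<..<R\<^sup>2}"
    then have "ln s < 2 * ln R" using assms(3) by (metis greaterThanLessThan_iff ln_less_cancel_iff ln_realpow of_nat_numeral zero_less_power)
    then show "s \<in> (\<lambda>x. exp (2 * x)) ` {..<ln R}" using s by (intro image_eqI[of _ _ "ln s / 2"]) auto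
  qed
  have "(\<integral>\<^sup>+s\<in>(\<lambda>x. exp (2 * x)) ` {..<ln R}. ennreal (f s) \<partial>lborel) = (\<integral>\<^sup>+x\<in>{..<ln R}. ennreal (\<bar>2 * exp (2 * x)\<bar> * f (exp (2 * x))) \<partial>lborel)"
    by (rule nn_integral_change_of_variables_real)
       (use assms i in \<open>auto intro!: derivative_eq_intros continuous_intros simp: inj_on_def\<close>)
  then show ?thesis unfolding i by (simp add: abs_mult)
qed

lemma nn_integral_Beta_nat:
  "(\<integral>\<^sup>+s\<in>{0<..<1}. ennreal (s ^ k * (1 - s) ^ m) \<partial>lborel) = ennreal (fact k * fact m / fact (k + m + 1))"
proof -
  have "((\<lambda>t. t powr (real (k + 1) - 1) * (1 - t) powr (real (m + 1) - 1)) has_integral Beta (real (k + 1)) (real (m + 1))) {0..1}"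
    by (rule has_integral_Beta_real) auto
  then have "((\<lambda>t. t powr (real (k + 1) - 1) * (1 - t) powr (real (m + 1) - 1)) has_integral Beta (real (k + 1)) (real (m + 1))) {0<..<1}"
    by (simp add: has_integral_Icc_iff_Ioo)
  then have "((\<lambda>t. t ^ k * (1 - t) ^ m) has_integral Beta (real (k + 1)) (real (m + 1))) {0<..<1}"
    by (rule has_integral_eq[rotated]) (auto simp: powr_realpow)
  moreover have "Beta (real (k + 1)) (real (m + 1)) = fact k * fact m / fact (k + m + 1)"
  proof -
    have "Gamma (real (k + 1)) = fact k" "Gamma (real (m + 1)) = fact m" "Gamma (real (k + 1) + real (m + 1)) = fact (k + m + 1)"
      using Gamma_fact[of k, where 'a=real] Gamma_fact[of m, where 'a=real] Gamma_fact[of "k + m + 1", where 'a=real]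
      by (simp_all add: add_ac)
    then show ?thesis by (simp add: Beta_def)
  qed
  ultimately have h: "((\<lambda>t. t ^ k * (1 - t) ^ m) has_integral fact k * fact m / fact (k + m + 1)) {0<..<(1::real)}" by simp
  have "(\<integral>\<^sup>+s\<in>{0<..<1}. ennreal (s ^ k * (1 - s) ^ m) \<partial>lborel) = (\<integral>\<^sup>+s. ennreal (indicator {0<..<1} s * (s ^ k * (1 - s) ^ m)) \<partial>lborel)"
    by (intro nn_integral_cong) (auto simp: indicator_def)
  also have "\<dots> = ennreal (fact k * fact m / fact (k + m + 1))"
  proof (rule nn_integral_has_integral_lebesgue)
    show "((\<lambda>s. s ^ k * (1 - s) ^ m) has_integral fact k * fact m / fact (k + m + 1)) {0<..<(1::real)}" by (rule h)
  qed (auto)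
  finally show ?thesis .
qed

section \<open>The Cayley transform\<close>

definition cayley :: "complex \<Rightarrow> complex" where "cayley z = (z - \<i>) / (z + \<i>)"

text \<open>At the pole w = 1 the value is 0 by division by zero; identities that involve the pole
  carry w \<noteq> 1.\<close>

definition inv_cayley :: "complex \<Rightarrow> complex" where "inv_cayley w = \<i> * (1 + w) / (1 - w)"

lemma add_i_nonzero: "0 \<le> Im z \<Longrightarrow> z + \<i> \<noteq> 0"
  by (auto simp: complex_eq_iff)

lemma one_minus_cayley: "z + \<i> \<noteq> 0 \<Longrightarrow> 1 - cayley z = 2 * \<i> / (z + \<i>)"
  by (simp add: cayley_def divide_simps)

lemma inv_cayley_cayley: "z + \<i> \<noteq> 0 \<Longrightarrow> inv_cayley (cayley z) = z"
proof -
  assume a: "z + \<i> \<noteq> 0"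
  have "1 + cayley z = 2 * z / (z + \<i>)" using a by (simp add: cayley_def divide_simps)
  then show ?thesis using a by (simp add: inv_cayley_def one_minus_cayley)
qed

lemma inv_cayley_add_i: "w \<noteq> 1 \<Longrightarrow> inv_cayley w + \<i> = 2 * \<i> / (1 - w)"
  by (simp add: inv_cayley_def divide_simps) (simp add: algebra_simps)

lemma cayley_inv_cayley: "w \<noteq> 1 \<Longrightarrow> cayley (inv_cayley w) = w"
proof -
  assume w: "w \<noteq> 1"
  then have "1 - w \<noteq> 0" by simp
  have "inv_cayley w - \<i> = 2 * \<i> * w / (1 - w)"
    using w by (simp add: inv_cayley_def divide_simps) (simp add: algebra_simps)
  then show ?thesis using inv_cayley_add_i[OF w] \<open>1 - w \<noteq> 0\<close> by (simp add: cayley_def)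
qed

lemma one_minus_cmod_cayley:
  assumes "z + \<i> \<noteq> 0"
  shows "1 - (cmod (cayley z))\<^sup>2 = 4 * Im z / (cmod (z + \<i>))\<^sup>2"
proof -
  have "(cmod (z + \<i>))\<^sup>2 - (cmod (z - \<i>))\<^sup>2 = 4 * Im z"
    unfolding cmod_power2 by (simp add: power2_eq_square algebra_simps)
  moreover have "(cmod (cayley z))\<^sup>2 = (cmod (z - \<i>))\<^sup>2 / (cmod (z + \<i>))\<^sup>2"
    by (simp add: cayley_def norm_divide power_divide)
  then have "1 - (cmod (cayley z))\<^sup>2 = ((cmod (z + \<i>))\<^sup>2 - (cmod (z - \<i>))\<^sup>2) / (cmod (z + \<i>))\<^sup>2"
    using assms by (simp add: diff_divide_distrib)
  ultimately show ?thesis by simp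
qed

lemma cmod_cayley_less_1: assumes "z \<in> uhp" shows "cmod (cayley z) < 1"
proof -
  have z: "0 < Im z" using assms by (simp add: uhp_def)
  then have "z + \<i> \<noteq> 0" by (simp add: add_i_nonzero)
  then have "0 < 1 - (cmod (cayley z))\<^sup>2" unfolding one_minus_cmod_cayley[OF \<open>z + \<i> \<noteq> 0\<close>]
    using z by simp
  then show ?thesis by (simp add: abs_square_less_1)
qed

lemma Im_inv_cayley: assumes "w \<noteq> 1" shows "Im (inv_cayley w) = (1 - (cmod w)\<^sup>2) / (cmod (1 - w))\<^sup>2"
proof -
  have z: "inv_cayley w + \<i> \<noteq> 0" using inv_cayley_add_i[OF assms] assms by simp
  have "1 - (cmod w)\<^sup>2 = 4 * Im (inv_cayley w) / (cmod (inv_cayley w + \<i>))\<^sup>2"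
    using one_minus_cmod_cayley[OF z] cayley_inv_cayley[OF assms] by simp
  then show ?thesis using assms by (simp add: inv_cayley_add_i[OF assms] norm_divide norm_mult power_divide)
qed

lemma inv_cayley_in_uhp: assumes "cmod w < 1" shows "inv_cayley w \<in> uhp"
proof -
  have "w \<noteq> 1" using assms by auto
  moreover have "(cmod w)\<^sup>2 < 1" using assms by (simp add: abs_square_less_1)
  ultimately show ?thesis by (simp add: uhp_def Im_inv_cayley)
qed

lemma open_uhp: "open uhp"
  unfolding uhp_def by (simp add: open_halfspace_Im_gt)

lemma uhp_nonzero: "z \<in> uhp \<Longrightarrow> z + \<i> \<noteq> 0"
  by (simp add: uhp_def add_i_nonzero)

lemma holomorphic_inv_cayley: "inv_cayley holomorphic_on ball 0 1"
  unfolding inv_cayley_def by (intro holomorphic_intros) auto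

lemma holomorphic_cayley: "cayley holomorphic_on uhp"
  unfolding cayley_def by (intro holomorphic_intros) (simp add: uhp_nonzero)

text \<open>The orthonormal basis that corresponds to the monomials w^n; pi is the integral of 1 /
  (1 + x^2) over the line.\<close>

definition hbasis :: "nat \<Rightarrow> complex \<Rightarrow> complex" where
  "hbasis n z = cayley z ^ n / (of_real (sqrt pi) * (z + \<i>))"

section \<open>Norms on the Hardy space\<close>

lemma borel_measurable_hol_uhp: assumes "h \<in> hol_uhp" shows "h \<in> borel_measurable borel"
proof -
  have "h \<in> borel_measurable (restrict_space borel uhp)"
    using assms by (intro borel_measurable_continuous_on_restrict holomorphic_on_imp_continuous_on) (simp add: hol_uhp_def)
  then have "(\<lambda>z. indicator uhp z *\<^sub>R h z) \<in> borel_measurable borel"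
    using open_uhp by (subst (asm) borel_measurable_restrict_space_iff) auto
  also have "(\<lambda>z. indicator uhp z *\<^sub>R h z) = h"
    using assms by (auto simp: hol_uhp_def indicator_def)
  finally show ?thesis .
qed

lemma borel_measurable_Complex: "(\<lambda>x. Complex x y) \<in> borel_measurable borel"
  by (simp add: Complex_eq)

text \<open>The line Im z = y goes to the circle w = 1 - (1 + e^(i t)) / (1 + y) through 1. With x =
  (1 + y) tan (t / 2) one has dx / |z + i|^2 = dt / (2 (1 + y)), so the density in t is constant.
  The case y = 0 covers boundary integrals.\<close>

lemma nn_integral_horizontal_line:
  assumes "0 \<le> y" and m: "(\<lambda>x. h (Complex x y)) \<in> borel_measurable borel"
    and h: "\<And>x. h (Complex x y) = K (cayley (Complex x y)) / (of_real (sqrt pi) * (Complex x y + \<i>))"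
  shows "(\<integral>\<^sup>+x. ennreal ((cmod (h (Complex x y)))\<^sup>2) \<partial>lborel)
    = (\<integral>\<^sup>+t\<in>angles. ennreal (1 / (2 * pi * (1 + y)) * (cmod (K (1 - (1 + cis t) / of_real (1 + y))))\<^sup>2) \<partial>lborel)"
proof -
  define k where "k = 1 + y"
  have k: "0 < k" using assms(1) by (simp add: k_def)
  have "(\<integral>\<^sup>+x. ennreal ((cmod (h (Complex x y)))\<^sup>2) \<partial>lborel)
    = (\<integral>\<^sup>+t\<in>angles. ennreal (k / 2 * (1 + (tan (t / 2))\<^sup>2) * (cmod (h (Complex (k * tan (t / 2)) y)))\<^sup>2) \<partial>lborel)"
    by (rule nn_integral_tan_half[OF k, of "\<lambda>x. (cmod (h (Complex x y)))\<^sup>2"]) (use m in auto)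
  also have "\<dots> = (\<integral>\<^sup>+t\<in>angles. ennreal (1 / (2 * pi * k) * (cmod (K (1 - (1 + cis t) / of_real k)))\<^sup>2) \<partial>lborel)"
  proof (rule nn_integral_cong)
    fix t :: real
    show "ennreal (k / 2 * (1 + (tan (t / 2))\<^sup>2) * (cmod (h (Complex (k * tan (t / 2)) y)))\<^sup>2) * indicator angles t
      = ennreal (1 / (2 * pi * k) * (cmod (K (1 - (1 + cis t) / of_real k)))\<^sup>2) * indicator angles t"
    proof (cases "t \<in> angles")
      case True
      define z where "z = Complex (k * tan (t / 2)) y"
      have c: "cos (t / 2) \<noteq> 0" using True cos_gt_zero_pi[of "t / 2"] by auto
      have zi: "z + \<i> = of_real k * Complex (tan (t / 2)) 1"
        by (simp add: z_def complex_eq_iff k_def)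
      have z0: "z + \<i> \<noteq> 0" using k unfolding zi by (simp add: complex_eq_iff)
      have n: "(cmod (z + \<i>))\<^sup>2 = k\<^sup>2 * (1 + (tan (t / 2))\<^sup>2)"
        unfolding zi by (simp add: norm_mult power_mult_distrib cmod_power2)
      have ct: "cos t = 2 * (cos (t / 2))\<^sup>2 - 1" "sin t = 2 * sin (t / 2) * cos (t / 2)"
        using cos_double_cos[of "t / 2"] sin_double[of "t / 2"] by simp_all
      \<comment> \<open>Half angles: 1 + e^(i t) = 2 cos (t / 2) e^(i t / 2), while tan (t / 2) + i
        = i e^(- i t / 2) / cos (t / 2).\<close>
      have "(1 + cis t) * Complex (tan (t / 2)) 1 = 2 * \<i>"
      proof (rule complex_eqI)
        show "Re ((1 + cis t) * Complex (tan (t / 2)) 1) = Re (2 * \<i>)"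
          using c by (simp add: ct tan_def field_simps power2_eq_square)
        have "2 * (cos (t / 2) * cos (t / 2)) + 2 * (sin (t / 2) * sin (t / 2)) = 2"
          using sin_cos_squared_add3[of "t / 2"] by linarith
        then show "Im ((1 + cis t) * Complex (tan (t / 2)) 1) = Im (2 * \<i>)"
          using c by (simp add: ct tan_def power2_eq_square)
      qed
      then have "(1 + cis t) / of_real k * (z + \<i>) = 2 * \<i>" using k unfolding zi by simp
      then have "(1 + cis t) / of_real k = 2 * \<i> / (z + \<i>)" using z0 by (metis nonzero_mult_div_cancel_right)
      then have cz: "cayley z = 1 - (1 + cis t) / of_real k" using one_minus_cayley[OF z0] by (metis diff_diff_eq2 add_diff_cancel_left')
      have "(cmod (h z))\<^sup>2 = (cmod (K (1 - (1 + cis t) / of_real k)))\<^sup>2 / (pi * (k\<^sup>2 * (1 + (tan (t / 2))\<^sup>2)))"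
        using h[of "k * tan (t / 2)"] n by (simp add: z_def[symmetric] cz norm_divide norm_mult power_divide power_mult_distrib)
      moreover have alg: "k / 2 * A * (B / (pi * (k\<^sup>2 * A))) = 1 / (2 * pi * k) * B" if "A \<noteq> 0" for A B
        using that k by (simp add: power2_eq_square)
      moreover have "1 + (tan (t / 2))\<^sup>2 \<noteq> 0" by (metis add_pos_nonneg less_irrefl zero_le_power2 zero_less_one)
      ultimately have "k / 2 * (1 + (tan (t / 2))\<^sup>2) * (cmod (h z))\<^sup>2 = 1 / (2 * pi * k) * (cmod (K (1 - (1 + cis t) / of_real k)))\<^sup>2"
        using alg k by simp
      then show ?thesis by (simp only: z_def)
    qed simp
  qed
  finally show ?thesis by (simp add: k_def)
qed

text \<open>The terms are negative binomial probabilities: the (j + 1)-st success, each of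
  probability s, occurs at trial n + 1. Pascal's rule gives the recursion behind the induction; the
  bound is the column sum in the Schur test.\<close>

lemma negative_binomial_sum_le_1:
  fixes c s :: real
  assumes "0 \<le> c" "0 < s" "c + s = 1"
  shows "(\<Sum>n<N. real (n choose j) * c ^ (n - j) * s ^ (j + 1)) \<le> 1"
proof (induction N arbitrary: j)
  case 0 then show ?case by simp
next
  case (Suc N)
  let ?f = "\<lambda>n j. real (n choose j) * c ^ (n - j) * s ^ (j + 1)"
  show ?case
  proof (cases j)
    case 0
    have "(\<Sum>n<Suc N. ?f n 0) = s + c * (\<Sum>n<N. ?f n 0)"
      by (subst sum.lessThan_Suc_shift) (simp add: sum_distrib_left algebra_simps)
    also have "\<dots> \<le> s + c * 1" using Suc.IH[of 0] assms by (intro add_mono mult_left_mono) auto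
    finally show ?thesis using assms 0 by simp
  next
    case (Suc i)
    have step: "?f (Suc n) (Suc i) = c * ?f n (Suc i) + s * ?f n i" for n
    proof -
      have "c * c ^ (n - Suc i) = c ^ (n - i)" if "Suc i \<le> n"
        using that by (metis Suc_diff_Suc Suc_le_lessD power_Suc)
      then have 1: "real (n choose Suc i) * c ^ (n - i) = c * (real (n choose Suc i) * c ^ (n - Suc i))"
        by (cases "Suc i \<le> n") auto
      have "?f (Suc n) (Suc i) = real (n choose Suc i) * c ^ (n - i) * s ^ (Suc i + 1) + s * ?f n i"
        by (simp add: algebra_simps)
      then show ?thesis unfolding 1 by (simp add: mult.assoc)
    qed
    have "(\<Sum>n<Suc N. ?f n (Suc i)) = c * (\<Sum>n<N. ?f n (Suc i)) + s * (\<Sum>n<N. ?f n i)"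
    proof -
      have "(\<Sum>n<Suc N. ?f n (Suc i)) = (\<Sum>n<N. ?f (Suc n) (Suc i))"
        by (subst sum.lessThan_Suc_shift) (simp del: binomial_Suc_Suc power_Suc)
      also have "\<dots> = (\<Sum>n<N. c * ?f n (Suc i) + s * ?f n i)" by (intro sum.cong refl step)
      finally show ?thesis by (simp only: sum.distrib sum_distrib_left)
    qed
    also have "\<dots> \<le> c * 1 + s * 1" using assms by (intro add_mono mult_left_mono Suc.IH) auto
    finally show ?thesis using assms Suc by simp
  qed
qed

text \<open>A Schur test: the matrix of the composition with \<open>u \<mapsto> c + s u\<close> has row sums \<open>1\<close> and column sums \<open>1 / s\<close>.\<close>

lemma binomial_matrix_bound:
  fixes c s :: real and a :: "nat \<Rightarrow> complex"
  assumes "0 \<le> c" "0 < s" "c + s = 1"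
  defines "A \<equiv> \<lambda>n j. real (n choose j) * c ^ (n - j) * s ^ j"
  shows "s * (\<Sum>j<N. (cmod (\<Sum>n<N. a n * of_real (A n j)))\<^sup>2) \<le> (\<Sum>n<N. (cmod (a n))\<^sup>2)"
proof -
  have A0: "0 \<le> A n j" for n j using assms by (simp add: A_def)
  have row: "(\<Sum>j<N. A n j) \<le> 1" if "n < N" for n
  proof -
    have "(\<Sum>j<N. A n j) = (\<Sum>j\<le>n. A n j)"
      using that by (intro sum.mono_neutral_right) (auto simp: A_def)
    also have "\<dots> = (s + c) ^ n" unfolding binomial_ring A_def by (simp add: ac_simps)
    finally show ?thesis using assms by (simp add: add.commute)
  qed
  have col: "s * (\<Sum>n<N. A n j) \<le> 1" for j
    using negative_binomial_sum_le_1[OF assms(1-3), of j N] by (simp add: A_def sum_distrib_left ac_simps)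
  have "s * (cmod (\<Sum>n<N. a n * of_real (A n j)))\<^sup>2 \<le> (\<Sum>n<N. (cmod (a n))\<^sup>2 * A n j)" for j
  proof -
    \<comment> \<open>Splitting each entry into two square roots lets Cauchy-Schwarz separate the
      column sum from a weighted sum of |a n|^2.\<close>
    have "cmod (\<Sum>n<N. a n * of_real (A n j)) \<le> (\<Sum>n<N. (cmod (a n) * sqrt (A n j)) * sqrt (A n j))"
      using A0 by (intro order_trans[OF norm_sum] sum_mono) (simp add: norm_mult mult.assoc)
    then have "(cmod (\<Sum>n<N. a n * of_real (A n j)))\<^sup>2 \<le> (\<Sum>n<N. (cmod (a n) * sqrt (A n j)) * sqrt (A n j))\<^sup>2"
      by (intro power_mono) auto
    also have "\<dots> \<le> (\<Sum>n<N. (cmod (a n) * sqrt (A n j))\<^sup>2) * (\<Sum>n<N. (sqrt (A n j))\<^sup>2)"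
      by (rule Cauchy_Schwarz_ineq_sum)
    also have "\<dots> = (\<Sum>n<N. (cmod (a n))\<^sup>2 * A n j) * (\<Sum>n<N. A n j)"
      using A0 by (simp add: power_mult_distrib)
    finally have "s * (cmod (\<Sum>n<N. a n * of_real (A n j)))\<^sup>2 \<le> (\<Sum>n<N. (cmod (a n))\<^sup>2 * A n j) * (s * (\<Sum>n<N. A n j))"
      using assms(2) by (simp add: mult_left_mono ac_simps)
    also have "\<dots> \<le> (\<Sum>n<N. (cmod (a n))\<^sup>2 * A n j) * 1"
      using col A0 by (intro mult_left_mono sum_nonneg) auto
    finally show ?thesis by simp
  qed
  then have "s * (\<Sum>j<N. (cmod (\<Sum>n<N. a n * of_real (A n j)))\<^sup>2) \<le> (\<Sum>j<N. \<Sum>n<N. (cmod (a n))\<^sup>2 * A n j)"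
    unfolding sum_distrib_left by (rule sum_mono)
  also have "\<dots> = (\<Sum>n<N. (cmod (a n))\<^sup>2 * (\<Sum>j<N. A n j))"
    by (subst sum.swap) (simp add: sum_distrib_left)
  also have "\<dots> \<le> (\<Sum>n<N. (cmod (a n))\<^sup>2 * 1)" using row by (intro sum_mono mult_left_mono) auto
  finally show ?thesis by simp
qed

text \<open>On the image circle a polynomial in w is a polynomial in e^(i t), with coefficients
  given by the binomial matrix up to sign; Parseval reduces the integral to the matrix
  bound.\<close>

lemma horizontal_line_integral_finite:
  assumes "0 < y"
  shows "(\<integral>\<^sup>+x. ennreal ((cmod (\<Sum>n<N. a n * hbasis n (Complex x y)))\<^sup>2) \<partial>lborel) \<le> ennreal (\<Sum>n<N. (cmod (a n))\<^sup>2)"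
proof -
  \<comment> \<open>Radius s and centre c of the image circle, which is w = c - s e^(i t).\<close>
  define s where "s = 1 / (1 + y)"
  define c where "c = 1 - s"
  have cs: "0 \<le> c" "0 < s" "c + s = 1" using assms by (auto simp: c_def s_def)
  define K where "K = (\<lambda>w. \<Sum>n<N. a n * w ^ n)"
  define b where "b = (\<lambda>j. \<Sum>n<N. a n * of_real (real (n choose j) * c ^ (n - j) * s ^ j))"
  have K: "K (1 - (1 + cis t) / of_real (1 + y)) = (\<Sum>j<N. ((- 1) ^ j * b j) * cis (real j * t))" for t
  proof -
    have pw: "(of_real s * (- cis t)) ^ j = (- 1) ^ j * of_real s ^ j * cis (real j * t)" for j
    proof -
      have "of_real s * (- cis t) = (- 1) * of_real s * cis t" by simp
      then show ?thesis by (simp only: power_mult_distrib Complex.DeMoivre)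
    qed
    have w: "1 - (1 + cis t) / of_real (1 + y) = (of_real s * (- cis t)) + of_real c"
      by (simp add: c_def s_def divide_inverse algebra_simps)
    have "K (1 - (1 + cis t) / of_real (1 + y)) = (\<Sum>n<N. a n * (\<Sum>j\<le>n. of_nat (n choose j) * (of_real s * (- cis t)) ^ j * of_real c ^ (n - j)))"
      unfolding K_def w binomial_ring ..
    also have "\<dots> = (\<Sum>n<N. a n * (\<Sum>j<N. of_nat (n choose j) * (of_real s * (- cis t)) ^ j * of_real c ^ (n - j)))"
      by (intro sum.cong refl arg_cong2[where f = "(*)"] sum.mono_neutral_left) auto
    also have "\<dots> = (\<Sum>j<N. ((- 1) ^ j * b j) * cis (real j * t))"
      unfolding sum_distrib_left b_def sum_distrib_right
      by (subst sum.swap, intro sum.cong refl) (simp only: pw, simp add: ac_simps)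
    finally show ?thesis .
  qed
  have "(\<integral>\<^sup>+x. ennreal ((cmod (\<Sum>n<N. a n * hbasis n (Complex x y)))\<^sup>2) \<partial>lborel)
     = (\<integral>\<^sup>+t\<in>angles. ennreal (1 / (2 * pi * (1 + y)) * (cmod (K (1 - (1 + cis t) / of_real (1 + y))))\<^sup>2) \<partial>lborel)"
  proof (rule nn_integral_horizontal_line)
    have "continuous_on UNIV (\<lambda>x. \<Sum>n<N. a n * hbasis n (Complex x y))"
      using add_i_nonzero assms unfolding hbasis_def cayley_def Complex_eq
      by (intro continuous_intros) (auto simp: complex_eq_iff)
    then show "(\<lambda>x. \<Sum>n<N. a n * hbasis n (Complex x y)) \<in> borel_measurable borel"
      by (rule borel_measurable_continuous_onI)
    show "(\<Sum>n<N. a n * hbasis n (Complex x y)) = K (cayley (Complex x y)) / (of_real (sqrt pi) * (Complex x y + \<i>))" for x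
      by (simp add: K_def hbasis_def sum_divide_distrib)
  qed (use assms in auto)
  also have "\<dots> = ennreal (s / (2 * pi) * (2 * pi * (\<Sum>j<N. (cmod ((- 1) ^ j * b j))\<^sup>2)))"
  proof (rule nn_integral_angles)
    have "((\<lambda>t. s / (2 * pi) * (cmod (\<Sum>j<N. ((- 1) ^ j * b j) * cis (real j * t)))\<^sup>2) has_integral
       s / (2 * pi) * (2 * pi * (\<Sum>j<N. (cmod ((- 1) ^ j * b j))\<^sup>2))) {- pi..pi}"
      by (rule has_integral_mult_right[OF Parseval_finite])
    then show "((\<lambda>t. 1 / (2 * pi * (1 + y)) * (cmod (K (1 - (1 + cis t) / of_real (1 + y))))\<^sup>2) has_integral
       s / (2 * pi) * (2 * pi * (\<Sum>j<N. (cmod ((- 1) ^ j * b j))\<^sup>2))) {- pi..pi}"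
      unfolding K by (simp add: s_def field_simps)
  qed (use assms in auto)
  also have "\<dots> = ennreal (s * (\<Sum>j<N. (cmod (b j))\<^sup>2))"
    by (simp add: norm_mult norm_power)
  also have "\<dots> \<le> ennreal (\<Sum>n<N. (cmod (a n))\<^sup>2)"
    unfolding b_def by (intro ennreal_leI binomial_matrix_bound cs)
  finally show ?thesis .
qed

section \<open>Taylor coefficients in the Cayley coordinate\<close>

definition hdisc :: "(complex \<Rightarrow> complex) \<Rightarrow> complex \<Rightarrow> complex" where
  "hdisc h w = of_real (sqrt pi) * (inv_cayley w + \<i>) * h (inv_cayley w)"

definition hcoef :: "(complex \<Rightarrow> complex) \<Rightarrow> nat \<Rightarrow> complex" where
  "hcoef h n = (deriv ^^ n) (hdisc h) 0 / fact n"

lemma holomorphic_hdisc: assumes "h \<in> hol_uhp" shows "hdisc h holomorphic_on ball 0 1"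
proof -
  have "h \<circ> inv_cayley holomorphic_on ball 0 1"
    using assms inv_cayley_in_uhp by (intro holomorphic_on_compose_gen[OF holomorphic_inv_cayley, of _ uhp]) (auto simp: hol_uhp_def)
  then have "(\<lambda>w. of_real (sqrt pi) * (inv_cayley w + \<i>) * (h \<circ> inv_cayley) w) holomorphic_on ball 0 1"
    by (intro holomorphic_intros holomorphic_inv_cayley)
  then show ?thesis by (simp add: hdisc_def[abs_def])
qed

lemma hdisc_sums: assumes "h \<in> hol_uhp" "cmod w < 1" shows "(\<lambda>n. hcoef h n * w ^ n) sums hdisc h w"
  using holomorphic_power_series[OF holomorphic_hdisc[OF assms(1)], of w] assms(2) by (simp add: hcoef_def)

lemma hdisc_cayley: "z \<in> uhp \<Longrightarrow> h z = hdisc h (cayley z) / (of_real (sqrt pi) * (z + \<i>))"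
  using uhp_nonzero[of z] by (simp add: hdisc_def inv_cayley_cayley)

lemma hcoef_sums: assumes "h \<in> hol_uhp" "z \<in> uhp" shows "(\<lambda>n. hcoef h n * hbasis n z) sums h z"
  using sums_divide[OF hdisc_sums[OF assms(1) cmod_cayley_less_1[OF assms(2)]], of "of_real (sqrt pi) * (z + \<i>)"]
  unfolding hdisc_cayley[OF assms(2), of h, symmetric] by (simp add: hbasis_def)

lemma powser_unique:
  fixes c d :: "nat \<Rightarrow> complex"
  assumes "\<And>w. cmod w < 1 \<Longrightarrow> (\<lambda>n. c n * w ^ n) sums f w" "\<And>w. cmod w < 1 \<Longrightarrow> (\<lambda>n. d n * w ^ n) sums f w"
  shows "c = d"
proof (rule ext)
  define a where "a = (\<lambda>n. c n - d n)"
  have a: "(\<lambda>n. a n * (w - 0) ^ n) sums 0" if "cmod (w - 0) < 1" for w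
    using sums_diff[OF assms[of w]] that by (simp add: a_def algebra_simps)
  have "a m = 0" for m
  proof (rule ccontr)
    assume m: "a m \<noteq> 0"
    show False
    proof (cases "m = 0")
      case True
      then show False using a[of 0] m powser_sums_zero_iff[of a 0] by simp
    next
      case False
      show False
      proof (rule powser_0_nonzero[of 1 0 a "\<lambda>_. 0" m])
        show "(\<lambda>n. a n * (x - 0) ^ n) sums 0" if "norm (x - 0) < 1" for x using a that by blast
        fix s :: real assume "0 < s" "\<And>z::complex. z \<in> cball 0 s - {0} \<Longrightarrow> (0 :: complex) \<noteq> 0"
        from this(2)[of "of_real s"] this(1) show False by simp
      qed (use m False in auto)
    qed
  qed
  then show "c m = d m" for m by (simp add: a_def)
qed

lemma hcoef_unique:
  assumes "h \<in> hol_uhp" "\<And>z. z \<in> uhp \<Longrightarrow> (\<lambda>n. c n * hbasis n z) sums h z"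
  shows "hcoef h = c"
proof (rule powser_unique[where f = "hdisc h"])
  fix w :: complex assume w: "cmod w < 1"
  show "(\<lambda>n. hcoef h n * w ^ n) sums hdisc h w" by (rule hdisc_sums[OF assms(1) w])
  define z where "z = inv_cayley w"
  have z: "z \<in> uhp" "z + \<i> \<noteq> 0" "cayley z = w"
    using w inv_cayley_in_uhp[OF w] uhp_nonzero by (auto simp: z_def intro!: cayley_inv_cayley)
  show "(\<lambda>n. c n * w ^ n) sums hdisc h w"
    using sums_mult[OF assms(2)[OF z(1)], of "of_real (sqrt pi) * (z + \<i>)"] z(2,3)
    by (simp add: hdisc_def hbasis_def flip: z_def)
qed

lemma hol_uhp_add: "g \<in> hol_uhp \<Longrightarrow> h \<in> hol_uhp \<Longrightarrow> fadd g h \<in> hol_uhp"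
  by (auto simp: hol_uhp_def fadd_def intro!: holomorphic_intros)

lemma hol_uhp_scale: "g \<in> hol_uhp \<Longrightarrow> fscale c g \<in> hol_uhp"
  by (auto simp: hol_uhp_def fscale_def intro!: holomorphic_intros)

lemma hcoef_add: "g \<in> hol_uhp \<Longrightarrow> h \<in> hol_uhp \<Longrightarrow> hcoef (fadd g h) = (\<lambda>n. hcoef g n + hcoef h n)"
  by (rule hcoef_unique[OF hol_uhp_add]) (auto simp: fadd_def distrib_right intro!: sums_add hcoef_sums)

lemma hcoef_scale: "g \<in> hol_uhp \<Longrightarrow> hcoef (fscale c g) = (\<lambda>n. c * hcoef g n)"
  by (rule hcoef_unique[OF hol_uhp_scale]) (auto simp: fscale_def mult.assoc intro!: sums_mult hcoef_sums)

section \<open>The Hardy norm equals the coefficient norm\<close>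

lemma nn_integral_Fatou_le:
  assumes "\<And>n::nat. u n \<in> borel_measurable M" "\<And>x. x \<in> space M \<Longrightarrow> (\<lambda>n. u n x) \<longlonglongrightarrow> v x" "\<And>n. (\<integral>\<^sup>+x. u n x \<partial>M) \<le> B"
  shows "(\<integral>\<^sup>+x. v x \<partial>M) \<le> B"
proof -
  have "(\<integral>\<^sup>+x. v x \<partial>M) = (\<integral>\<^sup>+x. liminf (\<lambda>n. u n x) \<partial>M)"
    by (intro nn_integral_cong) (simp add: lim_imp_Liminf[OF _ assms(2)])
  also have "\<dots> \<le> liminf (\<lambda>n. \<integral>\<^sup>+x. u n x \<partial>M)"
    by (rule nn_integral_liminf) (rule assms(1))
  also have "\<dots> \<le> liminf (\<lambda>n. B)" by (rule Liminf_mono) (simp add: assms(3))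
  also have "\<dots> = B" by (simp add: Liminf_const)
  finally show ?thesis .
qed

text \<open>A radius between |r| and R gives the absolute convergence on the circle. Negative r is
  allowed, which amounts to a shift of the angle by pi.\<close>

lemma Parseval_disc:
  assumes "\<forall>w. cmod w < R \<longrightarrow> (\<lambda>n. c n * w ^ n) sums G w" "\<bar>r\<bar> < R"
  shows "(\<integral>\<^sup>+t\<in>angles. ennreal ((cmod (G (of_real r * cis t)))\<^sup>2) \<partial>lborel) = ennreal (2 * pi * (\<Sum>n. (cmod (c n))\<^sup>2 * r ^ (2 * n)))"
    and "summable (\<lambda>n. (cmod (c n))\<^sup>2 * r ^ (2 * n))"
proof -
  obtain q where q: "\<bar>r\<bar> < q" "q < R" using dense[OF assms(2)] by blast
  have "summable (\<lambda>n. c n * of_real q ^ n)" using assms(1)[rule_format, of "of_real q"] q by (auto simp: sums_iff)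
  from powser_insidea[OF this, of "of_real r"] q
  have s: "summable (\<lambda>n. cmod (c n * of_real r ^ n))" by simp
  have e: "(cmod (c n * of_real r ^ n))\<^sup>2 = (cmod (c n))\<^sup>2 * r ^ (2 * n)" for n
    by (simp add: norm_mult norm_power power_mult_distrib power_mult[symmetric] power_even_abs mult.commute)
  have "(\<Sum>n. (c n * of_real r ^ n) * cis (real n * t)) = G (of_real r * cis t)" for t
    using assms(1)[rule_format, of "of_real r * cis t"] assms(2)
    by (simp add: norm_mult power_mult_distrib Complex.DeMoivre sums_iff mult.assoc)
  then show "(\<integral>\<^sup>+t\<in>angles. ennreal ((cmod (G (of_real r * cis t)))\<^sup>2) \<partial>lborel) = ennreal (2 * pi * (\<Sum>n. (cmod (c n))\<^sup>2 * r ^ (2 * n)))"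
    using Parseval_circle(1)[OF s] by (simp only: e)
  show "summable (\<lambda>n. (cmod (c n))\<^sup>2 * r ^ (2 * n))" using Parseval_circle(2)[OF s] by (simp only: e)
qed

text \<open>The partial sums satisfy the bound on every horizontal line, and Fatou's lemma passes it
  to h.\<close>

lemma hardy_norm_sq_le:
  assumes "h \<in> hol_uhp" "l2 (hcoef h)"
  shows "hardy_norm_sq h \<le> ennreal ((l2norm (hcoef h))\<^sup>2)"
  unfolding hardy_norm_sq_def
proof (rule SUP_least)
  fix y :: real assume "y \<in> {0<..}"
  then have y: "0 < y" by simp
  show "(\<integral>\<^sup>+x. ennreal ((cmod (h (Complex x y)))\<^sup>2) \<partial>lborel) \<le> ennreal ((l2norm (hcoef h))\<^sup>2)"
  proof (rule nn_integral_Fatou_le)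
    fix x
    have "(\<lambda>N. \<Sum>n<N. hcoef h n * hbasis n (Complex x y)) \<longlonglongrightarrow> h (Complex x y)"
      using hcoef_sums[OF assms(1), of "Complex x y"] y by (simp add: sums_def uhp_def)
    then show "(\<lambda>N. ennreal ((cmod (\<Sum>n<N. hcoef h n * hbasis n (Complex x y)))\<^sup>2)) \<longlonglongrightarrow> ennreal ((cmod (h (Complex x y)))\<^sup>2)"
      by (intro tendsto_intros)
  next
    fix N
    have "continuous_on UNIV (\<lambda>x. \<Sum>n<N. hcoef h n * hbasis n (Complex x y))"
      using add_i_nonzero y unfolding hbasis_def cayley_def Complex_eq
      by (intro continuous_intros) (auto simp: complex_eq_iff)
    then have "(\<lambda>x. \<Sum>n<N. hcoef h n * hbasis n (Complex x y)) \<in> borel_measurable borel"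
      by (rule borel_measurable_continuous_onI)
    then show "(\<lambda>x. ennreal ((cmod (\<Sum>n<N. hcoef h n * hbasis n (Complex x y)))\<^sup>2)) \<in> borel_measurable lborel"
      by measurable
    have "(\<Sum>n<N. (cmod (hcoef h n))\<^sup>2) \<le> (l2norm (hcoef h))\<^sup>2"
      unfolding l2norm_sq using assms(2) by (intro finite_sum_le_infsum) (auto simp: l2_def)
    then show "(\<integral>\<^sup>+x. ennreal ((cmod (\<Sum>n<N. hcoef h n * hbasis n (Complex x y)))\<^sup>2) \<partial>lborel) \<le> ennreal ((l2norm (hcoef h))\<^sup>2)"
      by (intro order_trans[OF horizontal_line_integral_finite[OF y]] ennreal_leI)
  qed
qed

text \<open>On the disc of radius R = Im z about z the integral of |h|^2 is at most 2 R S, by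
  slicing into horizontal lines, and at least pi R^2 |h z|^2, by Parseval on each circle truncated
  to the constant term.\<close>

lemma hardy_pointwise_bound:
  assumes h: "h \<in> hol_uhp" and S: "\<And>y. 0 < y \<Longrightarrow> (\<integral>\<^sup>+x. ennreal ((cmod (h (Complex x y)))\<^sup>2) \<partial>lborel) \<le> ennreal S"
    and z: "z \<in> uhp" and S0: "0 \<le> S"
  shows "(cmod (h z))\<^sup>2 \<le> 2 * S / (pi * Im z)"
proof -
  define R where "R = Im z"
  have R: "0 < R" using z by (simp add: R_def uhp_def)
  have [measurable]: "ball (0 :: complex) R \<in> sets borel" by (rule borel_open) simp
  note hm[measurable] = borel_measurable_hol_uhp[OF h]
  have "continuous_on UNIV (\<lambda>w. z + w)" by (intro continuous_intros)
  from measurable_compose[OF borel_measurable_continuous_onI[OF this] hm]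
  have "(\<lambda>w. h (z + w)) \<in> borel_measurable borel" by simp
  then have fm: "(\<lambda>w. (cmod (h (z + w)))\<^sup>2) \<in> borel_measurable borel" by measurable
  have up: "(\<integral>\<^sup>+w\<in>ball 0 R. ennreal ((cmod (h (z + w)))\<^sup>2) \<partial>lborel) \<le> ennreal (2 * R * S)"
  proof -
    have "(\<integral>\<^sup>+w\<in>ball 0 R. ennreal ((cmod (h (z + w)))\<^sup>2) \<partial>lborel)
       = (\<integral>\<^sup>+y. \<integral>\<^sup>+x. ennreal ((cmod (h (z + Complex x y)))\<^sup>2) * indicator (ball 0 R) (Complex x y) \<partial>lborel \<partial>lborel)"
      by (rule nn_integral_complex_Fubini(2)) (use fm in measurable)
    also have "\<dots> \<le> (\<integral>\<^sup>+y. ennreal S * indicator {- R<..<R} y \<partial>lborel)"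
    proof (rule nn_integral_mono)
      fix y :: real
      show "(\<integral>\<^sup>+x. ennreal ((cmod (h (z + Complex x y)))\<^sup>2) * indicator (ball 0 R) (Complex x y) \<partial>lborel) \<le> ennreal S * indicator {- R<..<R} y"
      proof (cases "y \<in> {- R<..<R}")
        case True
        then have y: "0 < Im z + y" by (simp add: R_def)
        have "(\<integral>\<^sup>+x. ennreal ((cmod (h (z + Complex x y)))\<^sup>2) * indicator (ball 0 R) (Complex x y) \<partial>lborel)
           \<le> (\<integral>\<^sup>+x. ennreal ((cmod (h (Complex (Re z + 1 * x) (Im z + y))))\<^sup>2) \<partial>lborel)"
          by (intro nn_integral_mono) (auto simp: indicator_def plus_complex.code complex_eq_iff intro!: ennreal_leI arg_cong[of _ _ h] simp flip: Complex_eq)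
        also have "\<dots> = (\<integral>\<^sup>+x. ennreal ((cmod (h (Complex x (Im z + y))))\<^sup>2) \<partial>lborel)"
          using measurable_compose[OF borel_measurable_Complex hm]
          by (subst nn_integral_real_affine[where c = 1 and t = "Re z"]) auto
        also have "\<dots> \<le> ennreal S" by (rule S[OF y])
        finally show ?thesis using True by simp
      next
        case False
        have "Complex x y \<notin> ball 0 R" for x
          using abs_Im_le_cmod[of "Complex x y"] False by auto
        then show ?thesis by (simp add: indicator_def)
      qed
    qed
    also have "\<dots> = ennreal S * ennreal (2 * R)"
      using R by (subst nn_integral_cmult_indicator) auto
    also have "\<dots> = ennreal (2 * R * S)" using R S0 by (simp add: ennreal_mult[symmetric] mult.commute)
    finally show ?thesis .
  qed
  have low: "(\<integral>\<^sup>+w\<in>ball 0 R. ennreal ((cmod (h (z + w)))\<^sup>2) \<partial>lborel) \<ge> ennreal (pi * (cmod (h z))\<^sup>2 * R\<^sup>2)"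
  proof -
    define G where "G = (\<lambda>w. h (z + w))"
    define c where "c = (\<lambda>n. (deriv ^^ n) G 0 / fact n)"
    have G: "G holomorphic_on ball 0 R"
    proof -
      have "z + w \<in> uhp" if "w \<in> ball 0 R" for w
        using that abs_Im_le_cmod[of w] by (auto simp: uhp_def R_def)
      then have "(\<lambda>w. z + w) ` ball 0 R \<subseteq> uhp" by blast
      moreover have "(\<lambda>w. z + w) holomorphic_on ball 0 R" by (intro holomorphic_intros)
      moreover have "h holomorphic_on uhp" using h by (simp add: hol_uhp_def)
      ultimately have "h \<circ> (\<lambda>w. z + w) holomorphic_on ball 0 R" by (metis holomorphic_on_compose_gen)
      then show ?thesis by (simp add: G_def o_def)
    qed
    have c: "\<forall>w. cmod w < R \<longrightarrow> (\<lambda>n. c n * w ^ n) sums G w"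
      using holomorphic_power_series[OF G] by (simp add: c_def)
    have "ennreal (pi * (cmod (h z))\<^sup>2 * R\<^sup>2) = (\<integral>\<^sup>+s\<in>{0<..<R\<^sup>2}. ennreal (pi * (cmod (h z))\<^sup>2) \<partial>lborel)"
      by (subst nn_integral_cmult_indicator) (auto simp: ennreal_mult)
    also have "\<dots> = (\<integral>\<^sup>+x\<in>{..<ln R}. ennreal (2 * exp (2 * x) * (pi * (cmod (h z))\<^sup>2)) \<partial>lborel)"
      by (rule nn_integral_exp_double[OF _ _ R, of "\<lambda>_. pi * (cmod (h z))\<^sup>2"]) auto
    also have "\<dots> \<le> (\<integral>\<^sup>+x\<in>{..<ln R}. (\<integral>\<^sup>+t\<in>angles. ennreal (exp (2 * x) * (cmod (h (z + of_real (exp x) * cis t)))\<^sup>2) \<partial>lborel) \<partial>lborel)"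
    proof (rule nn_integral_mono)
      fix x :: real
      show "ennreal (2 * exp (2 * x) * (pi * (cmod (h z))\<^sup>2)) * indicator {..<ln R} x
        \<le> (\<integral>\<^sup>+t\<in>angles. ennreal (exp (2 * x) * (cmod (h (z + of_real (exp x) * cis t)))\<^sup>2) \<partial>lborel) * indicator {..<ln R} x"
      proof (cases "x < ln R")
        case True
        then have "exp x < exp (ln R)" by simp
        then have x: "\<bar>exp x\<bar> < R" using R by simp
        note P = Parseval_disc[of R c G "exp x", OF c x]
        have "c 0 = h z" by (simp add: c_def G_def)
        then have "(cmod (h z))\<^sup>2 \<le> (\<Sum>n. (cmod (c n))\<^sup>2 * exp x ^ (2 * n))"
          using sum_le_suminf[OF P(2), of "{0}"] by simp
        then have "ennreal (exp (2 * x)) * ennreal (2 * pi * (cmod (h z))\<^sup>2)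
           \<le> ennreal (exp (2 * x)) * (\<integral>\<^sup>+t\<in>angles. ennreal ((cmod (G (of_real (exp x) * cis t)))\<^sup>2) \<partial>lborel)"
          unfolding P(1) by (intro mult_left_mono ennreal_leI) auto
        also have "\<dots> = (\<integral>\<^sup>+t. ennreal (exp (2 * x)) * (ennreal ((cmod (G (of_real (exp x) * cis t)))\<^sup>2) * indicator angles t) \<partial>lborel)"
        proof (rule nn_integral_cmult[symmetric])
          have "continuous_on UNIV (\<lambda>t. of_real (exp x) * cis t)" by (intro continuous_intros)
          from measurable_compose[OF borel_measurable_continuous_onI[OF this] fm]
          show "(\<lambda>t. ennreal ((cmod (G (of_real (exp x) * cis t)))\<^sup>2) * indicator angles t) \<in> borel_measurable lborel"
            unfolding G_def by measurable
        qed
        also have "\<dots> = (\<integral>\<^sup>+t\<in>angles. ennreal (exp (2 * x) * (cmod (h (z + of_real (exp x) * cis t)))\<^sup>2) \<partial>lborel)"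
          by (intro nn_integral_cong) (simp add: G_def ennreal_mult mult.assoc)
        finally show ?thesis using True by (simp add: ennreal_mult[symmetric] ac_simps)
      qed simp
    qed
    also have "\<dots> = (\<integral>\<^sup>+w\<in>ball 0 R. ennreal ((cmod (h (z + w)))\<^sup>2) \<partial>lborel)"
      by (rule nn_integral_polar[OF fm _ R, symmetric]) simp
    finally show ?thesis .
  qed
  have "ennreal (pi * (cmod (h z))\<^sup>2 * R\<^sup>2) \<le> ennreal (2 * R * S)" using low up by (rule order_trans)
  then have "pi * (cmod (h z))\<^sup>2 * R\<^sup>2 \<le> 2 * R * S" using R S0 by (subst (asm) ennreal_le_iff) auto
  then have "R * (pi * R * (cmod (h z))\<^sup>2) \<le> R * (2 * S)" by (simp add: power2_eq_square ac_simps)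
  then have "pi * R * (cmod (h z))\<^sup>2 \<le> 2 * S" using R by simp
  then show ?thesis using R by (simp add: R_def field_simps)
qed


text \<open>The damping factor 1 / (1 - i d z) has modulus at most 1, so it costs nothing on a line,
  and at most 1 / (d |z + i|), which compensates the factor z + i of the disc picture.\<close>

lemma damping_factor_bound:
  assumes "0 \<le> Im z" "0 < d" "d \<le> 1"
  shows "d * cmod (z + \<i>) \<le> cmod (1 - \<i> * of_real d * z)" "1 \<le> cmod (1 - \<i> * of_real d * z)"
proof -
  have e: "1 - \<i> * of_real d * z = - \<i> * of_real d * (z + \<i> / of_real d)"
    using assms(2) by (simp add: field_simps)
  have "(cmod (z + \<i>))\<^sup>2 \<le> (cmod (z + \<i> / of_real d))\<^sup>2"
  proof -
    have "1 \<le> 1 / d" using assms by simp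
    then have "(Im z + 1)\<^sup>2 \<le> (Im z + 1 / d)\<^sup>2" using assms by (intro power_mono) auto
    then show ?thesis by (simp add: cmod_power2 Im_divide_of_real)
  qed
  then have "cmod (z + \<i>) \<le> cmod (z + \<i> / of_real d)" by (rule power2_le_imp_le) simp
  then show "d * cmod (z + \<i>) \<le> cmod (1 - \<i> * of_real d * z)"
    using assms(2) unfolding e by (simp add: norm_mult)
  have "1 \<le> Re (1 - \<i> * of_real d * z)" using assms by simp
  also have "\<dots> \<le> cmod (1 - \<i> * of_real d * z)" by (rule complex_Re_le_cmod)
  finally show "1 \<le> cmod (1 - \<i> * of_real d * z)" .
qed

lemma disc_subset: "cmod w < 1 \<Longrightarrow> w \<in> cball 0 1 - {1}"
  by auto

lemma continuous_on_inv_cayley: "continuous_on (- {1}) inv_cayley"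
  unfolding inv_cayley_def by (intro continuous_intros) auto

text \<open>The damping factor \<open>1 / (1 - i d z)\<close> makes the translate \<open>h (z + i d)\<close> correspond to a bounded
  function on the closed disc without the point \<open>1\<close>, so that circles of radius \<open>r < 1\<close> may be compared with the unit circle.\<close>

lemma damped_circle_bound:
  assumes h: "h \<in> hol_uhp" and S: "\<And>y. 0 < y \<Longrightarrow> (\<integral>\<^sup>+x. ennreal ((cmod (h (Complex x y)))\<^sup>2) \<partial>lborel) \<le> ennreal S"
    and S0: "0 \<le> S" and d: "0 < d" "d \<le> 1" and r: "0 \<le> r" "r < 1"
  defines "K \<equiv> \<lambda>w. of_real (sqrt pi) * (inv_cayley w + \<i>) * (h (inv_cayley w + \<i> * of_real d) / (1 - \<i> * of_real d * inv_cayley w))"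
  shows "(\<integral>\<^sup>+t\<in>angles. ennreal ((cmod (K (of_real (- r) * cis t)))\<^sup>2) \<partial>lborel) \<le> ennreal (2 * pi * S)"
proof -
  \<comment> \<open>The pointwise bound at height at least d, times the bound 1 / d for the damped
    factor z + i, times the normalisation sqrt pi.\<close>
  define B where "B = sqrt pi * sqrt (2 * S / (pi * d)) / d"
  have hc: "continuous_on uhp h" using h by (auto simp: hol_uhp_def intro: holomorphic_on_imp_continuous_on)
  have Im: "0 \<le> Im (inv_cayley w)" if "w \<noteq> 1" "cmod w \<le> 1" for w
    using that by (simp add: Im_inv_cayley abs_square_le_1)
  have up: "inv_cayley w + \<i> * of_real d \<in> uhp" if "w \<noteq> 1" "cmod w \<le> 1" for w
    using Im[OF that] d by (simp add: uhp_def)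
  have nz: "1 - \<i> * of_real d * inv_cayley w \<noteq> 0" if "w \<noteq> 1" "cmod w \<le> 1" for w
    using damping_factor_bound(2)[OF Im[OF that] d] by auto
  have KB: "cmod (K w) \<le> B" if w: "w \<noteq> 1" "cmod w \<le> 1" for w
  proof -
    define z where "z = inv_cayley w"
    have z: "0 \<le> Im z" using Im[OF w] by (simp add: z_def)
    have "(cmod (h (z + \<i> * of_real d)))\<^sup>2 \<le> 2 * S / (pi * Im (z + \<i> * of_real d))"
      using up[OF w] by (intro hardy_pointwise_bound h S S0) (auto simp: z_def)
    also have "\<dots> \<le> 2 * S / (pi * d)" using z d S0 by (intro divide_left_mono mult_left_mono) auto
    finally have "cmod (h (z + \<i> * of_real d)) \<le> sqrt (2 * S / (pi * d))" by (rule real_le_rsqrt)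
    moreover have "cmod (z + \<i>) / cmod (1 - \<i> * of_real d * z) \<le> 1 / d"
      using damping_factor_bound[OF z d] d by (simp add: field_simps) (smt (verit) divide_le_eq_1 mult.commute)
    ultimately have "sqrt pi * cmod (h (z + \<i> * of_real d)) * (cmod (z + \<i>) / cmod (1 - \<i> * of_real d * z))
        \<le> sqrt pi * sqrt (2 * S / (pi * d)) * (1 / d)"
      using S0 d by (intro mult_mono mult_nonneg_nonneg) auto
    then show ?thesis by (simp add: K_def B_def z_def norm_mult norm_divide ac_simps)
  qed
  have Kc: "continuous_on (cball 0 1 - {1}) K"
  proof -
    have ic: "continuous_on (cball 0 1 - {1}) inv_cayley" by (rule continuous_on_subset[OF continuous_on_inv_cayley]) auto
    have "(\<lambda>w. inv_cayley w + \<i> * of_real d) ` (cball 0 1 - {1}) \<subseteq> uhp" by (auto intro!: up)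
    then have "continuous_on (cball 0 1 - {1}) (\<lambda>w. h (inv_cayley w + \<i> * of_real d))"
      by (intro continuous_on_compose2[OF hc] continuous_intros ic) 
    moreover have "\<forall>w\<in>cball 0 1 - {1}. 1 - \<i> * of_real d * inv_cayley w \<noteq> 0" using nz by (metis DiffE dist_0_norm insertI1 mem_cball)
    ultimately show ?thesis unfolding K_def by (intro continuous_intros ic) 
  qed
  have Kh: "K holomorphic_on ball 0 1"
  proof -
    have b: "w \<noteq> 1" "cmod w \<le> 1" if "w \<in> ball 0 1" for w :: complex using that by auto
    have "(\<lambda>w. inv_cayley w + \<i> * of_real d) ` ball 0 1 \<subseteq> uhp" using up b by blast
    moreover have "(\<lambda>w. inv_cayley w + \<i> * of_real d) holomorphic_on ball 0 1"
      by (intro holomorphic_intros holomorphic_inv_cayley)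
    moreover have "h holomorphic_on uhp" using h by (simp add: hol_uhp_def)
    ultimately have "h \<circ> (\<lambda>w. inv_cayley w + \<i> * of_real d) holomorphic_on ball 0 1" by (metis holomorphic_on_compose_gen)
    then have "(\<lambda>w. of_real (sqrt pi) * (inv_cayley w + \<i>) * ((h \<circ> (\<lambda>w. inv_cayley w + \<i> * of_real d)) w / (1 - \<i> * of_real d * inv_cayley w))) holomorphic_on ball 0 1"
    proof (intro holomorphic_intros holomorphic_inv_cayley)
      show "1 - \<i> * of_real d * inv_cayley w \<noteq> 0" if "w \<in> ball 0 1" for w by (rule nz[OF b[OF that]])
    qed
    then show ?thesis by (simp add: K_def)
  qed
  define c where "c = (\<lambda>n. (deriv ^^ n) K 0 / fact n)"
  have c: "\<forall>w. cmod w < 1 \<longrightarrow> (\<lambda>n. c n * w ^ n) sums K w"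
    using holomorphic_power_series[OF Kh] by (simp add: c_def)
  \<comment> \<open>Radii that increase from r to 1.\<close>
  define q where "q = (\<lambda>k. 1 - (1 - r) / real (Suc k))"
  have q: "r \<le> q k" "q k < 1" "0 \<le> q k" for k
  proof -
    have "(1 - r) / real (Suc k) \<le> (1 - r) / 1" using r by (intro divide_left_mono) auto
    then have 1: "(1 - r) / real (Suc k) \<le> 1 - r" by (simp only: div_by_1)
    have 2: "0 < (1 - r) / real (Suc k)" using r by simp
    show "r \<le> q k" unfolding q_def using 1 by linarith
    then show "0 \<le> q k" using r by linarith
    show "q k < 1" unfolding q_def using 2 by linarith
  qed
  have qlim: "q \<longlonglongrightarrow> 1"
  proof -
    have "(\<lambda>k. 1 - (1 - r) * inverse (real (Suc k))) \<longlonglongrightarrow> 1 - (1 - r) * 0"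
      by (intro tendsto_intros LIMSEQ_inverse_real_of_nat)
    then show ?thesis by (simp add: q_def divide_inverse)
  qed
  \<comment> \<open>The sign matches the parametrisation of the real line, whose point with angle t
    goes to - e^(i t).\<close>
  define u where "u = (\<lambda>k t. ennreal ((cmod (K (of_real (- q k) * cis t)))\<^sup>2) * indicator angles t)"
  define u' where "u' = (\<lambda>t. ennreal ((cmod (K (- cis t)))\<^sup>2) * indicator angles t)"
  have cis1: "- cis t \<noteq> 1" if "t \<in> angles" for t
  proof
    assume "- cis t = 1"
    then have "cos t = - 1" by (simp add: complex_eq_iff)
    have "cos (t / 2) > 0" using that by (intro cos_gt_zero_pi) auto
    moreover have "cos t = 2 * (cos (t / 2))\<^sup>2 - 1" using cos_double_cos[of "t / 2"] by simp
    ultimately show False using \<open>cos t = - 1\<close> by simp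
  qed
  have ulim: "(\<lambda>k. u k t) \<longlonglongrightarrow> u' t" for t
  proof (cases "t \<in> angles")
    case True
    have "(\<lambda>k. K (of_real (- q k) * cis t)) \<longlonglongrightarrow> K (- cis t)"
    proof (rule continuous_on_tendsto_compose[OF Kc])
      have "(\<lambda>k. of_real (- q k) * cis t) \<longlonglongrightarrow> of_real (- 1) * cis t"
        by (intro tendsto_intros qlim)
      then show "(\<lambda>k. of_real (- q k) * cis t) \<longlonglongrightarrow> - cis t" by simp
      show "- cis t \<in> cball 0 1 - {1}" using cis1[OF True] by simp
      have "cmod (of_real (- q k) * cis t) < 1" for k using q[of k] by (simp add: norm_mult)
      from disc_subset[OF this]
      show "\<forall>\<^sub>F k in sequentially. of_real (- q k) * cis t \<in> cball 0 1 - {1}"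
        by (intro always_eventually allI)
    qed
    then show ?thesis using True by (auto simp: u_def u'_def intro!: tendsto_intros)
  qed (simp add: u_def u'_def)
  have um: "u k \<in> borel_measurable lborel" for k
  proof -
    have "continuous_on UNIV (\<lambda>t. K (of_real (- q k) * cis t))"
      using q[of k] by (intro continuous_on_compose2[OF holomorphic_on_imp_continuous_on[OF Kh]] continuous_intros) (auto simp: norm_mult)
    from borel_measurable_continuous_onI[OF this] show ?thesis unfolding u_def by measurable
  qed
  have um': "u' \<in> borel_measurable lborel"
    by (rule borel_measurable_LIMSEQ_order[OF ulim um])
  have "(\<lambda>k. \<integral>\<^sup>+t. u k t \<partial>lborel) \<longlonglongrightarrow> (\<integral>\<^sup>+t. u' t \<partial>lborel)"
  \<comment> \<open>A constant dominates: \<open>K\<close> is bounded by \<open>B\<close> on the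
    closed disc without 1, and the angles avoid that point.\<close>
  proof (rule nn_integral_dominated_convergence[where w = "\<lambda>t. ennreal (B\<^sup>2) * indicator angles t"])
    have "cmod (of_real (- q k) * cis t) < 1" for k t using q[of k] by (simp add: norm_mult)
    from disc_subset[OF this] have "cmod (K (of_real (- q k) * cis t)) \<le> B" for k t
      by (intro KB) (simp_all only: Diff_iff mem_cball_0 insert_iff empty_iff simp_thms)
    then show "AE t in lborel. u k t \<le> ennreal (B\<^sup>2) * indicator angles t" for k
      by (auto simp: u_def indicator_def intro!: AE_I2 ennreal_leI power_mono)
    have "(\<integral>\<^sup>+t. ennreal (B\<^sup>2) * indicator angles t \<partial>lborel) = ennreal (B\<^sup>2) * ennreal (2 * pi)"
      by (subst nn_integral_cmult_indicator) auto
    then show "(\<integral>\<^sup>+t. ennreal (B\<^sup>2) * indicator angles t \<partial>lborel) < \<infinity>"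
      by (simp add: ennreal_mult_less_top)
  qed (use um um' ulim in auto)
  \<comment> \<open>Circle means grow with the radius, because the Parseval series has nonnegative
    terms.\<close>
  moreover have "(\<integral>\<^sup>+t\<in>angles. ennreal ((cmod (K (of_real (- r) * cis t)))\<^sup>2) \<partial>lborel) \<le> (\<integral>\<^sup>+t. u k t \<partial>lborel)" for k
  proof -
    have r': "\<bar>- r\<bar> < 1" "\<bar>- q k\<bar> < 1" using r q[of k] by auto
    note P = Parseval_disc[of 1 c K, OF c r'(1)] and Q = Parseval_disc[of 1 c K, OF c r'(2)]
    have "(- r) ^ (2 * n) \<le> (- q k) ^ (2 * n)" for n using q[of k] r by (simp add: power_mono)
    then have "(cmod (c n))\<^sup>2 * (- r) ^ (2 * n) \<le> (cmod (c n))\<^sup>2 * (- q k) ^ (2 * n)" for n by (intro mult_left_mono) auto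
    from suminf_le[OF this P(2) Q(2)] show ?thesis unfolding u_def P(1) Q(1)
      by (intro ennreal_leI mult_left_mono) auto
  qed
  ultimately have le: "(\<integral>\<^sup>+t\<in>angles. ennreal ((cmod (K (of_real (- r) * cis t)))\<^sup>2) \<partial>lborel) \<le> (\<integral>\<^sup>+t. u' t \<partial>lborel)"
    by (intro LIMSEQ_le_const) auto
  define g where "g = (\<lambda>z. h (z + \<i> * of_real d) / (1 - \<i> * of_real d * z))"
  have "(\<integral>\<^sup>+x. ennreal ((cmod (g (Complex x 0)))\<^sup>2) \<partial>lborel)
    = (\<integral>\<^sup>+t\<in>angles. ennreal (1 / (2 * pi * (1 + 0)) * (cmod (K (1 - (1 + cis t) / of_real (1 + 0))))\<^sup>2) \<partial>lborel)"
  proof (rule nn_integral_horizontal_line)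
    have "continuous_on UNIV (\<lambda>x. h (Complex x 0 + \<i> * of_real d) / (1 - \<i> * of_real d * Complex x 0))"
      using d unfolding Complex_eq
      by (intro continuous_intros continuous_on_compose2[OF hc]) (auto simp: uhp_def complex_eq_iff)
    then show "(\<lambda>x. g (Complex x 0)) \<in> borel_measurable borel" unfolding g_def by (rule borel_measurable_continuous_onI)
    show "g (Complex x 0) = K (cayley (Complex x 0)) / (of_real (sqrt pi) * (Complex x 0 + \<i>))" for x
    proof -
      have "Complex x 0 + \<i> \<noteq> 0" by (simp add: complex_eq_iff)
      then show ?thesis by (simp add: K_def g_def inv_cayley_cayley)
    qed
  qed simp
  also have "\<dots> = (\<integral>\<^sup>+t. ennreal (1 / (2 * pi)) * u' t \<partial>lborel)"
    by (intro nn_integral_cong) (simp add: u'_def ennreal_mult[symmetric] mult.assoc[symmetric] flip: ennreal_mult)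
  also have "\<dots> = ennreal (1 / (2 * pi)) * (\<integral>\<^sup>+t. u' t \<partial>lborel)"
    by (rule nn_integral_cmult[OF um'])
  finally have e: "ennreal (2 * pi) * (\<integral>\<^sup>+x. ennreal ((cmod (g (Complex x 0)))\<^sup>2) \<partial>lborel) = (\<integral>\<^sup>+t. u' t \<partial>lborel)"
    by (simp add: mult.assoc[symmetric] flip: ennreal_mult)
  have "(\<integral>\<^sup>+x. ennreal ((cmod (g (Complex x 0)))\<^sup>2) \<partial>lborel) \<le> (\<integral>\<^sup>+x. ennreal ((cmod (h (Complex x d)))\<^sup>2) \<partial>lborel)"
  proof (intro nn_integral_mono ennreal_leI power_mono)
    fix x
    \<comment> \<open>The translation moves the real line to height d, where the integral of |h|^2
      is bounded by hypothesis.\<close>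
    have "Complex x 0 + \<i> * of_real d = Complex x d" by (simp add: complex_eq_iff)
    then have "cmod (g (Complex x 0)) = cmod (h (Complex x d)) / cmod (1 - \<i> * of_real d * Complex x 0)"
      by (simp add: g_def norm_divide)
    also have "\<dots> \<le> cmod (h (Complex x d)) / 1"
      using damping_factor_bound(2)[of "Complex x 0" d] d by (intro divide_left_mono) auto
    finally show "cmod (g (Complex x 0)) \<le> cmod (h (Complex x d))" by simp
  qed simp
  also have "\<dots> \<le> ennreal S" by (rule S[OF d(1)])
  finally have "(\<integral>\<^sup>+t. u' t \<partial>lborel) \<le> ennreal (2 * pi) * ennreal S"
    unfolding e[symmetric] by (rule mult_left_mono) simp
  also have "\<dots> = ennreal (2 * pi * S)" using S0 by (simp add: ennreal_mult)
  finally show ?thesis using le by (rule order_trans[rotated])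
qed

text \<open>At a fixed radius r the damping is removed by Fatou as d tends to 0; afterwards r tends
  to 1 inside a finite sum.\<close>

lemma hcoef_partial_sum_le:
  assumes h: "h \<in> hol_uhp" and S: "\<And>y. 0 < y \<Longrightarrow> (\<integral>\<^sup>+x. ennreal ((cmod (h (Complex x y)))\<^sup>2) \<partial>lborel) \<le> ennreal S"
    and S0: "0 \<le> S"
  shows "(\<Sum>n<N. (cmod (hcoef h n))\<^sup>2) \<le> S"
proof -
  have hc: "continuous_on uhp h" using h by (auto simp: hol_uhp_def intro: holomorphic_on_imp_continuous_on)
  have r: "(\<Sum>n<N. (cmod (hcoef h n))\<^sup>2 * r ^ (2 * n)) \<le> S" if r: "0 \<le> r" "r < 1" for r
  proof -
    define K where "K = (\<lambda>d w. of_real (sqrt pi) * (inv_cayley w + \<i>) * (h (inv_cayley w + \<i> * of_real d) / (1 - \<i> * of_real d * inv_cayley w)))"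
    define d where "d = (\<lambda>j. inverse (real (Suc j)))"
    have d: "0 < d j" "d j \<le> 1" for j by (auto simp: d_def inverse_eq_divide)
    have dl: "d \<longlonglongrightarrow> 0" unfolding d_def by (rule LIMSEQ_inverse_real_of_nat)
    have in_disc: "cmod (of_real (- r) * cis t) < 1" for t using r by (simp add: norm_mult)
    have "(\<integral>\<^sup>+t. ennreal ((cmod (hdisc h (of_real (- r) * cis t)))\<^sup>2) * indicator angles t \<partial>lborel) \<le> ennreal (2 * pi * S)"
    proof (rule nn_integral_Fatou_le)
      show "(\<integral>\<^sup>+t. ennreal ((cmod (K (d j) (of_real (- r) * cis t)))\<^sup>2) * indicator angles t \<partial>lborel) \<le> ennreal (2 * pi * S)" for j
        unfolding K_def by (rule damped_circle_bound[OF h S S0 d r])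
      have ic: "continuous_on UNIV (\<lambda>t. inv_cayley (of_real (- r) * cis t))"
      proof (rule continuous_on_compose2[OF continuous_on_inv_cayley])
        show "range (\<lambda>t. of_real (- r) * cis t) \<subseteq> - {1}"
          using disc_subset[OF in_disc] by (intro image_subsetI) (simp only: Diff_iff Compl_iff simp_thms)
      qed (intro continuous_intros)
      have "continuous_on UNIV (\<lambda>t. K (d j) (of_real (- r) * cis t))" for j
        unfolding K_def
      proof (intro continuous_intros ic continuous_on_compose2[OF hc])
        show "(\<lambda>t. inv_cayley (of_real (- r) * cis t) + \<i> * of_real (d j)) ` UNIV \<subseteq> uhp"
          using inv_cayley_in_uhp[OF in_disc] d[of j] by (auto simp: uhp_def add_pos_pos)
        show "\<forall>t\<in>UNIV. 1 - \<i> * of_real (d j) * inv_cayley (of_real (- r) * cis t) \<noteq> 0"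
        proof
          fix t
          have "0 \<le> Im (inv_cayley (of_real (- r) * cis t))" using inv_cayley_in_uhp[OF in_disc[of t]] by (simp add: uhp_def)
          from damping_factor_bound(2)[OF this d[of j]] show "1 - \<i> * of_real (d j) * inv_cayley (of_real (- r) * cis t) \<noteq> 0" by auto
        qed
      qed
      from borel_measurable_continuous_onI[OF this]
      show "(\<lambda>t. ennreal ((cmod (K (d j) (of_real (- r) * cis t)))\<^sup>2) * indicator angles t) \<in> borel_measurable lborel" for j
        by measurable
      fix t
      define z where "z = inv_cayley (of_real (- r) * cis t)"
      have z: "z \<in> uhp" unfolding z_def by (rule inv_cayley_in_uhp[OF in_disc])
      have "(\<lambda>j. h (z + \<i> * of_real (d j))) \<longlonglongrightarrow> h z"
      proof (rule continuous_on_tendsto_compose[OF hc _ z])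
        have "(\<lambda>j. z + \<i> * of_real (d j)) \<longlonglongrightarrow> z + \<i> * of_real 0" by (intro tendsto_intros dl)
        then show "(\<lambda>j. z + \<i> * of_real (d j)) \<longlonglongrightarrow> z" by simp
        show "\<forall>\<^sub>F j in sequentially. z + \<i> * of_real (d j) \<in> uhp"
          using z d by (intro always_eventually allI) (simp add: uhp_def add_pos_pos)
      qed
      then have "(\<lambda>j. of_real (sqrt pi) * (z + \<i>) * (h (z + \<i> * of_real (d j)) / (1 - \<i> * of_real (d j) * z)))
          \<longlonglongrightarrow> of_real (sqrt pi) * (z + \<i>) * (h z / (1 - \<i> * of_real 0 * z))"
        by (intro tendsto_intros dl) auto
      then have "(\<lambda>j. K (d j) (of_real (- r) * cis t)) \<longlonglongrightarrow> hdisc h (of_real (- r) * cis t)"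
        by (simp add: K_def hdisc_def z_def)
      then show "(\<lambda>j. ennreal ((cmod (K (d j) (of_real (- r) * cis t)))\<^sup>2) * indicator angles t)
         \<longlonglongrightarrow> ennreal ((cmod (hdisc h (of_real (- r) * cis t)))\<^sup>2) * indicator angles t"
        by (cases "t \<in> angles") (auto intro!: tendsto_intros)
    qed
    moreover have "\<forall>w. cmod w < 1 \<longrightarrow> (\<lambda>n. hcoef h n * w ^ n) sums hdisc h w" using hdisc_sums[OF h] by blast
    moreover have "\<bar>- r\<bar> < 1" using r by simp
    note P = Parseval_disc[of 1 "hcoef h" "hdisc h", OF calculation(2) this]
    ultimately have "2 * pi * (\<Sum>n. (cmod (hcoef h n))\<^sup>2 * (- r) ^ (2 * n)) \<le> 2 * pi * S"
      using S0 unfolding P(1) by (subst (asm) ennreal_le_iff) auto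
    then have "(\<Sum>n. (cmod (hcoef h n))\<^sup>2 * r ^ (2 * n)) \<le> S" by simp
    moreover have "(\<Sum>n<N. (cmod (hcoef h n))\<^sup>2 * r ^ (2 * n)) \<le> (\<Sum>n. (cmod (hcoef h n))\<^sup>2 * r ^ (2 * n))"
      using P(2) by (intro sum_le_suminf) auto
    ultimately show ?thesis by linarith
  qed
  have "(\<lambda>k. \<Sum>n<N. (cmod (hcoef h n))\<^sup>2 * (1 - inverse (real (Suc k))) ^ (2 * n)) \<longlonglongrightarrow> (\<Sum>n<N. (cmod (hcoef h n))\<^sup>2 * (1 - 0) ^ (2 * n))"
    by (intro tendsto_intros LIMSEQ_inverse_real_of_nat)
  then have "(\<Sum>n<N. (cmod (hcoef h n))\<^sup>2 * (1 - 0) ^ (2 * n)) \<le> S"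
    by (rule LIMSEQ_le_const2) (auto intro!: r simp: inverse_eq_divide)
  then show ?thesis by simp
qed

lemma hardy_norm_sq_finite:
  assumes h: "h \<in> hol_uhp" and fin: "hardy_norm_sq h < \<infinity>"
  shows "l2 (hcoef h)" "hardy_norm_sq h = ennreal ((l2norm (hcoef h))\<^sup>2)"
proof -
  obtain S where S: "hardy_norm_sq h = ennreal S" "0 \<le> S" using fin by (cases "hardy_norm_sq h") auto
  have lines: "(\<integral>\<^sup>+x. ennreal ((cmod (h (Complex x y)))\<^sup>2) \<partial>lborel) \<le> ennreal S" if "0 < y" for y
    using SUP_upper[of y "{0<..}" "\<lambda>y. \<integral>\<^sup>+x. ennreal ((cmod (h (Complex x y)))\<^sup>2) \<partial>lborel"] that
    unfolding S(1)[symmetric] by (simp add: hardy_norm_sq_def)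
  have le: "(\<Sum>n<N. (cmod (hcoef h n))\<^sup>2) \<le> S" for N
    by (rule hcoef_partial_sum_le[OF h lines S(2)])
  have L2: "L2_set (\<lambda>n. cmod (hcoef h n)) F \<le> sqrt S" if "finite F" for F
  proof -
    from finite_nat_bounded[OF that] obtain N where "F \<subseteq> {..<N}" ..
    then have "(\<Sum>n\<in>F. (cmod (hcoef h n))\<^sup>2) \<le> (\<Sum>n<N. (cmod (hcoef h n))\<^sup>2)" by (intro sum_mono2) auto
    then show ?thesis unfolding L2_set_def using order_trans[OF _ le[of N]] by (intro real_sqrt_le_mono) blast
  qed
  then show l: "l2 (hcoef h)" by (rule l2I(1))
  have "l2norm (hcoef h) \<le> sqrt S" by (rule l2I(2)) (rule L2)
  then have "(l2norm (hcoef h))\<^sup>2 \<le> S" using S(2) by (metis l2norm_nonneg power_mono real_sqrt_pow2)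
  then have "ennreal ((l2norm (hcoef h))\<^sup>2) \<le> hardy_norm_sq h" unfolding S(1) by (rule ennreal_leI)
  then show "hardy_norm_sq h = ennreal ((l2norm (hcoef h))\<^sup>2)"
    using hardy_norm_sq_le[OF h l] by (rule antisym[rotated])
qed

lemma hardy_iff: "h \<in> hardy \<longleftrightarrow> h \<in> hol_uhp \<and> l2 (hcoef h)"
  using hardy_norm_sq_finite(1)[of h] order_le_less_trans[OF hardy_norm_sq_le[of h] ennreal_less_top]
  by (auto simp: hardy_def)

lemma hardy_norm_sq_eq: "h \<in> hardy \<Longrightarrow> hardy_norm_sq h = ennreal ((l2norm (hcoef h))\<^sup>2)"
  by (simp add: hardy_def hardy_norm_sq_finite)

lemma hardy_scale: "g \<in> hardy \<Longrightarrow> fscale c g \<in> hardy"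
  by (simp add: hardy_iff hol_uhp_scale hcoef_scale l2_scale)

text \<open>The counterpart on families of the formula that defines \<open>hardy_ip\<close>:
  summation over the fourth roots of unity keeps only the term with the conjugate root, which is
  \<open>l2ip a b\<close>.\<close>

lemma polarization:
  fixes a b :: "'i \<Rightarrow> complex"
  assumes "l2 a" "l2 b"
  shows "(\<Sum>k<4. \<i> ^ k * of_real ((l2norm (\<lambda>i. a i + \<i> ^ k * b i))\<^sup>2)) / 4 = l2ip a b"
proof -
  have e: "of_real ((l2norm (\<lambda>i. a i + c * b i))\<^sup>2) = l2ip a a + cnj c * l2ip a b + c * l2ip b a + c * cnj c * l2ip b b" for c
  proof -
    have r: "l2ip x (\<lambda>i. a i + c * b i) = l2ip x a + cnj c * l2ip x b" if "l2 x" for x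
      using arg_cong[OF l2ip_add_left[OF assms(1) l2_scale[OF assms(2), of c] that], of cnj]
      by (simp add: l2ip_cnj l2ip_scale_left)
    have "of_real ((l2norm (\<lambda>i. a i + c * b i))\<^sup>2) = l2ip (\<lambda>i. a i + c * b i) (\<lambda>i. a i + c * b i)"
      by (rule l2ip_self[symmetric]) (intro l2_add l2_scale assms)
    also have "\<dots> = l2ip a (\<lambda>i. a i + c * b i) + c * l2ip b (\<lambda>i. a i + c * b i)"
      by (simp add: l2ip_add_left l2ip_scale_left l2_add l2_scale assms)
    finally show ?thesis using assms by (simp add: r algebra_simps)
  qed
  show ?thesis unfolding e by (simp add: eval_nat_numeral algebra_simps)
qed

lemma hardy_ip_eq:
  assumes "g \<in> hardy" "h \<in> hardy"
  shows "hardy_ip g h = l2ip (hcoef g) (hcoef h)"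
proof -
  have "enn2real (hardy_norm_sq (fadd g (fscale (\<i> ^ k) h))) = (l2norm (\<lambda>i. hcoef g i + \<i> ^ k * hcoef h i))\<^sup>2" for k
    using assms by (subst hardy_norm_sq_eq) (auto simp: hardy_scale hcoef_add hcoef_scale hardy_iff hol_uhp_scale hol_uhp_add l2_add l2_scale)
  then have "hardy_ip g h = (\<Sum>k<4. \<i> ^ k * of_real ((l2norm (\<lambda>i. hcoef g i + \<i> ^ k * hcoef h i))\<^sup>2)) / 4"
    unfolding hardy_ip_def by (simp only:)
  also have "\<dots> = l2ip (hcoef g) (hcoef h)" by (rule polarization) (use assms in \<open>simp_all add: hardy_iff\<close>)
  finally show ?thesis .
qed

section \<open>The Hilbert tensor square\<close>

definition syn2 :: "coeffs \<Rightarrow> complex \<times> complex \<Rightarrow> complex" where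
  "syn2 a = (\<lambda>p. if p \<in> uhp \<times> uhp
     then ps2 a (cayley (fst p)) (cayley (snd p)) / (of_real pi * (fst p + \<i>) * (snd p + \<i>)) else 0)"

lemma cayley_derivative: "z + \<i> \<noteq> 0 \<Longrightarrow> (cayley has_field_derivative 2 * \<i> / (z + \<i>)\<^sup>2) (at z)"
  unfolding cayley_def by (auto intro!: derivative_eq_intros simp: power2_eq_square)

lemma syn2_has_derivative:
  assumes a: "conv_coeffs a" and p: "p \<in> uhp \<times> uhp"
  shows "\<exists>A B. (syn2 a has_derivative (\<lambda>(u, v). A * u + B * v)) (at p)"
proof -
  obtain z1 z2 where z: "p = (z1, z2)" "z1 \<in> uhp" "z2 \<in> uhp" using p by auto
  have n: "z1 + \<i> \<noteq> 0" "z2 + \<i> \<noteq> 0" using z uhp_nonzero by auto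
  define c1 c2 where "c1 = 2 * \<i> / (z1 + \<i>)\<^sup>2" and "c2 = 2 * \<i> / (z2 + \<i>)\<^sup>2"
  define q where "q = (\<lambda>z::complex. 1 / (z + \<i>))"
  define X Y where "X = ps2 (dcoef1 a) (cayley z1) (cayley z2)" and "Y = ps2 (dcoef2 a) (cayley z1) (cayley z2)"
  have q': "(q has_field_derivative - q z * q z) (at z)" if "z + \<i> \<noteq> 0" for z
    unfolding q_def using that by (auto intro!: derivative_eq_intros simp: power2_eq_square)
  have fst': "((\<lambda>p. f (fst p)) has_derivative (\<lambda>h. d * fst h)) (at p)" if "(f has_field_derivative d) (at z1)" for f d
    using has_derivative_compose[OF has_derivative_fst[OF has_derivative_ident[of "at p"]], of f "(*) d"] that
    by (simp add: z(1) has_field_derivative_def)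
  have snd': "((\<lambda>p. f (snd p)) has_derivative (\<lambda>h. d * snd h)) (at p)" if "(f has_field_derivative d) (at z2)" for f d
    using has_derivative_compose[OF has_derivative_snd[OF has_derivative_ident[of "at p"]], of f "(*) d"] that
    by (simp add: z(1) has_field_derivative_def)
  have cay: "((\<lambda>p. (cayley (fst p), cayley (snd p))) has_derivative (\<lambda>h. (c1 * fst h, c2 * snd h))) (at p)"
    unfolding c1_def c2_def by (intro has_derivative_Pair fst' snd' cayley_derivative n)
  have F: "((\<lambda>p. ps2 a (cayley (fst p)) (cayley (snd p))) has_derivative (\<lambda>h. X * (c1 * fst h) + Y * (c2 * snd h))) (at p)"
  proof -
    have "((\<lambda>(x, y). ps2 a x y) has_derivative (\<lambda>(u, v). X * u + Y * v)) (at (cayley z1, cayley z2))"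
      unfolding X_def Y_def by (intro ps2_has_derivative a cmod_cayley_less_1 z)
    then show ?thesis
      using has_derivative_compose[OF cay, of "\<lambda>(x, y). ps2 a x y" "\<lambda>(u, v). X * u + Y * v"] z(1) by simp
  qed
  define k :: complex where "k = 1 / of_real pi"
  let ?f = "\<lambda>p. ps2 a (cayley (fst p)) (cayley (snd p)) * (q (fst p) * q (snd p) * k)"
  have "(?f has_derivative (\<lambda>h. ps2 a (cayley (fst p)) (cayley (snd p)) *
       ((q (fst p) * (- q z2 * q z2 * snd h) + - q z1 * q z1 * fst h * q (snd p)) * k)
     + (X * (c1 * fst h) + Y * (c2 * snd h)) * (q (fst p) * q (snd p) * k))) (at p)"
    by (intro has_derivative_mult F has_derivative_mult_left fst' snd' q' n)
  moreover have "\<exists>A B. (\<lambda>h. ps2 a (cayley (fst p)) (cayley (snd p)) *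
       ((q (fst p) * (- q z2 * q z2 * snd h) + - q z1 * q z1 * fst h * q (snd p)) * k)
     + (X * (c1 * fst h) + Y * (c2 * snd h)) * (q (fst p) * q (snd p) * k)) = (\<lambda>(u, v). A * u + B * v)"
    by (rule exI[of _ "ps2 a (cayley z1) (cayley z2) * (- q z1 * q z1 * q z2) * k + X * c1 * (q z1 * q z2 * k)"],
        rule exI[of _ "ps2 a (cayley z1) (cayley z2) * (- q z1 * q z2 * q z2) * k + Y * c2 * (q z1 * q z2 * k)"])
       (auto simp: z(1) fun_eq_iff algebra_simps)
  ultimately obtain A B where AB: "(?f has_derivative (\<lambda>(u, v). A * u + B * v)) (at p)" by auto
  have "(syn2 a has_derivative (\<lambda>(u, v). A * u + B * v)) (at p)"
  proof (rule has_derivative_transform_within_open[OF AB])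
    show "open (uhp \<times> uhp)" by (intro open_Times open_uhp)
    show "?f p' = syn2 a p'" if "p' \<in> uhp \<times> uhp" for p'
      using that by (simp add: syn2_def q_def k_def)
  qed (rule p)
  then show ?thesis by blast
qed

lemma syn2_in_hol_uhp2:
  assumes "conv_coeffs a"
  shows "syn2 a \<in> hol_uhp2"
  unfolding hol_uhp2_def holomorphic2_on_def
proof (intro CollectI conjI ballI allI impI)
  fix p assume "p \<in> uhp \<times> uhp"
  from syn2_has_derivative[OF assms this] obtain A B where "(syn2 a has_derivative (\<lambda>(u, v). A * u + B * v)) (at p)" by auto
  then show "\<exists>A B. (syn2 a has_derivative (\<lambda>(u, v). A * u + B * v)) (at p within uhp \<times> uhp)"
    using has_derivative_at_withinI by metis
next
  fix p assume "p \<notin> uhp \<times> uhp"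
  then show "syn2 a p = 0" unfolding syn2_def by (rule if_not_P)
qed

lemma syn2_add: "conv_coeffs a \<Longrightarrow> conv_coeffs b \<Longrightarrow> fadd (syn2 a) (syn2 b) = syn2 (\<lambda>p. a p + b p)"
  by (auto simp: fadd_def syn2_def fun_eq_iff ps2_add cmod_cayley_less_1 add_divide_distrib)

lemma syn2_scale: "fscale c (syn2 a) = syn2 (\<lambda>p. c * a p)"
  by (auto simp: fscale_def syn2_def fun_eq_iff ps2_scale)

lemma syn2_diff: "conv_coeffs a \<Longrightarrow> conv_coeffs b \<Longrightarrow> fsub (syn2 a) (syn2 b) = syn2 (\<lambda>p. a p - b p)"
  by (auto simp: fsub_def syn2_def fun_eq_iff ps2_diff cmod_cayley_less_1 diff_divide_distrib)

lemma syn2_0: "syn2 (\<lambda>_. 0) = (\<lambda>_. 0)"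
  by (auto simp: syn2_def ps2_def fun_eq_iff case_prod_unfold)

lemma syn2_inject:
  assumes "conv_coeffs a" "conv_coeffs b" "syn2 a = syn2 b"
  shows "a = b"
proof (rule ps2_inject[OF assms(1,2)])
  fix x y :: complex assume xy: "cmod x < 1" "cmod y < 1"
  then have c: "cayley (inv_cayley x) = x" "cayley (inv_cayley y) = y" by (auto intro!: cayley_inv_cayley)
  have u: "inv_cayley x \<in> uhp" "inv_cayley y \<in> uhp" using xy by (auto intro: inv_cayley_in_uhp)
  then show "ps2 a x y = ps2 b x y"
    using fun_cong[OF assms(3), of "(inv_cayley x, inv_cayley y)"] c uhp_nonzero[OF u(1)] uhp_nonzero[OF u(2)] by (simp add: syn2_def)
qed

text \<open>Up to conjugation and normalisation these are the coefficients of the reproducing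
  kernel; the squares of their moduli are again geometric.\<close>

lemma l2_geometric:
  assumes "cmod x < 1" "cmod y < 1"
  shows "l2 (\<lambda>(i, j). x ^ i * y ^ j)"
proof -
  have "conv_coeffs (\<lambda>_. 1)" by (rule conv_coeffsI_bounded) (auto intro!: exI[of _ 1] power_le_one)
  moreover have "cmod (x\<^sup>2) < 1" "cmod (y\<^sup>2) < 1" using assms by (auto simp: norm_power power_less_one_iff abs_square_less_1)
  ultimately have "(\<lambda>(i, j). cmod (1 * (x\<^sup>2) ^ i * (y\<^sup>2) ^ j)) summable_on UNIV"
    by (rule conv_coeffs_abs_summable)
  then show ?thesis
    unfolding l2_def by (rule summable_on_cong[THEN iffD1, rotated])
       (auto simp: norm_mult norm_power power_mult_distrib power_mult[symmetric] mult.commute)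
qed

text \<open>Point evaluation is the pairing with a geometric array. Its boundedness turns norm
  limits into pointwise limits.\<close>

lemma syn2_bound:
  assumes "p \<in> uhp \<times> uhp"
  shows "\<exists>K. \<forall>a. l2 a \<longrightarrow> cmod (syn2 a p) \<le> K * l2norm a"
proof -
  define x y where "x = cayley (fst p)" and "y = cayley (snd p)"
  have xy: "cmod x < 1" "cmod y < 1" using assms by (auto simp: x_def y_def cmod_cayley_less_1)
  define D where "D = of_real pi * (fst p + \<i>) * (snd p + \<i>)"
  have "cmod (syn2 a p) \<le> l2norm (\<lambda>(i, j). x ^ i * y ^ j) / cmod D * l2norm a" if "l2 a" for a
  proof -
    have "ps2 a x y = (\<Sum>\<^sub>\<infinity>p. a p * (case p of (i, j) \<Rightarrow> x ^ i * y ^ j))"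
      unfolding ps2_def by (intro infsum_cong) (auto simp: mult.assoc)
    then have "cmod (ps2 a x y) \<le> l2norm a * l2norm (\<lambda>(i, j). x ^ i * y ^ j)"
      using Cauchy_Schwarz_l2(2)[OF that l2_geometric[OF xy]] by simp
    then have "cmod (ps2 a x y) / cmod D \<le> l2norm a * l2norm (\<lambda>(i, j). x ^ i * y ^ j) / cmod D"
      by (rule divide_right_mono) simp
    then show ?thesis using assms by (simp add: syn2_def x_def y_def D_def norm_divide mult.commute)
  qed
  then show ?thesis by blast
qed

definition outer :: "(nat \<Rightarrow> complex) \<Rightarrow> (nat \<Rightarrow> complex) \<Rightarrow> coeffs" where
  "outer g h = (\<lambda>(i, j). g i * h j)"

lemma l2_outer:
  assumes "l2 g" "l2 h"
  shows "l2 (outer g h)"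
proof -
  have "(\<lambda>(i, j). (cmod (g i))\<^sup>2 * (cmod (h j))\<^sup>2) summable_on UNIV \<times> UNIV"
  proof (rule summable_on_SigmaI[where g = "\<lambda>i. (cmod (g i))\<^sup>2 * (l2norm h)\<^sup>2"])
    show "((\<lambda>j. case (i, j) of (i, j) \<Rightarrow> (cmod (g i))\<^sup>2 * (cmod (h j))\<^sup>2) has_sum (cmod (g i))\<^sup>2 * (l2norm h)\<^sup>2) UNIV" for i
      using has_sum_cmult_right[OF has_sum_infsum[OF assms(2)[unfolded l2_def]], of "(cmod (g i))\<^sup>2"] by (simp add: l2norm_sq)
    show "(\<lambda>i. (cmod (g i))\<^sup>2 * (l2norm h)\<^sup>2) summable_on UNIV"
      by (rule summable_on_cmult_left[OF assms(1)[unfolded l2_def]])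
  qed auto
  then show ?thesis
    unfolding l2_def UNIV_Times_UNIV by (rule summable_on_cong[THEN iffD1, rotated])
       (auto simp: outer_def norm_mult power_mult_distrib)
qed

lemma infsum_outer:
  fixes f g :: "nat \<Rightarrow> complex"
  assumes "(\<lambda>(i, j). f i * g j) summable_on UNIV"
  shows "(\<Sum>\<^sub>\<infinity>(i, j). f i * g j) = (\<Sum>\<^sub>\<infinity>i. f i) * (\<Sum>\<^sub>\<infinity>j. g j)"
proof -
  have "(\<Sum>\<^sub>\<infinity>(i, j). f i * g j) = (\<Sum>\<^sub>\<infinity>i. \<Sum>\<^sub>\<infinity>j. f i * g j)"
    using infsum_Sigma_banach[of "\<lambda>(i, j). f i * g j" UNIV "\<lambda>_. UNIV"] assms by simp
  also have "\<dots> = (\<Sum>\<^sub>\<infinity>i. f i) * (\<Sum>\<^sub>\<infinity>j. g j)"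
    by (simp add: infsum_cmult_right' infsum_cmult_left')
  finally show ?thesis .
qed

lemma l2ip_outer:
  assumes "l2 g" "l2 h" "l2 g'" "l2 h'"
  shows "l2ip (outer g h) (outer g' h') = l2ip g g' * l2ip h h'"
proof -
  have e: "(\<lambda>p. outer g h p * cnj (outer g' h' p)) = (\<lambda>(i, j). (g i * cnj (g' i)) * (h j * cnj (h' j)))"
    by (auto simp: outer_def)
  have "(\<lambda>(i, j). (g i * cnj (g' i)) * (h j * cnj (h' j))) summable_on UNIV"
    using l2ip_summable[OF l2_outer[OF assms(1,2)] l2_outer[OF assms(3,4)]] unfolding e .
  from infsum_outer[OF this] show ?thesis unfolding l2ip_def e .
qed

lemma ps2_outer:
  assumes "l2 (hcoef g)" "l2 (hcoef h)" "g \<in> hol_uhp" "h \<in> hol_uhp" "cmod x < 1" "cmod y < 1"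
  shows "ps2 (outer (hcoef g) (hcoef h)) x y = hdisc g x * hdisc h y"
proof -
  have one: "(\<Sum>\<^sub>\<infinity>n. hcoef k n * w ^ n) = hdisc k w" if k: "k \<in> hol_uhp" and w: "cmod w < 1" for k w
  proof -
    obtain q where q: "cmod w < q" "q < 1" using dense[OF w] by blast
    then have q': "norm (of_real q :: complex) < 1" using order.strict_trans1[OF norm_ge_zero q(1)] by simp
    have "summable (\<lambda>n. hcoef k n * of_real q ^ n)" using hdisc_sums[OF k q'] by (auto simp: sums_iff)
    from powser_insidea[OF this, of w] have "summable (\<lambda>n. norm (hcoef k n * w ^ n))" using q by simp
    from norm_summable_imp_has_sum[OF this hdisc_sums[OF k w]] show ?thesis by (rule infsumI)
  qed
  have e: "(\<lambda>(i, j). outer (hcoef g) (hcoef h) (i, j) * x ^ i * y ^ j) = (\<lambda>(i, j). (hcoef g i * x ^ i) * (hcoef h j * y ^ j))"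
    by (auto simp: outer_def)
  have "(\<lambda>(i, j). (hcoef g i * x ^ i) * (hcoef h j * y ^ j)) summable_on UNIV"
    using conv_coeffs_summable[OF conv_coeffs_l2[OF l2_outer[OF assms(1,2)]] assms(5,6)] unfolding e .
  from infsum_outer[OF this] show ?thesis unfolding ps2_def e using one assms by simp
qed

section \<open>Algebraic tensors and their coefficient arrays\<close>

definition tcoef :: "tensor \<Rightarrow> coeffs" where
  "tcoef u = (\<lambda>p. \<Sum>(g, h)\<leftarrow>u. outer (hcoef g) (hcoef h) p)"

lemma tcoef_simps:
  "tcoef [] = (\<lambda>_. 0)" "tcoef ((g, h) # u) = (\<lambda>p. outer (hcoef g) (hcoef h) p + tcoef u p)"
  by (auto simp: tcoef_def)

lemma l2_tcoef: "set u \<subseteq> hardy \<times> hardy \<Longrightarrow> l2 (tcoef u)"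
proof (induction u)
  case Nil
  then show ?case by (simp add: tcoef_simps)
next
  case (Cons x u)
  then show ?case by (cases x) (simp add: tcoef_simps l2_add l2_outer hardy_iff)
qed

lemma tensor_fun_eq_syn2:
  assumes "set u \<subseteq> hardy \<times> hardy" "p \<in> uhp \<times> uhp"
  shows "tensor_fun u p = syn2 (tcoef u) p"
  using assms(1)
proof (induction u)
  case Nil
  then show ?case by (simp add: tensor_fun_def tcoef_simps syn2_0)
next
  case (Cons x u)
  obtain g h where x: "x = (g, h)" by force
  have gh: "g \<in> hol_uhp" "l2 (hcoef g)" "h \<in> hol_uhp" "l2 (hcoef h)" using Cons.prems x by (auto simp: hardy_iff)
  obtain z1 z2 where p: "p = (z1, z2)" "z1 \<in> uhp" "z2 \<in> uhp" using assms(2) by auto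
  have "syn2 (outer (hcoef g) (hcoef h)) p = g z1 * h z2"
    using p gh assms(2) unfolding syn2_def
    by (simp add: ps2_outer cmod_cayley_less_1 hdisc_cayley[of z1 g] hdisc_cayley[of z2 h] flip: of_real_mult)
  moreover have "syn2 (tcoef (x # u)) p = syn2 (outer (hcoef g) (hcoef h)) p + syn2 (tcoef u) p"
    using fun_cong[OF syn2_add[OF conv_coeffs_l2[OF l2_outer[OF gh(2,4)]] conv_coeffs_l2[OF l2_tcoef[of u]]], of p] Cons.prems
    by (simp add: x tcoef_simps fadd_def)
  ultimately show ?case using Cons by (simp add: tensor_fun_def x p)
qed

lemma tensor_ip_eq:
  assumes "set u \<subseteq> hardy \<times> hardy" "set v \<subseteq> hardy \<times> hardy"
  shows "tensor_ip u v = l2ip (tcoef u) (tcoef v)"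
proof -
  have 1: "(\<Sum>(g', h')\<leftarrow>v. hardy_ip g g' * hardy_ip h h') = l2ip (outer (hcoef g) (hcoef h)) (tcoef v)"
    if gh: "g \<in> hardy" "h \<in> hardy" for g h
    using assms(2)
  proof (induction v)
    case Nil
    then show ?case by (simp add: tcoef_simps l2ip_def)
  next
    case (Cons x v)
    obtain g' h' where x: "x = (g', h')" by force
    have a: "l2 (hcoef g)" "l2 (hcoef h)" "l2 (hcoef g')" "l2 (hcoef h')" "g' \<in> hardy" "h' \<in> hardy"
      using gh Cons.prems x by (auto simp: hardy_iff)
    have "l2ip (outer (hcoef g) (hcoef h)) (tcoef (x # v))
       = l2ip (outer (hcoef g) (hcoef h)) (outer (hcoef g') (hcoef h')) + l2ip (outer (hcoef g) (hcoef h)) (tcoef v)"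
      using arg_cong[OF l2ip_add_left[of "outer (hcoef g') (hcoef h')" "tcoef v" "outer (hcoef g) (hcoef h)"], of cnj]
        Cons.prems a by (simp add: l2ip_cnj x tcoef_simps l2_outer l2_tcoef)
    then show ?case using Cons a gh by (simp add: x hardy_ip_eq l2ip_outer)
  qed
  show ?thesis using assms(1)
  proof (induction u)
    case Nil
    then show ?case by (simp add: tcoef_simps l2ip_def tensor_ip_def)
  next
    case (Cons x u)
    obtain g h where x: "x = (g, h)" by force
    have gh: "g \<in> hardy" "h \<in> hardy" using Cons.prems x by auto
    then show ?case using Cons 1[OF gh] assms(2)
      by (simp add: tensor_ip_def x tcoef_simps l2ip_add_left l2_outer l2_tcoef hardy_iff)
  qed
qed

lemma set_tensor_diff: "set u \<subseteq> hardy \<times> hardy \<Longrightarrow> set v \<subseteq> hardy \<times> hardy \<Longrightarrow> set (tensor_diff u v) \<subseteq> hardy \<times> hardy"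
  by (auto simp: tensor_diff_def hardy_scale)

lemma tcoef_append: "tcoef (u @ v) = (\<lambda>p. tcoef u p + tcoef v p)"
  by (simp add: tcoef_def)

lemma tcoef_diff:
  assumes "set u \<subseteq> hardy \<times> hardy" "set v \<subseteq> hardy \<times> hardy"
  shows "tcoef (tensor_diff u v) = (\<lambda>p. tcoef u p - tcoef v p)"
proof -
  have "tcoef (map (\<lambda>(g, h). (fscale (- 1) g, h)) v) = (\<lambda>p. - tcoef v p)"
    using assms(2)
  proof (induction v)
    case Nil
    then show ?case by (simp add: tcoef_simps)
  next
    case (Cons x v)
    obtain g h where x: "x = (g, h)" by force
    then have "hcoef (fscale (- 1) g) = (\<lambda>n. - 1 * hcoef g n)" using Cons.prems by (intro hcoef_scale) (auto simp: hardy_iff)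
    then show ?case using Cons by (auto simp: x tcoef_simps outer_def fun_eq_iff)
  qed
  then show ?thesis by (simp add: tensor_diff_def tcoef_append)
qed

lemma tensor_norm_eq: "set u \<subseteq> hardy \<times> hardy \<Longrightarrow> tensor_norm u = l2norm (tcoef u)"
  by (simp add: tensor_norm_def tensor_ip_eq l2ip_self l2_tcoef del: of_real_power)

text \<open>Tensor norms are coefficient norms, so a Cauchy sequence of tensors has a limit array by
  completeness. Bounded evaluations identify the pointwise limit with \<open>syn2 a\<close>.\<close>

lemma represents_coef:
  assumes X: "represents X f" and f: "\<And>p. p \<notin> uhp \<times> uhp \<Longrightarrow> f p = 0"
  obtains a where "l2 a" "f = syn2 a" "(\<lambda>n. l2norm (\<lambda>p. tcoef (X n) p - a p)) \<longlonglongrightarrow> 0"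
proof -
  have s: "set (X n) \<subseteq> hardy \<times> hardy" for n using X by (simp add: represents_def)
  have l: "l2 (tcoef (X n))" for n by (rule l2_tcoef[OF s])
  have "\<exists>N. \<forall>m\<ge>N. \<forall>n\<ge>N. l2norm (\<lambda>p. tcoef (X m) p - tcoef (X n) p) < e" if "0 < e" for e
  proof -
    obtain N where N: "\<forall>m\<ge>N. \<forall>n\<ge>N. tensor_norm (tensor_diff (X m) (X n)) < e" using X \<open>0 < e\<close> unfolding represents_def by blast
    have "tensor_norm (tensor_diff (X m) (X n)) = l2norm (\<lambda>p. tcoef (X m) p - tcoef (X n) p)" for m n
      using tensor_norm_eq[OF set_tensor_diff[OF s s]] tcoef_diff[OF s s] by simp
    with N show ?thesis by auto
  qed
  from l2_complete[OF l this] obtain a where a: "l2 a" "(\<lambda>n. l2norm (\<lambda>p. tcoef (X n) p - a p)) \<longlonglongrightarrow> 0" by auto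
  have "f p = syn2 a p" for p
  proof (cases "p \<in> uhp \<times> uhp")
    case True
    obtain K where K: "\<forall>a. l2 a \<longrightarrow> cmod (syn2 a p) \<le> K * l2norm a" using syn2_bound[OF True] by blast
    have "(\<lambda>n. syn2 (tcoef (X n)) p - syn2 a p) \<longlonglongrightarrow> 0"
    proof (rule Lim_null_comparison)
      show "(\<lambda>n. K * l2norm (\<lambda>p. tcoef (X n) p - a p)) \<longlonglongrightarrow> 0" using tendsto_mult_right_zero[OF a(2)] .
      have "syn2 (tcoef (X n)) p - syn2 a p = syn2 (\<lambda>p. tcoef (X n) p - a p) p" for n
        using fun_cong[OF syn2_diff[OF conv_coeffs_l2[OF l] conv_coeffs_l2[OF a(1)]], of n p] by (simp add: fsub_def)
      then show "\<forall>\<^sub>F n in sequentially. norm (syn2 (tcoef (X n)) p - syn2 a p) \<le> K * l2norm (\<lambda>p. tcoef (X n) p - a p)"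
        using K l2_diff[OF l a(1)] by (intro always_eventually allI) simp
    qed
    then have "(\<lambda>n. tensor_fun (X n) p) \<longlonglongrightarrow> syn2 a p"
      using tensor_fun_eq_syn2[OF s True] by (simp add: LIM_zero_iff)
    moreover have "(\<lambda>n. tensor_fun (X n) p) \<longlonglongrightarrow> f p" using X True unfolding represents_def by blast
    ultimately show ?thesis using LIMSEQ_unique by blast
  next
    case False
    then show ?thesis using f by (simp add: syn2_def)
  qed
  then have "f = syn2 a" by (rule ext)
  then show ?thesis using that[OF a(1) _ a(2)] by simp
qed

text \<open>Truncation goes by total degree because \<open>casimir\<close> preserves the degree and
  so maps truncated arrays to truncated ones.\<close>

definition tri :: "nat \<Rightarrow> (nat \<times> nat) set" where "tri N = {(i, j). i + j < N}"

lemma finite_tri [simp]: "finite (tri N)"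
  by (rule finite_subset[of _ "{..<N} \<times> {..<N}"]) (auto simp: tri_def)

lemma tri_exhaust: assumes "finite F" shows "\<exists>N. F \<subseteq> tri N"
proof -
  have "finite ((\<lambda>(i, j). i + j) ` F)" using assms by simp
  from finite_nat_bounded[OF this] obtain N where N: "(\<lambda>(i, j). i + j) ` F \<subseteq> {..<N}" ..
  have "F \<subseteq> tri N"
  proof
    fix p assume "p \<in> F"
    then have "(case p of (i, j) \<Rightarrow> i + j) \<in> {..<N}" using N by blast
    then show "p \<in> tri N" by (auto simp: tri_def split: prod.splits)
  qed
  then show ?thesis ..
qed

lemma l2_truncate: "l2 (\<lambda>p. if p \<in> tri N then a p else 0)"
  by (rule l2_finite_support[of "tri N"]) auto

lemma l2_tail: assumes "l2 a" shows "l2 (\<lambda>p. if p \<in> tri N then 0 else a p)"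
proof -
  have "(\<lambda>p. if p \<in> tri N then 0 else a p) = (\<lambda>p. a p - (if p \<in> tri N then a p else 0))" by auto
  then show ?thesis using l2_diff[OF assms l2_truncate] by simp
qed

lemma l2_tail_tendsto_0:
  assumes "l2 a"
  shows "(\<lambda>N. l2norm (\<lambda>p. if p \<in> tri N then 0 else a p)) \<longlonglongrightarrow> 0"
proof (rule LIMSEQ_I)
  fix e :: real assume e: "0 < e"
  have s: "(\<lambda>p. (cmod (a p))\<^sup>2) summable_on UNIV" using assms by (simp add: l2_def)
  define S where "S = (\<Sum>\<^sub>\<infinity>p. (cmod (a p))\<^sup>2)"
  from has_sum_infsum[OF s] have "((\<lambda>p. (cmod (a p))\<^sup>2) has_sum S) UNIV" by (simp add: S_def)
  then have "\<forall>\<^sub>F F in finite_subsets_at_top UNIV. dist (\<Sum>p\<in>F. (cmod (a p))\<^sup>2) S < (e / 2)\<^sup>2"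
    unfolding has_sum_def using e by (intro tendstoD) auto
  then obtain F where F: "finite F" "\<forall>F'. finite F' \<and> F \<subseteq> F' \<longrightarrow> dist (\<Sum>p\<in>F'. (cmod (a p))\<^sup>2) S < (e / 2)\<^sup>2"
    unfolding eventually_finite_subsets_at_top by auto
  obtain N0 where N0: "F \<subseteq> tri N0" using tri_exhaust[OF F(1)] by blast
  have "l2norm (\<lambda>p. if p \<in> tri N then 0 else a p) \<le> e / 2" if "N \<ge> N0" for N
  proof (rule l2I(2))
    fix G :: "(nat \<times> nat) set" assume G: "finite G"
    have sub: "F \<subseteq> tri N" using N0 that by (auto simp: tri_def)
    have "(\<Sum>p\<in>G. (cmod (if p \<in> tri N then 0 else a p))\<^sup>2) = (\<Sum>p\<in>G - tri N. (cmod (a p))\<^sup>2)"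
      using G by (intro sum.mono_neutral_cong_right) auto
    also have "\<dots> = (\<Sum>p\<in>G \<union> tri N. (cmod (a p))\<^sup>2) - (\<Sum>p\<in>tri N. (cmod (a p))\<^sup>2)"
      using G sum.subset_diff[of "tri N" "G \<union> tri N" "\<lambda>p. (cmod (a p))\<^sup>2"] by (simp add: Un_Diff)
    also have "\<dots> \<le> S - (\<Sum>p\<in>tri N. (cmod (a p))\<^sup>2)"
      unfolding S_def using finite_sum_le_infsum[OF s, of "G \<union> tri N"] G by simp
    also have "\<dots> \<le> (e / 2)\<^sup>2" using F(2)[rule_format, of "tri N"] sub by (simp add: dist_real_def)
    finally show "L2_set (\<lambda>p. cmod (if p \<in> tri N then 0 else a p)) G \<le> e / 2"
      unfolding L2_set_def using e by (intro real_le_lsqrt) auto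
  qed
  then have "norm (l2norm (\<lambda>p. if p \<in> tri N then 0 else a p) - 0) < e" if "N \<ge> N0" for N
    using e that by fastforce
  then show "\<exists>no. \<forall>n\<ge>no. norm (l2norm (\<lambda>p. if p \<in> tri n then 0 else a p) - 0) < e" by blast
qed

section \<open>Realisation of all square-summable arrays\<close>

definition hbasis0 :: "nat \<Rightarrow> complex \<Rightarrow> complex" where
  "hbasis0 n z = (if z \<in> uhp then hbasis n z else 0)"

lemma hbasis0_hol: "hbasis0 n \<in> hol_uhp"
proof -
  have "hbasis n holomorphic_on uhp" unfolding hbasis_def
    by (intro holomorphic_intros holomorphic_cayley) (simp add: uhp_nonzero)
  then have "hbasis0 n holomorphic_on uhp" by (rule holomorphic_transform) (simp add: hbasis0_def)
  then show ?thesis by (simp add: hol_uhp_def hbasis0_def)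
qed

lemma hcoef_hbasis0: "hcoef (hbasis0 n) = (\<lambda>k. if k = n then 1 else 0)"
proof (rule hcoef_unique[OF hbasis0_hol])
  fix z assume "z \<in> uhp"
  then show "(\<lambda>k. (if k = n then 1 else 0) * hbasis k z) sums hbasis0 n z"
    using sums_single[of n "\<lambda>k. hbasis k z"] by (simp add: hbasis0_def if_distrib[of "\<lambda>c. c * _"] cong: if_cong)
qed

lemma hbasis0_hardy: "hbasis0 n \<in> hardy"
proof -
  have "l2 (\<lambda>k. if k = n then 1 else 0)" by (rule l2_finite_support[of "{n}"]) auto
  then show ?thesis by (simp add: hardy_iff hbasis0_hol hcoef_hbasis0)
qed

text \<open>The degree truncations of a are finite sums of elementary tensors of basis functions and
  converge to a.\<close>

lemma represents_exists:
  assumes a: "l2 a"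
  shows "\<exists>X. represents X (syn2 a)"
proof -
  \<comment> \<open>Tensors are lists, so an enumeration of the finite triangle is chosen.\<close>
  define L where "L = (\<lambda>N. SOME xs. set xs = tri N \<and> distinct xs)"
  have L: "set (L N) = tri N" "distinct (L N)" for N
    using someI_ex[OF finite_distinct_list[OF finite_tri[of N]]] by (auto simp: L_def)
  define X where "X = (\<lambda>N. map (\<lambda>(i, j). (fscale (a (i, j)) (hbasis0 i), hbasis0 j)) (L N))"
  have s: "set (X N) \<subseteq> hardy \<times> hardy" for N
    by (auto simp: X_def hbasis0_hardy hardy_scale)
  have t: "tcoef (X N) = (\<lambda>p. if p \<in> tri N then a p else 0)" for N
  proof (rule ext)
    fix p
    have "tcoef (X N) p = (\<Sum>q\<leftarrow>L N. if q = p then a p else 0)"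
      unfolding tcoef_def X_def map_map
      by (intro arg_cong[where f = sum_list] map_cong)
         (auto simp: outer_def hcoef_scale[OF hbasis0_hol] hcoef_hbasis0 split: prod.splits)
    also have "\<dots> = (\<Sum>q\<in>tri N. if q = p then a p else 0)"
      by (subst sum_list_distinct_conv_sum_set[OF L(2)]) (simp add: L(1))
    finally show "tcoef (X N) p = (if p \<in> tri N then a p else 0)" by simp
  qed
  have tail: "(\<lambda>p. tcoef (X N) p - a p) = (\<lambda>p. - 1 * (if p \<in> tri N then 0 else a p))" for N
    by (auto simp: t)
  have tl: "l2norm (\<lambda>p. tcoef (X N) p - a p) = l2norm (\<lambda>p. if p \<in> tri N then 0 else a p)" for N
    unfolding tail using l2norm_scale[OF l2_tail[OF a], of "- 1" N] by simp
  have lim: "(\<lambda>N. l2norm (\<lambda>p. tcoef (X N) p - a p)) \<longlonglongrightarrow> 0" unfolding tl by (rule l2_tail_tendsto_0[OF a])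
  have l: "l2 (tcoef (X N))" for N by (rule l2_tcoef[OF s])
  have "represents X (syn2 a)"
    unfolding represents_def
  proof (intro conjI allI impI ballI)
    show "set (X N) \<subseteq> hardy \<times> hardy" for N by (rule s)
  next
    fix e :: real assume "0 < e"
    then have "\<forall>\<^sub>F N in sequentially. l2norm (\<lambda>p. tcoef (X N) p - a p) < e / 2"
      using lim by (intro order_tendstoD) auto
    then obtain N0 where N0: "\<And>N. N \<ge> N0 \<Longrightarrow> l2norm (\<lambda>p. tcoef (X N) p - a p) < e / 2"
      unfolding eventually_sequentially by blast
    have "tensor_norm (tensor_diff (X m) (X n)) < e" if "m \<ge> N0" "n \<ge> N0" for m n
    proof -
      have "tensor_norm (tensor_diff (X m) (X n)) = l2norm (\<lambda>p. tcoef (X m) p - tcoef (X n) p)"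
        using tensor_norm_eq[OF set_tensor_diff[OF s s]] tcoef_diff[OF s s] by simp
      also have "\<dots> \<le> l2norm (\<lambda>p. tcoef (X m) p - a p) + l2norm (\<lambda>p. a p - tcoef (X n) p)"
        by (rule l2norm_diff_triangle[OF l a l])
      also have "\<dots> < e" using N0[OF that(1)] N0[OF that(2)] by (simp add: l2norm_minus_commute[of a])
      finally show ?thesis .
    qed
    then show "\<exists>N. \<forall>m\<ge>N. \<forall>n\<ge>N. tensor_norm (tensor_diff (X m) (X n)) < e" by blast
  next
    fix p assume p: "p \<in> uhp \<times> uhp"
    obtain K where K: "\<forall>a. l2 a \<longrightarrow> cmod (syn2 a p) \<le> K * l2norm a" using syn2_bound[OF p] by blast
    have "(\<lambda>n. syn2 (tcoef (X n)) p - syn2 a p) \<longlonglongrightarrow> 0"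
    proof (rule Lim_null_comparison)
      show "(\<lambda>n. K * l2norm (\<lambda>p. tcoef (X n) p - a p)) \<longlonglongrightarrow> 0" using tendsto_mult_right_zero[OF lim] .
      have "syn2 (tcoef (X n)) p - syn2 a p = syn2 (\<lambda>p. tcoef (X n) p - a p) p" for n
        using fun_cong[OF syn2_diff[OF conv_coeffs_l2[OF l] conv_coeffs_l2[OF a]], of n p] by (simp add: fsub_def)
      then show "\<forall>\<^sub>F n in sequentially. norm (syn2 (tcoef (X n)) p - syn2 a p) \<le> K * l2norm (\<lambda>p. tcoef (X n) p - a p)"
        using K l2_diff[OF l a] by (intro always_eventually allI) simp
    qed
    then show "(\<lambda>n. tensor_fun (X n) p) \<longlonglongrightarrow> syn2 a p"
      using tensor_fun_eq_syn2[OF s p] by (simp add: LIM_zero_iff)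
  qed
  then show ?thesis by blast
qed

text \<open>The completed tensor square is the image of the square-summable arrays; together with
  \<open>hardy2_ip_syn2\<close> this moves the operator theory to arrays.\<close>

lemma hardy2_eq: "hardy2 = syn2 ` {a. l2 a}"
proof (intro subset_antisym subsetI)
  fix f assume f: "f \<in> hardy2"
  then obtain X where X: "represents X f" by (auto simp: hardy2_def)
  have "\<And>p. p \<notin> uhp \<times> uhp \<Longrightarrow> f p = 0" using f unfolding hardy2_def hol_uhp2_def by blast
  from represents_coef[OF X this] obtain a where "l2 a" "f = syn2 a" by metis
  then show "f \<in> syn2 ` {a. l2 a}" by blast
next
  fix f assume "f \<in> syn2 ` {a. l2 a}"
  then obtain a where a: "l2 a" "f = syn2 a" by blast
  then show "f \<in> hardy2"
    using represents_exists[OF a(1)] syn2_in_hol_uhp2[OF conv_coeffs_l2[OF a(1)]] by (simp add: hardy2_def)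
qed

lemma represents_syn2:
  assumes "represents X (syn2 a)" "l2 a"
  shows "(\<lambda>n. l2norm (\<lambda>p. tcoef (X n) p - a p)) \<longlonglongrightarrow> 0"
proof -
  have "\<And>p. p \<notin> uhp \<times> uhp \<Longrightarrow> syn2 a p = 0" by (auto simp: syn2_def)
  from represents_coef[OF assms(1) this] obtain b where b: "l2 b" "syn2 a = syn2 b" "(\<lambda>n. l2norm (\<lambda>p. tcoef (X n) p - b p)) \<longlonglongrightarrow> 0" by metis
  have "a = b" by (rule syn2_inject[OF conv_coeffs_l2[OF assms(2)] conv_coeffs_l2[OF b(1)] b(2)])
  then show ?thesis using b(3) by simp
qed

text \<open>All sequences that represent a function converge to the same array, so the limit is
  independent of them and the definite description is well defined.\<close>

lemma hardy2_ip_syn2: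
  assumes "l2 a" "l2 b"
  shows "hardy2_ip (syn2 a) (syn2 b) = l2ip a b"
proof -
  have lim: "(\<lambda>n. tensor_ip (X n) (Y n)) \<longlonglongrightarrow> l2ip a b" if X: "represents X (syn2 a)" and Y: "represents Y (syn2 b)" for X Y
  proof -
    have s: "set (X n) \<subseteq> hardy \<times> hardy" "set (Y n) \<subseteq> hardy \<times> hardy" for n using X Y by (simp_all add: represents_def)
    have "(\<lambda>n. l2ip (tcoef (X n)) (tcoef (Y n))) \<longlonglongrightarrow> l2ip a b"
      by (rule l2ip_tendsto[OF l2_tcoef[OF s(1)] l2_tcoef[OF s(2)] assms represents_syn2[OF X assms(1)] represents_syn2[OF Y assms(2)]])
    then show ?thesis using tensor_ip_eq[OF s] by simp
  qed
  obtain X Y where XY: "represents X (syn2 a)" "represents Y (syn2 b)" using represents_exists[OF assms(1)] represents_exists[OF assms(2)] by blast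
  show ?thesis unfolding hardy2_ip_def
  proof (rule the_equality)
    show "\<exists>X Y. represents X (syn2 a) \<and> represents Y (syn2 b) \<and> (\<lambda>n. tensor_ip (X n) (Y n)) \<longlonglongrightarrow> l2ip a b"
      using XY lim[OF XY] by blast
    fix c assume "\<exists>X Y. represents X (syn2 a) \<and> represents Y (syn2 b) \<and> (\<lambda>n. tensor_ip (X n) (Y n)) \<longlonglongrightarrow> c"
    then show "c = l2ip a b" using lim LIMSEQ_unique by blast
  qed
qed

lemma ip_norm_syn2: "l2 a \<Longrightarrow> ip_norm hardy2_ip (syn2 a) = l2norm a"
  by (simp add: ip_norm_def hardy2_ip_syn2 l2ip_self del: of_real_power)

lemma fsub_syn2: "l2 a \<Longrightarrow> l2 b \<Longrightarrow> fsub (syn2 a) (syn2 b) = syn2 (\<lambda>p. a p - b p)"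
  by (intro syn2_diff conv_coeffs_l2)

lemma fadd_syn2: "l2 a \<Longrightarrow> l2 b \<Longrightarrow> fadd (syn2 a) (syn2 b) = syn2 (\<lambda>p. a p + b p)"
  by (intro syn2_add conv_coeffs_l2)

lemma hilbert_space_hardy2: "hilbert_space hardy2 hardy2_ip"
  unfolding hilbert_space_def
proof (intro conjI)
  have "(\<lambda>_. 0) \<in> hardy2" unfolding hardy2_eq by (rule image_eqI[of _ _ "\<lambda>_. 0"]) (simp_all add: syn2_0)
  then show "complex_subspace hardy2"
    unfolding complex_subspace_def by (auto simp: hardy2_eq fadd_syn2 syn2_scale l2_add l2_scale)
  show "\<forall>f\<in>hardy2. \<forall>g\<in>hardy2. \<forall>h\<in>hardy2. hardy2_ip (fadd f g) h = hardy2_ip f h + hardy2_ip g h"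
    by (auto simp: hardy2_eq fadd_syn2 hardy2_ip_syn2 l2_add l2ip_add_left)
  show "\<forall>c. \<forall>f\<in>hardy2. \<forall>g\<in>hardy2. hardy2_ip (fscale c f) g = c * hardy2_ip f g"
    by (auto simp: hardy2_eq syn2_scale hardy2_ip_syn2 l2_scale l2ip_scale_left)
  show "\<forall>f\<in>hardy2. \<forall>g\<in>hardy2. hardy2_ip g f = cnj (hardy2_ip f g)"
    by (auto simp: hardy2_eq hardy2_ip_syn2 l2ip_cnj)
  show "\<forall>f\<in>hardy2. 0 \<le> Re (hardy2_ip f f) \<and> (hardy2_ip f f = 0 \<longrightarrow> f = (\<lambda>_. 0))"
  proof
    fix f assume "f \<in> hardy2"
    then obtain a where a: "l2 a" "f = syn2 a" by (auto simp: hardy2_eq)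
    have e: "hardy2_ip f f = of_real ((l2norm a)\<^sup>2)" by (simp add: a hardy2_ip_syn2 l2ip_self)
    have "f = (\<lambda>_. 0)" if "hardy2_ip f f = 0"
    proof -
      have "l2norm a = 0" using that unfolding e by simp
      from l2norm_eq_0[OF a(1) this] show ?thesis by (simp add: a(2) syn2_0)
    qed
    then show "0 \<le> Re (hardy2_ip f f) \<and> (hardy2_ip f f = 0 \<longrightarrow> f = (\<lambda>_. 0))" by (simp add: e del: of_real_power)
  qed
  show "\<forall>X. (\<forall>n. X n \<in> hardy2) \<and> (\<forall>e>0. \<exists>N. \<forall>m\<ge>N. \<forall>n\<ge>N. ip_norm hardy2_ip (fsub (X m) (X n)) < e) \<longrightarrow>
      (\<exists>f\<in>hardy2. (\<lambda>n. ip_norm hardy2_ip (fsub (X n) f)) \<longlonglongrightarrow> 0)"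
  proof (intro allI impI, elim conjE)
    fix X :: "nat \<Rightarrow> complex \<times> complex \<Rightarrow> complex" assume X: "\<forall>n. X n \<in> hardy2" and C: "\<forall>e>0. \<exists>N. \<forall>m\<ge>N. \<forall>n\<ge>N. ip_norm hardy2_ip (fsub (X m) (X n)) < e"
    have "\<forall>n. \<exists>a. l2 a \<and> X n = syn2 a" using X unfolding hardy2_eq by blast
    from choice[OF this] obtain a where a: "\<And>n. l2 (a n)" "\<And>n. X n = syn2 (a n)" by blast
    have e: "ip_norm hardy2_ip (fsub (X n) (syn2 b)) = l2norm (\<lambda>p. a n p - b p)" if "l2 b" for n b
      using that a by (simp add: fsub_syn2 ip_norm_syn2 l2_diff)
    have C': "\<exists>N. \<forall>m\<ge>N. \<forall>n\<ge>N. l2norm (\<lambda>p. a m p - a n p) < r" if "0 < r" for r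
      using C[rule_format, OF that] e[OF a(1)] by (simp add: a(2))
    obtain b where b: "l2 b" "(\<lambda>n. l2norm (\<lambda>p. a n p - b p)) \<longlonglongrightarrow> 0"
      by (rule l2_complete[of a]) (use a(1) C' in blast)+
    show "\<exists>f\<in>hardy2. (\<lambda>n. ip_norm hardy2_ip (fsub (X n) f)) \<longlonglongrightarrow> 0"
      by (rule bexI[of _ "syn2 b"]) (use b in \<open>auto simp: e hardy2_eq\<close>)
  qed
qed

section \<open>The operator in coefficients\<close>

lemma syn2_eq:
  "z1 \<in> uhp \<Longrightarrow> z2 \<in> uhp \<Longrightarrow> syn2 a (z1, z2) = ps2 a (cayley z1) (cayley z2) * (inverse (z1 + \<i>) * inverse (z2 + \<i>) * inverse (of_real pi))"
  by (simp add: syn2_def divide_inverse)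

lemma inverse_add_i_derivative:
  "z + \<i> \<noteq> 0 \<Longrightarrow> ((\<lambda>z. inverse (z + \<i>)) has_field_derivative - (inverse (z + \<i>))\<^sup>2) (at z)"
  by (auto intro!: derivative_eq_intros simp: power2_eq_square)

lemma cayley_derivative':
  "z + \<i> \<noteq> 0 \<Longrightarrow> (cayley has_field_derivative 2 * \<i> * (inverse (z + \<i>))\<^sup>2) (at z)"
  using cayley_derivative[of z] by (simp add: divide_inverse power_inverse)

lemma ps2_cayley_derivative:
  assumes "conv_coeffs a" "z1 \<in> uhp" "z2 \<in> uhp"
  shows "((\<lambda>z. ps2 a (cayley z) (cayley z2)) has_field_derivative ps2 (dcoef1 a) (cayley z1) (cayley z2) * (2 * \<i> * (inverse (z1 + \<i>))\<^sup>2)) (at z1)"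
    and "((\<lambda>z. ps2 a (cayley z1) (cayley z)) has_field_derivative ps2 (dcoef2 a) (cayley z1) (cayley z2) * (2 * \<i> * (inverse (z2 + \<i>))\<^sup>2)) (at z2)"
  using DERIV_chain2[OF ps2_DERIV1[OF assms(1)] cayley_derivative'[OF uhp_nonzero[OF assms(2)]], of "cayley z2"]
    DERIV_chain2[OF ps2_DERIV2[OF assms(1)] cayley_derivative'[OF uhp_nonzero[OF assms(3)]], of "cayley z1"] assms
  by (simp_all add: cmod_cayley_less_1)

lemma d1_syn2:
  assumes "conv_coeffs a" "z1 \<in> uhp" "z2 \<in> uhp"
  defines "q1 \<equiv> inverse (z1 + \<i>)" and "q2 \<equiv> inverse (z2 + \<i>)"
  shows "d1 (syn2 a) (z1, z2) = (2 * \<i> * ps2 (dcoef1 a) (cayley z1) (cayley z2) * q1 ^ 3 - ps2 a (cayley z1) (cayley z2) * q1\<^sup>2) * q2 * inverse (of_real pi)"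
proof -
  have "((\<lambda>z. ps2 a (cayley z) (cayley z2) * (inverse (z + \<i>) * q2 * inverse (of_real pi))) has_field_derivative
     (ps2 (dcoef1 a) (cayley z1) (cayley z2) * (2 * \<i> * q1\<^sup>2)) * (q1 * q2 * inverse (of_real pi))
      + (- q1\<^sup>2 * q2 * inverse (of_real pi)) * ps2 a (cayley z1) (cayley z2)) (at z1)"
    unfolding q1_def
    by (intro DERIV_mult DERIV_cmult_right ps2_cayley_derivative(1) assms inverse_add_i_derivative uhp_nonzero)
  then have "((\<lambda>z. syn2 a (z, z2)) has_field_derivative
     (ps2 (dcoef1 a) (cayley z1) (cayley z2) * (2 * \<i> * q1\<^sup>2)) * (q1 * q2 * inverse (of_real pi))
      + (- q1\<^sup>2 * q2 * inverse (of_real pi)) * ps2 a (cayley z1) (cayley z2)) (at z1)"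
    by (rule has_field_derivative_transform_within_open[OF _ open_uhp assms(2)]) (simp add: syn2_eq assms(3) q2_def)
  from DERIV_imp_deriv[OF this] show ?thesis
    by (simp add: d1_def algebra_simps power2_eq_square power3_eq_cube)
qed

lemma d2_syn2:
  assumes "conv_coeffs a" "z1 \<in> uhp" "z2 \<in> uhp"
  defines "q1 \<equiv> inverse (z1 + \<i>)" and "q2 \<equiv> inverse (z2 + \<i>)"
  shows "d2 (syn2 a) (z1, z2) = (2 * \<i> * ps2 (dcoef2 a) (cayley z1) (cayley z2) * q2 ^ 3 - ps2 a (cayley z1) (cayley z2) * q2\<^sup>2) * q1 * inverse (of_real pi)"
proof -
  have "((\<lambda>z. ps2 a (cayley z1) (cayley z) * (inverse (z + \<i>) * q1 * inverse (of_real pi))) has_field_derivative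
     (ps2 (dcoef2 a) (cayley z1) (cayley z2) * (2 * \<i> * q2\<^sup>2)) * (q2 * q1 * inverse (of_real pi))
      + (- q2\<^sup>2 * q1 * inverse (of_real pi)) * ps2 a (cayley z1) (cayley z2)) (at z2)"
    unfolding q2_def
    by (intro DERIV_mult DERIV_cmult_right ps2_cayley_derivative(2) assms inverse_add_i_derivative uhp_nonzero)
  then have "((\<lambda>z. syn2 a (z1, z)) has_field_derivative
     (ps2 (dcoef2 a) (cayley z1) (cayley z2) * (2 * \<i> * q2\<^sup>2)) * (q2 * q1 * inverse (of_real pi))
      + (- q2\<^sup>2 * q1 * inverse (of_real pi)) * ps2 a (cayley z1) (cayley z2)) (at z2)"
    by (rule has_field_derivative_transform_within_open[OF _ open_uhp assms(3)]) (simp add: syn2_eq assms(2) q1_def mult.commute)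
  from DERIV_imp_deriv[OF this] show ?thesis
    by (simp add: d2_def algebra_simps power2_eq_square power3_eq_cube)
qed

lemma d1_d2_syn2:
  assumes "conv_coeffs a" "z1 \<in> uhp" "z2 \<in> uhp"
  defines "q1 \<equiv> inverse (z1 + \<i>)" and "q2 \<equiv> inverse (z2 + \<i>)" and "w1 \<equiv> cayley z1" and "w2 \<equiv> cayley z2"
  shows "d1 (d2 (syn2 a)) (z1, z2) = ((2 * \<i> * (ps2 (dcoef1 (dcoef2 a)) w1 w2 * (2 * \<i> * q1\<^sup>2)) * q2 ^ 3 - ps2 (dcoef1 a) w1 w2 * (2 * \<i> * q1\<^sup>2) * q2\<^sup>2) * q1
     - (2 * \<i> * ps2 (dcoef2 a) w1 w2 * q2 ^ 3 - ps2 a w1 w2 * q2\<^sup>2) * q1\<^sup>2) * inverse (of_real pi)"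
proof -
  have A: "((\<lambda>z. 2 * \<i> * ps2 (dcoef2 a) (cayley z) w2 * q2 ^ 3 - ps2 a (cayley z) w2 * q2\<^sup>2) has_field_derivative
     2 * \<i> * (ps2 (dcoef1 (dcoef2 a)) w1 w2 * (2 * \<i> * q1\<^sup>2)) * q2 ^ 3 - ps2 (dcoef1 a) w1 w2 * (2 * \<i> * q1\<^sup>2) * q2\<^sup>2) (at z1)"
    unfolding q1_def w1_def w2_def
    by (intro DERIV_diff DERIV_cmult_right DERIV_cmult ps2_cayley_derivative(1) conv_coeffs_dcoef2 assms)
  have "((\<lambda>z. (2 * \<i> * ps2 (dcoef2 a) (cayley z) w2 * q2 ^ 3 - ps2 a (cayley z) w2 * q2\<^sup>2) * inverse (z + \<i>) * inverse (of_real pi)) has_field_derivative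
     ((2 * \<i> * (ps2 (dcoef1 (dcoef2 a)) w1 w2 * (2 * \<i> * q1\<^sup>2)) * q2 ^ 3 - ps2 (dcoef1 a) w1 w2 * (2 * \<i> * q1\<^sup>2) * q2\<^sup>2) * inverse (z1 + \<i>)
     + - q1\<^sup>2 * (2 * \<i> * ps2 (dcoef2 a) (cayley z1) w2 * q2 ^ 3 - ps2 a (cayley z1) w2 * q2\<^sup>2)) * inverse (of_real pi)) (at z1)"
    unfolding q1_def
    by (intro DERIV_mult DERIV_cmult_right A[unfolded q1_def] assms inverse_add_i_derivative uhp_nonzero)
  then have "((\<lambda>z. d2 (syn2 a) (z, z2)) has_field_derivative
     ((2 * \<i> * (ps2 (dcoef1 (dcoef2 a)) w1 w2 * (2 * \<i> * q1\<^sup>2)) * q2 ^ 3 - ps2 (dcoef1 a) w1 w2 * (2 * \<i> * q1\<^sup>2) * q2\<^sup>2) * inverse (z1 + \<i>)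
     + - q1\<^sup>2 * (2 * \<i> * ps2 (dcoef2 a) (cayley z1) w2 * q2 ^ 3 - ps2 a (cayley z1) w2 * q2\<^sup>2)) * inverse (of_real pi)) (at z1)"
    by (rule has_field_derivative_transform_within_open[OF _ open_uhp assms(2)])
       (simp add: d2_syn2[OF assms(1) _ assms(3)] q2_def w2_def)
  from DERIV_imp_deriv[OF this] show ?thesis
    by (simp add: d1_def q1_def w1_def algebra_simps)
qed

text \<open>With q_j = 1 / (z_j + i) one has (z1 - z2) q1 q2 = q2 - q1, and the Cayley transforms
  differ by 2 i (q2 - q1). The powers of z1 - z2 in \<open>P\<close> thus absorb the surplus powers
  of q_j that the derivatives produce, and the same operator reappears in the disc
  variables.\<close>

lemma opP_syn2:
  assumes a: "conv_coeffs a"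
  shows "opP (syn2 a) = syn2 (casimir a)"
proof (rule ext, clarify)
  fix z1 z2
  show "opP (syn2 a) (z1, z2) = syn2 (casimir a) (z1, z2)"
  proof (cases "(z1, z2) \<in> uhp \<times> uhp")
    case True
    then have z: "z1 \<in> uhp" "z2 \<in> uhp" by auto
    define q1 q2 k u where "q1 = inverse (z1 + \<i>)" and "q2 = inverse (z2 + \<i>)" and "k = inverse (complex_of_real pi)" and "u = z1 - z2"
    define F X Y XY where "F = ps2 a (cayley z1) (cayley z2)" and "X = ps2 (dcoef1 a) (cayley z1) (cayley z2)"
      and "Y = ps2 (dcoef2 a) (cayley z1) (cayley z2)" and "XY = ps2 (dcoef1 (dcoef2 a)) (cayley z1) (cayley z2)"
    have n: "z1 + \<i> \<noteq> 0" "z2 + \<i> \<noteq> 0" using z uhp_nonzero by auto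
    have r: "u * q1 * q2 = q2 - q1"
      using n by (simp add: u_def q1_def q2_def field_simps)
    have w: "cayley z1 - cayley z2 = 2 * \<i> * (q2 - q1)"
    proof -
      have "cayley z1 = 1 - 2 * \<i> * q1" "cayley z2 = 1 - 2 * \<i> * q2"
        using one_minus_cayley[OF n(1)] one_minus_cayley[OF n(2)] by (simp_all add: q1_def q2_def divide_inverse algebra_simps)
      then show ?thesis by (simp add: algebra_simps)
    qed
    have "opP (syn2 a) (z1, z2) = u\<^sup>2 * (((2 * \<i> * (XY * (2 * \<i> * q1\<^sup>2)) * q2 ^ 3 - X * (2 * \<i> * q1\<^sup>2) * q2\<^sup>2) * q1
        - (2 * \<i> * Y * q2 ^ 3 - F * q2\<^sup>2) * q1\<^sup>2) * k) - u * ((2 * \<i> * X * q1 ^ 3 - F * q1\<^sup>2) * q2 * k - (2 * \<i> * Y * q2 ^ 3 - F * q2\<^sup>2) * q1 * k)"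
      using True unfolding opP_def
      by (simp add: d1_syn2[OF a z] d2_syn2[OF a z] d1_d2_syn2[OF a z] q1_def q2_def k_def u_def F_def X_def Y_def XY_def)
    also have "\<dots> = ((2 * \<i> * (q2 - q1))\<^sup>2 * XY - (2 * \<i> * (q2 - q1)) * (X - Y)) * (q1 * q2 * k)"
    proof -
      define v where "v = q2 - q1"
      have v: "u * (q1 * q2) = v" using r by (simp add: v_def mult.assoc)
      have q: "q2 = q1 + v" by (simp add: v_def)
      have "u\<^sup>2 * (((2 * \<i> * (XY * (2 * \<i> * q1\<^sup>2)) * q2 ^ 3 - X * (2 * \<i> * q1\<^sup>2) * q2\<^sup>2) * q1
        - (2 * \<i> * Y * q2 ^ 3 - F * q2\<^sup>2) * q1\<^sup>2) * k) - u * ((2 * \<i> * X * q1 ^ 3 - F * q1\<^sup>2) * q2 * k - (2 * \<i> * Y * q2 ^ 3 - F * q2\<^sup>2) * q1 * k)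
        = ((2 * \<i> * (u * (q1 * q2)))\<^sup>2 * XY * (q1 * q2)
          - 2 * \<i> * X * q1 * (u * (q1 * q2)) * ((u * (q1 * q2)) + q1)
          - 2 * \<i> * Y * q2 * (u * (q1 * q2)) * ((u * (q1 * q2)) - q2)
          + F * (u * (q1 * q2)) * ((u * (q1 * q2)) + q1 - q2)) * k"
        by (simp add: power2_eq_square power3_eq_cube algebra_simps)
      \<comment> \<open>Since q2 = q1 + v, the bracket of F vanishes and those of X and Y become q2
        and - q1.\<close>
      also have "\<dots> = ((2 * \<i> * v)\<^sup>2 * XY - (2 * \<i> * v) * (X - Y)) * (q1 * q2 * k)"
        unfolding v unfolding q by (simp add: power2_eq_square algebra_simps)
      finally show ?thesis by (simp add: v_def)
    qed
    also have "\<dots> = syn2 (casimir a) (z1, z2)"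
      using z by (simp add: syn2_eq ps2_casimir a cmod_cayley_less_1 w q1_def q2_def k_def X_def Y_def XY_def)
    finally show ?thesis .
  next
    case False
    then show ?thesis unfolding opP_def by (auto simp: syn2_def[of "casimir a"])
  qed
qed

section \<open>\<open>P\<close> as a block operator, its domain and its eigenspaces\<close>

lemma casimir_add: "casimir (\<lambda>p. a p + b p) = (\<lambda>p. casimir a p + casimir b p)"
proof (rule ext, clarify)
  fix i j show "casimir (\<lambda>p. a p + b p) (i, j) = casimir a (i, j) + casimir b (i, j)"
    by (cases i; cases j) (simp_all add: casimir_def raise_def lower_def algebra_simps)
qed

lemma casimir_scale: "casimir (\<lambda>p. c * a p) = (\<lambda>p. c * casimir a p)"
proof (rule ext, clarify)
  fix i j show "casimir (\<lambda>p. c * a p) (i, j) = c * casimir a (i, j)"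
    by (cases i; cases j) (simp_all add: casimir_def raise_def lower_def algebra_simps)
qed

lemma casimir_0: "casimir (\<lambda>_. 0) = (\<lambda>_. 0)"
  using casimir_scale[of 0 "\<lambda>_. 0"] by simp

text \<open>Every summand of \<open>casimir\<close> either keeps the degree or lowers and raises it
  by one: the operator is block diagonal over the degrees.\<close>

lemma casimir_cong_diag:
  assumes "\<And>p. p \<in> diag N \<Longrightarrow> a p = b p" "p \<in> diag N"
  shows "casimir a p = casimir b p"
proof -
  obtain i j where p: "p = (i, j)" "i + j = N" using assms(2) by (auto simp: diag_def)
  have "a (i', j') = b (i', j')" if "i' + j' = i + j" for i' j' using assms(1) that p by (auto simp: diag_def)
  then show ?thesis unfolding p(1)
    by (cases i; cases j) (simp_all add: casimir_def raise_def lower_def)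
qed

lemma casimir_tendsto:
  assumes "\<And>p. (\<lambda>n. a n p) \<longlonglongrightarrow> b p"
  shows "(\<lambda>n. casimir (a n) p) \<longlonglongrightarrow> casimir b p"
proof -
  obtain i j where p: "p = (i, j)" by force
  show ?thesis unfolding p
    by (cases i; cases j) (auto simp add: casimir_def raise_def lower_def intro!: tendsto_intros assms)
qed

lemma has_sum_diag:
  fixes f :: "nat \<times> nat \<Rightarrow> complex"
  assumes "f summable_on UNIV"
  shows "((\<lambda>N. \<Sum>p\<in>diag N. f p) has_sum infsum f UNIV) UNIV"
proof -
  have "(f has_sum infsum f UNIV) UNIV" using assms by (rule has_sum_infsum)
  also have "?this \<longleftrightarrow> ((\<lambda>(N, p). f p) has_sum infsum f UNIV) (Sigma UNIV diag)"
    by (rule has_sum_reindex_bij_witness[of _ snd "\<lambda>(i, j). (i + j, (i, j))"]) (auto simp: diag_def)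
  finally have "((\<lambda>(N, p). f p) has_sum infsum f UNIV) (Sigma UNIV diag)" .
  then show ?thesis by (rule has_sum_Sigma') simp
qed

lemma l2ip_diag:
  assumes "l2 a" "l2 b"
  shows "((\<lambda>N. diag_ip N a b) has_sum l2ip a b) UNIV"
  using has_sum_diag[OF l2ip_summable[OF assms]] by (simp add: diag_ip_def l2ip_def)

lemma l2ip_eq_diag:
  assumes "l2 a" "l2 b" "l2 a'" "l2 b'" "\<And>N. diag_ip N a b = diag_ip N a' b'"
  shows "l2ip a b = l2ip a' b'"
  using infsumI[OF l2ip_diag[OF assms(1,2)]] infsumI[OF l2ip_diag[OF assms(3,4)]] assms(5) by simp

text \<open>If the image under \<open>P\<close> lies in the space, it has an array of its own;
  injectivity of \<open>syn2\<close> on convergent arrays identifies that array with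
  \<open>casimir a\<close>.\<close>

lemma domP_eq: "domP = syn2 ` {a. l2 a \<and> l2 (casimir a)}"
proof (intro subset_antisym subsetI)
  fix f assume "f \<in> domP"
  then obtain a b where a: "l2 a" "f = syn2 a" and b: "l2 b" "opP f = syn2 b" unfolding domP_def hardy2_eq by auto
  have "syn2 (casimir a) = syn2 b" using a b opP_syn2[OF conv_coeffs_l2[OF a(1)]] by simp
  then have "casimir a = b"
    by (rule syn2_inject[OF conv_coeffs_casimir[OF conv_coeffs_l2[OF a(1)]] conv_coeffs_l2[OF b(1)]])
  then show "f \<in> syn2 ` {a. l2 a \<and> l2 (casimir a)}" using a b by auto
next
  fix f assume "f \<in> syn2 ` {a. l2 a \<and> l2 (casimir a)}"
  then show "f \<in> domP" unfolding domP_def hardy2_eq by (auto simp: opP_syn2 conv_coeffs_l2)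
qed

lemma eigenP_eq: "eigenP l = syn2 ` {a. l2 a \<and> (\<forall>p. casimir a p = - (of_nat l * (of_nat l + 1)) * a p)}"
proof (intro subset_antisym subsetI)
  fix f assume "f \<in> eigenP l"
  then obtain a where a: "l2 a" "f = syn2 a" and e: "opP f = fscale (- (of_nat l * (of_nat l + 1))) f"
    unfolding eigenP_def hardy2_eq by auto
  have "syn2 (casimir a) = syn2 (\<lambda>p. - (of_nat l * (of_nat l + 1)) * a p)"
    using e a opP_syn2[OF conv_coeffs_l2[OF a(1)]] syn2_scale by metis
  then have "casimir a = (\<lambda>p. - (of_nat l * (of_nat l + 1)) * a p)"
    by (rule syn2_inject[OF conv_coeffs_casimir[OF conv_coeffs_l2[OF a(1)]] conv_coeffs_scale[OF conv_coeffs_l2[OF a(1)]]])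
  then show "f \<in> syn2 ` {a. l2 a \<and> (\<forall>p. casimir a p = - (of_nat l * (of_nat l + 1)) * a p)}"
    using a fun_cong by fastforce
next
  fix f assume "f \<in> syn2 ` {a. l2 a \<and> (\<forall>p. casimir a p = - (of_nat l * (of_nat l + 1)) * a p)}"
  then obtain a where a: "l2 a" "f = syn2 a" "\<And>p. casimir a p = - (of_nat l * (of_nat l + 1)) * a p" by blast
  have "casimir a = (\<lambda>p. - (of_nat l * (of_nat l + 1)) * a p)" using a(3) by (rule ext)
  then have "opP f = fscale (- (of_nat l * (of_nat l + 1))) f"
    unfolding a(2) opP_syn2[OF conv_coeffs_l2[OF a(1)]] syn2_scale by (rule arg_cong)
  then show "f \<in> eigenP l" using a(1,2) unfolding eigenP_def hardy2_eq by blast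
qed

lemma l2_casimir_truncate: "l2 (casimir (\<lambda>p. if p \<in> tri N then a p else 0))"
proof (rule l2_finite_support[OF finite_tri[of N]])
  fix p assume p: "p \<notin> tri N"
  define M where "M = fst p + snd p"
  have M: "p \<in> diag M" by (simp add: diag_def M_def split: prod.splits)
  have "casimir (\<lambda>p. if p \<in> tri N then a p else 0) p = casimir (\<lambda>_. 0) p"
    by (rule casimir_cong_diag[OF _ M]) (use p in \<open>auto simp: diag_def tri_def M_def split: prod.splits\<close>)
  then show "casimir (\<lambda>p. if p \<in> tri N then a p else 0) p = 0" by (simp only: casimir_0)
qed

text \<open>Symmetry on each degree adds up, as both pairings are summable over the degrees.\<close>

lemma l2ip_casimir:
  assumes "l2 a" "l2 (casimir a)" "l2 b" "l2 (casimir b)"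
  shows "l2ip (casimir a) b = l2ip a (casimir b)"
  by (rule l2ip_eq_diag) (simp_all add: assms diag_ip_casimir)

text \<open>Pairing with the array supported at one entry p reads off \<open>casimir b p\<close>,
  although \<open>casimir b\<close> is not known to be square-summable beforehand.\<close>

lemma casimir_adjoint:
  assumes b: "l2 b" and c: "l2 c"
    and eq: "\<And>a. l2 a \<Longrightarrow> l2 (casimir a) \<Longrightarrow> l2ip (casimir a) b = l2ip a c"
  shows "casimir b = c"
proof (rule ext)
  fix p :: "nat \<times> nat"
  define N where "N = fst p + snd p"
  have N: "p \<in> diag N" by (simp add: diag_def N_def split: prod.splits)
  \<comment> \<open>Written as a truncation so that \<open>l2_casimir_truncate\<close> applies to
    it.\<close>
  define e where "e = (\<lambda>q. if q \<in> tri (Suc N) then (if q = p then 1 else 0) else (0 :: complex))"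
  have e: "e q = (if q = p then 1 else 0)" for q using N by (auto simp: e_def tri_def diag_def)
  have le: "l2 e" "l2 (casimir e)" unfolding e_def by (rule l2_truncate, rule l2_casimir_truncate)
  have single: "diag_ip M e x = (if M = N then cnj (x p) else 0)" for M x
  proof -
    have "diag_ip M e x = (\<Sum>q\<in>diag M. if q = p then cnj (x p) else 0)"
      unfolding diag_ip_def by (intro sum.cong) (auto simp: e)
    moreover have "p \<in> diag M \<longleftrightarrow> M = N" using N by (auto simp: diag_def)
    ultimately show ?thesis by simp
  qed
  have s: "((\<lambda>M. if M = N then k else 0) has_sum k) UNIV" for k :: complex
    by (rule has_sum_finite_neutralI[of "{N}"]) auto
  have "l2ip (casimir e) b = cnj (casimir b p)"
    using infsumI[OF l2ip_diag[OF le(2) b]] infsumI[OF s[of "cnj (casimir b p)"]] by (simp add: diag_ip_casimir single)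
  moreover have "l2ip e c = cnj (c p)"
    using infsumI[OF l2ip_diag[OF le(1) c]] infsumI[OF s[of "cnj (c p)"]] by (simp add: single)
  ultimately have "cnj (casimir b p) = cnj (c p)" using eq[OF le] by simp
  then show "casimir b p = c p" by simp
qed

text \<open>An element of the domain of the adjoint satisfies the defining equation entrywise, hence
  already lies in the maximal domain; truncations show that this domain is dense.\<close>

theorem self_adjoint_P: "self_adjoint_operator hardy2 hardy2_ip domP opP"
  unfolding self_adjoint_operator_def
proof (intro conjI)
  show "hilbert_space hardy2 hardy2_ip" by (rule hilbert_space_hardy2)
  show "domP \<subseteq> hardy2" by (auto simp: domP_def)
  have "(\<lambda>_. 0) \<in> domP" unfolding domP_eq
  proof (rule image_eqI)
    show "(\<lambda>_. 0) = syn2 (\<lambda>_. 0)" by (simp add: syn2_0)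
    show "(\<lambda>_. 0) \<in> {a. l2 a \<and> l2 (casimir a)}" by (simp add: casimir_0)
  qed
  moreover have "fadd f g \<in> domP" if "f \<in> domP" "g \<in> domP" for f g
    using that unfolding domP_eq by (auto simp: fadd_syn2 casimir_add intro!: imageI l2_add)
  moreover have "fscale c f \<in> domP" if "f \<in> domP" for c f
    using that unfolding domP_eq by (auto simp: syn2_scale casimir_scale intro!: imageI l2_scale)
  ultimately show "complex_subspace domP" by (simp add: complex_subspace_def)
  show "\<forall>f\<in>hardy2. \<forall>e>0. \<exists>d\<in>domP. ip_norm hardy2_ip (fsub f d) < e"
  proof (intro ballI allI impI)
    fix f and e :: real assume "f \<in> hardy2" and e: "0 < e"
    then obtain a where a: "l2 a" "f = syn2 a" by (auto simp: hardy2_eq)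
    have "\<forall>\<^sub>F N in sequentially. l2norm (\<lambda>p. if p \<in> tri N then 0 else a p) < e"
      by (rule order_tendstoD(2)[OF l2_tail_tendsto_0[OF a(1)] e])
    then obtain N where N: "l2norm (\<lambda>p. if p \<in> tri N then 0 else a p) < e" by (auto simp: eventually_sequentially)
    let ?t = "\<lambda>p. if p \<in> tri N then a p else 0"
    have t: "(\<lambda>p. a p - ?t p) = (\<lambda>p. if p \<in> tri N then 0 else a p)" by auto
    have "ip_norm hardy2_ip (fsub f (syn2 ?t)) < e"
      using N by (simp only: a(2) fsub_syn2[OF a(1) l2_truncate] t ip_norm_syn2[OF l2_tail[OF a(1)]])
    moreover have "syn2 ?t \<in> domP" unfolding domP_eq using l2_truncate l2_casimir_truncate by blast
    ultimately show "\<exists>d\<in>domP. ip_norm hardy2_ip (fsub f d) < e" by blast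
  qed
  show "\<forall>f\<in>domP. opP f \<in> hardy2" by (simp add: domP_def)
  show "complex_linear_on domP opP"
    unfolding complex_linear_on_def domP_eq
    by (auto simp: fadd_syn2 syn2_scale opP_syn2 conv_coeffs_l2 l2_add l2_scale casimir_add casimir_scale)
  show "\<forall>g\<in>hardy2. \<forall>h\<in>hardy2. (\<forall>f\<in>domP. hardy2_ip (opP f) g = hardy2_ip f h) \<longleftrightarrow> g \<in> domP \<and> opP g = h"
  proof (intro ballI iffI)
    fix g h assume "g \<in> hardy2" "h \<in> hardy2" and eq: "\<forall>f\<in>domP. hardy2_ip (opP f) g = hardy2_ip f h"
    then obtain b c where b: "l2 b" "g = syn2 b" and c: "l2 c" "h = syn2 c" by (auto simp: hardy2_eq)
    have "casimir b = c"
    proof (rule casimir_adjoint[OF b(1) c(1)])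
      fix a assume a: "l2 a" "l2 (casimir a)"
      then have "syn2 a \<in> domP" by (auto simp: domP_eq)
      from bspec[OF eq this] show "l2ip (casimir a) b = l2ip a c"
        using a b c by (simp add: opP_syn2 conv_coeffs_l2 hardy2_ip_syn2)
    qed
    then show "g \<in> domP \<and> opP g = h" using b c by (auto simp: domP_eq opP_syn2 conv_coeffs_l2)
  next
    fix g h f assume "g \<in> domP \<and> opP g = h" "f \<in> domP"
    then obtain a b where "l2 a" "l2 (casimir a)" "f = syn2 a" "l2 b" "l2 (casimir b)" "g = syn2 b" "h = opP (syn2 b)"
      unfolding domP_eq by auto
    then show "hardy2_ip (opP f) g = hardy2_ip f h"
      by (simp add: opP_syn2 conv_coeffs_l2 hardy2_ip_syn2 l2ip_casimir)
  qed
qed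

section \<open>The eigenspace decomposition\<close>

text \<open>The components along \<open>eigvec l\<close> in all degrees; the guard excludes the
  degrees below l, where the subtraction would be truncated.\<close>

definition eigproj :: "nat \<Rightarrow> coeffs \<Rightarrow> coeffs" where
  "eigproj l a = (\<lambda>(i, j). if l \<le> i + j then eigcoef l (i + j - l) a * eigvec l (i, j) else 0)"

lemma eigproj_diag: "p \<in> diag N \<Longrightarrow> eigproj l a p = (if l \<le> N then eigcoef l (N - l) a else 0) * eigvec l p"
  by (auto simp: eigproj_def diag_def)

lemma casimir_eigproj: "casimir (eigproj l a) p = - (of_nat l * (of_nat l + 1)) * eigproj l a p"
proof -
  define N where "N = fst p + snd p"
  have N: "p \<in> diag N" by (simp add: diag_def N_def split: prod.splits)
  have "casimir (eigproj l a) p = casimir (\<lambda>p. (if l \<le> N then eigcoef l (N - l) a else 0) * eigvec l p) p"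
    by (rule casimir_cong_diag[OF _ N]) (rule eigproj_diag)
  also have "\<dots> = - (of_nat l * (of_nat l + 1)) * ((if l \<le> N then eigcoef l (N - l) a else 0) * eigvec l p)"
    unfolding casimir_scale casimir_eigvec by simp
  finally show ?thesis unfolding eigproj_diag[OF N] .
qed

lemma diag_norm_eigvecs:
  assumes "M \<subseteq> {..N}"
  shows "(\<Sum>p\<in>diag N. (cmod (\<Sum>m\<in>M. c m * eigvec m p))\<^sup>2) = (\<Sum>m\<in>M. (cmod (c m))\<^sup>2 * real (eigvec_norm m (N - m)))"
proof -
  have fin: "finite M" using assms finite_subset by blast
  have right: "diag_ip N b (\<lambda>p. \<Sum>m\<in>M. c m * eigvec m p) = (\<Sum>m\<in>M. cnj (c m) * diag_ip N b (eigvec m))" for b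
    by (simp add: diag_ip_def sum_distrib_left sum.swap[of _ M] ac_simps)
  have "of_real (\<Sum>p\<in>diag N. (cmod (\<Sum>m\<in>M. c m * eigvec m p))\<^sup>2) = diag_ip N (\<lambda>p. \<Sum>m\<in>M. c m * eigvec m p) (\<lambda>p. \<Sum>m\<in>M. c m * eigvec m p)"
    unfolding diag_ip_def of_real_sum by (intro sum.cong refl complex_norm_square)
  also have "\<dots> = (\<Sum>m\<in>M. \<Sum>l\<in>M. if l = m then c m * cnj (c m) * of_nat (eigvec_norm m (N - m)) else 0)"
    unfolding diag_ip_sum_left diag_ip_scale_left right sum_distrib_left
  proof (intro sum.cong refl)
    fix m l assume "m \<in> M" "l \<in> M"
    then have "m \<le> N" using assms by auto
    then show "c m * (cnj (c l) * diag_ip N (eigvec m) (eigvec l)) = (if l = m then c m * cnj (c m) * of_nat (eigvec_norm m (N - m)) else 0)"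
      using diag_ip_eigvec_self[of m "N - m"] by (auto simp: diag_ip_eigvec_orth)
  qed
  also have "\<dots> = (\<Sum>m\<in>M. c m * cnj (c m) * of_nat (eigvec_norm m (N - m)))"
    using fin by (intro sum.cong refl) simp
  also have "\<dots> = of_real (\<Sum>m\<in>M. (cmod (c m))\<^sup>2 * real (eigvec_norm m (N - m)))"
    by (simp add: complex_norm_square[symmetric] del: of_real_power)
  finally show ?thesis by (simp only: of_real_eq_iff)
qed

text \<open>Pythagoras for the orthogonal eigenvectors of one degree: omitting some of them does not
  increase the norm.\<close>

lemma diag_norm_eigvecs_mono:
  assumes "M \<subseteq> {..N}"
  shows "(\<Sum>p\<in>diag N. (cmod (\<Sum>m\<in>M. eigcoef m (N - m) a * eigvec m p))\<^sup>2) \<le> (\<Sum>p\<in>diag N. (cmod (a p))\<^sup>2)"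
proof -
  have "(\<Sum>p\<in>diag N. (cmod (\<Sum>m\<in>M. eigcoef m (N - m) a * eigvec m p))\<^sup>2) \<le> (\<Sum>p\<in>diag N. (cmod (\<Sum>m\<le>N. eigcoef m (N - m) a * eigvec m p))\<^sup>2)"
    unfolding diag_norm_eigvecs[OF assms] diag_norm_eigvecs[OF order_refl] by (rule sum_mono2) (use assms in auto)
  also have "\<dots> = (\<Sum>p\<in>diag N. (cmod (a p))\<^sup>2)"
    by (intro sum.cong refl) (simp only: diag_expansion[symmetric])
  finally show ?thesis .
qed

lemma sum_tri: "(\<Sum>p\<in>tri M. f p) = (\<Sum>N<M. \<Sum>p\<in>diag N. f p)"
proof -
  have "tri M = (\<Union>N\<in>{..<M}. diag N)" by (auto simp: tri_def diag_def)
  then show ?thesis by (simp only:) (rule sum.UNION_disjoint, simp, simp, auto simp: diag_def)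
qed

lemma l2_diag_mono:
  assumes a: "l2 a" and le: "\<And>N. (\<Sum>p\<in>diag N. (cmod (b p))\<^sup>2) \<le> (\<Sum>p\<in>diag N. (cmod (a p))\<^sup>2)"
  shows "l2 b" "l2norm b \<le> l2norm a"
proof -
  have "L2_set (\<lambda>p. cmod (b p)) F \<le> l2norm a" if F: "finite F" for F
  proof -
    obtain M where M: "F \<subseteq> tri M" using tri_exhaust[OF F] by blast
    have "(\<Sum>p\<in>F. (cmod (b p))\<^sup>2) \<le> (\<Sum>p\<in>tri M. (cmod (b p))\<^sup>2)" using M by (intro sum_mono2) auto
    also have "\<dots> \<le> (\<Sum>p\<in>tri M. (cmod (a p))\<^sup>2)" unfolding sum_tri by (intro sum_mono le)
    finally have "L2_set (\<lambda>p. cmod (b p)) F \<le> L2_set (\<lambda>p. cmod (a p)) (tri M)"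
      unfolding L2_set_def by (rule real_sqrt_le_mono)
    also have "\<dots> \<le> l2norm a" by (rule L2_set_le_l2norm[OF a finite_tri])
    finally show ?thesis .
  qed
  then show "l2 b" "l2norm b \<le> l2norm a" by (auto intro: l2I)
qed

lemma l2_eigproj: assumes "l2 a" shows "l2 (eigproj l a)"
proof (rule l2_diag_mono(1)[OF assms])
  fix N
  show "(\<Sum>p\<in>diag N. (cmod (eigproj l a p))\<^sup>2) \<le> (\<Sum>p\<in>diag N. (cmod (a p))\<^sup>2)"
  proof (cases "l \<le> N")
    case True
    then show ?thesis using diag_norm_eigvecs_mono[of "{l}" N a] by (simp add: eigproj_diag)
  next
    case False
    then show ?thesis by (simp add: eigproj_diag sum_nonneg)
  qed
qed

lemma l2_sum: "finite S \<Longrightarrow> (\<And>l. l \<in> S \<Longrightarrow> l2 (a l)) \<Longrightarrow> l2 (\<lambda>p. \<Sum>l\<in>S. a l p)"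
  by (induction S rule: finite_induct) (auto intro: l2_add)

lemma syn2_sum:
  assumes "finite S" "\<And>l. l \<in> S \<Longrightarrow> l2 (a l)"
  shows "(\<lambda>q. \<Sum>l\<in>S. syn2 (a l) q) = syn2 (\<lambda>p. \<Sum>l\<in>S. a l p)"
  using assms
proof (induction S rule: finite_induct)
  case empty
  then show ?case by (simp add: syn2_0)
next
  case (insert x S)
  then have "fadd (syn2 (a x)) (syn2 (\<lambda>p. \<Sum>l\<in>S. a l p)) = syn2 (\<lambda>p. a x p + (\<Sum>l\<in>S. a l p))"
    by (intro fadd_syn2 l2_sum) auto
  then show ?case using insert by (simp add: fadd_def fun_eq_iff)
qed

text \<open>In degree N the eigenvectors have index m \<le> N, so removal of the first n projections
  leaves nothing in degrees below n and a part of a elsewhere. The degree tail of a therefore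
  controls the residual.\<close>

lemma eigproj_residual_norm:
  assumes a: "l2 a"
  shows "l2norm (\<lambda>p. a p - (\<Sum>l<n. eigproj l a p)) \<le> l2norm (\<lambda>p. if p \<in> tri n then 0 else a p)"
proof (rule l2_diag_mono(2)[OF l2_tail[OF a]])
  fix N
  have r: "a p - (\<Sum>l<n. eigproj l a p) = (\<Sum>m\<in>{n..N}. eigcoef m (N - m) a * eigvec m p)" if p: "p \<in> diag N" for p
  proof -
    let ?f = "\<lambda>m. eigcoef m (N - m) a * eigvec m p"
    have "(\<Sum>l<n. eigproj l a p) = (\<Sum>l<n. if l \<le> N then ?f l else 0)"
      by (intro sum.cong refl) (simp add: eigproj_diag[OF p])
    also have "\<dots> = (\<Sum>l\<in>{..<n} \<inter> {..N}. ?f l)" by (subst sum.inter_restrict) (auto intro!: sum.cong)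
    finally have e: "(\<Sum>l<n. eigproj l a p) = (\<Sum>l\<in>{..<n} \<inter> {..N}. ?f l)" .
    have "a p = (\<Sum>l\<le>N. ?f l)" by (rule diag_expansion[OF p])
    also have "{..N} = ({..<n} \<inter> {..N}) \<union> {n..N}" by auto
    also have "(\<Sum>l\<in>({..<n} \<inter> {..N}) \<union> {n..N}. ?f l) = (\<Sum>l\<in>{..<n} \<inter> {..N}. ?f l) + (\<Sum>l\<in>{n..N}. ?f l)"
      by (rule sum.union_disjoint) auto
    finally show ?thesis using e by simp
  qed
  have e: "(\<Sum>p\<in>diag N. (cmod (a p - (\<Sum>l<n. eigproj l a p)))\<^sup>2) = (\<Sum>p\<in>diag N. (cmod (\<Sum>m\<in>{n..N}. eigcoef m (N - m) a * eigvec m p))\<^sup>2)"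
    by (intro sum.cong refl) (simp add: r)
  show "(\<Sum>p\<in>diag N. (cmod (a p - (\<Sum>l<n. eigproj l a p)))\<^sup>2) \<le> (\<Sum>p\<in>diag N. (cmod (if p \<in> tri n then 0 else a p))\<^sup>2)"
  proof (cases "N < n")
    case True
    then show ?thesis unfolding e by (simp add: sum_nonneg)
  next
    case False
    then have "(\<Sum>p\<in>diag N. (cmod (if p \<in> tri n then 0 else a p))\<^sup>2) = (\<Sum>p\<in>diag N. (cmod (a p))\<^sup>2)"
      by (intro sum.cong refl) (auto simp: diag_def tri_def)
    then show ?thesis unfolding e using diag_norm_eigvecs_mono[of "{n..N}" N a] by auto
  qed
qed

text \<open>Norm convergence implies convergence of entries, and each entry of
  \<open>casimir\<close> involves finitely many of them, so the eigen equation passes to the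
  limit.\<close>

lemma closed_subspace_eigenP: "closed_subspace_of hardy2 hardy2_ip (eigenP l)"
  unfolding closed_subspace_of_def
proof (intro conjI allI impI)
  show "eigenP l \<subseteq> hardy2" by (auto simp: eigenP_def)
  have "(\<lambda>_. 0) \<in> eigenP l" unfolding eigenP_eq
  proof (rule image_eqI)
    show "(\<lambda>_. 0) = syn2 (\<lambda>_. 0)" by (simp add: syn2_0)
    show "(\<lambda>_. 0) \<in> {a. l2 a \<and> (\<forall>p. casimir a p = - (of_nat l * (of_nat l + 1)) * a p)}" by (simp add: casimir_0)
  qed
  moreover have "fadd f g \<in> eigenP l" if "f \<in> eigenP l" "g \<in> eigenP l" for f g
  proof -
    obtain a b where a: "l2 a" "f = syn2 a" "\<And>p. casimir a p = - (of_nat l * (of_nat l + 1)) * a p"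
      and b: "l2 b" "g = syn2 b" "\<And>p. casimir b p = - (of_nat l * (of_nat l + 1)) * b p"
      using \<open>f \<in> eigenP l\<close> \<open>g \<in> eigenP l\<close> unfolding eigenP_eq by blast
    show ?thesis unfolding eigenP_eq
      by (rule image_eqI[of _ _ "\<lambda>p. a p + b p"])
         (simp_all only: mem_Collect_eq a(2) b(2) fadd_syn2[OF a(1) b(1)] l2_add[OF a(1) b(1)] casimir_add a(3) b(3), simp add: distrib_left)
  qed
  moreover have "fscale c f \<in> eigenP l" if "f \<in> eigenP l" for c f
  proof -
    obtain a where a: "l2 a" "f = syn2 a" "\<And>p. casimir a p = - (of_nat l * (of_nat l + 1)) * a p"
      using \<open>f \<in> eigenP l\<close> unfolding eigenP_eq by blast
    show ?thesis unfolding eigenP_eq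
      by (rule image_eqI[of _ _ "\<lambda>p. c * a p"])
         (simp_all only: mem_Collect_eq a(2) syn2_scale l2_scale[OF a(1)] casimir_scale a(3), simp)
  qed
  ultimately show "complex_subspace (eigenP l)" by (simp add: complex_subspace_def)
  fix X :: "nat \<Rightarrow> complex \<times> complex \<Rightarrow> complex" and f
  assume *: "(\<forall>n. X n \<in> eigenP l) \<and> f \<in> hardy2 \<and> (\<lambda>n. ip_norm hardy2_ip (fsub (X n) f)) \<longlonglongrightarrow> 0"
  then have "\<forall>n. \<exists>a. l2 a \<and> X n = syn2 a \<and> (\<forall>p. casimir a p = - (of_nat l * (of_nat l + 1)) * a p)"
    unfolding eigenP_eq by blast
  from choice[OF this] obtain a where a: "\<And>n. l2 (a n)" "\<And>n. X n = syn2 (a n)" "\<And>n p. casimir (a n) p = - (of_nat l * (of_nat l + 1)) * a n p"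
    by blast
  from * obtain b where b: "l2 b" "f = syn2 b" by (auto simp: hardy2_eq)
  have lim: "(\<lambda>n. l2norm (\<lambda>p. a n p - b p)) \<longlonglongrightarrow> 0"
    using * by (simp add: a(2) b(2) fsub_syn2 ip_norm_syn2 l2_diff a(1) b(1))
  have pt: "(\<lambda>n. a n p) \<longlonglongrightarrow> b p" for p
  proof -
    have "(\<lambda>n. a n p - b p) \<longlonglongrightarrow> 0"
      by (rule Lim_null_comparison[OF _ lim]) (intro always_eventually allI cmod_le_l2norm[of "\<lambda>p. a _ p - b p"] l2_diff a(1) b(1))
    then show ?thesis by (simp add: LIM_zero_iff)
  qed
  have "casimir b p = - (of_nat l * (of_nat l + 1)) * b p" for p
  proof (rule LIMSEQ_unique)
    show "(\<lambda>n. casimir (a n) p) \<longlonglongrightarrow> casimir b p" by (rule casimir_tendsto[OF pt])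
    show "(\<lambda>n. casimir (a n) p) \<longlonglongrightarrow> - (of_nat l * (of_nat l + 1)) * b p" unfolding a(3) by (intro tendsto_mult tendsto_const pt)
  qed
  then show "f \<in> eigenP l" unfolding eigenP_eq using b by blast
qed

theorem hilbert_sum_eigenP: "hilbert_sum hardy2 hardy2_ip eigenP"
  unfolding hilbert_sum_def
proof (intro conjI allI impI ballI)
  show "hilbert_space hardy2 hardy2_ip" by (rule hilbert_space_hardy2)
  show "closed_subspace_of hardy2 hardy2_ip (eigenP l)" for l by (rule closed_subspace_eigenP)
next
  fix k l :: nat and f g assume kl: "k \<noteq> l" "f \<in> eigenP k" "g \<in> eigenP l"
  obtain a where a: "l2 a" "f = syn2 a" "\<And>p. casimir a p = - (of_nat k * (of_nat k + 1)) * a p" using kl(2) unfolding eigenP_eq by blast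
  obtain b where b: "l2 b" "g = syn2 b" "\<And>p. casimir b p = - (of_nat l * (of_nat l + 1)) * b p" using kl(3) unfolding eigenP_eq by blast
  have "diag_ip N a b = 0" for N
  proof -
    have "- (of_nat k * (of_nat k + 1)) * diag_ip N a b = diag_ip N (casimir a) b"
      unfolding diag_ip_scale_left[symmetric] by (rule diag_ip_cong) (simp_all only: a(3))
    also have "\<dots> = diag_ip N a (casimir b)" by (rule diag_ip_casimir)
    also have "\<dots> = diag_ip N a (\<lambda>p. - (of_nat l * (of_nat l + 1)) * b p)"
      by (rule diag_ip_cong) (simp_all only: b(3))
    also have "\<dots> = - (of_nat l * (of_nat l + 1)) * diag_ip N a b" unfolding diag_ip_scale_right by simp
    finally show ?thesis using eigenvalue_inject[of k l] kl(1) by auto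
  qed
  then have "l2ip a b = 0" using infsumI[OF l2ip_diag[OF a(1) b(1)]] by simp
  then show "hardy2_ip f g = 0" by (simp add: a(2) b(2) hardy2_ip_syn2 a(1) b(1))
next
  fix f assume "f \<in> hardy2"
  then obtain a where a: "l2 a" "f = syn2 a" by (auto simp: hardy2_eq)
  show "\<exists>g. (\<forall>l. g l \<in> eigenP l) \<and> (\<lambda>n. ip_norm hardy2_ip (fsub f (\<lambda>p. \<Sum>l<n. g l p))) \<longlonglongrightarrow> 0"
  proof (intro exI conjI allI)
    show "syn2 (eigproj l a) \<in> eigenP l" for l
      unfolding eigenP_eq using l2_eigproj[OF a(1)] casimir_eigproj by blast
    have e: "ip_norm hardy2_ip (fsub f (\<lambda>p. \<Sum>l<n. syn2 (eigproj l a) p)) = l2norm (\<lambda>p. a p - (\<Sum>l<n. eigproj l a p))" for n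
      by (simp add: syn2_sum l2_eigproj a fsub_syn2 l2_sum ip_norm_syn2 l2_diff)
    show "(\<lambda>n. ip_norm hardy2_ip (fsub f (\<lambda>p. \<Sum>l<n. syn2 (eigproj l a) p))) \<longlonglongrightarrow> 0"
      unfolding e
      by (rule Lim_null_comparison[OF _ l2_tail_tendsto_0[OF a(1)]]) (simp add: eigproj_residual_norm[OF a(1)])
  qed
qed

section \<open>Norms on the weighted Bergman spaces\<close>

text \<open>(z + i)^(2 l + 2) is the automorphy factor of weight 2 l + 2, the weight for which |f|^2
  y^(2 l) dx dy transforms into the analogous density on the disc.\<close>

definition bdisc :: "nat \<Rightarrow> (complex \<Rightarrow> complex) \<Rightarrow> complex \<Rightarrow> complex" where
  "bdisc l f w = f (inv_cayley w) * (inv_cayley w + \<i>) ^ (2 * l + 2)"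

definition bcoef :: "nat \<Rightarrow> (complex \<Rightarrow> complex) \<Rightarrow> nat \<Rightarrow> complex" where
  "bcoef l f n = (deriv ^^ n) (bdisc l f) 0 / fact n"

text \<open>The squared norm of w^n in the disc picture: the factorials are the Beta integral of s^n
  (1 - s)^(2 l), and the power of 2 comes from the change of variables.\<close>

definition bergman_weight :: "nat \<Rightarrow> nat \<Rightarrow> real" where
  "bergman_weight l n = pi / 2 ^ (4 * l + 2) * (fact n * fact (2 * l) / fact (n + 2 * l + 1))"

lemma holomorphic_bdisc: assumes "f \<in> hol_uhp" shows "bdisc l f holomorphic_on ball 0 1"
proof -
  have "f \<circ> inv_cayley holomorphic_on ball 0 1"
    using assms inv_cayley_in_uhp by (intro holomorphic_on_compose_gen[OF holomorphic_inv_cayley, of _ uhp]) (auto simp: hol_uhp_def)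
  then have "(\<lambda>w. (f \<circ> inv_cayley) w * (inv_cayley w + \<i>) ^ (2 * l + 2)) holomorphic_on ball 0 1"
    by (intro holomorphic_intros holomorphic_inv_cayley)
  then show ?thesis by (simp add: bdisc_def[abs_def])
qed

lemma bdisc_sums: assumes "f \<in> hol_uhp" shows "\<forall>w. cmod w < 1 \<longrightarrow> (\<lambda>n. bcoef l f n * w ^ n) sums bdisc l f w"
  using holomorphic_power_series[OF holomorphic_bdisc[OF assms]] by (simp add: bcoef_def)

lemma bdisc_cayley: "z \<in> uhp \<Longrightarrow> f z = bdisc l f (cayley z) / (z + \<i>) ^ (2 * l + 2)"
  using uhp_nonzero[of z] by (simp add: bdisc_def inv_cayley_cayley)

lemma inv_cayley_image: "inv_cayley ` ball 0 1 = uhp"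
proof (intro subset_antisym subsetI)
  fix z assume "z \<in> uhp"
  then show "z \<in> inv_cayley ` ball 0 1"
    by (intro image_eqI[of _ _ "cayley z"]) (simp_all add: inv_cayley_cayley uhp_nonzero cmod_cayley_less_1)
qed (auto intro: inv_cayley_in_uhp)

lemma inj_on_inv_cayley: "inj_on inv_cayley (ball 0 1)"
proof (rule inj_on_inverseI)
  fix w :: complex assume "w \<in> ball 0 1"
  then show "cayley (inv_cayley w) = w" by (intro cayley_inv_cayley) auto
qed

lemma deriv_inv_cayley: "w \<noteq> 1 \<Longrightarrow> deriv inv_cayley w = 2 * \<i> / (1 - w)\<^sup>2"
proof (rule DERIV_imp_deriv)
  assume "w \<noteq> 1"
  then show "(inv_cayley has_field_derivative 2 * \<i> / (1 - w)\<^sup>2) (at w)"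
    unfolding inv_cayley_def by (auto intro!: derivative_eq_intros simp: power2_eq_square algebra_simps)
qed

text \<open>With d = |1 - w| the derivative of \<open>inv_cayley\<close> has modulus 2 / d^2, the
  imaginary part is (1 - |w|^2) / d^2 and |z + i| = 2 / d; all powers of d cancel.\<close>

lemma bergman_density:
  assumes "w \<in> ball 0 1"
  shows "(cmod (deriv inv_cayley w))\<^sup>2 * ((cmod (f (inv_cayley w)))\<^sup>2 * Im (inv_cayley w) ^ (2 * l))
    = (cmod (bdisc l f w))\<^sup>2 * (1 - (cmod w)\<^sup>2) ^ (2 * l) / 2 ^ (4 * l + 2)"
proof -
  have w: "w \<noteq> 1" using assms by auto
  define d where "d = cmod (1 - w)"
  have d: "0 < d" using w by (simp add: d_def)
  define F where "F = (cmod (f (inv_cayley w)))\<^sup>2"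
  define m where "m = 1 - (cmod w)\<^sup>2"
  have 1: "(cmod (deriv inv_cayley w))\<^sup>2 = 4 / d ^ 4"
    by (simp add: deriv_inv_cayley[OF w] norm_divide norm_mult norm_power power_divide d_def flip: power_mult)
  have 2: "Im (inv_cayley w) ^ (2 * l) = m ^ (2 * l) / d ^ (4 * l)"
    by (simp add: Im_inv_cayley[OF w] power_divide d_def m_def flip: power_mult)
  have 3: "(cmod (bdisc l f w))\<^sup>2 = F * (2 ^ (4 * l + 4) / d ^ (4 * l + 4))"
  proof -
    have "(2 / d) ^ (2 * l + 2) * (2 / d) ^ (2 * l + 2) = 2 ^ (4 * l + 4) / d ^ (4 * l + 4)"
    proof -
      have "2 * l + 2 + (2 * l + 2) = 4 * l + 4" by simp
      then have "(2 / d) ^ (2 * l + 2) * (2 / d) ^ (2 * l + 2) = (2 / d) ^ (4 * l + 4)" by (simp only: power_add[symmetric])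
      then show ?thesis by (simp only: power_divide)
    qed
    moreover have "cmod (bdisc l f w) = cmod (f (inv_cayley w)) * (2 / d) ^ (2 * l + 2)"
      by (simp only: bdisc_def norm_mult norm_power inv_cayley_add_i[OF w] norm_divide d_def) (simp add: norm_mult)
    then have "(cmod (bdisc l f w))\<^sup>2 = F * ((2 / d) ^ (2 * l + 2) * (2 / d) ^ (2 * l + 2))"
      by (simp only: F_def power2_eq_square mult_ac)
    ultimately show ?thesis by (simp only:)
  qed
  have "4 / d ^ 4 * (F * (m ^ (2 * l) / d ^ (4 * l))) = F * (2 ^ (4 * l + 4) / d ^ (4 * l + 4)) * m ^ (2 * l) / 2 ^ (4 * l + 2)"
    using d by (simp add: power_add field_simps)
  then show ?thesis unfolding 1 2 3 F_def[symmetric] m_def[symmetric] .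
qed

lemma borel_measurable_inv_cayley [measurable]: "inv_cayley \<in> borel_measurable borel"
  unfolding inv_cayley_def by measurable

text \<open>The weight is radial, so Parseval on circles can be integrated termwise. The identity is
  one of extended reals and thus also characterises membership, as surjectivity requires.\<close>

lemma bergman_norm_sq_eq:
  assumes f: "f \<in> hol_uhp"
  shows "bergman_norm_sq l f = (\<Sum>n. ennreal (bergman_weight l n * (cmod (bcoef l f n))\<^sup>2))"
proof -
  note [measurable] = borel_measurable_hol_uhp[OF f]
  define K where "K = pi / 2 ^ (4 * l + 2)"
  have K: "0 < K" by (simp add: K_def)
  define c where "c = bcoef l f"
  define G where "G = (\<lambda>w. (cmod (bdisc l f w))\<^sup>2 * (1 - (cmod w)\<^sup>2) ^ (2 * l) / 2 ^ (4 * l + 2))"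
  have "bdisc l f \<in> borel_measurable borel" unfolding bdisc_def[abs_def] by measurable
  then have Gm: "G \<in> borel_measurable borel" unfolding G_def by measurable
  have G0: "0 \<le> G w" for w by (simp add: G_def zero_le_even_power)
  have "bergman_norm_sq l f = (\<integral>\<^sup>+z\<in>inv_cayley ` ball 0 1. ennreal ((cmod (f z))\<^sup>2 * Im z ^ (2 * l)) \<partial>lborel)"
    unfolding bergman_norm_sq_def inv_cayley_image ..
  also have "\<dots> = (\<integral>\<^sup>+w\<in>ball 0 1. ennreal ((cmod (deriv inv_cayley w))\<^sup>2 * ((cmod (f (inv_cayley w)))\<^sup>2 * Im (inv_cayley w) ^ (2 * l))) \<partial>lborel)"
    by (rule nn_integral_change_of_variables_holomorphic[OF open_ball _ _ holomorphic_inv_cayley inj_on_inv_cayley])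
       (auto simp: zero_le_even_power)
  also have "\<dots> = (\<integral>\<^sup>+w\<in>ball 0 1. ennreal (G w) \<partial>lborel)"
    by (intro nn_integral_cong) (simp add: bergman_density G_def split: split_indicator)
  also have "\<dots> = (\<integral>\<^sup>+x\<in>{..<ln 1}. (\<integral>\<^sup>+t\<in>angles. ennreal (exp (2 * x) * G (of_real (exp x) * cis t)) \<partial>lborel) \<partial>lborel)"
    by (rule nn_integral_polar[OF Gm G0]) simp
  \<comment> \<open>The absolute value keeps the integrand, as a function of s = exp (2 x),
    nonnegative on the whole line; this is a hypothesis of the later substitution.\<close>
  also have "\<dots> = (\<integral>\<^sup>+x. (\<Sum>n. ennreal (2 * exp (2 * x) * (K * (cmod (c n))\<^sup>2 * (\<bar>exp (2 * x)\<bar> ^ n * (1 - exp (2 * x)) ^ (2 * l)))) * indicator {..<ln 1} x) \<partial>lborel)"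
  proof (rule nn_integral_cong)
    fix x :: real
    show "(\<integral>\<^sup>+t\<in>angles. ennreal (exp (2 * x) * G (of_real (exp x) * cis t)) \<partial>lborel) * indicator {..<ln 1} x
      = (\<Sum>n. ennreal (2 * exp (2 * x) * (K * (cmod (c n))\<^sup>2 * (\<bar>exp (2 * x)\<bar> ^ n * (1 - exp (2 * x)) ^ (2 * l)))) * indicator {..<ln 1} x)"
    proof (cases "x < ln 1")
      case True
      then have x: "\<bar>exp x\<bar> < 1" by simp
      define D where "D = exp (2 * x) * (1 - exp (2 * x)) ^ (2 * l) / 2 ^ (4 * l + 2)"
      have D0: "0 \<le> D" by (simp add: D_def zero_le_even_power)
      note P = Parseval_disc[OF bdisc_sums[OF f, of l] x]
      have "(\<integral>\<^sup>+t\<in>angles. ennreal (exp (2 * x) * G (of_real (exp x) * cis t)) \<partial>lborel)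
         = (\<integral>\<^sup>+t. ennreal D * (ennreal ((cmod (bdisc l f (of_real (exp x) * cis t)))\<^sup>2) * indicator angles t) \<partial>lborel)"
      proof (rule nn_integral_cong)
        fix t :: real
        have "exp (2 * x) * G (of_real (exp x) * cis t) = D * (cmod (bdisc l f (of_real (exp x) * cis t)))\<^sup>2"
          by (simp add: G_def D_def norm_mult exp_double)
        then show "ennreal (exp (2 * x) * G (of_real (exp x) * cis t)) * indicator angles t
           = ennreal D * (ennreal ((cmod (bdisc l f (of_real (exp x) * cis t)))\<^sup>2) * indicator angles t)"
          by (simp only: ennreal_mult[OF D0 zero_le_power2] mult.assoc)
      qed
      also have "\<dots> = ennreal D * ennreal (2 * pi * (\<Sum>n. (cmod (bcoef l f n))\<^sup>2 * exp x ^ (2 * n)))"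
      proof (subst nn_integral_cmult)
        have "continuous_on UNIV (\<lambda>t. bdisc l f (of_real (exp x) * cis t))"
          using x by (intro continuous_on_compose2[OF holomorphic_on_imp_continuous_on[OF holomorphic_bdisc[OF f]]] continuous_intros) (auto simp: norm_mult)
        from borel_measurable_continuous_onI[OF this]
        show "(\<lambda>t. ennreal ((cmod (bdisc l f (of_real (exp x) * cis t)))\<^sup>2) * indicator angles t) \<in> borel_measurable lborel" by measurable
      qed (simp only: P(1))
      also have "\<dots> = ennreal (\<Sum>n. D * (2 * pi) * ((cmod (c n))\<^sup>2 * exp x ^ (2 * n)))"
      proof -
        have s: "summable (\<lambda>n. (cmod (c n))\<^sup>2 * exp x ^ (2 * n))" using P(2) by (simp only: c_def)
        have "0 \<le> 2 * pi * (\<Sum>n. (cmod (c n))\<^sup>2 * exp x ^ (2 * n))" by (intro mult_nonneg_nonneg suminf_nonneg s) auto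
        from ennreal_mult[OF D0 this] show ?thesis
          using suminf_mult[OF s, of "D * (2 * pi)"] by (simp only: c_def mult.assoc)
      qed
      also have "\<dots> = (\<Sum>n. ennreal (D * (2 * pi) * ((cmod (c n))\<^sup>2 * exp x ^ (2 * n))))"
        using D0 P(2) by (intro suminf_ennreal2[symmetric] summable_mult) (auto simp: c_def)
      also have "\<dots> = (\<Sum>n. ennreal (2 * exp (2 * x) * (K * (cmod (c n))\<^sup>2 * (\<bar>exp (2 * x)\<bar> ^ n * (1 - exp (2 * x)) ^ (2 * l)))))"
      proof (intro suminf_cong arg_cong[where f = ennreal])
        fix n
        have "exp x ^ (2 * n) = exp (2 * x) ^ n" by (simp add: exp_double power_mult)
        then show "D * (2 * pi) * ((cmod (c n))\<^sup>2 * exp x ^ (2 * n)) = 2 * exp (2 * x) * (K * (cmod (c n))\<^sup>2 * (\<bar>exp (2 * x)\<bar> ^ n * (1 - exp (2 * x)) ^ (2 * l)))"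
          by (simp add: D_def K_def)
      qed
      finally show ?thesis using True by simp
    qed simp
  qed
  also have "\<dots> = (\<Sum>n. \<integral>\<^sup>+x\<in>{..<ln 1}. ennreal (2 * exp (2 * x) * (K * (cmod (c n))\<^sup>2 * (\<bar>exp (2 * x)\<bar> ^ n * (1 - exp (2 * x)) ^ (2 * l)))) \<partial>lborel)"
    by (rule nn_integral_suminf) measurable
  also have "\<dots> = (\<Sum>n. ennreal (bergman_weight l n * (cmod (bcoef l f n))\<^sup>2))"
  proof (rule suminf_cong)
    fix n
    have "(\<integral>\<^sup>+x\<in>{..<ln 1}. ennreal (2 * exp (2 * x) * (K * (cmod (c n))\<^sup>2 * (\<bar>exp (2 * x)\<bar> ^ n * (1 - exp (2 * x)) ^ (2 * l)))) \<partial>lborel)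
      = (\<integral>\<^sup>+s\<in>{0<..<1\<^sup>2}. ennreal (K * (cmod (c n))\<^sup>2 * (\<bar>s\<bar> ^ n * (1 - s) ^ (2 * l))) \<partial>lborel)"
      using K by (intro nn_integral_exp_double[symmetric]) (auto simp: zero_le_even_power)
    also have "\<dots> = (\<integral>\<^sup>+s. ennreal (K * (cmod (c n))\<^sup>2) * (ennreal (s ^ n * (1 - s) ^ (2 * l)) * indicator {0<..<1} s) \<partial>lborel)"
    proof (rule nn_integral_cong)
      fix s :: real
      have "ennreal (K * (cmod (c n))\<^sup>2 * (s ^ n * (1 - s) ^ (2 * l))) = ennreal (K * (cmod (c n))\<^sup>2) * ennreal (s ^ n * (1 - s) ^ (2 * l))" if "0 < s"
        using K that by (intro ennreal_mult) (auto simp: zero_le_even_power)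
      then show "ennreal (K * (cmod (c n))\<^sup>2 * (\<bar>s\<bar> ^ n * (1 - s) ^ (2 * l))) * indicator {0<..<1\<^sup>2} s
         = ennreal (K * (cmod (c n))\<^sup>2) * (ennreal (s ^ n * (1 - s) ^ (2 * l)) * indicator {0<..<1} s)"
        by (cases "0 < s \<and> s < 1") auto
    qed
    also have "\<dots> = ennreal (K * (cmod (c n))\<^sup>2) * ennreal (fact n * fact (2 * l) / fact (n + 2 * l + 1))"
      by (subst nn_integral_cmult) (simp_all only: nn_integral_Beta_nat, measurable)
    also have "\<dots> = ennreal (bergman_weight l n * (cmod (bcoef l f n))\<^sup>2)"
    proof -
      have "ennreal (K * (cmod (c n))\<^sup>2) * ennreal (fact n * fact (2 * l) / fact (n + 2 * l + 1)) = ennreal (K * (cmod (c n))\<^sup>2 * (fact n * fact (2 * l) / fact (n + 2 * l + 1)))"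
        using K by (intro ennreal_mult[symmetric]) auto
      then show ?thesis by (simp only: bergman_weight_def K_def c_def mult_ac)
    qed
    finally show "(\<integral>\<^sup>+x\<in>{..<ln 1}. ennreal (2 * exp (2 * x) * (K * (cmod (c n))\<^sup>2 * (\<bar>exp (2 * x)\<bar> ^ n * (1 - exp (2 * x)) ^ (2 * l)))) \<partial>lborel)
      = ennreal (bergman_weight l n * (cmod (bcoef l f n))\<^sup>2)" .
  qed
  finally show ?thesis .
qed

section \<open>The generating operator\<close>

text \<open>A function that is not integrable has contour integral 0 by convention, and
  multiplication by c \<noteq> 0 preserves non-integrability; hence the rule for arbitrary
  f.\<close>

lemma contour_integral_lmul_nonzero:
  assumes "c \<noteq> 0"
  shows "contour_integral g (\<lambda>x. c * f x) = c * contour_integral g f"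
proof (cases "f contour_integrable_on g")
  case True
  then show ?thesis by (rule contour_integral_lmul)
next
  case False
  have "\<not> (\<lambda>x. c * f x) contour_integrable_on g"
  proof
    assume "(\<lambda>x. c * f x) contour_integrable_on g"
    from contour_integrable_lmul[OF this, of "inverse c"] show False using False assms by (simp add: mult.assoc[symmetric])
  qed
  then show ?thesis using False by (simp add: not_integrable_contour_integral)
qed

text \<open>The zero in \<open>b\<close> of the denominator \<open>(a - z) (b - z) + t (a - b) = (a - z - t) (b - pole z t a)\<close>.\<close>

definition pole :: "complex \<Rightarrow> complex \<Rightarrow> complex \<Rightarrow> complex" where
  "pole z t a = z - t * (a - z) / (a - z - t)"

definition T_radius :: "complex \<Rightarrow> complex \<Rightarrow> real" where
  "T_radius z t = (2 * cmod t + Im z) / 2"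

context
  fixes z t :: complex
  assumes dom: "(z, t) \<in> domT"
begin

lemma T_radius_bounds: "2 * cmod t < T_radius z t" "T_radius z t < Im z" "0 < T_radius z t" "0 < Im z"
proof -
  have z: "0 < Im z" "2 * cmod t < Im z" using dom by (auto simp: domT_def uhp_def)
  show "0 < Im z" by (rule z(1))
  show "2 * cmod t < T_radius z t" "T_radius z t < Im z" using z by (simp_all add: T_radius_def)
  show "0 < T_radius z t" using z(1) unfolding T_radius_def by (intro divide_pos_pos add_nonneg_pos) auto
qed

lemma cball_subset_uhp: "cball z (T_radius z t) \<subseteq> uhp"
proof
  fix a assume "a \<in> cball z (T_radius z t)"
  then have "\<bar>Im (z - a)\<bar> \<le> T_radius z t" using abs_Im_le_cmod[of "z - a"] by (simp add: dist_norm)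
  then show "a \<in> uhp" using T_radius_bounds(2) by (auto simp: uhp_def)
qed

lemma sphere_nonzero: assumes "a \<in> sphere z (T_radius z t)" shows "a - z - t \<noteq> 0"
proof
  assume "a - z - t = 0"
  then have "cmod (a - z) = cmod t" by simp
  then show False using assms T_radius_bounds(1) norm_ge_zero[of t] by (simp add: dist_norm norm_minus_commute)
qed

text \<open>The distance from the pole to z is at most |t| r / (r - |t|), and this is below r
  because r > 2 |t|; here lies the origin of the factor 2 in the domain.\<close>

lemma pole_in_ball: assumes "a \<in> sphere z (T_radius z t)" shows "pole z t a \<in> ball z (T_radius z t)"
proof -
  let ?r = "T_radius z t"
  have a: "cmod (a - z) = ?r" using assms by (simp add: dist_norm norm_minus_commute)
  have n: "?r - cmod t \<le> cmod (a - z - t)" using norm_triangle_ineq2[of "a - z" t] a by simp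
  have p: "0 < ?r - cmod t" using T_radius_bounds(1) norm_ge_zero[of t] by linarith
  have "cmod (pole z t a - z) = cmod t * ?r / cmod (a - z - t)"
    by (simp add: pole_def norm_divide norm_mult a)
  also have "\<dots> \<le> cmod t * ?r / (?r - cmod t)"
    using n p T_radius_bounds(3) by (intro divide_left_mono mult_nonneg_nonneg mult_pos_pos) auto
  also have "\<dots> < ?r"
  proof -
    have "cmod t * ?r < ?r * (?r - cmod t)" using T_radius_bounds(1,3) by (simp add: algebra_simps)
    then show ?thesis using p by (simp add: divide_less_eq)
  qed
  finally show ?thesis by (simp add: dist_norm norm_minus_commute)
qed

lemma denominator_factor:
  assumes "a - z - t \<noteq> 0"
  shows "(a - z) * (b - z) + t * (a - b) = (a - z - t) * (b - pole z t a)"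
  using assms by (simp add: pole_def field_simps)

lemma continuous_on_pole: "continuous_on (sphere z (T_radius z t)) (pole z t)"
  unfolding pole_def using sphere_nonzero by (intro continuous_intros) auto

lemma opT_single_integral:
  assumes f: "\<And>a. a \<in> uhp \<Longrightarrow> (\<lambda>b. f (a, b)) holomorphic_on uhp"
  shows "opT f (z, t) = 1 / (2 * of_real pi * \<i>) * contour_integral (circlepath z (T_radius z t)) (\<lambda>a. f (a, pole z t a) / (a - z - t))"
proof -
  let ?C = "circlepath z (T_radius z t)"
  have img: "path_image ?C = sphere z (T_radius z t)" using T_radius_bounds(3) by simp
  have inner: "contour_integral ?C (\<lambda>b. f (a, b) / ((a - z) * (b - z) + t * (a - b))) = 2 * of_real pi * \<i> * (f (a, pole z t a) / (a - z - t))"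
    if "a \<in> path_image ?C" for a
  proof -
    have a: "a \<in> sphere z (T_radius z t)" using that by (simp only: img)
    have a': "a \<in> uhp" using a cball_subset_uhp sphere_cball by blast
    have "(\<lambda>b. f (a, b) / (a - z - t)) holomorphic_on cball z (T_radius z t)"
      by (intro holomorphic_intros holomorphic_on_subset[OF f[OF a'] cball_subset_uhp]) (rule sphere_nonzero[OF a])
    moreover have "cmod (pole z t a - z) < T_radius z t"
      using pole_in_ball[OF a] by (simp add: dist_norm norm_minus_commute)
    ultimately have "((\<lambda>b. f (a, b) / (a - z - t) / (b - pole z t a)) has_contour_integral (2 * of_real pi * \<i> * (f (a, pole z t a) / (a - z - t)))) ?C"
      by (rule Cauchy_integral_circlepath_simple)
    then show ?thesis
      by (intro contour_integral_unique) (simp add: denominator_factor[OF sphere_nonzero[OF a]])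
  qed
  have "opT f (z, t) = 1 / (2 * of_real pi * \<i>)\<^sup>2 * contour_integral ?C (\<lambda>a. contour_integral ?C (\<lambda>b. f (a, b) / ((a - z) * (b - z) + t * (a - b))))"
    by (simp add: opT_def T_radius_def Let_def)
  also have "contour_integral ?C (\<lambda>a. contour_integral ?C (\<lambda>b. f (a, b) / ((a - z) * (b - z) + t * (a - b))))
     = contour_integral ?C (\<lambda>a. 2 * of_real pi * \<i> * (f (a, pole z t a) / (a - z - t)))"
    by (rule contour_integral_eq) (rule inner)
  \<comment> \<open>Only holomorphy in the second variable is given, so the outer integrand may fail
    to be integrable; the scalar rule covers this case.\<close>
  also have "\<dots> = 2 * of_real pi * \<i> * contour_integral ?C (\<lambda>a. f (a, pole z t a) / (a - z - t))"
    by (rule contour_integral_lmul_nonzero) simp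
  finally show ?thesis by (simp add: power2_eq_square)
qed

lemma cmod_cayley_bound: "\<exists>\<rho>. 0 \<le> \<rho> \<and> \<rho> < 1 \<and> (\<forall>a\<in>cball z (T_radius z t). cmod (cayley a) \<le> \<rho>)"
proof -
  have "continuous_on (cball z (T_radius z t)) (\<lambda>a. cmod (cayley a))"
    by (intro continuous_intros continuous_on_subset[OF holomorphic_on_imp_continuous_on[OF holomorphic_cayley] cball_subset_uhp])
  from continuous_attains_sup[OF compact_cball _ this] T_radius_bounds(3)
  obtain a where a: "a \<in> cball z (T_radius z t)" "\<forall>b\<in>cball z (T_radius z t). cmod (cayley b) \<le> cmod (cayley a)" by auto
  moreover have "cmod (cayley a) < 1" using a(1) cball_subset_uhp cmod_cayley_less_1 by blast
  ultimately show ?thesis by (intro exI[of _ "cmod (cayley a)"]) simp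
qed

lemma holomorphic_syn2_snd:
  assumes "conv_coeffs a" "x \<in> uhp"
  shows "(\<lambda>b. syn2 a (x, b)) holomorphic_on uhp"
proof -
  have "(\<lambda>b. ps2 a (cayley x) (cayley b)) holomorphic_on uhp"
    using ps2_cayley_derivative(2)[OF assms] field_differentiable_at_within
    unfolding holomorphic_on_def field_differentiable_def by (metis has_field_derivative_at_within)
  then have "(\<lambda>b. ps2 a (cayley x) (cayley b) * (inverse (x + \<i>) * inverse (b + \<i>) * inverse (of_real pi))) holomorphic_on uhp"
    by (intro holomorphic_intros) (auto simp: uhp_nonzero)
  then show ?thesis by (rule holomorphic_transform) (simp add: syn2_eq assms(2))
qed

definition T_kernel :: "complex \<Rightarrow> complex" where
  "T_kernel a = inverse (a + \<i>) * inverse (pole z t a + \<i>) * inverse (of_real pi) / (a - z - t)"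

text \<open>The value of \<open>T\<close> on the basis tensor of index (i, j), written after
  evaluation of the inner integral.\<close>

definition T_coeffs :: coeffs where
  "T_coeffs = (\<lambda>(i, j). 1 / (2 * of_real pi * \<i>) *
     contour_integral (circlepath z (T_radius z t)) (\<lambda>a. cayley a ^ i * cayley (pole z t a) ^ j * T_kernel a))"

lemma sphere_in_uhp: "a \<in> sphere z (T_radius z t) \<Longrightarrow> a \<in> uhp" "a \<in> sphere z (T_radius z t) \<Longrightarrow> pole z t a \<in> uhp"
  using cball_subset_uhp sphere_cball pole_in_ball ball_subset_cball by blast+

lemma continuous_on_T_kernel: "continuous_on (sphere z (T_radius z t)) T_kernel"
  unfolding T_kernel_def
  by (intro continuous_intros continuous_on_pole) (use sphere_in_uhp uhp_nonzero sphere_nonzero in auto)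

lemma continuous_on_T_term: "continuous_on (sphere z (T_radius z t)) (\<lambda>a. cayley a ^ i * cayley (pole z t a) ^ j * T_kernel a)"
proof -
  have c: "continuous_on uhp cayley" by (intro holomorphic_on_imp_continuous_on holomorphic_cayley)
  have "continuous_on (sphere z (T_radius z t)) cayley"
    by (rule continuous_on_subset[OF c]) (use sphere_in_uhp(1) in blast)
  moreover have "continuous_on (sphere z (T_radius z t)) (\<lambda>a. cayley (pole z t a))"
    by (rule continuous_on_compose2[OF c continuous_on_pole]) (use sphere_in_uhp(2) in blast)
  ultimately show ?thesis by (intro continuous_intros continuous_on_T_kernel)
qed

text \<open>On the circle both a point and its pole stay in a closed disc of the half plane, where
  the Cayley transform has modulus at most some \<rho> < 1; the double series converges uniformly
  and may be integrated termwise.\<close>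

lemma opT_has_sum:
  assumes a: "conv_coeffs a"
  shows "((\<lambda>p. a p * T_coeffs p) has_sum opT (syn2 a) (z, t)) UNIV"
proof -
  let ?r = "T_radius z t"
  obtain \<rho> where \<rho>: "0 \<le> \<rho>" "\<rho> < 1" "\<And>b. b \<in> cball z ?r \<Longrightarrow> cmod (cayley b) \<le> \<rho>" using cmod_cayley_bound by auto
  have "bounded (T_kernel ` sphere z ?r)"
    by (intro compact_imp_bounded compact_continuous_image continuous_on_T_kernel) simp
  then obtain G where "\<forall>x\<in>T_kernel ` sphere z ?r. norm x \<le> G" unfolding bounded_iff by blast
  then have G: "cmod (T_kernel b) \<le> G" if "b \<in> sphere z ?r" for b using that by blast
  define f where "f = (\<lambda>p u. case p of (i, j) \<Rightarrow> a (i, j) * (cayley u ^ i * cayley (pole z t u) ^ j * T_kernel u))"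
  have ul: "uniform_limit (sphere z ?r) (\<lambda>X u. \<Sum>p\<in>X. f p u) (\<lambda>u. \<Sum>\<^sub>\<infinity>p. f p u) (finite_subsets_at_top UNIV)"
  proof (rule Weierstrass_m_test_general[where M = "\<lambda>(i, j). (cmod (a (i, j)) * \<rho> ^ (i + j)) * G"])
    fix p :: "nat \<times> nat" and u assume u: "u \<in> sphere z ?r"
    obtain i j where p: "p = (i, j)" by force
    have "u \<in> cball z ?r" "pole z t u \<in> cball z ?r" using u sphere_cball pole_in_ball ball_subset_cball by blast+
    then have "cmod (a (i, j) * cayley u ^ i * cayley (pole z t u) ^ j) * cmod (T_kernel u) \<le> (cmod (a (i, j)) * \<rho> ^ (i + j)) * G"
      using \<rho> G[OF u] by (intro mult_mono conv_coeffs_bound) auto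
    then show "norm (f p u) \<le> (case p of (i, j) \<Rightarrow> (cmod (a (i, j)) * \<rho> ^ (i + j)) * G)"
      by (simp add: f_def p norm_mult mult.assoc)
  next
    have "(\<lambda>(i, j). cmod (a (i, j)) * \<rho> ^ (i + j)) summable_on UNIV" using a \<rho> by (auto simp: conv_coeffs_def)
    from summable_on_cmult_left[OF this, of G] show "(\<lambda>(i, j). (cmod (a (i, j)) * \<rho> ^ (i + j)) * G) summable_on UNIV"
      by (simp add: case_prod_unfold)
  qed
  have ci: "f p contour_integrable_on circlepath z ?r" for p
    unfolding f_def case_prod_unfold
    by (intro contour_integrable_lmul contour_integrable_continuous_circlepath)
       (simp only: path_image_circlepath abs_of_pos[OF T_radius_bounds(3)] continuous_on_T_term)
  have si: "(\<lambda>u. \<Sum>p\<in>X. f p u) contour_integrable_on circlepath z ?r" if "finite X" for X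
    by (rule contour_integrable_sum[OF that ci])
  have ev: "\<forall>\<^sub>F X in finite_subsets_at_top UNIV. (\<lambda>u. \<Sum>p\<in>X. f p u) contour_integrable_on circlepath z ?r"
    by (rule eventually_finite_subsets_at_top_weakI) (rule si)
  have lim: "((\<lambda>X. contour_integral (circlepath z ?r) (\<lambda>u. \<Sum>p\<in>X. f p u)) \<longlongrightarrow> contour_integral (circlepath z ?r) (\<lambda>u. \<Sum>\<^sub>\<infinity>p. f p u)) (finite_subsets_at_top UNIV)"
    by (rule contour_integral_uniform_limit_circlepath(2)[OF ev ul _ T_radius_bounds(3)]) simp
  have summand: "1 / (2 * of_real pi * \<i>) * contour_integral (circlepath z ?r) (f p) = a p * T_coeffs p" for p
    unfolding f_def T_coeffs_def case_prod_unfold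
    by (subst contour_integral_lmul)
       (simp_all add: contour_integrable_continuous_circlepath abs_of_pos[OF T_radius_bounds(3)] continuous_on_T_term)
  have part: "1 / (2 * of_real pi * \<i>) * contour_integral (circlepath z ?r) (\<lambda>u. \<Sum>p\<in>X. f p u) = (\<Sum>p\<in>X. a p * T_coeffs p)" if "finite X" for X
    unfolding contour_integral_sum[OF that ci] sum_distrib_left by (intro sum.cong refl summand)
  have tot: "1 / (2 * of_real pi * \<i>) * contour_integral (circlepath z ?r) (\<lambda>u. \<Sum>\<^sub>\<infinity>p. f p u) = opT (syn2 a) (z, t)"
  proof -
    have "(\<Sum>\<^sub>\<infinity>p. f p u) = syn2 a (u, pole z t u) / (u - z - t)" if "u \<in> path_image (circlepath z ?r)" for u
    proof -
      have u: "u \<in> sphere z ?r" using that T_radius_bounds(3) by simp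
      have "(\<Sum>\<^sub>\<infinity>p. f p u) = (\<Sum>\<^sub>\<infinity>(i, j). a (i, j) * cayley u ^ i * cayley (pole z t u) ^ j) * T_kernel u"
        unfolding infsum_cmult_left'[symmetric] by (intro infsum_cong) (auto simp: f_def)
      then show ?thesis by (simp add: syn2_eq[OF sphere_in_uhp[OF u]] ps2_def T_kernel_def)
    qed
    then have "contour_integral (circlepath z ?r) (\<lambda>u. \<Sum>\<^sub>\<infinity>p. f p u) = contour_integral (circlepath z ?r) (\<lambda>u. syn2 a (u, pole z t u) / (u - z - t))"
      by (rule contour_integral_eq)
    then show ?thesis using opT_single_integral[of "syn2 a"] holomorphic_syn2_snd[OF a] by simp
  qed
  have "((\<lambda>X. 1 / (2 * of_real pi * \<i>) * contour_integral (circlepath z ?r) (\<lambda>u. \<Sum>p\<in>X. f p u)) \<longlongrightarrow> opT (syn2 a) (z, t)) (finite_subsets_at_top UNIV)"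
    unfolding tot[symmetric] by (intro tendsto_mult tendsto_const lim)
  then show ?thesis unfolding has_sum_def
    by (rule Lim_transform_eventually) (rule eventually_finite_subsets_at_top_weakI, rule part)
qed

lemma conv_coeffs_powers: assumes "cmod x < 1" "cmod y < 1" shows "conv_coeffs (\<lambda>(i, j). x ^ i * y ^ j)"
  by (rule conv_coeffs_l2[OF l2_geometric[OF assms]])

text \<open>Applied to the geometric array x^i y^j, the operator \<open>T\<close> yields the
  generating function of \<open>T_coeffs\<close>; one closed form then determines all of
  them.\<close>

lemma T_coeffs_ps2:
  assumes "cmod x < 1" "cmod y < 1"
  shows "((\<lambda>(i, j). T_coeffs (i, j) * x ^ i * y ^ j) has_sum opT (syn2 (\<lambda>(i, j). x ^ i * y ^ j)) (z, t)) UNIV"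
proof -
  have e: "(\<lambda>(i, j). T_coeffs (i, j) * x ^ i * y ^ j) = (\<lambda>p. (case p of (i, j) \<Rightarrow> x ^ i * y ^ j) * T_coeffs p)"
    by (auto simp: ac_simps)
  show ?thesis unfolding e by (rule opT_has_sum[OF conv_coeffs_powers[OF assms]])
qed

text \<open>Unordered summability of complex numbers is absolute, so it is enough to take the
  generating function at x = y = r.\<close>

lemma conv_coeffs_T_coeffs: "conv_coeffs T_coeffs"
  unfolding conv_coeffs_def
proof (intro allI impI)
  fix r :: real assume r: "0 \<le> r \<and> r < 1"
  then have "cmod (of_real r) < 1" by simp
  from has_sum_imp_summable[OF T_coeffs_ps2[OF this this]]
  have "(\<lambda>p. cmod (case p of (i, j) \<Rightarrow> T_coeffs (i, j) * of_real r ^ i * of_real r ^ j)) summable_on UNIV"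
    by (simp only: summable_on_iff_abs_summable_on_complex)
  moreover have "(\<lambda>p. cmod (case p of (i, j) \<Rightarrow> T_coeffs (i, j) * of_real r ^ i * of_real r ^ j)) = (\<lambda>(i, j). cmod (T_coeffs (i, j)) * r ^ (i + j))"
    using r by (auto simp: norm_mult norm_power power_add)
  ultimately show "(\<lambda>(i, j). cmod (T_coeffs (i, j)) * r ^ (i + j)) summable_on UNIV" by simp
qed

text \<open>On a product of two Szego kernels both contour integrals are evaluated by Cauchy's formula.\<close>

lemma opT_kernel:
  assumes x: "cmod x < 1" and y: "cmod y < 1"
  defines "s \<equiv> cayley z"
  shows "of_real pi * ((z + \<i>)\<^sup>2 * ((1 - x * s) * (1 - y * s)) - 2 * \<i> * t * (x - y)) * opT (syn2 (\<lambda>(i, j). x ^ i * y ^ j)) (z, t) = 1"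
proof -
  let ?r = "T_radius z t"
  \<comment> \<open>Clearing the denominator of the pole makes the second kernel factor linear in a:
    for b = \<open>pole z t a\<close>, ((b + i) - y (b - i)) (a - z - t) = \<alpha> a +
    \<beta>.\<close>
  define \<alpha> where "\<alpha> = (1 - y) * (z - t) + \<i> * (1 + y)"
  define \<beta> where "\<beta> = - (1 - y) * z\<^sup>2 - \<i> * (1 + y) * (z + t)"
  \<comment> \<open>The zero in b of (b + i) - y (b - i). It equals - \<open>inv_cayley y\<close>
    and so lies in the lower half plane.\<close>
  define \<tau> where "\<tau> = - \<i> * (1 + y) / (1 - y)"
  define Dx where "Dx = (\<lambda>a. (a + \<i>) - x * (a - \<i>))"
  have y1: "1 - y \<noteq> 0" using y by auto
  have Dn: "(a + \<i>) - v * (a - \<i>) \<noteq> 0" "(a + \<i>) - v * (a - \<i>) = (a + \<i>) * (1 - v * cayley a)" if "a \<in> uhp" "cmod v < 1" for a v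
  proof -
    have n: "a + \<i> \<noteq> 0" using uhp_nonzero[OF that(1)] .
    then show e: "(a + \<i>) - v * (a - \<i>) = (a + \<i>) * (1 - v * cayley a)" by (simp add: cayley_def field_simps)
    have "cmod v * cmod (cayley a) \<le> cmod v * 1" using cmod_cayley_less_1[OF that(1)] by (intro mult_left_mono) auto
    then have "cmod (v * cayley a) < 1" using that(2) by (simp add: norm_mult)
    then have "1 - v * cayley a \<noteq> 0" by auto
    then show "(a + \<i>) - v * (a - \<i>) \<noteq> 0" unfolding e using n by simp
  qed
  have Im\<tau>: "Im \<tau> < 0"
  proof -
    have "\<tau> = - inv_cayley y" by (simp add: \<tau>_def inv_cayley_def)
    then show ?thesis using inv_cayley_in_uhp[OF y] by (simp add: uhp_def)
  qed
  have X: "?r < cmod (z - \<tau>)"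
  proof -
    have "Im z < Im (z - \<tau>)" using Im\<tau> by simp
    also have "\<dots> \<le> cmod (z - \<tau>)" using abs_Im_le_cmod[of "z - \<tau>"] by simp
    finally show ?thesis using T_radius_bounds(2) by simp
  qed
  have \<alpha>: "\<alpha> = (1 - y) * (z - \<tau> - t)" and \<beta>: "\<beta> = - (1 - y) * (z\<^sup>2 - \<tau> * (z + t))"
    using y1 by (simp_all add: \<alpha>_def \<beta>_def \<tau>_def field_simps)
  have n: "cmod (z - \<tau>) - cmod t \<le> cmod (z - \<tau> - t)" using norm_triangle_ineq2[of "z - \<tau>" t] by simp
  have p: "0 < cmod (z - \<tau>) - cmod t" using X T_radius_bounds(1) norm_ge_zero[of t] by linarith
  have nz: "z - \<tau> - t \<noteq> 0" using n p by auto
  have \<alpha>0: "\<alpha> \<noteq> 0" using \<alpha> y1 nz by simp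
  \<comment> \<open>The zero of \<alpha> a + \<beta>. It lies inside the circle because \<tau> is
    farther from z than the radius, so the outer integral is Cauchy's formula at a0.\<close>
  define a0 where "a0 = - \<beta> / \<alpha>"
  have a0: "a0 - z = t * (z - \<tau>) / (z - \<tau> - t)"
  proof -
    have "a0 = ((1 - y) * (z\<^sup>2 - \<tau> * (z + t))) / ((1 - y) * (z - \<tau> - t))" by (simp only: a0_def \<alpha> \<beta> mult_minus_left minus_minus)
    also have "\<dots> = (z\<^sup>2 - \<tau> * (z + t)) / (z - \<tau> - t)" by (rule mult_divide_mult_cancel_left[OF y1])
    finally show ?thesis using nz by (simp add: divide_simps) (simp add: algebra_simps power2_eq_square)
  qed
  have a0r: "cmod (a0 - z) < ?r"
  proof -
    have "cmod (a0 - z) = cmod t * cmod (z - \<tau>) / cmod (z - \<tau> - t)" by (simp add: a0 norm_divide norm_mult)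
    also have "\<dots> \<le> cmod t * cmod (z - \<tau>) / (cmod (z - \<tau>) - cmod t)"
      using n p by (intro divide_left_mono mult_nonneg_nonneg mult_pos_pos) auto
    also have "\<dots> < ?r"
    proof -
      have "2 * (cmod t * cmod (z - \<tau>)) \<le> ?r * cmod (z - \<tau>)"
        using T_radius_bounds(1) by (simp add: mult_right_mono flip: mult.assoc)
      moreover have "2 * (?r * cmod t) < ?r * ?r" using T_radius_bounds(1,3) by simp
      moreover have "?r * ?r \<le> ?r * cmod (z - \<tau>)" using X T_radius_bounds(3) by simp
      ultimately have "cmod t * cmod (z - \<tau>) < ?r * (cmod (z - \<tau>) - cmod t)" by (simp add: right_diff_distrib)
      then show ?thesis using p by (simp add: divide_less_eq)
    qed
    finally show ?thesis .
  qed
  have a0u: "a0 \<in> uhp"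
  proof -
    have "a0 \<in> cball z ?r" using a0r by (simp add: dist_norm norm_minus_commute)
    then show ?thesis using cball_subset_uhp by blast
  qed
  \<comment> \<open>Summing the two geometric series gives the product of two Szego kernels.\<close>
  have syn: "syn2 (\<lambda>(i, j). x ^ i * y ^ j) (a, b) = inverse (of_real pi * Dx a * ((b + \<i>) - y * (b - \<i>)))" if "a \<in> uhp" "b \<in> uhp" for a b
  proof -
    have lt: "cmod (v * cayley c) < 1" if "cmod v < 1" "c \<in> uhp" for v c
    proof -
      have "cmod v * cmod (cayley c) \<le> cmod v * 1" using cmod_cayley_less_1[OF that(2)] by (intro mult_left_mono) auto
      then show ?thesis using that(1) by (simp add: norm_mult)
    qed
    have geo: "(\<Sum>\<^sub>\<infinity>n. w ^ n) = inverse (1 - w)" if "cmod w < 1" for w :: complex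
    proof (rule infsumI, rule norm_summable_imp_has_sum)
      show "summable (\<lambda>n. norm (w ^ n))" using that by (simp add: norm_power summable_geometric)
      show "(\<lambda>n. w ^ n) sums inverse (1 - w)" using geometric_sums[OF that] by (simp add: inverse_eq_divide)
    qed
    let ?u = "x * cayley a" and ?v = "y * cayley b"
    have e: "(\<lambda>(i, j). (case (i, j) of (i, j) \<Rightarrow> x ^ i * y ^ j) * cayley a ^ i * cayley b ^ j) = (\<lambda>(i, j). ?u ^ i * ?v ^ j)"
      by (auto simp: power_mult_distrib)
    have "(\<lambda>(i, j). ?u ^ i * ?v ^ j) summable_on UNIV"
      using conv_coeffs_summable[OF conv_coeffs_powers[OF x y] cmod_cayley_less_1[OF that(1)] cmod_cayley_less_1[OF that(2)]] unfolding e .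
    from infsum_outer[OF this] have "ps2 (\<lambda>(i, j). x ^ i * y ^ j) (cayley a) (cayley b) = inverse (1 - ?u) * inverse (1 - ?v)"
      unfolding ps2_def e geo[OF lt[OF x that(1)]] geo[OF lt[OF y that(2)]] .
    then show ?thesis
      unfolding syn2_eq[OF that] Dx_def Dn(2)[OF that(1) x] Dn(2)[OF that(2) y] by (simp add: inverse_mult_distrib)
  qed
  have kern: "syn2 (\<lambda>(i, j). x ^ i * y ^ j) (a, pole z t a) / (a - z - t) = (inverse (of_real pi * \<alpha>) * inverse (Dx a)) / (a - a0)"
    if "a \<in> path_image (circlepath z ?r)" for a
  proof -
    have a: "a \<in> sphere z ?r" using that T_radius_bounds(3) by simp
    have az: "a - z - t \<noteq> 0" by (rule sphere_nonzero[OF a])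
    have "((pole z t a + \<i>) - y * (pole z t a - \<i>)) * (a - z - t) = \<alpha> * a + \<beta>"
    proof -
      have "pole z t a * (a - z - t) = z * (a - z) - t * a" using az by (simp add: pole_def field_simps)
      moreover have "((pole z t a + \<i>) - y * (pole z t a - \<i>)) * (a - z - t) = (1 - y) * (pole z t a * (a - z - t)) + \<i> * (1 + y) * (a - z - t)"
        by (simp add: algebra_simps)
      ultimately have "((pole z t a + \<i>) - y * (pole z t a - \<i>)) * (a - z - t) = (1 - y) * (z * (a - z) - t * a) + \<i> * (1 + y) * (a - z - t)"
        by (simp only:)
      then show ?thesis by (simp add: \<alpha>_def \<beta>_def algebra_simps power2_eq_square)
    qed
    also have "\<alpha> * a + \<beta> = \<alpha> * (a - a0)" using \<alpha>0 by (simp add: a0_def algebra_simps)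
    finally have e: "((pole z t a + \<i>) - y * (pole z t a - \<i>)) * (a - z - t) = \<alpha> * (a - a0)" .
    have "syn2 (\<lambda>(i, j). x ^ i * y ^ j) (a, pole z t a) / (a - z - t) = inverse (of_real pi * Dx a * (((pole z t a + \<i>) - y * (pole z t a - \<i>)) * (a - z - t)))"
      unfolding syn[OF sphere_in_uhp[OF a]] by (simp add: divide_inverse inverse_mult_distrib)
    also have "\<dots> = (inverse (of_real pi * \<alpha>) * inverse (Dx a)) / (a - a0)"
      unfolding e by (simp add: divide_inverse inverse_mult_distrib)
    finally show ?thesis .
  qed
  have "(\<lambda>a. inverse (of_real pi * \<alpha>) * inverse (Dx a)) holomorphic_on cball z ?r"
    unfolding Dx_def using Dn(1)[OF _ x] cball_subset_uhp by (intro holomorphic_intros) auto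
  from Cauchy_integral_circlepath_simple[OF this a0r]
  have ci: "contour_integral (circlepath z ?r) (\<lambda>a. (inverse (of_real pi * \<alpha>) * inverse (Dx a)) / (a - a0)) = 2 * of_real pi * \<i> * (inverse (of_real pi * \<alpha>) * inverse (Dx a0))"
    by (rule contour_integral_unique)
  have "opT (syn2 (\<lambda>(i, j). x ^ i * y ^ j)) (z, t) = 1 / (2 * of_real pi * \<i>) *
     contour_integral (circlepath z ?r) (\<lambda>a. syn2 (\<lambda>(i, j). x ^ i * y ^ j) (a, pole z t a) / (a - z - t))"
    by (rule opT_single_integral) (rule holomorphic_syn2_snd[OF conv_coeffs_powers[OF x y]])
  also have "contour_integral (circlepath z ?r) (\<lambda>a. syn2 (\<lambda>(i, j). x ^ i * y ^ j) (a, pole z t a) / (a - z - t))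
     = contour_integral (circlepath z ?r) (\<lambda>a. (inverse (of_real pi * \<alpha>) * inverse (Dx a)) / (a - a0))"
    by (rule contour_integral_eq) (rule kern)
  finally have T: "opT (syn2 (\<lambda>(i, j). x ^ i * y ^ j)) (z, t) = inverse (of_real pi * \<alpha>) * inverse (Dx a0)"
    unfolding ci by simp
  \<comment> \<open>Because \<alpha> a0 = - \<beta>, the denominator \<alpha> \<open>Dx a0\<close>
    of the result is a polynomial in z, t, x and y.\<close>
  have Q: "(z + \<i>)\<^sup>2 * ((1 - x * s) * (1 - y * s)) - 2 * \<i> * t * (x - y) = \<alpha> * Dx a0"
  proof -
    have zi: "z + \<i> \<noteq> 0" using T_radius_bounds(4) by (simp add: add_i_nonzero)
    have "(z + \<i>) * (1 - v * s) = (z + \<i>) - v * (z - \<i>)" for v using zi by (simp add: s_def cayley_def field_simps)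
    then have l: "(z + \<i>)\<^sup>2 * ((1 - x * s) * (1 - y * s)) = ((z + \<i>) - x * (z - \<i>)) * ((z + \<i>) - y * (z - \<i>))"
      by (metis (no_types, opaque_lifting) mult.assoc mult.left_commute power2_eq_square)
    have "\<alpha> * Dx a0 = (1 - x) * (\<alpha> * a0) + \<i> * (1 + x) * \<alpha>" by (simp add: Dx_def algebra_simps)
    also have "\<alpha> * a0 = - \<beta>" using \<alpha>0 by (simp add: a0_def)
    finally show ?thesis unfolding l by (simp add: \<alpha>_def \<beta>_def power2_eq_square algebra_simps)
  qed
  have "Dx a0 \<noteq> 0" using Dn(1)[OF a0u x] by (simp add: Dx_def)
  then show ?thesis unfolding T Q using \<alpha>0 by (simp add: field_simps)
qed

end

section \<open>Expansion of the generating function of \<open>T\<close>\<close>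

lemma diffmul_add: "diffmul (\<lambda>p. a p + b p) = (\<lambda>p. diffmul a p + diffmul b p)"
proof (rule ext, clarify)
  fix i j show "diffmul (\<lambda>p. a p + b p) (i, j) = diffmul a (i, j) + diffmul b (i, j)"
    by (cases i; cases j) (simp_all add: diffmul_simps)
qed

lemma diffmul_scale: "diffmul (\<lambda>p. c * a p) = (\<lambda>p. c * diffmul a p)"
proof (rule ext, clarify)
  fix i j show "diffmul (\<lambda>p. c * a p) (i, j) = c * diffmul a (i, j)"
    by (cases i; cases j) (simp_all add: diffmul_simps algebra_simps)
qed

text \<open>On power series, multiplication by 1 - s x and by 1 - s y.\<close>

definition geo1 :: "complex \<Rightarrow> coeffs \<Rightarrow> coeffs" where "geo1 s a = (\<lambda>p. a p - s * shift1 a p)"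
definition geo2 :: "complex \<Rightarrow> coeffs \<Rightarrow> coeffs" where "geo2 s a = (\<lambda>p. a p - s * shift2 a p)"

text \<open>In terms of power series: multiplication by \<open>q\<^sup>2 (1 - s x) (1 - s y) - c (x - y)\<close>, the denominator in \<open>opT_kernel\<close>.\<close>

definition kernel_op :: "complex \<Rightarrow> complex \<Rightarrow> complex \<Rightarrow> coeffs \<Rightarrow> coeffs" where
  "kernel_op q s c a = (\<lambda>p. q\<^sup>2 * geo1 s (geo2 s a) p - c * diffmul a p)"

text \<open>The substitution of s x and s y for x and y.\<close>

definition scaled :: "complex \<Rightarrow> coeffs \<Rightarrow> coeffs" where
  "scaled s a = (\<lambda>(i, j). s ^ (i + j) * a (i, j))"

definition unit_array :: coeffs where "unit_array = (\<lambda>p. if p = (0, 0) then 1 else 0)"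

lemma geo_diffmul: "geo1 s (diffmul a) = diffmul (geo1 s a)" "geo2 s (diffmul a) = diffmul (geo2 s a)"
proof (rule_tac [!] ext, clarify)
  fix i j
  show "geo1 s (diffmul a) (i, j) = diffmul (geo1 s a) (i, j)"
    by (cases i; cases j; cases "i - 1") (simp_all add: geo1_def diffmul_simps algebra_simps)
next
  fix p :: "nat \<times> nat"
  obtain i j where p: "p = (i, j)" by force
  show "geo2 s (diffmul a) p = diffmul (geo2 s a) p" unfolding p
    by (cases i; cases j; cases "j - 1") (simp_all add: geo2_def diffmul_simps algebra_simps)
qed

lemma geo_diffmul_pow: "geo1 s (geo2 s ((diffmul ^^ m) a)) = (diffmul ^^ m) (geo1 s (geo2 s a))"
  by (induction m) (simp_all add: geo_diffmul)

lemma choose_shift_diff: "(of_nat ((Suc m + Suc i) choose Suc m) :: complex) - of_nat ((Suc m + i) choose Suc m) = of_nat ((m + Suc i) choose m)"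
  by (simp add: add.commute)

text \<open>\<open>scaled s (base_array m)\<close> is the series of ((1 - s x) (1 - s y))^(-(m +
  1)); the two linear factors lower the exponent by one. On coefficients this is Pascal's rule in
  each index.\<close>

lemma geo_base_array_Suc: "geo1 s (geo2 s (scaled s (base_array (Suc m)))) = scaled s (base_array m)"
proof -
  have 2: "geo2 s (scaled s (base_array (Suc m))) (i, j) = s ^ (i + j) * (of_nat ((Suc m + i) choose Suc m) * of_nat ((m + j) choose m))" for i j
  proof (cases j)
    case (Suc k)
    have "geo2 s (scaled s (base_array (Suc m))) (i, j) = s ^ (i + j) * of_nat ((Suc m + i) choose Suc m) *
       (of_nat ((Suc m + Suc k) choose Suc m) - of_nat ((Suc m + k) choose Suc m))"
      by (simp add: Suc geo2_def scaled_def base_array_def algebra_simps del: binomial_Suc_Suc)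
    then show ?thesis unfolding choose_shift_diff by (simp add: Suc mult.assoc)
  qed (simp add: geo2_def scaled_def base_array_def)
  show ?thesis
  proof (rule ext, clarify)
    fix i j
    show "geo1 s (geo2 s (scaled s (base_array (Suc m)))) (i, j) = scaled s (base_array m) (i, j)"
    proof (cases i)
      case 0
      have "geo1 s (geo2 s (scaled s (base_array (Suc m)))) (0, j) = s ^ j * of_nat ((m + j) choose m)"
        by (simp add: geo1_def 2)
      then show ?thesis by (simp add: 0 scaled_def base_array_def)
    next
      case (Suc k)
      have "geo1 s (geo2 s (scaled s (base_array (Suc m)))) (i, j) = s ^ (i + j) * of_nat ((m + j) choose m) *
         (of_nat ((Suc m + Suc k) choose Suc m) - of_nat ((Suc m + k) choose Suc m))"
        by (simp add: Suc geo1_def 2 algebra_simps del: binomial_Suc_Suc)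
      then show ?thesis unfolding choose_shift_diff by (simp add: Suc scaled_def base_array_def ac_simps)
    qed
  qed
qed

lemma geo_base_array_0: "geo1 s (geo2 s (scaled s (base_array 0))) = unit_array"
proof (rule ext, clarify)
  fix i j show "geo1 s (geo2 s (scaled s (base_array 0))) (i, j) = unit_array (i, j)"
    by (cases i; cases j) (simp_all add: geo1_def geo2_def scaled_def base_array_def unit_array_def)
qed

text \<open>A partial sum of the geometric expansion of 1 / (q^2 A - c D) in powers of c D / (q^2
  A), where A = (1 - s x) (1 - s y) and D = x - y.\<close>

definition kernel_array :: "complex \<Rightarrow> complex \<Rightarrow> complex \<Rightarrow> nat \<Rightarrow> coeffs" where
  "kernel_array q s c K = (\<lambda>p. \<Sum>m\<le>K. c ^ m / q ^ (2 * m + 2) * (diffmul ^^ m) (scaled s (base_array m)) p)"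

lemma geo_linear:
  "geo1 s (geo2 s (\<lambda>p. a p + c * b p)) = (\<lambda>p. geo1 s (geo2 s a) p + c * geo1 s (geo2 s b) p)"
proof (rule ext, clarify)
  fix i j show "geo1 s (geo2 s (\<lambda>p. a p + c * b p)) (i, j) = geo1 s (geo2 s a) (i, j) + c * geo1 s (geo2 s b) (i, j)"
    by (cases i; cases j) (simp_all add: geo1_def geo2_def algebra_simps)
qed

text \<open>The sum telescopes up to a remainder that vanishes on low degrees.\<close>

lemma kernel_op_kernel_array:
  assumes q: "q \<noteq> 0"
  shows "kernel_op q s c (kernel_array q s c K) = (\<lambda>p. unit_array p - c ^ (K + 1) / q ^ (2 * K + 2) * (diffmul ^^ (K + 1)) (scaled s (base_array K)) p)"
proof (induction K)
  case 0
  have k0: "kernel_array q s c 0 = (\<lambda>p. (\<lambda>_. 0) p + inverse (q\<^sup>2) * scaled s (base_array 0) p)"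
    by (simp add: kernel_array_def power2_eq_square divide_inverse)
  have g: "geo1 s (geo2 s (kernel_array q s c 0)) = (\<lambda>p. inverse (q\<^sup>2) * unit_array p)"
    unfolding k0 geo_linear geo_base_array_0 by (simp add: geo1_def geo2_def shift1_def shift2_def fun_eq_iff split: nat.splits)
  have d: "diffmul (kernel_array q s c 0) = (\<lambda>p. inverse (q\<^sup>2) * diffmul (scaled s (base_array 0)) p)"
    unfolding k0 by (simp add: diffmul_scale)
  show ?case unfolding kernel_op_def g d using q by (simp add: fun_eq_iff field_simps power2_eq_square)
next
  case (Suc K)
  let ?G = "(diffmul ^^ Suc K) (scaled s (base_array (Suc K)))"
  let ?k = "c ^ Suc K / q ^ (2 * Suc K + 2)"
  have k: "kernel_array q s c (Suc K) = (\<lambda>p. kernel_array q s c K p + ?k * ?G p)"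
    by (simp add: kernel_array_def)
  have g: "geo1 s (geo2 s ?G) = (diffmul ^^ Suc K) (scaled s (base_array K))"
    unfolding geo_diffmul_pow geo_base_array_Suc ..
  have d: "diffmul (\<lambda>p. kernel_array q s c K p + ?k * ?G p) = (\<lambda>p. diffmul (kernel_array q s c K) p + ?k * diffmul ?G p)"
    unfolding diffmul_add diffmul_scale ..
  have "kernel_op q s c (kernel_array q s c (Suc K)) p = kernel_op q s c (kernel_array q s c K) p + q\<^sup>2 * ?k * (diffmul ^^ Suc K) (scaled s (base_array K)) p - c * ?k * diffmul ?G p" for p
    unfolding kernel_op_def k geo_linear g d by (simp add: algebra_simps)
  moreover have "q\<^sup>2 * ?k = c ^ (K + 1) / q ^ (2 * K + 2)"
    using q by (simp add: power2_eq_square field_simps)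
  moreover have "c * ?k = c ^ (Suc K + 1) / q ^ (2 * Suc K + 2)" by simp
  moreover have "diffmul ?G = (diffmul ^^ (Suc K + 1)) (scaled s (base_array (Suc K)))" by simp
  ultimately show ?case unfolding Suc.IH by (intro ext) (simp only: Suc_eq_plus1, simp)
qed

lemma kernel_op_diff: "kernel_op q s c (\<lambda>p. a p - b p) = (\<lambda>p. kernel_op q s c a p - kernel_op q s c b p)"
proof (rule ext, clarify)
  fix i j show "kernel_op q s c (\<lambda>p. a p - b p) (i, j) = kernel_op q s c a (i, j) - kernel_op q s c b (i, j)"
    by (cases i; cases j) (simp_all add: kernel_op_def geo1_def geo2_def diffmul_simps algebra_simps)
qed

text \<open>The denominator has constant term q^2, so each entry is determined by the entries of
  lower degree.\<close>

lemma kernel_op_eq_0_imp: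
  assumes q: "q \<noteq> 0" and z: "\<And>i j. i + j \<le> K \<Longrightarrow> kernel_op q s c a (i, j) = 0"
  shows "i + j \<le> K \<Longrightarrow> a (i, j) = 0"
proof (induction "i + j" arbitrary: i j rule: less_induct)
  case less
  have IH: "a (i', j') = 0" if "i' + j' < i + j" for i' j' using less that by auto
  have "q\<^sup>2 * a (i, j) = kernel_op q s c a (i, j)"
    by (cases i; cases j) (simp_all add: kernel_op_def geo1_def geo2_def diffmul_simps IH)
  then show ?case using z[OF less.prems] q by simp
qed

text \<open>Only the series is rescaled and not the m factors x - y, hence the exponent i + j - m.
  Below degree m both sides vanish, so the truncated subtraction is harmless.\<close>

lemma diffmul_pow_scaled: "(diffmul ^^ m) (scaled s a) (i, j) = s ^ (i + j - m) * (diffmul ^^ m) a (i, j)"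
proof (induction m arbitrary: i j)
  case 0
  then show ?case by (simp add: scaled_def)
next
  case (Suc m)
  show ?case
    by (cases i; cases j) (simp_all add: diffmul_simps Suc.IH right_diff_distrib)
qed

lemma kernel_array_eq:
  assumes "i + j = N"
  shows "kernel_array q s c N (i, j) = (\<Sum>m\<le>N. c ^ m / q ^ (2 * m + 2) * s ^ (N - m) * eigvec m (i, j))"
  unfolding kernel_array_def diffmul_pow_scaled assms by (simp add: eigvec_def mult.assoc)

text \<open>Multiplied by the denominator, pi times the generating function is 1, and so is the
  series of \<open>kernel_array\<close> up to terms of degree above N. As the denominator can be
  cancelled degree by degree, the two agree up to degree N.\<close>

lemma T_coeffs_eq:
  assumes dom: "(z, t) \<in> domT" and ij: "i + j = N"
  shows "T_coeffs z t (i, j) = 1 / of_real pi * (\<Sum>m\<le>N. (2 * \<i> * t) ^ m / (z + \<i>) ^ (2 * m + 2) * cayley z ^ (N - m) * eigvec m (i, j))"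
proof -
  define q s c where "q = z + \<i>" and "s = cayley z" and "c = 2 * \<i> * t"
  have q: "q \<noteq> 0" using dom uhp_nonzero by (auto simp: q_def domT_def)
  define A where "A = (\<lambda>p. of_real pi * T_coeffs z t p)"
  have convT: "conv_coeffs (T_coeffs z t)" by (rule conv_coeffs_T_coeffs[OF dom])
  have convA: "conv_coeffs A" unfolding A_def by (rule conv_coeffs_scale[OF convT])
  have cg2: "conv_coeffs (geo2 s A)" unfolding geo2_def
    by (intro conv_coeffs_diff conv_coeffs_scale conv_coeffs_shift2 convA)
  have cg1: "conv_coeffs (geo1 s (geo2 s A))" unfolding geo1_def
    by (intro conv_coeffs_diff conv_coeffs_scale conv_coeffs_shift1 cg2)
  have convQ: "conv_coeffs (kernel_op q s c A)" unfolding kernel_op_def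
    by (intro conv_coeffs_diff conv_coeffs_scale conv_coeffs_diffmul cg1 convA)
  have convU: "conv_coeffs unit_array"
    by (rule conv_coeffs_l2, rule l2_finite_support[of "{(0, 0)}"]) (auto simp: unit_array_def)
  have "kernel_op q s c A = unit_array"
  proof (rule ps2_inject[OF convQ convU])
    fix x y :: complex assume xy: "cmod x < 1" "cmod y < 1"
    have g2: "ps2 (geo2 s A) x y = (1 - y * s) * ps2 A x y"
      unfolding geo2_def using xy convA
      by (simp add: ps2_diff ps2_scale ps2_shift2 conv_coeffs_scale conv_coeffs_shift2 algebra_simps)
    have g1: "ps2 (geo1 s (geo2 s A)) x y = (1 - x * s) * ps2 (geo2 s A) x y"
      unfolding geo1_def[of s "geo2 s A"] using xy cg2
      by (simp add: ps2_diff ps2_scale ps2_shift1 conv_coeffs_scale conv_coeffs_shift1 algebra_simps)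
    have "ps2 (kernel_op q s c A) x y = (q\<^sup>2 * ((1 - x * s) * (1 - y * s)) - c * (x - y)) * ps2 A x y"
      unfolding kernel_op_def using xy cg1 convA
      by (simp add: ps2_diff ps2_scale ps2_diffmul conv_coeffs_scale conv_coeffs_diffmul g1 g2 algebra_simps)
    also have "ps2 A x y = of_real pi * opT (syn2 (\<lambda>(i, j). x ^ i * y ^ j)) (z, t)"
    proof -
      have "ps2 (T_coeffs z t) x y = opT (syn2 (\<lambda>(i, j). x ^ i * y ^ j)) (z, t)"
        unfolding ps2_def by (rule infsumI[OF T_coeffs_ps2[OF dom xy]])
      then show ?thesis by (simp add: A_def ps2_scale)
    qed
    also have "(q\<^sup>2 * ((1 - x * s) * (1 - y * s)) - c * (x - y)) * (of_real pi * opT (syn2 (\<lambda>(i, j). x ^ i * y ^ j)) (z, t)) = 1"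
      using opT_kernel[OF dom xy] by (simp only: q_def s_def c_def mult_ac)
    also have "1 = ps2 unit_array x y"
    proof -
      have "((\<lambda>(i, j). unit_array (i, j) * x ^ i * y ^ j) has_sum 1) UNIV"
        by (rule has_sum_finite_neutralI[of "{(0, 0)}"]) (auto simp: unit_array_def split: if_splits)
      then show ?thesis unfolding ps2_def by (rule infsumI[symmetric])
    qed
    finally show "ps2 (kernel_op q s c A) x y = ps2 unit_array x y" .
  qed
  then have "kernel_op q s c (\<lambda>p. A p - kernel_array q s c N p) (i', j') = 0" if "i' + j' \<le> N" for i' j'
    unfolding kernel_op_diff kernel_op_kernel_array[OF q] using that diffmul_pow_lowest(2)[of i' j' "N + 1"] by simp
  from kernel_op_eq_0_imp[OF q this] ij have "A (i, j) = kernel_array q s c N (i, j)" by auto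
  then show ?thesis unfolding kernel_array_eq[OF ij] A_def q_def s_def c_def by (simp add: field_simps)
qed

section \<open>The reduced operator\<close>

text \<open>The constant (2 i)^l / pi is what remains of (2 i t)^l / pi in
  \<open>T_coeffs_eq\<close> once t^l is split off.\<close>

definition red_coef :: "nat \<Rightarrow> coeffs \<Rightarrow> nat \<Rightarrow> complex" where
  "red_coef l a k = (2 * \<i>) ^ l / of_real pi * diag_ip (l + k) a (eigvec l)"

definition red_fun :: "nat \<Rightarrow> coeffs \<Rightarrow> complex \<Rightarrow> complex" where
  "red_fun l a z = (if z \<in> uhp then (\<Sum>k. red_coef l a k * cayley z ^ k) / (z + \<i>) ^ (2 * l + 2) else 0)"

text \<open>The sum is grouped by degree. As \<open>eigvec m\<close> is real, each block is a
  combination of the values \<open>diag_ip N a (eigvec m)\<close>, which vanish for m \<noteq> l;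
  only the power t^l survives.\<close>

lemma opT_eigen_has_sum:
  assumes dom: "(z, t) \<in> domT" and a: "l2 a" and e: "\<And>p. casimir a p = - (of_nat l * (of_nat l + 1)) * a p"
  shows "((\<lambda>k. t ^ l / (z + \<i>) ^ (2 * l + 2) * (red_coef l a k * cayley z ^ k)) has_sum opT (syn2 a) (z, t)) UNIV"
proof -
  have hs: "((\<lambda>p. a p * T_coeffs z t p) has_sum opT (syn2 a) (z, t)) UNIV"
    by (rule opT_has_sum[OF dom conv_coeffs_l2[OF a]])
  define c where "c = (\<lambda>m. (2 * \<i> * t) ^ m / (z + \<i>) ^ (2 * m + 2))"
  define g where "g = (\<lambda>N. if l \<le> N then 1 / of_real pi * (c l * cayley z ^ (N - l) * diag_ip N a (eigvec l)) else 0)"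
  have d: "(\<Sum>p\<in>diag N. a p * T_coeffs z t p) = g N" for N
  proof -
    have "(\<Sum>p\<in>diag N. a p * T_coeffs z t p) = (\<Sum>p\<in>diag N. a p * (1 / of_real pi * (\<Sum>m\<le>N. c m * cayley z ^ (N - m) * eigvec m p)))"
      using T_coeffs_eq[OF dom] by (intro sum.cong) (auto simp: diag_def c_def)
    also have "\<dots> = (\<Sum>p\<in>diag N. \<Sum>m\<le>N. 1 / of_real pi * (c m * cayley z ^ (N - m) * (a p * eigvec m p)))"
      by (simp add: sum_distrib_left ac_simps)
    also have "\<dots> = (\<Sum>m\<le>N. 1 / of_real pi * (c m * cayley z ^ (N - m) * diag_ip N a (eigvec m)))"
      by (subst sum.swap) (simp add: diag_ip_def sum_distrib_left)
    also have "\<dots> = (\<Sum>m\<le>N. if m = l then 1 / of_real pi * (c l * cayley z ^ (N - l) * diag_ip N a (eigvec l)) else 0)"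
      using diag_ip_eigvec_eq_0[of N a l] e by (intro sum.cong refl) auto
    also have "\<dots> = g N" by (simp add: g_def)
    finally show ?thesis .
  qed
  have "((\<lambda>N. \<Sum>p\<in>diag N. a p * T_coeffs z t p) has_sum opT (syn2 a) (z, t)) UNIV"
    using has_sum_diag[OF has_sum_imp_summable[OF hs]] infsumI[OF hs] by simp
  then have "(g has_sum opT (syn2 a) (z, t)) UNIV" unfolding d .
  also have "?this \<longleftrightarrow> (g has_sum opT (syn2 a) (z, t)) {l..}"
    by (rule has_sum_cong_neutral) (auto simp: g_def)
  also have "\<dots> \<longleftrightarrow> ((\<lambda>k. g (l + k)) has_sum opT (syn2 a) (z, t)) UNIV"
    by (rule has_sum_reindex_bij_witness[of _ "\<lambda>k. l + k" "\<lambda>N. N - l"]) auto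
  finally have "((\<lambda>k. g (l + k)) has_sum opT (syn2 a) (z, t)) UNIV" .
  moreover have "g (l + k) = t ^ l / (z + \<i>) ^ (2 * l + 2) * (red_coef l a k * cayley z ^ k)" for k
    by (simp add: g_def c_def red_coef_def power_mult_distrib mult_ac)
  ultimately show ?thesis by simp
qed

text \<open>Convergence on the whole disc is read off the series for \<open>T\<close> at the point
  with Cayley coordinate w, for an admissible nonzero t whose power can be cancelled.\<close>

lemma red_coef_sums:
  assumes w: "cmod w < 1" and a: "l2 a" and e: "\<And>p. casimir a p = - (of_nat l * (of_nat l + 1)) * a p"
  shows "(\<lambda>k. red_coef l a k * w ^ k) sums (\<Sum>k. red_coef l a k * w ^ k)"
proof -
  define z where "z = inv_cayley w"
  have z: "z \<in> uhp" using inv_cayley_in_uhp[OF w] by (simp add: z_def)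
  have cz: "cayley z = w" using w by (auto simp: z_def intro!: cayley_inv_cayley)
  define t where "t = complex_of_real (Im z / 4)"
  have Im: "0 < Im z" using z by (simp add: uhp_def)
  then have dom: "(z, t) \<in> domT" using z by (simp add: domT_def t_def)
  have n: "t ^ l / (z + \<i>) ^ (2 * l + 2) \<noteq> 0" using Im uhp_nonzero[OF z] by (simp add: t_def)
  have "(\<lambda>k. t ^ l / (z + \<i>) ^ (2 * l + 2) * (red_coef l a k * w ^ k)) summable_on UNIV"
    using has_sum_imp_summable[OF opT_eigen_has_sum[OF dom a e]] unfolding cz .
  then have "summable (\<lambda>k. t ^ l / (z + \<i>) ^ (2 * l + 2) * (red_coef l a k * w ^ k))" by (rule summable_on_imp_summable)
  then have "summable (\<lambda>k. red_coef l a k * w ^ k)" using n by (simp only: summable_cmult_iff simp_thms)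
  then show ?thesis by (rule summable_sums)
qed

lemma opT_eigen:
  assumes dom: "(z, t) \<in> domT" and a: "l2 a" and e: "\<And>p. casimir a p = - (of_nat l * (of_nat l + 1)) * a p"
  shows "opT (syn2 a) (z, t) = t ^ l * red_fun l a z"
proof -
  have z: "z \<in> uhp" using dom by (simp add: domT_def)
  from has_sum_imp_sums[OF opT_eigen_has_sum[OF dom a e]]
    sums_mult[OF red_coef_sums[OF cmod_cayley_less_1[OF z] a e], of "t ^ l / (z + \<i>) ^ (2 * l + 2)"]
  have "opT (syn2 a) (z, t) = t ^ l / (z + \<i>) ^ (2 * l + 2) * (\<Sum>k. red_coef l a k * cayley z ^ k)"
    by (rule sums_unique2)
  then show ?thesis using z by (simp add: red_fun_def)
qed

lemma red_fun_hol:
  assumes a: "l2 a" and e: "\<And>p. casimir a p = - (of_nat l * (of_nat l + 1)) * a p"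
  shows "red_fun l a \<in> hol_uhp"
proof -
  have "(\<lambda>w. \<Sum>k. red_coef l a k * w ^ k) holomorphic_on ball 0 1"
    by (rule power_series_holomorphic[of 0 1 "red_coef l a"]) (use red_coef_sums[OF _ a e] in simp)
  then have "(\<lambda>w. \<Sum>k. red_coef l a k * w ^ k) \<circ> cayley holomorphic_on uhp"
    by (intro holomorphic_on_compose_gen[OF holomorphic_cayley, of _ "ball 0 1"]) (auto simp: cmod_cayley_less_1)
  then have "(\<lambda>z. \<Sum>k. red_coef l a k * cayley z ^ k) holomorphic_on uhp" by (simp only: o_def)
  moreover have "(\<lambda>z. (z + \<i>) ^ (2 * l + 2)) holomorphic_on uhp" by (intro holomorphic_intros)
  ultimately have "(\<lambda>z. (\<Sum>k. red_coef l a k * cayley z ^ k) / (z + \<i>) ^ (2 * l + 2)) holomorphic_on uhp"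
    by (rule holomorphic_on_divide) (simp add: uhp_nonzero)
  then have "red_fun l a holomorphic_on uhp" by (rule holomorphic_transform) (simp add: red_fun_def)
  then show ?thesis by (simp add: hol_uhp_def red_fun_def)
qed

lemma factors_as_red_fun:
  assumes a: "l2 a" and e: "\<And>p. casimir a p = - (of_nat l * (of_nat l + 1)) * a p"
  shows "factors_as l (syn2 a) (red_fun l a)"
  using red_fun_hol[OF a e] opT_eigen[OF _ a e] by (auto simp: factors_as_def)

text \<open>At a nonzero admissible t, such as Im z / 4, the power t^l can be cancelled.\<close>

lemma factors_as_unique:
  assumes "factors_as l f g" "factors_as l f h"
  shows "g = h"
proof (rule ext)
  fix z
  show "g z = h z"
  proof (cases "z \<in> uhp")
    case True
    define t where "t = complex_of_real (Im z / 4)"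
    have Im: "0 < Im z" using True by (simp add: uhp_def)
    then have dom: "(z, t) \<in> domT" using True by (simp add: domT_def t_def)
    have "t ^ l * g z = t ^ l * h z" using assms dom unfolding factors_as_def by fastforce
    then show ?thesis using Im by (simp add: t_def)
  next
    case False
    then show ?thesis using assms by (simp add: factors_as_def hol_uhp_def)
  qed
qed

lemma reducedT_eq:
  assumes a: "l2 a" and e: "\<And>p. casimir a p = - (of_nat l * (of_nat l + 1)) * a p"
  shows "reducedT l (syn2 a) = red_fun l a"
  unfolding reducedT_def
  by (rule the_equality, rule factors_as_red_fun[OF a e], erule factors_as_unique[OF _ factors_as_red_fun[OF a e]])

lemma bcoef_red_fun:
  assumes a: "l2 a" and e: "\<And>p. casimir a p = - (of_nat l * (of_nat l + 1)) * a p"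
  shows "bcoef l (red_fun l a) = red_coef l a"
proof (rule powser_unique[where f = "bdisc l (red_fun l a)"])
  fix w :: complex assume w: "cmod w < 1"
  show "(\<lambda>n. bcoef l (red_fun l a) n * w ^ n) sums bdisc l (red_fun l a) w"
    using bdisc_sums[OF red_fun_hol[OF a e], of l] w by blast
  define z where "z = inv_cayley w"
  have z: "z \<in> uhp" using inv_cayley_in_uhp[OF w] by (simp add: z_def)
  have cz: "cayley z = w" using w by (auto simp: z_def intro!: cayley_inv_cayley)
  have "bdisc l (red_fun l a) w = (\<Sum>k. red_coef l a k * w ^ k)"
    using z uhp_nonzero[OF z] by (simp add: bdisc_def red_fun_def cz flip: z_def)
  then show "(\<lambda>n. red_coef l a n * w ^ n) sums bdisc l (red_fun l a) w"
    using red_coef_sums[OF w a e] by simp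
qed

text \<open>In degree l + k an eigenarray is a multiple of \<open>eigvec l\<close>, so its squared
  norm there is |pairing|^2 divided by \<open>eigvec_norm l k\<close>.\<close>

lemma eigen_norm_sums:
  assumes a: "l2 a" and e: "\<And>p. casimir a p = - (of_nat l * (of_nat l + 1)) * a p"
  shows "(\<lambda>k. (cmod (diag_ip (l + k) a (eigvec l)))\<^sup>2 / real (eigvec_norm l k)) sums (l2norm a)\<^sup>2"
proof -
  define g where "g = (\<lambda>N. if l \<le> N then complex_of_real ((cmod (diag_ip N a (eigvec l)))\<^sup>2 / real (eigvec_norm l (N - l))) else 0)"
  have d: "diag_ip N a a = g N" for N
  proof -
    define b where "b = (if l \<le> N then eigcoef l (N - l) a else 0)"
    have ab: "a p = b * eigvec l p" if "p \<in> diag N" for p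
      using casimir_eigen_diag[OF e that] by (simp add: b_def)
    have "diag_ip N a a = diag_ip N (\<lambda>p. b * eigvec l p) (\<lambda>p. b * eigvec l p)" by (rule diag_ip_cong) (simp_all only: ab)
    also have "\<dots> = b * cnj b * diag_ip N (eigvec l) (eigvec l)" unfolding diag_ip_scale_left diag_ip_scale_right by simp
    also have "\<dots> = g N"
    proof (cases "l \<le> N")
      case True
      then show ?thesis using diag_ip_eigvec_self[of l "N - l"] eigvec_norm_pos[of l "N - l"]
        by (simp add: b_def g_def eigcoef_def complex_norm_square power2_eq_square del: of_real_mult)
           (simp add: complex_norm_square[symmetric] flip: power2_eq_square)
    qed (simp add: b_def g_def)
    finally show ?thesis .
  qed
  have "(g has_sum of_real ((l2norm a)\<^sup>2)) UNIV"
    using l2ip_diag[OF a a] unfolding d l2ip_self[OF a] .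
  also have "?this \<longleftrightarrow> (g has_sum of_real ((l2norm a)\<^sup>2)) {l..}"
    by (rule has_sum_cong_neutral) (auto simp: g_def)
  also have "\<dots> \<longleftrightarrow> ((\<lambda>k. g (l + k)) has_sum of_real ((l2norm a)\<^sup>2)) UNIV"
    by (rule has_sum_reindex_bij_witness[of _ "\<lambda>k. l + k" "\<lambda>N. N - l"]) auto
  finally have "((\<lambda>k. complex_of_real ((cmod (diag_ip (l + k) a (eigvec l)))\<^sup>2 / real (eigvec_norm l k))) has_sum of_real ((l2norm a)\<^sup>2)) UNIV"
    by (simp add: g_def)
  then have "((\<lambda>k. (cmod (diag_ip (l + k) a (eigvec l)))\<^sup>2 / real (eigvec_norm l k)) has_sum (l2norm a)\<^sup>2) UNIV"
    by (simp only: has_sum_of_real_iff)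
  then show ?thesis by (rule has_sum_imp_sums)
qed

text \<open>The Beta integral contributes k! / (2 l + k + 1)! and the norm of the eigenvector the
  inverse of this quotient, up to factors free of k.\<close>

lemma weight_constant: "bergman_weight l k * (4 ^ l / pi\<^sup>2) * real (eigvec_norm l k) = b_const l"
proof -
  have 1: "real ((2 * l) choose l) = fact (2 * l) / (fact l * fact l)"
    by (simp add: binomial_fact mult_2)
  have 2: "real ((2 * l + k + 1) choose k) = fact (2 * l + k + 1) / (fact k * fact (2 * l + 1))"
    by (simp add: binomial_fact)
  have 3: "(fact (2 * l + 1) :: real) = (2 * real l + 1) * fact (2 * l)" by simp
  have 4: "(2 :: real) ^ (4 * l + 2) = 2 ^ (2 * l + 2) * 4 ^ l"
  proof -
    have "(4 :: real) ^ l = 2 ^ (2 * l)" by (simp add: power_mult)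
    then show ?thesis by (simp add: power_add[symmetric])
  qed
  have 5: "k + 2 * l + 1 = 2 * l + k + 1" by simp
  \<comment> \<open>Here P = 2^(2 l + 2), Q = 4^l, u = k!, f = (2 l)!, G = (2 l + k + 1)!, v = l!
    and N = 2 l + 1.\<close>
  have key: "pi / (P * Q) * (u * f / G) * (Q / pi\<^sup>2) * (f / (v * v) * (G / (u * (N * f)))) = f / (P * pi * N * v\<^sup>2)"
    if "0 < P" "0 < Q" "0 < u" "0 < f" "0 < G" "0 < v" "0 < N" for P Q u f G v N :: real
    using that by (simp add: power2_eq_square field_simps)
  show ?thesis
    unfolding bergman_weight_def eigvec_norm_def of_nat_mult 1 2 4 5 3 b_const_def
    by (rule key) (simp_all add: add_nonneg_pos)
qed

lemma bergman_weight_pos: "0 < bergman_weight l k"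
  by (simp add: bergman_weight_def)

lemma weighted_red_coef: "bergman_weight l k * (cmod (red_coef l a k))\<^sup>2 = b_const l * ((cmod (diag_ip (l + k) a (eigvec l)))\<^sup>2 / real (eigvec_norm l k))"
proof -
  have "(cmod (red_coef l a k))\<^sup>2 = 4 ^ l / pi\<^sup>2 * (cmod (diag_ip (l + k) a (eigvec l)))\<^sup>2"
  proof -
    have "((2 :: real) ^ l)\<^sup>2 = 4 ^ l" by (simp add: power2_eq_square flip: power_mult_distrib)
    then show ?thesis by (simp add: red_coef_def norm_mult norm_divide norm_power power_mult_distrib power_divide)
  qed
  then show ?thesis using eigvec_norm_pos[of l k] by (simp add: weight_constant[of l k, symmetric])
qed

lemma bergman_norm_red_fun:
  assumes a: "l2 a" and e: "\<And>p. casimir a p = - (of_nat l * (of_nat l + 1)) * a p"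
  shows "bergman_norm_sq l (red_fun l a) = ennreal (b_const l * (l2norm a)\<^sup>2)"
proof -
  have b: "0 \<le> b_const l" by (simp add: b_const_def)
  have s: "(\<lambda>k. b_const l * ((cmod (diag_ip (l + k) a (eigvec l)))\<^sup>2 / real (eigvec_norm l k))) sums (b_const l * (l2norm a)\<^sup>2)"
    by (rule sums_mult[OF eigen_norm_sums[OF a e]])
  show ?thesis
    unfolding bergman_norm_sq_eq[OF red_fun_hol[OF a e]] bcoef_red_fun[OF a e] weighted_red_coef
    by (rule suminf_ennreal_eq[OF _ s]) (use b in simp)
qed

text \<open>The Taylor coefficients of \<phi> prescribe the component along \<open>eigvec l\<close>
  in every degree. By \<open>weighted_red_coef\<close>, finiteness of the Bergman norm is
  square-summability of the resulting array.\<close>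

lemma red_fun_surj:
  assumes "\<phi> \<in> bergman l"
  shows "\<exists>a. l2 a \<and> (\<forall>p. casimir a p = - (of_nat l * (of_nat l + 1)) * a p) \<and> red_fun l a = \<phi>"
proof -
  have hol: "\<phi> \<in> hol_uhp" and fin: "bergman_norm_sq l \<phi> < \<infinity>" using assms by (auto simp: bergman_def)
  define c where "c = bcoef l \<phi>"
  \<comment> \<open>Chosen to make \<open>red_coef l a\<close> equal to c: the factor undoes (2 i)^l
    / pi and the squared norm of the eigenvector.\<close>
  define \<beta> where "\<beta> = (\<lambda>k. of_real pi / (2 * \<i>) ^ l * c k / of_nat (eigvec_norm l k))"
  define a where "a = (\<lambda>(i, j). (if l \<le> i + j then \<beta> (i + j - l) else 0) * eigvec l (i, j))"
  have ad: "a p = (if l \<le> N then \<beta> (N - l) else 0) * eigvec l p" if "p \<in> diag N" for p N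
    using that by (auto simp: a_def diag_def)
  have e: "casimir a p = - (of_nat l * (of_nat l + 1)) * a p" for p
  proof -
    define N where "N = fst p + snd p"
    have N: "p \<in> diag N" by (simp add: diag_def N_def split: prod.splits)
    have "casimir a p = casimir (\<lambda>p. (if l \<le> N then \<beta> (N - l) else 0) * eigvec l p) p"
      by (rule casimir_cong_diag[OF _ N]) (rule ad)
    also have "\<dots> = - (of_nat l * (of_nat l + 1)) * ((if l \<le> N then \<beta> (N - l) else 0) * eigvec l p)"
      unfolding casimir_scale casimir_eigvec by simp
    finally show ?thesis unfolding ad[OF N] .
  qed
  have dip: "diag_ip (l + k) a (eigvec l) = \<beta> k * of_nat (eigvec_norm l k)" for k
  proof -
    have "diag_ip (l + k) a (eigvec l) = diag_ip (l + k) (\<lambda>p. \<beta> k * eigvec l p) (eigvec l)"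
      by (rule diag_ip_cong) (simp_all add: ad)
    then show ?thesis unfolding diag_ip_scale_left diag_ip_eigvec_self .
  qed
  have rc: "red_coef l a = c"
  proof (rule ext)
    fix k
    show "red_coef l a k = c k" unfolding red_coef_def dip \<beta>_def using eigvec_norm_pos[of l k] by simp
  qed
  have s: "summable (\<lambda>k. bergman_weight l k * (cmod (c k))\<^sup>2)"
  proof (rule summable_suminf_not_top)
    show "0 \<le> bergman_weight l k * (cmod (c k))\<^sup>2" for k using bergman_weight_pos[of l k] by simp
    show "(\<Sum>k. ennreal (bergman_weight l k * (cmod (c k))\<^sup>2)) \<noteq> top"
      using fin unfolding bergman_norm_sq_eq[OF hol] c_def by simp
  qed
  have b: "0 < b_const l" by (simp add: b_const_def)
  have "summable (\<lambda>k. b_const l * ((cmod (diag_ip (l + k) a (eigvec l)))\<^sup>2 / real (eigvec_norm l k)))"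
    using s unfolding rc[symmetric] weighted_red_coef .
  then have s2: "summable (\<lambda>k. (cmod (diag_ip (l + k) a (eigvec l)))\<^sup>2 / real (eigvec_norm l k))"
    using b by (simp only: summable_cmult_iff) auto
  have dn: "(\<Sum>p\<in>diag N. (cmod (a p))\<^sup>2) = (if l \<le> N then (cmod (diag_ip N a (eigvec l)))\<^sup>2 / real (eigvec_norm l (N - l)) else 0)" for N
  proof (cases "l \<le> N")
    case True
    define k where "k = N - l"
    have k: "N = l + k" using True by (simp add: k_def)
    have "(\<Sum>p\<in>diag N. (cmod (a p))\<^sup>2) = (cmod (\<beta> k))\<^sup>2 * real (eigvec_norm l k)"
      using diag_norm_eigvecs[of "{l}" N "\<lambda>_. \<beta> k"] True by (simp add: ad k_def)
    then show ?thesis using True eigvec_norm_pos[of l k] dip[of k]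
      by (simp add: k norm_mult power_mult_distrib power2_eq_square)
  next
    case False
    then show ?thesis by (simp add: ad)
  qed
  have "l2 a"
  proof (rule l2I(1))
    fix F :: "(nat \<times> nat) set" assume F: "finite F"
    obtain M where M: "F \<subseteq> tri M" using tri_exhaust[OF F] by blast
    let ?g = "\<lambda>k. (cmod (diag_ip (l + k) a (eigvec l)))\<^sup>2 / real (eigvec_norm l k)"
    have "(\<Sum>p\<in>F. (cmod (a p))\<^sup>2) \<le> (\<Sum>p\<in>tri M. (cmod (a p))\<^sup>2)" using M by (intro sum_mono2) auto
    also have "\<dots> \<le> (\<Sum>p\<in>tri (l + M). (cmod (a p))\<^sup>2)" by (intro sum_mono2 finite_tri) (auto simp: tri_def)
    also have "\<dots> = (\<Sum>N<l + M. if l \<le> N then (cmod (diag_ip N a (eigvec l)))\<^sup>2 / real (eigvec_norm l (N - l)) else 0)"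
      unfolding sum_tri dn ..
    also have "\<dots> = (\<Sum>N\<in>{l..<l + M}. if l \<le> N then (cmod (diag_ip N a (eigvec l)))\<^sup>2 / real (eigvec_norm l (N - l)) else 0)"
      by (rule sum.mono_neutral_right) auto
    also have "\<dots> = (\<Sum>k<M. ?g k)"
      by (rule sum.reindex_bij_witness[of _ "\<lambda>k. l + k" "\<lambda>N. N - l"]) auto
    also have "\<dots> \<le> (\<Sum>k. ?g k)" by (rule sum_le_suminf[OF s2]) auto
    finally show "L2_set (\<lambda>p. cmod (a p)) F \<le> sqrt (\<Sum>k. ?g k)" unfolding L2_set_def by (rule real_sqrt_le_mono)
  qed
  moreover have "red_fun l a = \<phi>"
  proof (rule ext)
    fix z
    show "red_fun l a z = \<phi> z"
    proof (cases "z \<in> uhp")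
      case True
      have "(\<lambda>n. c n * cayley z ^ n) sums bdisc l \<phi> (cayley z)"
        using bdisc_sums[OF hol, of l] cmod_cayley_less_1[OF True] by (simp add: c_def)
      then show ?thesis using True by (simp add: red_fun_def rc bdisc_cayley[OF True, of \<phi> l] sums_iff)
    next
      case False
      then show ?thesis using hol by (simp add: red_fun_def hol_uhp_def)
    qed
  qed
  ultimately show ?thesis using e by blast
qed

section \<open>Double factorials\<close>

lemma double_fact_even: "double_fact (2 * int l) = 2 ^ l * fact l"
proof (induction l)
  case 0
  have "{k \<in> {1..0::int}. even (0 - k)} = {}" by auto
  then show ?case by (simp add: double_fact_def)
next
  case (Suc l)
  have "{k \<in> {1..2 * int (Suc l)}. even (2 * int (Suc l) - k)} = insert (2 * int (Suc l)) {k \<in> {1..2 * int l}. even (2 * int l - k)}"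
  proof (intro set_eqI iffI)
    fix k assume k: "k \<in> {k \<in> {1..2 * int (Suc l)}. even (2 * int (Suc l) - k)}"
    then have "even k" "1 \<le> k" "k \<le> 2 * int l + 2" by auto
    then have "k = 2 * int l + 2 \<or> k \<le> 2 * int l" by presburger
    then show "k \<in> insert (2 * int (Suc l)) {k \<in> {1..2 * int l}. even (2 * int l - k)}" using \<open>even k\<close> \<open>1 \<le> k\<close> by auto
  qed auto
  moreover have "finite {k \<in> {1..2 * int l}. even (2 * int l - k)}" by (rule finite_subset[of _ "{1..2 * int l}"]) auto
  ultimately have "double_fact (2 * int (Suc l)) = 2 * int (Suc l) * double_fact (2 * int l)"
    unfolding double_fact_def by (simp only:) (subst prod.insert; simp)
  then show ?case unfolding Suc.IH by (simp add: algebra_simps)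
qed

text \<open>As 2^l l! is (2 l)!!, this splits (2 l)! into its odd and even factors; at l = 0 the odd
  part is the empty product (-1)!!.\<close>

lemma double_fact_odd: "double_fact (2 * int l - 1) * (2 ^ l * fact l) = fact (2 * l)"
proof (induction l)
  case 0
  then show ?case by (simp add: double_fact_def)
next
  case (Suc l)
  have "{k \<in> {1..2 * int (Suc l) - 1}. even (2 * int (Suc l) - 1 - k)} = insert (2 * int l + 1) {k \<in> {1..2 * int l - 1}. even (2 * int l - 1 - k)}"
  proof (intro set_eqI iffI)
    fix k assume k: "k \<in> {k \<in> {1..2 * int (Suc l) - 1}. even (2 * int (Suc l) - 1 - k)}"
    then have "odd k" "1 \<le> k" "k \<le> 2 * int l + 1" by auto
    then have "k = 2 * int l + 1 \<or> k \<le> 2 * int l - 1" by presburger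
    then show "k \<in> insert (2 * int l + 1) {k \<in> {1..2 * int l - 1}. even (2 * int l - 1 - k)}" using \<open>odd k\<close> \<open>1 \<le> k\<close> by auto
  qed auto
  moreover have "finite {k \<in> {1..2 * int l - 1}. even (2 * int l - 1 - k)}" by (rule finite_subset[of _ "{1..2 * int l - 1}"]) auto
  ultimately have "double_fact (2 * int (Suc l) - 1) = (2 * int l + 1) * double_fact (2 * int l - 1)"
    unfolding double_fact_def by (simp only:) (subst prod.insert; simp)
  then have "double_fact (2 * int (Suc l) - 1) * (2 ^ Suc l * fact (Suc l)) = (2 * int l + 1) * (2 * int l + 2) * (double_fact (2 * int l - 1) * (2 ^ l * fact l))"
    by (simp add: algebra_simps)
  also have "\<dots> = fact (2 * Suc l)" unfolding Suc.IH by (simp add: algebra_simps)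
  finally show ?case .
qed

lemma b_const_double_fact:
  "b_const l = real_of_int (double_fact (2 * int l - 1)) / (4 * pi * (2 * real l + 1) * real_of_int (double_fact (2 * int l)))"
proof -
  have o: "real_of_int (double_fact (2 * int l - 1)) * (2 ^ l * fact l) = fact (2 * l)"
    using arg_cong[OF double_fact_odd[of l], of real_of_int] by simp
  then have o': "real_of_int (double_fact (2 * int l - 1)) = fact (2 * l) / (2 ^ l * fact l)"
    by (simp add: field_simps)
  have e: "2 * l + 2 = l + l + 2" by simp
  have p: "(2 :: real) ^ (2 * l + 2) = 4 * (2 ^ l * 2 ^ l)" unfolding e power_add by simp
  show ?thesis unfolding o' double_fact_even b_const_def p by (simp add: power2_eq_square)
qed

section \<open>Linearity, bijectivity and norm of the reduced operator\<close>

lemma reducedT_linear: "complex_linear_on (eigenP l) (reducedT l)"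
proof -
  have ex: "\<exists>a. f = syn2 a \<and> l2 a \<and> (\<forall>p. casimir a p = - (of_nat l * (of_nat l + 1)) * a p)" if "f \<in> eigenP l" for f
    using that unfolding eigenP_eq by blast
  have fact: "factors_as l f (reducedT l f)" if f: "f \<in> eigenP l" for f
  proof -
    obtain a where "f = syn2 a" "l2 a" "\<And>p. casimir a p = - (of_nat l * (of_nat l + 1)) * a p" using ex[OF f] by blast
    then show ?thesis using factors_as_red_fun[of a l] reducedT_eq[of a l] by simp
  qed
  have red_add: "red_fun l (\<lambda>p. a p + b p) = fadd (red_fun l a) (red_fun l b)"
    if a: "l2 a" "\<And>p. casimir a p = - (of_nat l * (of_nat l + 1)) * a p" and b: "l2 b" "\<And>p. casimir b p = - (of_nat l * (of_nat l + 1)) * b p" for a b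
  proof (rule ext)
    fix z
    show "red_fun l (\<lambda>p. a p + b p) z = fadd (red_fun l a) (red_fun l b) z"
    proof (cases "z \<in> uhp")
      case True
      have "red_coef l (\<lambda>p. a p + b p) k = red_coef l a k + red_coef l b k" for k
        by (simp add: red_coef_def diag_ip_def distrib_right sum.distrib distrib_left)
      then have "(\<lambda>k. red_coef l (\<lambda>p. a p + b p) k * cayley z ^ k) sums ((\<Sum>k. red_coef l a k * cayley z ^ k) + (\<Sum>k. red_coef l b k * cayley z ^ k))"
        using sums_add[OF red_coef_sums[OF cmod_cayley_less_1[OF True] a] red_coef_sums[OF cmod_cayley_less_1[OF True] b]] by (simp add: distrib_right)
      then show ?thesis using True by (simp add: red_fun_def fadd_def sums_iff add_divide_distrib)
    qed (simp add: red_fun_def fadd_def)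
  qed
  have red_scale: "red_fun l (\<lambda>p. c * a p) = fscale c (red_fun l a)"
    if a: "l2 a" "\<And>p. casimir a p = - (of_nat l * (of_nat l + 1)) * a p" for a c
  proof (rule ext)
    fix z
    show "red_fun l (\<lambda>p. c * a p) z = fscale c (red_fun l a) z"
    proof (cases "z \<in> uhp")
      case True
      have rc: "red_coef l (\<lambda>p. c * a p) k = c * red_coef l a k" for k
        by (simp add: red_coef_def diag_ip_scale_left)
      have "(\<lambda>k. red_coef l (\<lambda>p. c * a p) k * cayley z ^ k) sums (c * (\<Sum>k. red_coef l a k * cayley z ^ k))"
        unfolding rc mult.assoc by (rule sums_mult[OF red_coef_sums[OF cmod_cayley_less_1[OF True] a]])
      then show ?thesis using True by (simp add: red_fun_def fscale_def sums_iff)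
    qed (simp add: red_fun_def fscale_def)
  qed
  show ?thesis unfolding complex_linear_on_def
  proof (intro conjI allI ballI)
    fix f g assume "f \<in> eigenP l" "g \<in> eigenP l"
    then obtain a b where a: "f = syn2 a" "l2 a" "\<And>p. casimir a p = - (of_nat l * (of_nat l + 1)) * a p"
      and b: "g = syn2 b" "l2 b" "\<And>p. casimir b p = - (of_nat l * (of_nat l + 1)) * b p" using ex by meson
    have e: "casimir (\<lambda>p. a p + b p) p = - (of_nat l * (of_nat l + 1)) * (a p + b p)" for p
      unfolding casimir_add a(3) b(3) by (simp add: distrib_left)
    show "reducedT l (fadd f g) = fadd (reducedT l f) (reducedT l g)"
      unfolding a(1) b(1) fadd_syn2[OF a(2) b(2)] reducedT_eq[OF l2_add[OF a(2) b(2)] e] reducedT_eq[OF a(2,3)] reducedT_eq[OF b(2,3)]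
      by (rule red_add[OF a(2,3) b(2,3)])
  next
    fix c f assume "f \<in> eigenP l"
    then obtain a where a: "f = syn2 a" "l2 a" "\<And>p. casimir a p = - (of_nat l * (of_nat l + 1)) * a p" using ex by meson
    have e: "casimir (\<lambda>p. c * a p) p = - (of_nat l * (of_nat l + 1)) * (c * a p)" for p
      unfolding casimir_scale a(3) by simp
    show "reducedT l (fscale c f) = fscale c (reducedT l f)"
      unfolding a(1) syn2_scale reducedT_eq[OF l2_scale[OF a(2)] e] reducedT_eq[OF a(2,3)]
      by (rule red_scale[OF a(2,3)])
  qed
qed

text \<open>For injectivity, the Taylor coefficients of the image give back the pairings with
  \<open>eigvec l\<close>, and these determine an eigenarray in every degree.\<close>

lemma reducedT_bij: "bij_betw (reducedT l) (eigenP l) (bergman l)"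
proof (rule bij_betw_imageI)
  show "inj_on (reducedT l) (eigenP l)"
  proof (rule inj_onI)
    fix f g assume fg: "f \<in> eigenP l" "g \<in> eigenP l" "reducedT l f = reducedT l g"
    obtain a where a: "f = syn2 a" "l2 a" "\<And>p. casimir a p = - (of_nat l * (of_nat l + 1)) * a p" using fg(1) unfolding eigenP_eq by blast
    obtain b where b: "g = syn2 b" "l2 b" "\<And>p. casimir b p = - (of_nat l * (of_nat l + 1)) * b p" using fg(2) unfolding eigenP_eq by blast
    have "red_fun l a = red_fun l b" using fg(3) unfolding a(1) b(1) reducedT_eq[OF a(2,3)] reducedT_eq[OF b(2,3)] .
    then have "red_coef l a = red_coef l b" using bcoef_red_fun[OF a(2,3)] bcoef_red_fun[OF b(2,3)] by simp
    then have rc: "diag_ip (l + k) a (eigvec l) = diag_ip (l + k) b (eigvec l)" for k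
      by (auto simp: red_coef_def fun_eq_iff)
    have "a p = b p" for p
    proof -
      define N where "N = fst p + snd p"
      have N: "p \<in> diag N" by (simp add: diag_def N_def split: prod.splits)
      have "eigcoef l (N - l) a = eigcoef l (N - l) b" by (simp only: eigcoef_def rc)
      then show ?thesis unfolding casimir_eigen_diag[OF a(3) N] casimir_eigen_diag[OF b(3) N] by simp
    qed
    then show "f = g" unfolding a(1) b(1) by (metis ext)
  qed
  show "reducedT l ` eigenP l = bergman l"
  proof (intro subset_antisym subsetI)
    fix \<phi> assume "\<phi> \<in> reducedT l ` eigenP l"
    then obtain a where a: "l2 a" "\<And>p. casimir a p = - (of_nat l * (of_nat l + 1)) * a p" "\<phi> = reducedT l (syn2 a)" unfolding eigenP_eq by blast
    then show "\<phi> \<in> bergman l"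
      using red_fun_hol[OF a(1,2)] bergman_norm_red_fun[OF a(1,2)] reducedT_eq[OF a(1,2)] by (simp add: bergman_def)
  next
    fix \<phi> assume "\<phi> \<in> bergman l"
    from red_fun_surj[OF this] obtain a where a: "l2 a" "\<And>p. casimir a p = - (of_nat l * (of_nat l + 1)) * a p" "red_fun l a = \<phi>" by blast
    then have "syn2 a \<in> eigenP l" unfolding eigenP_eq by blast
    then show "\<phi> \<in> reducedT l ` eigenP l" using reducedT_eq[OF a(1,2)] a(3) by (metis imageI)
  qed
qed

lemma reducedT_factors: assumes "f \<in> eigenP l" shows "factors_as l f (reducedT l f)"
proof -
  obtain a where a: "f = syn2 a" "l2 a" "\<And>p. casimir a p = - (of_nat l * (of_nat l + 1)) * a p" using assms unfolding eigenP_eq by blast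
  show ?thesis unfolding a(1) reducedT_eq[OF a(2,3)] by (rule factors_as_red_fun[OF a(2,3)])
qed

lemma reducedT_norm:
  assumes "f \<in> eigenP l"
  shows "bergman_norm_sq l (reducedT l f) = ennreal (b_const l * (ip_norm hardy2_ip f)\<^sup>2)"
proof -
  obtain a where a: "f = syn2 a" "l2 a" "\<And>p. casimir a p = - (of_nat l * (of_nat l + 1)) * a p" using assms unfolding eigenP_eq by blast
  show ?thesis unfolding a(1) reducedT_eq[OF a(2,3)] ip_norm_syn2[OF a(2)] by (rule bergman_norm_red_fun[OF a(2,3)])
qed

theorem theorem5p1:
  shows "self_adjoint_operator hardy2 hardy2_ip domP opP
    \<and> hilbert_sum hardy2 hardy2_ip eigenP
    \<and> (\<forall>l::nat.
         (\<forall>f\<in>eigenP l. factors_as l f (reducedT l f))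
       \<and> complex_linear_on (eigenP l) (reducedT l)
       \<and> bij_betw (reducedT l) (eigenP l) (bergman l)
       \<and> (\<forall>f\<in>eigenP l.
            bergman_norm_sq l (reducedT l f) = ennreal (b_const l * (ip_norm hardy2_ip f)\<^sup>2))
       \<and> b_const l = real_of_int (double_fact (2 * int l - 1))
            / (4 * pi * (2 * real l + 1) * real_of_int (double_fact (2 * int l))))"
    using self_adjoint_P hilbert_sum_eigenP reducedT_factors reducedT_linear reducedT_bij reducedT_norm b_const_double_fact
  by blast

end
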